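(* Assume $0<\varepsilon<1/7$ and $\lambda=\varepsilon^{-1}$. Then, for any $\alpha,\beta>0$, there exist a set $I_1\subset(0,\infty)$ depending on $\varepsilon,\alpha,\beta$ and a set $I_0\subset(0,\infty)$ depending on $\varepsilon,\beta$, with Lebesgue measures satisfying $$|I_1|\le\varepsilon^\beta|\ln\varepsilon|,\qquad|I_0|\le\frac{\ln|\ln\varepsilon|}{(|\ln\varepsilon|+1)^\beta},$$ such that for all $R\ge\varepsilon$ and $\sigma\in\mathbb{R}$, $$\sup_{\sqrt{q_0}\,\omega\in(0,\infty)\setminus I_1}\left\Vert u_\varepsilon^s(|x|=R)\right\Vert_{H^\sigma_*}\le\frac{18}\alpha\sqrt{\frac{\varepsilon^{1-2\beta}}R}\;\mathcal{N}^{\sigma+2+\alpha}(u^i)$$ and $$\sup_{\sqrt{q_0}\,\omega\in(0,\infty)\setminus I_0}\left|\frac1{2\pi}\int_0^{2\pi}u_\varepsilon^s(|x|=R)\,d\theta\right|\le12\,\frac{|u^i(0)|}{\sqrt{(|\ln\varepsilon|+1)^{3/2-2\beta}\,R}}.$$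
   Context: $J_n,Y_n$ are Bessel functions and $H_n^{(1)}=J_n+iY_n$. Setting: $\varepsilon,\omega,q,q_0>0$; $q_\varepsilon=q$ for $|x|<\varepsilon$ and $q_\varepsilon=q_0$ for $|x|>\varepsilon$ in $\mathbb{R}^2$; $\omega_\varepsilon=\sqrt{q_0}\,\omega\varepsilon$ and $\lambda=\sqrt{q/q_0}$; $(r,\theta)$ are polar coordinates. The incident field, a non-singular solution of $\Delta u^i+\omega^2q_0u^i=0$ in $\mathbb{R}^2$, is $u^i=\sum_{n\in\mathbb{Z}}a_nJ_n(\sqrt{q_0}\,\omega r)e^{in\theta}$ (so $u^i(0)=a_0$); when $\omega$ varies, the coefficients $a_n$ and $\varepsilon,q,q_0$ are fixed. $u_\varepsilon\in H^1_{loc}(\mathbb{R}^2)$ solves $\Delta u_\varepsilon+\omega^2q_\varepsilon u_\varepsilon=0$, with $u_\varepsilon=u^i+u^s_\varepsilon$ for $|x|>\varepsilon$, where $u_\varepsilon^s$ satisfies the outgoing radiation condition $\partial_ru^s_\varepsilon-i\omega\sqrt{q_0}u^s_\varepsilon=o(r^{-1/2})$. Equivalently, for $r\ge\varepsilon$, $u^s_\varepsilon=\sum_{n}a_nR_n(\omega_\varepsilon,\lambda)H^{(1)}_n(\sqrt{q_0}\,\omega r)e^{in\theta}$, with $$R_n(x,\lambda)=-\frac{\Re D_n}{D_n},\quad D_n=H_n^{(1)\prime}(x)J_n(\lambda x)-\lambda J_n'(\lambda x)H^{(1)}_n(x).$$ Norms: for $f$ on the circle $|x|=R$ with Fourier coefficients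 $c_n=\frac1{2\pi}\int_0^{2\pi}f(R,\theta)e^{-in\theta}d\theta$, $\Vert f(|x|=R)\Vert_{H^\sigma_*}=\sqrt{2\pi}\big(\sum_{n\ne0}|c_n|^2(1+|n|)^{2\sigma}\big)^{1/2}$; $\mathcal{N}^\sigma(u^i)=\sqrt{2\pi}\big(\sum_{n\ne0}|a_n|^2\sup_{x>0}|J_n(x)|^2(1+|n|)^{2\sigma}\big)^{1/2}$. Values $+\infty$ are allowed. *)

theory Defs
  imports "HOL-Analysis.Analysis"
begin

text \<open>
  The plane is identified with \<^typ>\<open>complex\<close>: the coordinate directions are \<^term>\<open>1::complex\<close>
  and \<^term>\<open>\<i>\<close>, and the point with polar coordinates \<open>(r, \<theta>)\<close> is \<open>rcis r \<theta>\<close>.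
\<close>

text \<open>
  The power series of the Bessel function of the first kind. As \<^const>\<open>rGamma\<close> is the reciprocal
  Gamma function, extended by \<open>0\<close> to the poles of Gamma, the same formula covers negative orders;
  the terms with a negative power of \<open>x\<close> have coefficient \<open>0\<close>.
\<close>

definition bessel_J :: "int \<Rightarrow> real \<Rightarrow> real" where
  "bessel_J n x =
    (\<Sum>k. (-1) ^ k / fact k * rGamma (of_int (int k + n + 1)) * (x / 2) powi (2 * int k + n))"

definition dir_deriv :: "complex \<Rightarrow> (complex \<Rightarrow> real) \<Rightarrow> complex \<Rightarrow> real" where
  "dir_deriv v f z = frechet_derivative f (at z) v"

primrec Ck :: "nat \<Rightarrow> (complex \<Rightarrow> real) \<Rightarrow> bool" where
  "Ck 0 f \<longleftrightarrow> continuous_on UNIV f"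
| "Ck (Suc k) f \<longleftrightarrow> (\<forall>z. f differentiable at z) \<and> (\<forall>v. Ck k (dir_deriv v f))"

definition test_function :: "(complex \<Rightarrow> real) \<Rightarrow> bool" where
  "test_function \<phi> \<longleftrightarrow> (\<forall>k. Ck k \<phi>) \<and> compact (closure {z. \<phi> z \<noteq> 0})"

definition L2_loc :: "(complex \<Rightarrow> complex) \<Rightarrow> bool" where
  "L2_loc f \<longleftrightarrow> f \<in> borel_measurable lborel \<and>
    (\<forall>K. compact K \<longrightarrow> set_integrable lborel K (\<lambda>z. (cmod (f z))\<^sup>2))"

definition weak_deriv :: "complex \<Rightarrow> (complex \<Rightarrow> complex) \<Rightarrow> (complex \<Rightarrow> complex) \<Rightarrow> bool" where
  "weak_deriv v u g \<longleftrightarrow>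
    (\<forall>\<phi>. test_function \<phi> \<longrightarrow>
      (LINT z|lborel. u z * of_real (dir_deriv v \<phi> z)) = - (LINT z|lborel. g z * of_real (\<phi> z)))"

definition H1_loc_grad ::
    "(complex \<Rightarrow> complex) \<Rightarrow> (complex \<Rightarrow> complex) \<Rightarrow> (complex \<Rightarrow> complex) \<Rightarrow> bool" where
  "H1_loc_grad u g\<^sub>1 g\<^sub>2 \<longleftrightarrow>
    L2_loc u \<and> L2_loc g\<^sub>1 \<and> L2_loc g\<^sub>2 \<and> weak_deriv 1 u g\<^sub>1 \<and> weak_deriv \<i> u g\<^sub>2"

text \<open>
  \<open>u\<close> is an \<open>H\<^sup>1\<close>-local weak solution of \<open>\<Delta>u + p u = 0\<close> in the whole plane. For a locally bounded
  potential \<open>p\<close> such a solution is continuous after modification on a null set; \<open>u\<close> is required to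
  be this continuous representative, so that its values on circles make sense.
\<close>

definition helmholtz_solution :: "(complex \<Rightarrow> real) \<Rightarrow> (complex \<Rightarrow> complex) \<Rightarrow> bool" where
  "helmholtz_solution p u \<longleftrightarrow> continuous_on UNIV u \<and>
    (\<exists>g\<^sub>1 g\<^sub>2. H1_loc_grad u g\<^sub>1 g\<^sub>2 \<and>
      (\<forall>\<phi>. test_function \<phi> \<longrightarrow>
        (LINT z|lborel. g\<^sub>1 z * of_real (dir_deriv 1 \<phi> z) + g\<^sub>2 z * of_real (dir_deriv \<i> \<phi> z)) =
        (LINT z|lborel. of_real (p z) * u z * of_real (\<phi> z))))"

definition incident_field ::
    "real \<Rightarrow> real \<Rightarrow> (int \<Rightarrow> complex) \<Rightarrow> (complex \<Rightarrow> complex) \<Rightarrow> bool" where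
  "incident_field \<omega> q\<^sub>0 a ui \<longleftrightarrow>
    helmholtz_solution (\<lambda>_. \<omega>\<^sup>2 * q\<^sub>0) ui \<and>
    (\<forall>r\<ge>0. \<forall>\<theta>. ((\<lambda>n. a n * of_real (bessel_J n (sqrt q\<^sub>0 * \<omega> * r)) * cis (of_int n * \<theta>))
        has_sum ui (rcis r \<theta>)) UNIV)"

definition q_eps :: "real \<Rightarrow> real \<Rightarrow> real \<Rightarrow> complex \<Rightarrow> real" where
  "q_eps \<epsilon> q q\<^sub>0 z = (if cmod z < \<epsilon> then q else q\<^sub>0)"

text \<open>
  \<open>\<partial>\<^sub>r u - i \<kappa> u = o(r\<^sup>-\<^sup>1\<^sup>/\<^sup>2)\<close> uniformly in the direction, for a field \<open>u\<close> considered on \<open>|x| > \<epsilon>\<close>.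
\<close>

definition outgoing :: "real \<Rightarrow> real \<Rightarrow> (complex \<Rightarrow> complex) \<Rightarrow> bool" where
  "outgoing \<epsilon> \<kappa> u \<longleftrightarrow>
    (\<forall>r>\<epsilon>. \<forall>\<theta>. (\<lambda>s. u (rcis s \<theta>)) differentiable at r) \<and>
    uniform_limit UNIV
      (\<lambda>r \<theta>. of_real (sqrt r) *
        (vector_derivative (\<lambda>s. u (rcis s \<theta>)) (at r) - \<i> * of_real \<kappa> * u (rcis r \<theta>)))
      (\<lambda>_. 0) at_top"

text \<open>
  \<open>u - ui\<close> is the scattered field; it is only meaningful for \<open>|x| \<ge> \<epsilon>\<close> (on the circle
  \<open>|x| = \<epsilon>\<close> by continuity).
\<close>

definition scattering_solution ::
    "real \<Rightarrow> real \<Rightarrow> real \<Rightarrow> real \<Rightarrow> (complex \<Rightarrow> complex) \<Rightarrow> (complex \<Rightarrow> complex) \<Rightarrow> bool" where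
  "scattering_solution \<epsilon> \<omega> q q\<^sub>0 ui u \<longleftrightarrow>
    helmholtz_solution (\<lambda>z. \<omega>\<^sup>2 * q_eps \<epsilon> q q\<^sub>0 z) u \<and>
    outgoing \<epsilon> (\<omega> * sqrt q\<^sub>0) (\<lambda>z. u z - ui z)"

definition circle_coeff :: "(complex \<Rightarrow> complex) \<Rightarrow> real \<Rightarrow> int \<Rightarrow> complex" where
  "circle_coeff f R n =
    of_real (1 / (2 * pi)) * integral {0..2 * pi} (\<lambda>\<theta>. f (rcis R \<theta>) * cis (- of_int n * \<theta>))"

definition ennreal_sqrt :: "ennreal \<Rightarrow> ennreal" where
  "ennreal_sqrt x = (if x = \<infinity> then \<infinity> else ennreal (sqrt (enn2real x)))"

definition H_star_norm :: "real \<Rightarrow> (complex \<Rightarrow> complex) \<Rightarrow> real \<Rightarrow> ennreal" where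
  "H_star_norm \<sigma> f R = ennreal (sqrt (2 * pi)) *
    ennreal_sqrt (\<Sum>\<^sub>\<infinity>n\<in>UNIV - {0}.
      ennreal ((cmod (circle_coeff f R n))\<^sup>2 * (1 + \<bar>of_int n\<bar>) powr (2 * \<sigma>)))"

definition N_norm :: "real \<Rightarrow> (int \<Rightarrow> complex) \<Rightarrow> ennreal" where
  "N_norm \<sigma> a = ennreal (sqrt (2 * pi)) *
    ennreal_sqrt (\<Sum>\<^sub>\<infinity>n\<in>UNIV - {0}.
      ennreal ((cmod (a n))\<^sup>2) * (SUP x\<in>{0<..}. ennreal (\<bar>bessel_J n x\<bar>\<^sup>2)) *
      ennreal ((1 + \<bar>of_int n\<bar>) powr (2 * \<sigma>)))"

text \<open>
  A scattering experiment at all frequencies \<open>\<omega> > 0\<close>, with \<open>\<epsilon>\<close>, \<open>q\<close>, \<open>q\<^sub>0\<close> and the coefficients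
  \<open>a\<close> of the incident field kept fixed.
\<close>

definition scattering_family ::
    "real \<Rightarrow> real \<Rightarrow> real \<Rightarrow> (int \<Rightarrow> complex) \<Rightarrow>
      (real \<Rightarrow> complex \<Rightarrow> complex) \<Rightarrow> (real \<Rightarrow> complex \<Rightarrow> complex) \<Rightarrow> bool" where
  "scattering_family \<epsilon> q q\<^sub>0 a ui u \<longleftrightarrow>
    (\<forall>\<omega>>0. incident_field \<omega> q\<^sub>0 a (ui \<omega>) \<and> scattering_solution \<epsilon> \<omega> q q\<^sub>0 (ui \<omega>) (u \<omega>))"

end

theory Submission
  imports Defs
begin

text \<open>
  Everything is done with the Fourier coefficients \<open>v\<close> of the scattered field on circles; Hankel functions do not occur.
  Testing the equation with products of a radial function and a harmonic polynomial, averaged over rotations,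
  shows that each coefficient is a classical solution of Bessel's equation on both sides of the interface.
  Boundedness at the origin makes it a multiple of \<open>J\<^sub>n\<close> inside, and with \<open>x = \<kappa> \<epsilon>\<close>, \<open>\<kappa> = \<surd>q\<^sub>0 \<omega>\<close> this
  becomes a matching condition at \<open>x\<close> involving \<open>\<kappa> J\<^sub>n' / J\<^sub>n (\<kappa>)\<close>.

  Outside, \<open>u = \<surd>s v = f + \<i> g\<close> solves \<open>u'' + (1 - \<mu> / s\<^sup>2) u = 0\<close>, \<open>\<mu> = n\<^sup>2 - 1 / 4\<close>, and the radiation condition reads
  \<open>u' - \<i> u \<longlongrightarrow> 0\<close>. Let \<open>c\<close> be the constant wronskian of \<open>f\<close> and \<open>g\<close>, \<open>p = \<bar>u\<bar>\<^sup>2\<close>, and \<open>k = 1 / 2 - s p' / (2 p)\<close>;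
  then \<open>s k' = k\<^sup>2 - n\<^sup>2 + s\<^sup>2 - (c s / p)\<^sup>2\<close>. The matching condition bounds \<open>p x\<close> by the incident amplitude divided by
  \<open>\<sigma> = k (\<epsilon> \<kappa>) + \<kappa> J\<^sub>n' / J\<^sub>n (\<kappa>)\<close>. By the two Riccati equations \<open>\<kappa> \<sigma>' \<le> - \<rho> \<kappa>\<^sup>2\<close> wherever \<open>\<bar>\<sigma>\<bar>\<close> is small,
  so between two zeros of \<open>J\<^sub>n\<close> the set \<open>\<bar>\<sigma>\<bar> \<le> \<delta>\<close> is short; these sets, for \<open>n \<le> \<kappa> \<le> n / \<epsilon>\<close>, are the excluded
  frequencies. For \<open>n = 0\<close> the logarithmic growth of \<open>v\<close> at the origin replaces monotonicity of \<open>p\<close>.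
\<close>

section \<open>Rotations, test functions and angular averages\<close>

text \<open>The bounds must be uniform in the frequency and are measured by sup |J_n|, so
  asymptotics in n are replaced by monotone energies: a critical point t of sqrt s J_n in [n, 4n]
  bounds the amplitude of sqrt s J_n at infinity, and flux conservation at the interface bounds
  \<open>c\<close> through it. Only the window n \<le> \<kappa> \<le> n/\<epsilon> can be resonant:
  below it both terms of \<sigma> are nonnegative with k \<ge> 1/2; above it the radial equation is
  already oscillatory at the interface and \<open>c\<close> controls p. In \<sigma>' the terms n^2
  cancel, so the slope is uniform in n. Zeros of J_n are more than 1 apart, so each unit cell
  contributes at most two intervals of length 2\<delta>/(\<rho>\<kappa>); summing 1/\<kappa> over
  the window gives |ln \<epsilon>|. With \<delta> = 2n/(Z - 1) the measure is at most 18 n |ln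
  \<epsilon>|/Z, while the mode is at most Z times an incident amplitude. Taking Z = (18/\<alpha>)
  (1 + n)^(2 + \<alpha>) \<epsilon>^(-\<beta>) makes the measures telescope; this is the origin of
  18/\<alpha> and of the loss of 2 + \<alpha> derivatives.\<close>

lemma lborel_complex_eq:
  "(lborel :: complex measure) = distr (lborel \<Otimes>\<^sub>M lborel) borel (\<lambda>p. Complex (fst p) (snd p))"
proof (rule lborel_eqI)
  let ?F = "\<lambda>p. Complex (fst p) (snd p)"
  have F: "?F \<in> borel_measurable (borel :: (real \<times> real) measure)"
    by (intro borel_measurable_continuous_onI) (auto intro!: continuous_intros simp: Complex_eq)
  hence Fm: "?F \<in> measurable (lborel \<Otimes>\<^sub>M lborel) borel"
    by (simp add: lborel_prod)
  fix l u :: complex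
  assume le: "\<And>b. b \<in> Basis \<Longrightarrow> l \<bullet> b \<le> u \<bullet> b"
  have le': "Re l \<le> Re u" "Im l \<le> Im u"
    using le[of 1] le[of \<i>] by (auto simp: Basis_complex_def)
  have "?F -` box l u = {Re l<..<Re u} \<times> {Im l<..<Im u}"
    by (auto simp: box_complex_eq in_box_complex_iff)
  hence "emeasure (distr (lborel \<Otimes>\<^sub>M lborel) borel ?F) (box l u)
      = emeasure (lborel \<Otimes>\<^sub>M lborel) ({Re l<..<Re u} \<times> {Im l<..<Im u})"
    by (subst emeasure_distr[OF Fm]) (auto simp: space_pair_measure)
  also have "\<dots> = ennreal (Re u - Re l) * ennreal (Im u - Im l)"
    using le' by (subst lborel.emeasure_pair_measure_Times) auto
  finally show "emeasure (distr (lborel \<Otimes>\<^sub>M lborel) borel ?F) (box l u) = (\<Prod>b\<in>Basis. (u - l) \<bullet> b)"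
    using le' by (simp add: Basis_complex_def ennreal_mult)
qed simp

lemma nn_integral_complex:
  assumes [measurable]: "f \<in> borel_measurable borel"
  shows "(\<integral>\<^sup>+z. f z \<partial>lborel) = (\<integral>\<^sup>+y. \<integral>\<^sup>+x. f (Complex x y) \<partial>lborel \<partial>lborel)"
    and "(\<integral>\<^sup>+z. f z \<partial>lborel) = (\<integral>\<^sup>+x. \<integral>\<^sup>+y. f (Complex x y) \<partial>lborel \<partial>lborel)"
proof -
  have "(\<lambda>p. Complex (fst p) (snd p)) \<in> borel_measurable (borel :: (real \<times> real) measure)"
    by (intro borel_measurable_continuous_onI) (auto intro!: continuous_intros simp: Complex_eq)
  hence [measurable]: "(\<lambda>p. Complex (fst p) (snd p)) \<in> measurable (lborel \<Otimes>\<^sub>M lborel) borel"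
    by (simp add: lborel_prod)
  have *: "(\<integral>\<^sup>+z. f z \<partial>lborel) = (\<integral>\<^sup>+p. f (Complex (fst p) (snd p)) \<partial>(lborel \<Otimes>\<^sub>M lborel))"
    by (subst lborel_complex_eq, subst nn_integral_distr) auto
  show "(\<integral>\<^sup>+z. f z \<partial>lborel) = (\<integral>\<^sup>+y. \<integral>\<^sup>+x. f (Complex x y) \<partial>lborel \<partial>lborel)"
    unfolding * by (subst lborel_pair.nn_integral_snd[symmetric]) (auto simp: case_prod_unfold)
  show "(\<integral>\<^sup>+z. f z \<partial>lborel) = (\<integral>\<^sup>+x. \<integral>\<^sup>+y. f (Complex x y) \<partial>lborel \<partial>lborel)"
    unfolding * by (subst lborel.nn_integral_fst[symmetric]) auto
qed

lemma nn_integral_lborel_shift: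
  fixes f :: "real \<Rightarrow> ennreal"
  assumes "f \<in> borel_measurable borel"
  shows "(\<integral>\<^sup>+x. f (x + t) \<partial>lborel) = (\<integral>\<^sup>+x. f x \<partial>lborel)"
  using nn_integral_real_affine[OF assms, of 1 t] by (simp add: add.commute)

text \<open>A shear translates each line parallel to one axis by an amount fixed on that line, so
  after Fubini it disappears under translation invariance in one real variable.\<close>

lemma nn_integral_shear:
  fixes f :: "complex \<Rightarrow> ennreal"
  assumes [measurable]: "f \<in> borel_measurable borel"
  shows "(\<integral>\<^sup>+z. f (z + of_real (t * Im z)) \<partial>lborel) = (\<integral>\<^sup>+z. f z \<partial>lborel)"
    and "(\<integral>\<^sup>+z. f (z + \<i> * of_real (t * Re z)) \<partial>lborel) = (\<integral>\<^sup>+z. f z \<partial>lborel)"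
proof -
  have [measurable]: "(\<lambda>z. z + of_real (t * Im z)) \<in> borel_measurable (borel :: complex measure)"
    "(\<lambda>z. z + \<i> * of_real (t * Re z)) \<in> borel_measurable (borel :: complex measure)"
    by (auto intro!: borel_measurable_continuous_onI continuous_intros)
  have m: "(\<lambda>z. f (z + of_real (t * Im z))) \<in> borel_measurable borel"
    "(\<lambda>z. f (z + \<i> * of_real (t * Re z))) \<in> borel_measurable borel"
    by measurable
  have Cm[measurable]: "(\<lambda>x. Complex x y) \<in> borel_measurable borel" "(\<lambda>x. Complex y x) \<in> borel_measurable borel" for y
    by (auto intro!: borel_measurable_continuous_onI continuous_intros simp: Complex_eq)
  have e1: "(\<integral>\<^sup>+x. f (Complex x y + of_real (t * y)) \<partial>lborel) = (\<integral>\<^sup>+x. f (Complex x y) \<partial>lborel)" for y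
  proof -
    have "Complex x y + of_real (t * y) = Complex (x + t * y) y" for x
      by (simp add: complex_eq_iff)
    thus ?thesis using nn_integral_lborel_shift[of "\<lambda>x. f (Complex x y)" "t * y"] by simp
  qed
  have e2: "(\<integral>\<^sup>+x. f (Complex y x + \<i> * of_real (t * y)) \<partial>lborel) = (\<integral>\<^sup>+x. f (Complex y x) \<partial>lborel)" for y
  proof -
    have "Complex y x + \<i> * of_real (t * y) = Complex y (x + t * y)" for x
      by (simp add: complex_eq_iff)
    thus ?thesis using nn_integral_lborel_shift[of "\<lambda>x. f (Complex y x)" "t * y"] by simp
  qed
  show "(\<integral>\<^sup>+z. f (z + of_real (t * Im z)) \<partial>lborel) = (\<integral>\<^sup>+z. f z \<partial>lborel)"
    by (subst (1 2) nn_integral_complex(1)) (auto simp only: complex.sel e1 intro: assms m)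
  show "(\<integral>\<^sup>+z. f (z + \<i> * of_real (t * Re z)) \<partial>lborel) = (\<integral>\<^sup>+z. f z \<partial>lborel)"
    by (subst (1 2) nn_integral_complex(2)) (auto simp only: complex.sel e2 intro: assms m)
qed

text \<open>A rotation by an angle other than \<open>\<pi>\<close> is a product of three shears.\<close>

lemma nn_integral_rotate:
  fixes f :: "complex \<Rightarrow> ennreal"
  assumes [measurable]: "f \<in> borel_measurable borel" and w: "cmod w = 1"
  shows "(\<integral>\<^sup>+z. f (w * z) \<partial>lborel) = (\<integral>\<^sup>+z. f z \<partial>lborel)"
proof -
  have ne: "(\<integral>\<^sup>+z. f (w * z) \<partial>lborel) = (\<integral>\<^sup>+z. f z \<partial>lborel)"
    if "f \<in> borel_measurable borel" "cmod w = 1" "Re w \<noteq> -1" for f :: "complex \<Rightarrow> ennreal" and w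
  proof -
    note [measurable] = that(1)
    have sq: "(Re w)\<^sup>2 + (Im w)\<^sup>2 = 1"
      using that(2) cmod_power2[of w] by simp
    \<comment> \<open>For w = cis t this is -tan (t/2), the factor of the two horizontal shears on
      either side of the vertical shear by \<open>Im w\<close>; it is finite because Re w \<noteq>
      -1.\<close>
    define a where "a = - Im w / (1 + Re w)"
    have ab: "1 + a * Im w = Re w" "2 * a + a * a * Im w = - Im w"
      using sq that(3) unfolding a_def by (simp_all add: divide_simps) (algebra, algebra)
    have [measurable]: "(\<lambda>z. z + of_real (t * Im z)) \<in> borel_measurable (borel :: complex measure)"
      "(\<lambda>z. z + \<i> * of_real (t * Re z)) \<in> borel_measurable (borel :: complex measure)" for t
      by (auto intro!: borel_measurable_continuous_onI continuous_intros)
    let ?H = "\<lambda>z. z + complex_of_real (a * Im z)" and ?V = "\<lambda>z. z + \<i> * complex_of_real (Im w * Re z)"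
    have "w * z = ?H (?V (?H z))" for z
    proof -
      have "Re w * Re z - Im w * Im z = (1 + a * Im w) * Re z + (2 * a + a * a * Im w) * Im z"
        "Re w * Im z + Im w * Re z = (1 + a * Im w) * Im z + Im w * Re z"
        by (simp_all add: ab)
      thus ?thesis by (simp add: complex_eq_iff algebra_simps)
    qed
    hence "(\<integral>\<^sup>+z. f (w * z) \<partial>lborel) = (\<integral>\<^sup>+z. f (?H (?V (?H z))) \<partial>lborel)"
      by presburger
    also have "\<dots> = (\<integral>\<^sup>+z. f (?H (?V z)) \<partial>lborel)"
      by (rule nn_integral_shear(1)[where f = "\<lambda>z. f (?H (?V z))"]) measurable
    also have "\<dots> = (\<integral>\<^sup>+z. f (?H z) \<partial>lborel)"
      by (rule nn_integral_shear(2)[where f = "\<lambda>z. f (?H z)"]) measurable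
    also have "\<dots> = (\<integral>\<^sup>+z. f z \<partial>lborel)"
      by (rule nn_integral_shear(1)) measurable
    finally show ?thesis .
  qed
  show ?thesis
  proof (cases "Re w = -1")
    case True
    \<comment> \<open>The remaining half turn is the composition of two quarter turns, to which
      \<open>ne\<close> applies.\<close>
    hence "w = \<i> * \<i>"
      using cmod_power2[of w] w by (simp add: complex_eq_iff)
    hence "(\<integral>\<^sup>+z. f (w * z) \<partial>lborel) = (\<integral>\<^sup>+z. f (\<i> * (\<i> * z)) \<partial>lborel)"
      by simp
    also have "\<dots> = (\<integral>\<^sup>+z. f (\<i> * z) \<partial>lborel)"
      by (rule ne[where f = "\<lambda>z. f (\<i> * z)"]) auto
    also have "\<dots> = (\<integral>\<^sup>+z. f z \<partial>lborel)"
      by (rule ne) auto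
    finally show ?thesis .
  qed (use ne assms in auto)
qed

lemma lborel_distr_rotate:
  assumes w: "cmod w = 1"
  shows "distr lborel borel ((*) w) = (lborel :: complex measure)"
proof (rule measure_eqI)
  fix A assume "A \<in> sets (distr lborel borel ((*) w))"
  hence A[measurable]: "A \<in> sets borel" by simp
  have "emeasure (distr lborel borel ((*) w)) A = (\<integral>\<^sup>+z. indicator A z \<partial>distr lborel borel ((*) w))"
    by (simp add: A)
  also have "\<dots> = (\<integral>\<^sup>+z. indicator A (w * z) \<partial>lborel)"
    by (subst nn_integral_distr) auto
  also have "\<dots> = emeasure lborel A"
    by (subst nn_integral_rotate[OF _ w]) auto
  finally show "emeasure (distr lborel borel ((*) w)) A = emeasure lborel A" .
qed simp

lemma integral_rotate:
  fixes f :: "complex \<Rightarrow> complex"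
  assumes "f \<in> borel_measurable borel" and w: "cmod w = 1"
  shows "(LINT z|lborel. f (w * z)) = (LINT z|lborel. f z)"
  by (subst (2) lborel_distr_rotate[OF w, symmetric], subst integral_distr) (use assms in auto)

text \<open>The disc |z|^2 \<le> t has area \<pi> t, so the squared modulus has constant density
  \<pi> on the half-line. Working with s = r^2 replaces polar coordinates and their
  Jacobian.\<close>

lemma lborel_distr_norm_square:
  "distr (lborel :: complex measure) borel (\<lambda>z. (cmod z)\<^sup>2) = density lborel (\<lambda>s. ennreal pi * indicator {0..} s)"
    (is "?M = ?N")
proof (rule measure_eqI_generator_eq[where E = "range (\<lambda>t::real. {..t})" and \<Omega> = UNIV and A = "\<lambda>n. {..real n}"])
  show "Int_stable (range (\<lambda>t::real. {..t}))"
    by (auto simp: Int_stable_def)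
  show "sets ?M = sigma_sets UNIV (range (\<lambda>t::real. {..t}))"
    by (simp add: borel_eq_atMost)
  show "sets ?N = sigma_sets UNIV (range (\<lambda>t::real. {..t}))"
    by (simp add: borel_eq_atMost)
  have M: "emeasure ?M {..t} = ennreal (pi * max 0 t)" for t
  proof (cases "t \<ge> 0")
    case True
    have "(\<lambda>z. (cmod z)\<^sup>2) -` {..t} = cball 0 (sqrt t)"
      using True by (auto simp: real_le_rsqrt dest: real_sqrt_le_mono) (metis norm_ge_zero real_sqrt_pow2 power_mono)
    thus ?thesis using True
      by (simp add: emeasure_distr emeasure_cball unit_ball_vol_2 ennreal_mult'')
  next
    case False
    have "(\<lambda>z. (cmod z)\<^sup>2) -` {..t} = {}"
      using False by (auto simp: not_le) (meson le_less_trans not_less zero_le_power2)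
    thus ?thesis using False by (simp add: emeasure_distr)
  qed
  have N: "emeasure ?N {..t} = ennreal (pi * max 0 t)" for t
  proof -
    have "emeasure ?N {..t} = (\<integral>\<^sup>+s. ennreal pi * indicator ({0..} \<inter> {..t}) s \<partial>lborel)"
      by (subst emeasure_density) (auto simp: mult.assoc indicator_inter_arith intro!: nn_integral_cong split: split_indicator)
    also have "\<dots> = ennreal pi * emeasure lborel {0..t}"
      by (subst nn_integral_cmult) (auto simp: atLeastAtMost_def)
    finally show ?thesis
      by (auto simp: ennreal_mult max_def)
  qed
  show "\<And>X. X \<in> range (\<lambda>t::real. {..t}) \<Longrightarrow> emeasure ?M X = emeasure ?N X"
    using M N by auto
  show "(\<Union>n. {..real n}) = UNIV"
    by (auto intro: real_arch_simple)
  show "emeasure ?M {..real n} \<noteq> \<infinity>" for n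
    unfolding M by simp
qed auto

lemma integral_radial:
  fixes f :: "real \<Rightarrow> complex"
  assumes [measurable]: "f \<in> borel_measurable borel"
  shows "(LINT z|lborel. f ((cmod z)\<^sup>2)) = of_real pi * (LINT s|lborel. indicator {0..} s *\<^sub>R f s)"
proof -
  have "(LINT z|lborel. f ((cmod z)\<^sup>2)) = (LINT s|distr (lborel :: complex measure) borel (\<lambda>z. (cmod z)\<^sup>2). f s)"
    by (subst integral_distr) auto
  also have "\<dots> = (LINT s|density lborel (\<lambda>s. ennreal (pi * indicator {0..} s)). f s)"
    unfolding lborel_distr_norm_square by (simp add: ennreal_mult' ennreal_indicator)
  also have "\<dots> = (LINT s|lborel. (pi * indicator {0..} s) *\<^sub>R f s)"
    by (subst integral_density) auto
  also have "\<dots> = (LINT s|lborel. of_real pi * (indicator {0..} s *\<^sub>R f s))"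
    by (simp add: scaleR_conv_of_real mult.assoc)
  also have "\<dots> = of_real pi * (LINT s|lborel. indicator {0..} s *\<^sub>R f s)"
    by (rule integral_mult_right_zero)
  finally show ?thesis .
qed

section \<open>Smooth bump functions\<close>

definition smooth_seq :: "(nat \<Rightarrow> real \<Rightarrow> real) \<Rightarrow> bool" where
  "smooth_seq D \<longleftrightarrow> (\<forall>j s. (D j has_real_derivative D (Suc j) s) (at s))"

text \<open>The polynomial in 1/x makes the family closed under differentiation, also at 0, where
  exp (-1/x) beats every power of 1/x; hence exp (-1/x), continued by 0, is smooth.\<close>

definition exp_cutoff :: "real poly \<Rightarrow> real \<Rightarrow> real" where
  "exp_cutoff Q x = (if x > 0 then poly Q (1 / x) * exp (- 1 / x) else 0)"

lemma poly_times_exp_minus_tendsto_0: "((\<lambda>y::real. poly Q y * exp (- y)) \<longlongrightarrow> 0) at_top"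
proof -
  have "((\<lambda>y::real. \<Sum>i\<le>degree Q. coeff Q i * (y ^ i / exp y)) \<longlongrightarrow> (\<Sum>i\<le>degree Q. coeff Q i * 0)) at_top"
    by (intro tendsto_intros tendsto_power_div_exp_0)
  thus ?thesis
    by (simp add: poly_altdef sum_distrib_right exp_minus divide_inverse mult.assoc)
qed

lemma exp_cutoff_deriv:
  "(exp_cutoff Q has_real_derivative exp_cutoff ([:0, 0, 1:] * (Q - pderiv Q)) x) (at x)"
proof -
  consider "x > 0" | "x < 0" | "x = 0" by linarith
  thus ?thesis
  proof cases
    case 1
    have "((\<lambda>x. poly Q (1 / x) * exp (- 1 / x)) has_real_derivative
        exp_cutoff ([:0, 0, 1:] * (Q - pderiv Q)) x) (at x)"
      using 1 unfolding exp_cutoff_def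
      by (auto intro!: derivative_eq_intros DERIV_chain2[OF poly_DERIV] simp: field_simps power2_eq_square)
    thus ?thesis
      by (rule has_field_derivative_transform_within_open[where S = "{0<..}"])
        (use 1 in \<open>auto simp: exp_cutoff_def\<close>)
  next
    case 2
    have "((\<lambda>x::real. 0) has_real_derivative exp_cutoff ([:0, 0, 1:] * (Q - pderiv Q)) x) (at x)"
      using 2 by (simp add: exp_cutoff_def)
    thus ?thesis
      by (rule has_field_derivative_transform_within_open[where S = "{..<0}"])
        (use 2 in \<open>auto simp: exp_cutoff_def\<close>)
  next
    case 3
    have "((\<lambda>h. exp_cutoff Q h / h) \<longlongrightarrow> 0) (at_right 0)"
    proof -
      have "((\<lambda>h. poly ([:0, 1:] * Q) (inverse h) * exp (- inverse h)) \<longlongrightarrow> (0::real)) (at_right 0)"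
        by (rule filterlim_compose[OF poly_times_exp_minus_tendsto_0 filterlim_inverse_at_top_right])
      moreover have "\<forall>\<^sub>F h in at_right 0. poly ([:0, 1:] * Q) (inverse h) * exp (- inverse h) = exp_cutoff Q h / h"
        using eventually_at_right_less[of "0::real"]
        by eventually_elim (simp add: exp_cutoff_def field_simps)
      ultimately show ?thesis by (rule Lim_transform_eventually)
    qed
    moreover have "((\<lambda>h. exp_cutoff Q h / h) \<longlongrightarrow> 0) (at_left 0)"
    proof -
      have "\<forall>\<^sub>F h in at_left (0::real). exp_cutoff Q h / h = 0"
        by (simp add: exp_cutoff_def eventually_at_filter)
      thus ?thesis by (rule tendsto_eventually)
    qed
    ultimately have "((\<lambda>h. exp_cutoff Q h / h) \<longlongrightarrow> 0) (at 0)"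
      by (simp add: filterlim_split_at)
    thus ?thesis using 3 by (simp add: DERIV_def exp_cutoff_def)
  qed
qed

text \<open>Differentiation does not leave this set, so a derivative can be chosen inside it again
  and again; the choices form the sequence demanded by \<open>smooth_seq\<close>.\<close>

inductive_set bump_span :: "(real \<Rightarrow> real) set" where
  gen: "(\<lambda>y. poly P y * exp_cutoff Q (1 - y\<^sup>2)) \<in> bump_span"
| add: "f \<in> bump_span \<Longrightarrow> g \<in> bump_span \<Longrightarrow> (\<lambda>y. f y + g y) \<in> bump_span"

lemma bump_span_deriv:
  assumes "f \<in> bump_span"
  shows "\<exists>g\<in>bump_span. \<forall>y. (f has_real_derivative g y) (at y)"
  using assms
proof induction
  case (gen P Q)
  let ?Q' = "[:0, 0, 1:] * (Q - pderiv Q)"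
  have "((\<lambda>y. poly P y * exp_cutoff Q (1 - y\<^sup>2)) has_real_derivative
      poly (pderiv P) y * exp_cutoff Q (1 - y\<^sup>2) + poly ([:0, -2:] * P) y * exp_cutoff ?Q' (1 - y\<^sup>2)) (at y)" for y
    by (rule derivative_eq_intros poly_DERIV DERIV_chain2[OF exp_cutoff_deriv] refl)+ (simp add: algebra_simps)
  moreover have "(\<lambda>y. poly (pderiv P) y * exp_cutoff Q (1 - y\<^sup>2) + poly ([:0, -2:] * P) y * exp_cutoff ?Q' (1 - y\<^sup>2)) \<in> bump_span"
    by (intro bump_span.intros)
  ultimately show ?case by (intro bexI allI)
next
  case (add f g)
  then obtain f' g' where "f' \<in> bump_span" "g' \<in> bump_span"
    "\<forall>y. (f has_real_derivative f' y) (at y)" "\<forall>y. (g has_real_derivative g' y) (at y)" by blast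
  thus ?case
    by (intro bexI[where x = "\<lambda>y. f' y + g' y"]) (auto intro: bump_span.add DERIV_add)
qed

lemma smooth_bump:
  obtains \<eta> where "smooth_seq \<eta>" "\<And>y. \<eta> 0 y \<ge> 0" "\<And>y. \<bar>y\<bar> \<ge> 1 \<Longrightarrow> \<eta> 0 y = 0" "\<eta> 0 0 > 0"
proof -
  define d where "d f = (SOME g. g \<in> bump_span \<and> (\<forall>y. (f has_real_derivative g y) (at y)))" for f
  define \<eta> where "\<eta> j = (d ^^ j) (\<lambda>y. poly 1 y * exp_cutoff 1 (1 - y\<^sup>2))" for j
  have d: "d f \<in> bump_span \<and> (\<forall>y. (f has_real_derivative d f y) (at y))" if "f \<in> bump_span" for f
    unfolding d_def using bump_span_deriv[OF that] by (intro someI_ex[where P = "\<lambda>g. g \<in> bump_span \<and> _ g"]) blast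
  have "\<eta> j \<in> bump_span" for j
    by (induction j) (use d bump_span.gen[of 1 1] in \<open>auto simp: \<eta>_def\<close>)
  hence "smooth_seq \<eta>"
    unfolding smooth_seq_def using d by (simp add: \<eta>_def)
  moreover have "\<eta> 0 y = 0" if "\<bar>y\<bar> \<ge> 1" for y :: real
  proof -
    have "1 \<le> y\<^sup>2"
      using that by (metis abs_le_square_iff abs_one one_power2)
    thus ?thesis by (simp add: \<eta>_def exp_cutoff_def)
  qed
  ultimately show thesis
    by (intro that[of \<eta>]) (auto simp: \<eta>_def exp_cutoff_def)
qed

text \<open>Closed under directional derivatives, since the derivative of |z|^2 along v is Re (cnj v
  z + v cnj z). Real parts appear because test functions are real; complex harmonics are recovered
  later from c = 1 and c = \<i>.\<close>

inductive_set radial_span :: "(nat \<Rightarrow> real \<Rightarrow> real) \<Rightarrow> (complex \<Rightarrow> real) set" for \<psi> where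
  gen: "(\<lambda>z. \<psi> j ((cmod z)\<^sup>2) * Re (c * z ^ a * cnj z ^ b)) \<in> radial_span \<psi>"
| add: "f \<in> radial_span \<psi> \<Longrightarrow> g \<in> radial_span \<psi> \<Longrightarrow> (\<lambda>z. f z + g z) \<in> radial_span \<psi>"

definition rgen :: "(nat \<Rightarrow> real \<Rightarrow> real) \<Rightarrow> nat \<Rightarrow> complex \<Rightarrow> nat \<Rightarrow> nat \<Rightarrow> complex \<Rightarrow> real" where
  "rgen \<psi> j c a b z = \<psi> j ((cmod z)\<^sup>2) * Re (c * z ^ a * cnj z ^ b)"

text \<open>The first two terms differentiate the radial factor, the last two the monomial.
  Truncated subtraction in \<open>a - 1\<close> and \<open>b - 1\<close> is harmless because the
  coefficient then contains the factor 0.\<close>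

definition rgen_deriv :: "(nat \<Rightarrow> real \<Rightarrow> real) \<Rightarrow> nat \<Rightarrow> complex \<Rightarrow> nat \<Rightarrow> nat \<Rightarrow> complex \<Rightarrow> complex \<Rightarrow> real" where
  "rgen_deriv \<psi> j c a b v z =
    (rgen \<psi> (Suc j) (cnj v * c) (Suc a) b z + rgen \<psi> (Suc j) (v * c) a (Suc b) z) +
    (rgen \<psi> j (of_nat a * c * v) (a - 1) b z + rgen \<psi> j (of_nat b * c * cnj v) a (b - 1) z)"

lemma rgen_has_derivative:
  assumes "smooth_seq \<psi>"
  shows "(rgen \<psi> j c a b has_derivative (\<lambda>v. rgen_deriv \<psi> j c a b v z)) (at z)"
proof -
  have n: "(cmod z)\<^sup>2 = (Re z)\<^sup>2 + (Im z)\<^sup>2" for z by (simp add: cmod_power2)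
  have 1: "((\<lambda>z. (cmod z)\<^sup>2) has_derivative (\<lambda>v. 2 * Re z * Re v + 2 * Im z * Im v)) (at z)"
    unfolding n by (auto intro!: derivative_eq_intros simp: algebra_simps)
  have "(\<psi> j has_derivative (\<lambda>h. \<psi> (Suc j) ((cmod z)\<^sup>2) * h)) (at ((cmod z)\<^sup>2))"
    using assms unfolding smooth_seq_def has_field_derivative_def by blast
  from has_derivative_compose[OF 1 this]
  have 2: "((\<lambda>z. \<psi> j ((cmod z)\<^sup>2)) has_derivative
      (\<lambda>v. \<psi> (Suc j) ((cmod z)\<^sup>2) * (2 * Re z * Re v + 2 * Im z * Im v))) (at z)" by simp
  have 3: "((\<lambda>z. Re (c * z ^ a * cnj z ^ b)) has_derivative
      (\<lambda>v. Re (of_nat a * c * v * z ^ (a - 1) * cnj z ^ b + of_nat b * c * cnj v * z ^ a * cnj z ^ (b - 1)))) (at z)"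
    by (rule derivative_eq_intros refl)+ (auto simp: algebra_simps)
  have "((\<lambda>z. \<psi> j ((cmod z)\<^sup>2) * Re (c * z ^ a * cnj z ^ b)) has_derivative
     (\<lambda>v. \<psi> j ((cmod z)\<^sup>2) * Re (of_nat a * c * v * z ^ (a - 1) * cnj z ^ b + of_nat b * c * cnj v * z ^ a * cnj z ^ (b - 1))
       + \<psi> (Suc j) ((cmod z)\<^sup>2) * (2 * Re z * Re v + 2 * Im z * Im v) * Re (c * z ^ a * cnj z ^ b))) (at z)"
    by (rule has_derivative_mult[OF 2 3])
  moreover have "\<psi> j ((cmod z)\<^sup>2) * Re (of_nat a * c * v * z ^ (a - 1) * cnj z ^ b + of_nat b * c * cnj v * z ^ a * cnj z ^ (b - 1))
       + \<psi> (Suc j) ((cmod z)\<^sup>2) * (2 * Re z * Re v + 2 * Im z * Im v) * Re (c * z ^ a * cnj z ^ b) = rgen_deriv \<psi> j c a b v z" for v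
  proof -
    have "(2 * Re z * Re v + 2 * Im z * Im v) * Re w = Re (cnj v * z * w) + Re (v * cnj z * w)" for w
      by (simp add: algebra_simps)
    from this[of "c * z ^ a * cnj z ^ b"]
    have key: "(2 * Re z * Re v + 2 * Im z * Im v) * Re (c * z ^ a * cnj z ^ b)
      = Re (cnj v * c * z ^ Suc a * cnj z ^ b) + Re (v * c * z ^ a * cnj z ^ Suc b)"
      by (simp only: power_Suc mult_ac)
    show ?thesis
      unfolding rgen_deriv_def rgen_def plus_complex.sel
      by (simp only: mult.assoc[of "\<psi> (Suc j) _"] key) (simp only: distrib_left add_ac)
  qed
  ultimately show ?thesis
    unfolding rgen_def[abs_def] by simp
qed

lemma rgen_dir_deriv:
  assumes "smooth_seq \<psi>"
  shows "dir_deriv v (rgen \<psi> j c a b) = rgen_deriv \<psi> j c a b v"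
proof
  fix z
  show "dir_deriv v (rgen \<psi> j c a b) z = rgen_deriv \<psi> j c a b v z"
    unfolding dir_deriv_def using fun_cong[OF frechet_derivative_at[OF rgen_has_derivative[OF assms, of j c a b z]], of v]
    by simp
qed

lemma radial_span_dir_deriv:
  assumes "smooth_seq \<psi>" "f \<in> radial_span \<psi>"
  shows "(\<forall>z. f differentiable at z) \<and> (\<forall>v. dir_deriv v f \<in> radial_span \<psi>)"
  using assms(2)
proof induction
  case (gen j c a b)
  have g: "rgen \<psi> j c a b \<in> radial_span \<psi>" for j c a b
    unfolding rgen_def[abs_def] by (rule radial_span.gen)
  have "rgen_deriv \<psi> j c a b v \<in> radial_span \<psi>" for v
    unfolding rgen_deriv_def[abs_def] by (intro radial_span.add g)
  have "\<forall>z. rgen \<psi> j c a b differentiable at z"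
    using rgen_has_derivative[OF assms(1), of j c a b] by (auto simp: differentiable_def)
  moreover have "\<forall>v. dir_deriv v (rgen \<psi> j c a b) \<in> radial_span \<psi>"
    unfolding rgen_dir_deriv[OF assms(1)] using \<open>\<And>v. rgen_deriv \<psi> j c a b v \<in> radial_span \<psi>\<close> by blast
  ultimately show ?case unfolding rgen_def[abs_def] by blast
next
  case (add f g)
  have "dir_deriv v (\<lambda>z. f z + g z) z = dir_deriv v f z + dir_deriv v g z" for v z
  proof -
    have "((\<lambda>z. f z + g z) has_derivative
        (\<lambda>v. frechet_derivative f (at z) v + frechet_derivative g (at z) v)) (at z)"
      using add.IH by (intro has_derivative_add) (auto simp: frechet_derivative_works)
    from frechet_derivative_at[OF this] show ?thesis
      unfolding dir_deriv_def by metis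
  qed
  hence "dir_deriv v (\<lambda>z. f z + g z) = (\<lambda>z. dir_deriv v f z + dir_deriv v g z)" for v
    by (simp add: fun_eq_iff)
  thus ?case using add by (auto intro: radial_span.add)
qed

lemma radial_span_Ck:
  assumes "smooth_seq \<psi>" "f \<in> radial_span \<psi>"
  shows "Ck k f"
  using assms(2)
proof (induction k arbitrary: f)
  case 0
  thus ?case using radial_span_dir_deriv[OF assms(1) 0]
    by (auto intro!: continuous_at_imp_continuous_on differentiable_imp_continuous_within)
next
  case (Suc k)
  thus ?case using radial_span_dir_deriv[OF assms(1)] by auto
qed

section \<open>Test functions, their Laplacians and integrability against them\<close>

lemma test_function_dir_deriv:
  assumes "test_function \<phi>"
  shows "test_function (dir_deriv v \<phi>)"
proof -
  have d: "\<phi> differentiable at z" for z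
    using assms unfolding test_function_def by (metis Ck.simps(2))
  have Ck: "Ck k (dir_deriv v \<phi>)" for k
    using assms unfolding test_function_def by (metis Ck.simps(2))
  have "dir_deriv v \<phi> z = 0" if "z \<notin> closure {z. \<phi> z \<noteq> 0}" for z
  proof -
    have "((\<lambda>_. 0) has_derivative (\<lambda>_. 0)) (at z)" by simp
    hence "(\<phi> has_derivative (\<lambda>_. 0)) (at z)"
      by (rule has_derivative_transform_within_open[where s = "- closure {z. \<phi> z \<noteq> 0}"])
        (use that closure_subset[of "{z. \<phi> z \<noteq> 0}"] in \<open>auto simp: subset_eq\<close>)
    thus ?thesis unfolding dir_deriv_def by (metis frechet_derivative_at)
  qed
  hence "{z. dir_deriv v \<phi> z \<noteq> 0} \<subseteq> closure {z. \<phi> z \<noteq> 0}" by blast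
  hence "closure {z. dir_deriv v \<phi> z \<noteq> 0} \<subseteq> closure {z. \<phi> z \<noteq> 0}"
    by (simp add: closure_minimal)
  moreover have "compact (closure {z. \<phi> z \<noteq> 0})"
    using assms by (simp add: test_function_def)
  ultimately have "compact (closure {z. dir_deriv v \<phi> z \<noteq> 0})"
    by (metis closed_closure compact_Int_closed inf.absorb2)
  thus ?thesis using Ck unfolding test_function_def by blast
qed

lemma test_function_rgen:
  assumes "smooth_seq \<psi>" and supp: "\<And>s. s > b \<Longrightarrow> \<psi> 0 s = 0"
  shows "test_function (rgen \<psi> 0 c m n)"
proof -
  have "rgen \<psi> 0 c m n \<in> radial_span \<psi>"
    unfolding rgen_def[abs_def] by (rule radial_span.gen)
  moreover have "{z. rgen \<psi> 0 c m n z \<noteq> 0} \<subseteq> cball 0 (sqrt \<bar>b\<bar>)"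
  proof
    fix z assume "z \<in> {z. rgen \<psi> 0 c m n z \<noteq> 0}"
    hence "(cmod z)\<^sup>2 \<le> b" using supp unfolding rgen_def by force
    hence "cmod z \<le> sqrt b" by (simp add: real_le_rsqrt)
    also have "\<dots> \<le> sqrt \<bar>b\<bar>" by simp
    finally show "z \<in> cball 0 (sqrt \<bar>b\<bar>)" by simp
  qed
  hence "bounded {z. rgen \<psi> 0 c m n z \<noteq> 0}" by (rule bounded_subset[OF bounded_cball])
  ultimately show ?thesis
    unfolding test_function_def using radial_span_Ck[OF assms(1)] by (auto simp: compact_closure)
qed

text \<open>The factor Re (c cnj z^N) is harmonic and homogeneous of degree N: its own Laplacian
  vanishes and Euler's identity turns the mixed term into a multiple of N, so with s = |z|^2 only 4
  (s \<psi>'' + (N + 1) \<psi>') remains.\<close>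

lemma rgen_laplacian:
  assumes "smooth_seq \<psi>"
  shows "dir_deriv 1 (dir_deriv 1 (rgen \<psi> 0 c 0 N)) z + dir_deriv \<i> (dir_deriv \<i> (rgen \<psi> 0 c 0 N)) z
    = 4 * ((cmod z)\<^sup>2 * \<psi> 2 ((cmod z)\<^sup>2) + (N + 1) * \<psi> 1 ((cmod z)\<^sup>2)) * Re (c * cnj z ^ N)"
proof -
  have d: "(rgen_deriv \<psi> j c a b v has_derivative (\<lambda>w.
      (rgen_deriv \<psi> (Suc j) (cnj v * c) (Suc a) b w z + rgen_deriv \<psi> (Suc j) (v * c) a (Suc b) w z) +
      (rgen_deriv \<psi> j (of_nat a * c * v) (a - 1) b w z + rgen_deriv \<psi> j (of_nat b * c * cnj v) a (b - 1) w z))) (at z)"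
    for j c a b v
    unfolding rgen_deriv_def[of \<psi> j c a b v, abs_def]
    by (intro has_derivative_add rgen_has_derivative assms)
  have dd: "dir_deriv w (dir_deriv v (rgen \<psi> j c a b)) z =
      (rgen_deriv \<psi> (Suc j) (cnj v * c) (Suc a) b w z + rgen_deriv \<psi> (Suc j) (v * c) a (Suc b) w z) +
      (rgen_deriv \<psi> j (of_nat a * c * v) (a - 1) b w z + rgen_deriv \<psi> j (of_nat b * c * cnj v) a (b - 1) w z)"
    for j c a b v w
    unfolding rgen_dir_deriv[OF assms] unfolding dir_deriv_def
    using fun_cong[OF frechet_derivative_at[OF d[of j c a b v]], of w] by simp
  have m: "rgen \<psi> j (- c) a b z = - rgen \<psi> j c a b z" "rgen \<psi> j 0 a b z = 0"
    "rgen \<psi> j (of_nat k * c) a b z = k * rgen \<psi> j c a b z"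
    "rgen \<psi> j (c + c') a b z = rgen \<psi> j c a b z + rgen \<psi> j c' a b z" for j c c' a b k
    by (simp_all add: rgen_def algebra_simps)
  have zz: "c * z ^ 1 * cnj z ^ Suc N = of_real ((cmod z)\<^sup>2) * (c * cnj z ^ N)"
    using complex_norm_square[of z] by (simp add: mult_ac)
  \<comment> \<open>In the sum over v = 1 and v = \<i> the terms containing v^2 or cnj v^2 cancel,
    and those containing v cnj v double.\<close>
  have L: "dir_deriv v (dir_deriv v (rgen \<psi> 0 c 0 N)) z
    = rgen \<psi> 2 (cnj v * cnj v * c) 2 N z + 2 * rgen \<psi> 2 (v * cnj v * c) 1 (Suc N) z
      + rgen \<psi> 2 (v * v * c) 0 (N + 2) z + 2 * (N + 1) * rgen \<psi> 1 (v * cnj v * c) 0 N z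
      + 2 * N * rgen \<psi> 1 (cnj v * cnj v * c) 1 (N - 1) z
      + N * (N - 1) * rgen \<psi> 0 (cnj v * cnj v * c) 0 (N - 2) z" for v
  proof -
    have 1: "rgen_deriv \<psi> (Suc 0) (cnj v * c) (Suc 0) N v z
      = rgen \<psi> 2 (cnj v * cnj v * c) 2 N z + rgen \<psi> 2 (v * cnj v * c) 1 (Suc N) z
        + rgen \<psi> 1 (v * cnj v * c) 0 N z + N * rgen \<psi> 1 (cnj v * cnj v * c) 1 (N - 1) z"
      unfolding rgen_deriv_def numeral_2_eq_2 using m(3)[of 1 N "cnj v * c * cnj v" 1 "N - 1"]
      by (simp add: mult_ac)
    have 2: "rgen_deriv \<psi> (Suc 0) (v * c) 0 (Suc N) v z
      = rgen \<psi> 2 (v * cnj v * c) 1 (Suc N) z + rgen \<psi> 2 (v * v * c) 0 (N + 2) z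
        + (N + 1) * rgen \<psi> 1 (v * cnj v * c) 0 N z"
      unfolding rgen_deriv_def numeral_2_eq_2 using m(3)[of 1 "Suc N" "v * c * cnj v" 0 N]
      by (simp add: mult_ac m(2) del: of_nat_Suc)
    have 3: "rgen_deriv \<psi> 0 (of_nat 0 * c * v) (0 - 1) N v z = 0"
      unfolding rgen_deriv_def by (simp add: m(2))
    have 4: "rgen_deriv \<psi> 0 (of_nat N * c * cnj v) 0 (N - 1) v z
      = N * rgen \<psi> 1 (cnj v * cnj v * c) 1 (N - 1) z + N * rgen \<psi> 1 (v * cnj v * c) 0 N z
        + N * (N - 1) * rgen \<psi> 0 (cnj v * cnj v * c) 0 (N - 2) z"
    proof (cases N)
      case (Suc M)
      have a: "rgen \<psi> 1 (cnj v * (of_nat N * c * cnj v)) 1 M z = N * rgen \<psi> 1 (cnj v * cnj v * c) 1 M z"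
        "rgen \<psi> 1 (v * (of_nat N * c * cnj v)) 0 N z = N * rgen \<psi> 1 (v * cnj v * c) 0 N z"
        "rgen \<psi> 0 (of_nat M * (of_nat N * c * cnj v) * cnj v) 0 (M - 1) z
         = N * M * rgen \<psi> 0 (cnj v * cnj v * c) 0 (M - 1) z"
        using m(3)[of 1 N "cnj v * cnj v * c" 1 M] m(3)[of 1 N "v * cnj v * c" 0 N]
          m(3)[of 0 "N * M" "cnj v * cnj v * c" 0 "M - 1"] by (simp_all add: mult_ac)
      have "N - 1 = M" "N - 2 = M - 1" "Suc M = N" using Suc by auto
      thus ?thesis
        unfolding rgen_deriv_def using a by (simp add: m(2))
    qed (simp add: rgen_deriv_def m(2))
    show ?thesis
      unfolding dd[of v v 0 c 0 N] 1 2 3 4 by (simp add: algebra_simps)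
  qed
  have "dir_deriv 1 (dir_deriv 1 (rgen \<psi> 0 c 0 N)) z + dir_deriv \<i> (dir_deriv \<i> (rgen \<psi> 0 c 0 N)) z
    = 4 * rgen \<psi> 2 c 1 (Suc N) z + 4 * (N + 1) * rgen \<psi> 1 c 0 N z"
    unfolding L by (simp add: m)
  also have "\<dots> = 4 * ((cmod z)\<^sup>2 * \<psi> 2 ((cmod z)\<^sup>2) + (N + 1) * \<psi> 1 ((cmod z)\<^sup>2)) * Re (c * cnj z ^ N)"
  proof -
    have "rgen \<psi> 2 c 1 (Suc N) z = (cmod z)\<^sup>2 * rgen \<psi> 2 c 0 N z"
      using arg_cong[OF zz, of Re] by (simp add: rgen_def)
    thus ?thesis by (simp add: rgen_def algebra_simps)
  qed
  finally show ?thesis by (simp add: add.commute)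
qed

lemma integrable_bounded_support:
  fixes F :: "complex \<Rightarrow> complex"
  assumes "F \<in> borel_measurable borel" "\<And>z. cmod (F z) \<le> C" "\<And>z. z \<notin> cball 0 R \<Longrightarrow> F z = 0"
  shows "integrable lborel F"
proof (rule Bochner_Integration.integrable_bound[where f = "\<lambda>z. C * indicator (cball 0 R) z"])
  show "integrable lborel (\<lambda>z::complex. C * indicator (cball 0 R) z)"
    by (intro integrable_mult_right integrable_real_indicator) (auto intro: emeasure_lborel_cball_finite[simplified])
  show "AE z in lborel. norm (F z) \<le> norm (C * indicator (cball 0 R) z)"
    using assms(2,3) by (intro AE_I2) (auto split: split_indicator intro: order_trans[OF _ abs_ge_self])
qed (use assms in auto)

lemma integrable_radial_cutoff:
  fixes v :: "complex \<Rightarrow> complex" and h :: "real \<Rightarrow> real"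
  assumes v: "continuous_on UNIV v" and h: "h \<in> borel_measurable borel" "\<And>s. \<bar>h s\<bar> \<le> C" "\<And>s. s > b \<Longrightarrow> h s = 0"
  shows "integrable lborel (\<lambda>z. v z * of_real (h ((cmod z)\<^sup>2)))"
proof -
  let ?R = "sqrt \<bar>b\<bar>"
  have "compact (v ` cball 0 ?R)"
    by (intro compact_continuous_image continuous_on_subset[OF v]) auto
  then obtain B where B: "\<And>z. z \<in> cball 0 ?R \<Longrightarrow> cmod (v z) \<le> B"
    by (metis bounded_iff compact_imp_bounded imageI)
  have C0: "C \<ge> 0" using h(2)[of 0] by linarith
  have B0: "B \<ge> 0" using B[of 0] by (auto intro: order_trans[OF norm_ge_zero])
  have out: "h ((cmod z)\<^sup>2) = 0" if "z \<notin> cball 0 ?R" for z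
  proof (rule h(3))
    have "?R < cmod z" using that by simp
    hence "?R\<^sup>2 < (cmod z)\<^sup>2" by (intro power_strict_mono) auto
    thus "b < (cmod z)\<^sup>2" by simp
  qed
  show ?thesis
  proof (rule integrable_bounded_support[where C = "B * C" and R = ?R])
    have [measurable]: "v \<in> borel_measurable borel"
      by (rule borel_measurable_continuous_onI[OF v])
    note [measurable] = h(1)
    show "(\<lambda>z. v z * of_real (h ((cmod z)\<^sup>2))) \<in> borel_measurable borel" by measurable
    show "cmod (v z * of_real (h ((cmod z)\<^sup>2))) \<le> B * C" for z
    proof (cases "z \<in> cball 0 ?R")
      case True
      thus ?thesis using B[OF True] h(2) B0 by (auto simp: norm_mult intro!: mult_mono)
    qed (use out B0 C0 in auto)
    show "v z * of_real (h ((cmod z)\<^sup>2)) = 0" if "z \<notin> cball 0 ?R" for z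
      using out[OF that] by simp
  qed
qed

lemma test_function_continuous: "test_function \<phi> \<Longrightarrow> continuous_on UNIV \<phi>"
  unfolding test_function_def by (metis Ck.simps(1))

lemma test_function_bound:
  assumes "test_function \<phi>"
  obtains K C where "compact K" "\<And>z. z \<notin> K \<Longrightarrow> \<phi> z = 0" "\<And>z. \<bar>\<phi> z\<bar> \<le> C"
proof -
  let ?K = "closure {z. \<phi> z \<noteq> 0}"
  have K: "compact ?K" using assms by (simp add: test_function_def)
  have "compact (\<phi> ` ?K)"
    by (intro compact_continuous_image continuous_on_subset[OF test_function_continuous[OF assms]] K) auto
  then obtain C where C: "\<And>z. z \<in> ?K \<Longrightarrow> \<bar>\<phi> z\<bar> \<le> C"
    by (metis bounded_iff compact_imp_bounded imageI real_norm_def)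
  have out: "\<phi> z = 0" if "z \<notin> ?K" for z
    using that closure_subset[of "{z. \<phi> z \<noteq> 0}"] by auto
  have "\<bar>\<phi> z\<bar> \<le> max C 0" for z
    using C[of z] out[of z] by (cases "z \<in> ?K") auto
  with K out show ?thesis by (rule that)
qed

text \<open>On the compact support, |g| \<le> 1 + |g|^2 turns local square integrability into
  integrability.\<close>

lemma integrable_L2_loc_test:
  assumes g: "L2_loc g" and \<phi>: "test_function \<phi>"
  shows "integrable lborel (\<lambda>z. g z * of_real (\<phi> z))"
proof -
  obtain K C where K: "compact K" "\<And>z. z \<notin> K \<Longrightarrow> \<phi> z = 0" "\<And>z. \<bar>\<phi> z\<bar> \<le> C"
    using test_function_bound[OF \<phi>] by blast
  have C0: "C \<ge> 0" using K(3)[of 0] by linarith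
  have [measurable]: "\<phi> \<in> borel_measurable borel" "g \<in> borel_measurable borel"
    using borel_measurable_continuous_onI[OF test_function_continuous[OF \<phi>]] g by (auto simp: L2_loc_def)
  have i1: "integrable lborel (\<lambda>z. indicator K z * (cmod (g z))\<^sup>2)"
    using g K(1) by (auto simp: L2_loc_def set_integrable_def)
  have i2: "integrable lborel (\<lambda>z. indicator K z :: real)"
    using K(1) emeasure_compact_finite[OF K(1)] by (simp add: compact_imp_closed)
  have "integrable lborel (\<lambda>z. C * (indicator K z + indicator K z * (cmod (g z))\<^sup>2))"
    by (intro integrable_mult_right Bochner_Integration.integrable_add i1 i2)
  thus ?thesis
  proof (rule Bochner_Integration.integrable_bound)
    show "AE z in lborel. norm (g z * of_real (\<phi> z)) \<le> norm (C * (indicator K z + indicator K z * (cmod (g z))\<^sup>2))"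
    proof (rule AE_I2)
      fix z
      show "norm (g z * of_real (\<phi> z)) \<le> norm (C * (indicator K z + indicator K z * (cmod (g z))\<^sup>2))"
      proof (cases "z \<in> K")
        case True
        have "2 * cmod (g z) \<le> 1 + (cmod (g z))\<^sup>2"
          using sum_squares_bound[of 1 "cmod (g z)"] by simp
        hence "cmod (g z) \<le> 1 + (cmod (g z))\<^sup>2" by (smt (verit) zero_le_power2 norm_ge_zero)
        hence "cmod (g z) * \<bar>\<phi> z\<bar> \<le> (1 + (cmod (g z))\<^sup>2) * C"
          using K(3) by (intro mult_mono) auto
        thus ?thesis using True C0 by (simp add: norm_mult mult.commute)
      qed (simp add: K(2))
    qed
  qed measurable
qed

text \<open>Both derivatives end on the test function: \<open>weak_deriv\<close> is applied to the
  first derivatives of \<open>\<phi>\<close>, which are again test functions. Only the continuous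
  function u then has to be averaged over circles.\<close>

lemma helmholtz_very_weak:
  assumes u: "helmholtz_solution p u" and \<phi>: "test_function \<phi>"
  shows "(LINT z|lborel. u z * of_real (dir_deriv 1 (dir_deriv 1 \<phi>) z)) +
    (LINT z|lborel. u z * of_real (dir_deriv \<i> (dir_deriv \<i> \<phi>) z)) =
    - (LINT z|lborel. of_real (p z) * u z * of_real (\<phi> z))"
proof -
  obtain g1 g2 where g: "H1_loc_grad u g1 g2" and
    w: "(LINT z|lborel. g1 z * of_real (dir_deriv 1 \<phi> z) + g2 z * of_real (dir_deriv \<i> \<phi> z)) =
        (LINT z|lborel. of_real (p z) * u z * of_real (\<phi> z))"
    using u \<phi> unfolding helmholtz_solution_def by blast
  note d = test_function_dir_deriv[OF \<phi>]
  have L: "L2_loc g1" "L2_loc g2" using g by (auto simp: H1_loc_grad_def)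
  have 1: "(LINT z|lborel. u z * of_real (dir_deriv 1 (dir_deriv 1 \<phi>) z)) = - (LINT z|lborel. g1 z * of_real (dir_deriv 1 \<phi> z))"
    and 2: "(LINT z|lborel. u z * of_real (dir_deriv \<i> (dir_deriv \<i> \<phi>) z)) = - (LINT z|lborel. g2 z * of_real (dir_deriv \<i> \<phi> z))"
    using g d unfolding H1_loc_grad_def weak_deriv_def by blast+
  have 3: "(LINT z|lborel. g1 z * of_real (dir_deriv 1 \<phi> z)) + (LINT z|lborel. g2 z * of_real (dir_deriv \<i> \<phi> z))
    = (LINT z|lborel. of_real (p z) * u z * of_real (\<phi> z))"
    unfolding w[symmetric] by (intro Bochner_Integration.integral_add[symmetric] integrable_L2_loc_test L d)
  show ?thesis
    unfolding 1 2 3[symmetric] by simp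
qed

section \<open>Averages over rotations and the weak radial equation\<close>

lemma integral_periodic_shift:
  fixes g :: "real \<Rightarrow> complex"
  assumes g: "continuous_on UNIV g" and per: "\<And>\<theta>. g (\<theta> + c) = g \<theta>" and "c \<ge> 0" "t \<ge> 0"
  shows "integral {0..c} (\<lambda>\<theta>. g (\<theta> + t)) = integral {0..c} g"
proof -
  have i: "g integrable_on {a..b}" for a b
    by (intro integrable_continuous_real continuous_on_subset[OF g]) auto
  have "integral {0..c} (\<lambda>\<theta>. g (\<theta> + t)) = integral {t..c + t} g"
    using integral_shift_Icc_real[of 0 c g t] by (simp add: o_def add.commute)
  also have "\<dots> = integral {0..c + t} g - integral {0..t} g"
    using Henstock_Kurzweil_Integration.integral_combine[of 0 t "c + t" g] assms i by (simp add: algebra_simps)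
  also have "\<dots> = integral {0..c} g + integral {c..t + c} g - integral {0..t} g"
    using Henstock_Kurzweil_Integration.integral_combine[of 0 c "c + t" g] assms i by (simp add: algebra_simps)
  also have "integral {c..t + c} g = integral {0..t} g"
    using integral_shift_Icc_real[of 0 t g c] per by (simp add: o_def add.commute[of c])
  finally show ?thesis by simp
qed

text \<open>Rotating the point at angle t through a full turn scans the circle from t on, which
  multiplies the coefficient by a phase. That phase cancels later against the one of
  \<open>ang\<close>.\<close>

lemma circle_coeff_rotate:
  assumes u: "continuous_on UNIV u" and "t \<ge> 0"
  shows "integral {0..2 * pi} (\<lambda>\<theta>. u (cis \<theta> * rcis r t) * cis (- of_int n * \<theta>))
    = of_real (2 * pi) * cis (of_int n * t) * circle_coeff u r n"
proof -
  define g where "g \<theta> = u (rcis r \<theta>) * cis (- of_int n * \<theta>)" for \<theta>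
  have cg: "continuous_on UNIV g"
    unfolding g_def rcis_def by (intro continuous_intros continuous_on_compose2[OF u]) auto
  have "cis (- of_int n * (\<theta> + 2 * pi)) = cis (- of_int n * \<theta>)" for \<theta>
  proof -
    have "- of_int n * (\<theta> + 2 * pi) = - of_int n * \<theta> + 2 * pi * of_int (- n)"
      by (simp add: algebra_simps)
    thus ?thesis by (simp only: cis_mult[symmetric] cis_multiple_2pi Ints_of_int) simp
  qed
  moreover have "rcis r (\<theta> + 2 * pi) = rcis r \<theta>" for \<theta>
    by (simp add: rcis_def cis_mult[symmetric])
  ultimately have per: "g (\<theta> + 2 * pi) = g \<theta>" for \<theta>
    by (simp add: g_def)
  have "integral {0..2 * pi} (\<lambda>\<theta>. u (cis \<theta> * rcis r t) * cis (- of_int n * \<theta>))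
    = integral {0..2 * pi} (\<lambda>\<theta>. cis (of_int n * t) * g (\<theta> + t))"
  proof (rule arg_cong[where f = "integral _"], rule ext)
    fix \<theta>
    have "cis (- of_int n * \<theta>) = cis (of_int n * t) * cis (- of_int n * (\<theta> + t))"
      by (simp add: cis_mult algebra_simps)
    moreover have "cis \<theta> * rcis r t = rcis r (\<theta> + t)"
      by (simp add: rcis_def cis_mult)
    ultimately show "u (cis \<theta> * rcis r t) * cis (- of_int n * \<theta>) = cis (of_int n * t) * g (\<theta> + t)"
      by (simp add: g_def)
  qed
  also have "\<dots> = cis (of_int n * t) * integral {0..2 * pi} g"
    using integral_periodic_shift[OF cg per _ assms(2)] by simp
  finally show ?thesis unfolding g_def[abs_def] by (simp add: circle_coeff_def)
qed

text \<open>The harmonic polynomial r^|n| cis (-n t); averaging its product with u over rotations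
  picks out the n-th coefficient.\<close>

definition ang :: "int \<Rightarrow> complex \<Rightarrow> complex" where
  "ang n z = (if n \<ge> 0 then cnj z ^ nat n else z ^ nat (- n))"

lemma ang_rcis: "ang n (rcis r t) = of_real (r ^ nat \<bar>n\<bar>) * cis (- of_int n * t)"
proof (cases "n \<ge> 0")
  case True
  then obtain N where "n = int N" using nonneg_int_cases by blast
  thus ?thesis
    by (simp add: ang_def rcis_def power_mult_distrib cis_cnj Complex.DeMoivre)
next
  case False
  then obtain N where "n = - int N" by (intro that[of "nat (- n)"]) simp
  thus ?thesis using False
    by (simp add: ang_def rcis_def power_mult_distrib Complex.DeMoivre)
qed

lemma ang_mult: "ang n (w * z) = ang n w * ang n z"
  by (simp add: ang_def power_mult_distrib)

lemma continuous_on_ang [continuous_intros]: "continuous_on S (ang n)"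
  unfolding ang_def[abs_def] by (cases "n \<ge> 0") (auto intro!: continuous_intros)

lemma continuous_on_circle_coeff:
  assumes u: "continuous_on UNIV u"
  shows "continuous_on UNIV (\<lambda>r. circle_coeff u r n)"
proof -
  have "continuous_on (UNIV \<times> cbox 0 (2 * pi)) (\<lambda>(r, \<theta>). u (rcis r \<theta>) * cis (- of_int n * \<theta>))"
    unfolding split_def rcis_def by (intro continuous_intros continuous_on_compose2[OF u]) auto
  from integral_continuous_on_param[OF this] show ?thesis
    unfolding circle_coeff_def by (auto intro!: continuous_intros)
qed

text \<open>Integrals over the plane are invariant under rotation, so the integrand may be replaced
  by its average over all rotations. The average is a function of |z| alone, namely r^|n| times the
  Fourier coefficient, and the radial formula in s = |z|^2 applies to it.\<close>

lemma integral_angular: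
  assumes u: "continuous_on UNIV u" and h: "h \<in> borel_measurable borel" "\<And>s. \<bar>h s\<bar> \<le> C" "\<And>s. s > b \<Longrightarrow> h s = 0"
  shows "(LINT z|lborel. u z * ang n z * of_real (h ((cmod z)\<^sup>2)))
    = of_real pi * (LINT s|lborel. indicator {0..} s *\<^sub>R
        (of_real (sqrt s ^ nat \<bar>n\<bar>) * circle_coeff u (sqrt s) n * of_real (h s)))"
proof -
  define F where "F z = u z * ang n z * of_real (h ((cmod z)\<^sup>2))" for z
  have [measurable]: "u \<in> borel_measurable borel" "ang n \<in> borel_measurable borel"
    by (auto intro!: borel_measurable_continuous_onI u continuous_intros)
  note [measurable] = h(1)
  have Fm[measurable]: "F \<in> borel_measurable borel"
    unfolding F_def[abs_def] by measurable
  have iF: "integrable lborel F"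
    unfolding F_def[abs_def] using u h by (intro integrable_radial_cutoff continuous_intros) auto
  define G where "G z = (LINT \<theta>|lborel. indicator {0..2 * pi} \<theta> *\<^sub>R F (cis \<theta> * z))" for z
  have cm[measurable]: "(\<lambda>p. cis (fst p) * snd p) \<in> borel_measurable (borel \<Otimes>\<^sub>M borel)"
    unfolding borel_prod by (intro borel_measurable_continuous_onI continuous_intros)
  have int_rot: "integrable lborel (\<lambda>z. F (cis \<theta> * z))" for \<theta>
    using iF by (subst (asm) lborel_distr_rotate[of "cis \<theta>", symmetric])
      (auto simp: integrable_distr_eq)
  have rot_norm: "(LINT z|lborel. norm (F (cis \<theta> * z))) = (LINT z|lborel. norm (F z))" for \<theta>
    by (subst (2) lborel_distr_rotate[of "cis \<theta>", symmetric]) (auto simp: integral_distr)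
  have "integrable (lborel \<Otimes>\<^sub>M lborel) (\<lambda>(\<theta>, z). indicator {0..2 * pi} \<theta> *\<^sub>R F (cis \<theta> * z))"
  proof (rule lborel_pair.Fubini_integrable)
    show "(\<lambda>(\<theta>, z). indicator {0..2 * pi} \<theta> *\<^sub>R F (cis \<theta> * z)) \<in> borel_measurable (lborel \<Otimes>\<^sub>M lborel)"
      unfolding split_def using measurable_compose[OF cm Fm] by simp
    have "(LINT z|lborel. norm (case (\<theta>, z) of (\<theta>, z) \<Rightarrow> indicator {0..2 * pi} \<theta> *\<^sub>R F (cis \<theta> * z)))
      = indicator {0..2 * pi} \<theta> * (LINT z|lborel. norm (F z))" for \<theta>
      using rot_norm[of \<theta>] by simp
    thus "integrable lborel (\<lambda>\<theta>. LINT z|lborel. norm (case (\<theta>, z) of (\<theta>, z) \<Rightarrow> indicator {0..2 * pi} \<theta> *\<^sub>R F (cis \<theta> * z)))"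
      by (simp only:) (intro integrable_mult_left integrable_real_indicator, auto)
    show "AE \<theta> in lborel. integrable lborel (\<lambda>z. case (\<theta>, z) of (\<theta>, z) \<Rightarrow> indicator {0..2 * pi} \<theta> *\<^sub>R F (cis \<theta> * z))"
      using int_rot by (intro AE_I2) simp
  qed
  from lborel_pair.Fubini_integral[OF this]
  have "(LINT z|lborel. G z) = (LINT \<theta>|lborel. LINT z|lborel. indicator {0..2 * pi} \<theta> *\<^sub>R F (cis \<theta> * z))"
    unfolding G_def by simp
  also have "\<dots> = (LINT \<theta>|lborel. indicator {0..2 * pi} \<theta> *\<^sub>R (LINT z|lborel. F z))"
    using integral_rotate[OF Fm] by simp
  also have "\<dots> = of_real (2 * pi) * (LINT z|lborel. F z)"
    by (simp add: scaleR_conv_of_real)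
  finally have 1: "(LINT z|lborel. G z) = of_real (2 * pi) * (LINT z|lborel. F z)" .
  define H where "H s = of_real (sqrt s ^ nat \<bar>n\<bar>) * circle_coeff u (sqrt s) n * of_real (h s)" for s
  have G: "G z = of_real (2 * pi) * H ((cmod z)\<^sup>2)" for z
  proof -
    define t where "t = Arg2pi z"
    have z: "z = rcis (cmod z) t"
      using complex_norm_eq_1_exp Arg2pi_eq[of z] by (simp add: t_def rcis_def cis_conv_exp)
    have t: "t \<ge> 0" by (simp add: t_def Arg2pi_ge_0)
    have Fz: "F (cis \<theta> * z) = (of_real (cmod z ^ nat \<bar>n\<bar>) * cis (- of_int n * t) * of_real (h ((cmod z)\<^sup>2)))
        * (u (cis \<theta> * rcis (cmod z) t) * cis (- of_int n * \<theta>))" for \<theta>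
    proof -
      have "ang n (cis \<theta>) = cis (- of_int n * \<theta>)" using ang_rcis[of n 1 \<theta>] by (simp add: rcis_def)
      moreover have "ang n z = of_real (cmod z ^ nat \<bar>n\<bar>) * cis (- of_int n * t)"
        by (subst z) (rule ang_rcis)
      ultimately show ?thesis
        by (simp add: F_def ang_mult norm_mult z[symmetric] mult_ac)
    qed
    have cont: "continuous_on {0..2 * pi} (\<lambda>\<theta>. F (cis \<theta> * z))"
      unfolding Fz by (intro continuous_intros continuous_on_compose2[OF u]) auto
    have "G z = (LINT \<theta>:{0..2 * pi}|lborel. F (cis \<theta> * z))"
      by (simp add: G_def set_lebesgue_integral_def)
    also have "\<dots> = integral {0..2 * pi} (\<lambda>\<theta>. F (cis \<theta> * z))"
      by (intro set_borel_integral_eq_integral) (use borel_integrable_atLeastAtMost'[OF cont] in auto)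
    also have "\<dots> = of_real (cmod z ^ nat \<bar>n\<bar>) * cis (- of_int n * t) * of_real (h ((cmod z)\<^sup>2))
        * (of_real (2 * pi) * cis (of_int n * t) * circle_coeff u (cmod z) n)"
      unfolding Fz by (simp only: integral_mult_right circle_coeff_rotate[OF u t])
    also have "\<dots> = of_real (2 * pi) * (cis (- of_int n * t) * cis (of_int n * t)) * H ((cmod z)\<^sup>2)"
      by (simp add: H_def)
    finally show ?thesis by (simp add: cis_mult)
  qed
  have [measurable]: "(\<lambda>r. circle_coeff u r n) \<in> borel_measurable borel"
    by (intro borel_measurable_continuous_onI continuous_on_circle_coeff u)
  have "H \<in> borel_measurable borel" unfolding H_def[abs_def] by measurable
  from integral_radial[OF this]
  have "(LINT z|lborel. G z) = of_real (2 * pi) * (of_real pi * (LINT s|lborel. indicator {0..} s *\<^sub>R H s))"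
    unfolding G by simp
  with 1 show ?thesis by (simp add: F_def H_def)
qed

lemma smooth_seq_continuous: "smooth_seq \<psi> \<Longrightarrow> continuous_on S (\<psi> j)"
  unfolding smooth_seq_def by (meson DERIV_isCont continuous_at_imp_continuous_on)

text \<open>Testing with \<psi>(|z|^2) Re (c cnj z^N) gives, in s = r^2, the weak form of an
  equation for s^(N/2) v(sqrt s), where v is the n-th coefficient of u. The supports stay away from
  s = 0; the origin enters later, through boundedness.\<close>

lemma coeff_weak_1d:
  fixes u :: "complex \<Rightarrow> complex" and n :: int
  assumes u: "helmholtz_solution (\<lambda>z. if cmod z < \<epsilon> then A else B) u" and "\<epsilon> > 0"
    and \<psi>: "smooth_seq \<psi>" and a: "0 < a" and ab: "a < b" and supp: "\<And>j s. j \<le> 2 \<Longrightarrow> s \<le> a \<or> s \<ge> b \<Longrightarrow> \<psi> j s = 0"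
  defines "N \<equiv> nat \<bar>n\<bar>"
  shows "((\<lambda>s. of_real (sqrt s ^ N) * circle_coeff u (sqrt s) n *
      of_real (4 * (s * \<psi> 2 s + (N + 1) * \<psi> 1 s) + (if s < \<epsilon>\<^sup>2 then A else B) * \<psi> 0 s)) has_integral 0) {a..b}"
proof -
  define P where "P s = (if s < \<epsilon>\<^sup>2 then A else B)" for s
  define f where "f s = 4 * (s * \<psi> 2 s + (N + 1) * \<psi> 1 s) + P s * \<psi> 0 s" for s
  have cu: "continuous_on UNIV u" and Lu: "L2_loc u"
    using u unfolding helmholtz_solution_def H1_loc_grad_def by auto
  have [measurable]: "\<psi> j \<in> borel_measurable borel" for j
    by (rule borel_measurable_continuous_onI[OF smooth_seq_continuous[OF \<psi>]])
  have [measurable]: "P \<in> borel_measurable borel" unfolding P_def[abs_def] by measurable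
  have fm[measurable]: "f \<in> borel_measurable borel" unfolding f_def[abs_def] by measurable
  have "\<exists>C. \<forall>s. j \<le> 2 \<longrightarrow> \<bar>\<psi> j s\<bar> \<le> C" for j
  proof -
    have "compact (\<psi> j ` {a..b})"
      by (intro compact_continuous_image smooth_seq_continuous \<psi>) auto
    then obtain C where C: "\<And>s. s \<in> {a..b} \<Longrightarrow> \<bar>\<psi> j s\<bar> \<le> C"
      by (metis bounded_iff compact_imp_bounded imageI real_norm_def)
    have "\<bar>\<psi> j s\<bar> \<le> max C 0" if "j \<le> 2" for s
      using C[of s] supp[OF that, of s] by (cases "s \<in> {a..b}") auto
    thus ?thesis by blast
  qed
  then obtain C where C: "\<And>j s. j \<le> 2 \<Longrightarrow> \<bar>\<psi> j s\<bar> \<le> C j" by metis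
  have C0: "j \<le> 2 \<Longrightarrow> C j \<ge> 0" for j using C[of j 0] by linarith
  have Pb: "\<bar>P s\<bar> \<le> \<bar>A\<bar> + \<bar>B\<bar>" for s by (simp add: P_def)
  have f0: "f s = 0" if "s \<le> a \<or> s \<ge> b" for s
    using supp[OF _ that] by (simp add: f_def)
  have fb: "\<bar>f s\<bar> \<le> 4 * (b * C 2 + (N + 1) * C 1) + (\<bar>A\<bar> + \<bar>B\<bar>) * C 0" for s
  proof (cases "s \<in> {a..b}")
    case True
    have "\<bar>s * \<psi> 2 s\<bar> \<le> b * C 2"
      unfolding abs_mult using True a C C0 by (intro mult_mono) auto
    moreover have "\<bar>(N + 1) * \<psi> 1 s\<bar> \<le> (N + 1) * C 1"
      unfolding abs_mult using C by (intro mult_mono) auto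
    moreover have "\<bar>P s * \<psi> 0 s\<bar> \<le> (\<bar>A\<bar> + \<bar>B\<bar>) * C 0"
      unfolding abs_mult using C Pb by (intro mult_mono) auto
    moreover have "\<bar>4 * (x + y) + w\<bar> \<le> 4 * (X + Y) + Z" if "\<bar>x\<bar> \<le> X" "\<bar>y\<bar> \<le> Y" "\<bar>w\<bar> \<le> Z" for x y w X Y Z :: real
      using that by (auto simp: abs_le_iff)
    ultimately show ?thesis unfolding f_def by blast
  next
    case False
    hence "f s = 0" by (intro f0) auto
    thus ?thesis using a ab C0 by simp
  qed
  have key: "(LINT z|lborel. u z * of_real (Re (c * cnj z ^ N)) * of_real (f ((cmod z)\<^sup>2))) = 0" for c
  proof -
    let ?\<phi> = "rgen \<psi> 0 c 0 N"
    have t: "test_function ?\<phi>"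
      by (rule test_function_rgen[OF \<psi>, of b]) (use supp in auto)
    note d = test_function_dir_deriv[OF t]
    have p: "of_real (if cmod z < \<epsilon> then A else B) * u z * of_real (?\<phi> z)
        = u z * of_real (Re (c * cnj z ^ N)) * of_real (P ((cmod z)\<^sup>2) * \<psi> 0 ((cmod z)\<^sup>2))" for z
    proof -
      have "cmod z < \<epsilon> \<longleftrightarrow> (cmod z)\<^sup>2 < \<epsilon>\<^sup>2"
        using \<open>\<epsilon> > 0\<close> by (metis norm_ge_zero power_strict_mono pos2 power_less_imp_less_base less_imp_le)
      thus ?thesis by (simp add: P_def rgen_def)
    qed
    have ip: "integrable lborel (\<lambda>z. u z * of_real (Re (c * cnj z ^ N)) * of_real (P ((cmod z)\<^sup>2) * \<psi> 0 ((cmod z)\<^sup>2)))"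
      by (rule integrable_radial_cutoff[where C = "(\<bar>A\<bar> + \<bar>B\<bar>) * C 0" and b = b])
        (use supp C Pb in \<open>auto intro!: continuous_intros cu mult_mono simp: abs_mult\<close>)
    have lap: "u z * of_real (dir_deriv 1 (dir_deriv 1 ?\<phi>) z) + u z * of_real (dir_deriv \<i> (dir_deriv \<i> ?\<phi>) z)
       + u z * of_real (Re (c * cnj z ^ N)) * of_real (P ((cmod z)\<^sup>2) * \<psi> 0 ((cmod z)\<^sup>2))
       = u z * of_real (Re (c * cnj z ^ N)) * of_real (f ((cmod z)\<^sup>2))" for z
    proof -
      have "u z * of_real (dir_deriv 1 (dir_deriv 1 ?\<phi>) z) + u z * of_real (dir_deriv \<i> (dir_deriv \<i> ?\<phi>) z)
        = u z * of_real (dir_deriv 1 (dir_deriv 1 ?\<phi>) z + dir_deriv \<i> (dir_deriv \<i> ?\<phi>) z)"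
        by (simp add: distrib_left)
      thus ?thesis
        unfolding rgen_laplacian[OF \<psi>] by (simp add: f_def algebra_simps)
    qed
    note i1 = integrable_L2_loc_test[OF Lu test_function_dir_deriv[OF d[of 1], of 1]]
    note i2 = integrable_L2_loc_test[OF Lu test_function_dir_deriv[OF d[of \<i>], of \<i>]]
    have "(LINT z|lborel. u z * of_real (Re (c * cnj z ^ N)) * of_real (f ((cmod z)\<^sup>2)))
      = (LINT z|lborel. u z * of_real (dir_deriv 1 (dir_deriv 1 ?\<phi>) z)) + (LINT z|lborel. u z * of_real (dir_deriv \<i> (dir_deriv \<i> ?\<phi>) z))
       + (LINT z|lborel. u z * of_real (Re (c * cnj z ^ N)) * of_real (P ((cmod z)\<^sup>2) * \<psi> 0 ((cmod z)\<^sup>2)))"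
      unfolding lap[symmetric]
      by (simp only: Bochner_Integration.integral_add i1 i2 ip Bochner_Integration.integrable_add)
    also have "\<dots> = 0"
      unfolding helmholtz_very_weak[OF u t] p by (rule left_minus)
    finally show ?thesis .
  qed
  \<comment> \<open>The two real test functions with c = 1 and c = \<i> combine to the complex
    harmonic, for either sign of n.\<close>
  have ang: "ang n z = of_real (Re (1 * cnj z ^ N)) + (if n \<ge> 0 then - \<i> else \<i>) * of_real (Re (\<i> * cnj z ^ N))" for z
    by (simp add: ang_def N_def complex_eq_iff flip: complex_cnj_power)
  have iu: "integrable lborel (\<lambda>z. u z * of_real (Re (c * cnj z ^ N)) * of_real (f ((cmod z)\<^sup>2)))" for c
    by (rule integrable_radial_cutoff[where b = b, OF _ fm fb])
      (use f0 in \<open>auto intro!: continuous_intros cu\<close>)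
  have "(LINT z|lborel. u z * ang n z * of_real (f ((cmod z)\<^sup>2)))
    = (LINT z|lborel. u z * of_real (Re (1 * cnj z ^ N)) * of_real (f ((cmod z)\<^sup>2))
      + (if n \<ge> 0 then - \<i> else \<i>) * (u z * of_real (Re (\<i> * cnj z ^ N)) * of_real (f ((cmod z)\<^sup>2))))"
    unfolding ang by (intro Bochner_Integration.integral_cong) (auto simp: algebra_simps)
  also have "\<dots> = 0"
    by (subst Bochner_Integration.integral_add) (use iu[of 1] iu[of \<i>] key[of 1] key[of \<i>] in auto)
  finally have 0: "(LINT z|lborel. u z * ang n z * of_real (f ((cmod z)\<^sup>2))) = 0" .
  define W where "W s = of_real (sqrt s ^ N) * circle_coeff u (sqrt s) n" for s
  have cW: "continuous_on UNIV W"
    unfolding W_def[abs_def]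
    by (intro continuous_intros continuous_on_compose2[OF continuous_on_circle_coeff[OF cu]]) auto
  have [measurable]: "W \<in> borel_measurable borel"
    by (rule borel_measurable_continuous_onI[OF cW])
  have "(LINT s|lborel. indicator {0..} s *\<^sub>R (W s * of_real (f s))) = 0"
    using integral_angular[OF cu fm fb, of b n] f0 0 by (auto simp: W_def N_def)
  moreover have "indicator {0..} s *\<^sub>R (W s * of_real (f s)) = indicator {a..b} s *\<^sub>R (W s * of_real (f s))" for s
    using f0[of s] a by (cases "s \<in> {a..b}") auto
  ultimately have I: "(LINT s:{a..b}|lborel. W s * of_real (f s)) = 0"
    by (simp add: set_lebesgue_integral_def)
  have "compact (W ` {a..b})"
    by (intro compact_continuous_image continuous_on_subset[OF cW]) auto
  then obtain D where D: "\<And>s. s \<in> {a..b} \<Longrightarrow> cmod (W s) \<le> D"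
    by (metis bounded_iff compact_imp_bounded imageI)
  let ?C = "4 * (b * C 2 + (N + 1) * C 1) + (\<bar>A\<bar> + \<bar>B\<bar>) * C 0"
  have "set_integrable lborel {a..b} (\<lambda>s. W s * of_real (f s))"
    unfolding set_integrable_def
  proof (rule Bochner_Integration.integrable_bound[where f = "\<lambda>s. (D * ?C) * indicator {a..b} s"])
    show "AE s in lborel. norm (indicator {a..b} s *\<^sub>R (W s * of_real (f s))) \<le> norm (D * ?C * indicator {a..b} s)"
    proof (rule AE_I2)
      fix s
      show "norm (indicator {a..b} s *\<^sub>R (W s * of_real (f s))) \<le> norm (D * ?C * indicator {a..b} s)"
      proof (cases "s \<in> {a..b}")
        case True
        have "norm (W s * of_real (f s)) \<le> D * ?C"
          unfolding norm_mult norm_of_real using D[OF True] fb[of s] order_trans[OF norm_ge_zero D[OF True]]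
          by (intro mult_mono) auto
        thus ?thesis using True by (auto intro: order_trans)
      qed auto
    qed
    show "integrable lborel (\<lambda>s. (D * ?C) * indicator {a..b} s)"
      by (intro integrable_mult_right integrable_real_indicator) (auto simp: emeasure_lborel_Icc_eq)
  qed measurable
  from set_borel_integral_eq_integral[OF this] I
  have "((\<lambda>s. W s * of_real (f s)) has_integral 0) {a..b}"
    using integrable_integral by fastforce
  thus ?thesis unfolding W_def f_def P_def of_nat_add of_nat_1 .
qed

section \<open>Weak solutions of the radial equation\<close>

lemma antiderivative_ray:
  fixes f :: "real \<Rightarrow> complex"
  assumes f: "continuous_on {0<..} f"
  obtains F where "\<And>x. x > 0 \<Longrightarrow> (F has_vector_derivative f x) (at x)"
proof
  fix x :: real assume x: "x > 0"
  let ?a = "min x 1 / 2" and ?b = "max x 1 + 1"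
  have "continuous_on {?a..?b} f"
    by (rule continuous_on_subset[OF f]) (use x in auto)
  hence "((\<lambda>u. LBINT y=ereal 1..u. f y) has_vector_derivative f x) (at x within {?a..?b})"
    by (intro interval_integral_FTC2) (use x in auto)
  thus "((\<lambda>u. LBINT y=ereal 1..u. f y) has_vector_derivative f x) (at x)"
    by (subst (asm) at_within_Icc_at) (use x in auto)
qed

lemma antiderivative_real:
  fixes f :: "real \<Rightarrow> real"
  assumes f: "continuous_on UNIV f"
  obtains F where "\<And>x. (F has_real_derivative f x) (at x)" "F c = 0"
proof
  fix x :: real
  let ?G = "\<lambda>u. LBINT y=ereal 0..u. f y"
  let ?a = "- \<bar>x\<bar> - 1" and ?b = "\<bar>x\<bar> + 1"
  have "(?G has_vector_derivative f x) (at x within {?a..?b})"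
    by (intro interval_integral_FTC2 continuous_on_subset[OF f]) auto
  hence "(?G has_vector_derivative f x) (at x)"
    by (subst (asm) at_within_Icc_at) auto
  hence "(?G has_real_derivative f x) (at x)"
    by (simp add: has_real_derivative_iff_has_vector_derivative)
  from DERIV_diff[OF this DERIV_const[of "?G c"]]
  show "((\<lambda>u. ?G u - ?G c) has_real_derivative f x) (at x)" by simp
qed simp

text \<open>\<open>D 2\<close> is a bump, \<open>D 1\<close> a smoothed step and \<open>D 0\<close>
  a smoothed ramp that is affine beyond 1. Suitable combinations of translated ramps have compact
  support while their second derivatives are approximate delta functions.\<close>

lemma smooth_kernel:
  obtains D m where "smooth_seq D" "\<And>y. D 2 y \<ge> 0" "\<And>y. \<bar>y\<bar> \<ge> 1 \<Longrightarrow> D 2 y = 0" "m > 0"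
    "\<And>j y. j \<le> 1 \<Longrightarrow> y \<le> -1 \<Longrightarrow> D j y = 0" "\<And>y. y \<ge> 1 \<Longrightarrow> D 1 y = m"
    "\<And>y. y \<ge> 1 \<Longrightarrow> D 0 y = D 0 1 + m * (y - 1)"
proof -
  obtain \<eta> where \<eta>: "smooth_seq \<eta>" "\<And>y. \<eta> 0 y \<ge> 0" "\<And>y. \<bar>y\<bar> \<ge> 1 \<Longrightarrow> \<eta> 0 y = 0" "\<eta> 0 0 > 0"
    using smooth_bump by blast
  have c\<eta>: "continuous_on UNIV (\<eta> 0)"
    using \<eta>(1) unfolding smooth_seq_def by (meson DERIV_isCont continuous_at_imp_continuous_on)
  obtain B1 where B1: "\<And>x. (B1 has_real_derivative \<eta> 0 x) (at x)" "B1 (-1) = 0"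
    using antiderivative_real[OF c\<eta>, of "-1"] by blast
  have cB1: "continuous_on UNIV B1"
    by (meson B1(1) DERIV_isCont continuous_at_imp_continuous_on)
  obtain B where B: "\<And>x. (B has_real_derivative B1 x) (at x)" "B (-1) = 0"
    using antiderivative_real[OF cB1, of "-1"] by blast
  have mono: "B1 x \<le> B1 y" if "x \<le> y" for x y
    by (rule DERIV_nonneg_imp_nondecreasing[OF that]) (use B1(1) \<eta>(2) in blast)
  have const: "g x = g y" if "\<And>t. x \<le> t \<Longrightarrow> t \<le> y \<Longrightarrow> (g has_real_derivative 0) (at t)" "x \<le> y" for g :: "real \<Rightarrow> real" and x y
  proof (rule antisym)
    show "g x \<le> g y" by (rule DERIV_nonneg_imp_nondecreasing[OF that(2)]) (use that(1) in blast)
    show "g y \<le> g x" by (rule DERIV_nonpos_imp_nonincreasing[OF that(2)]) (use that(1) in blast)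
  qed
  have l1: "B1 y = 0" if "y \<le> -1" for y
  proof -
    have "\<eta> 0 t = 0" if "t \<le> -1" for t using that by (intro \<eta>(3)) auto
    hence "B1 y = B1 (-1)"
      by (intro const[of y "-1" B1] that) (use B1(1) in metis)
    thus ?thesis using B1(2) by simp
  qed
  have r1: "B1 y = B1 1" if "y \<ge> 1" for y
  proof -
    have "\<eta> 0 t = 0" if "t \<ge> 1" for t using that by (intro \<eta>(3)) auto
    hence "B1 1 = B1 y"
      by (intro const[of 1 y B1] that) (use B1(1) in metis)
    thus ?thesis by simp
  qed
  have l0: "B y = 0" if "y \<le> -1" for y
  proof -
    have "B y = B (-1)"
      by (intro const[of y "-1" B] that) (use B(1) l1 in metis)
    thus ?thesis using B(2) by simp
  qed
  have r0: "B y = B 1 + B1 1 * (y - 1)" if "y \<ge> 1" for y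
  proof -
    have "((\<lambda>t. B t - B1 1 * (t - 1)) has_real_derivative 0) (at t)" if "1 \<le> t" for t
      using B(1)[of t] r1[OF that] by (auto intro!: derivative_eq_intros)
    from const[of 1 y, OF this that] show ?thesis by simp
  qed
  have "B1 1 > 0"
  proof (rule ccontr)
    assume "\<not> B1 1 > 0"
    hence "B1 y = 0" if "-1 < y" "y < 1" for y
      using mono[of "-1" y] mono[of y 1] that B1(2) by simp
    hence "((\<lambda>_. 0) has_real_derivative \<eta> 0 0) (at 0)"
      using has_field_derivative_transform_within_open[OF B1(1)[of 0], of "{-1<..<1}" "\<lambda>_. 0"] by simp
    from DERIV_unique[OF this DERIV_const] show False using \<eta>(4) by simp
  qed
  define D where "D j = (if j = 0 then B else if j = 1 then B1 else \<eta> (j - 2))" for j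
  have "smooth_seq D"
    unfolding smooth_seq_def
  proof (intro allI)
    fix j s
    show "(D j has_real_derivative D (Suc j) s) (at s)"
    proof (cases j)
      case 0
      thus ?thesis using B(1) by (simp add: D_def)
    next
      case (Suc i)
      thus ?thesis using B1(1) \<eta>(1) by (cases i) (auto simp: D_def smooth_seq_def)
    qed
  qed
  moreover have D: "D 2 = \<eta> 0" "D 1 = B1" "D 0 = B" by (simp_all add: D_def)
  moreover have "D j y = 0" if "j \<le> 1" "y \<le> -1" for j y
    using that l0 l1 by (auto simp: D_def)
  moreover have "D 0 y = D 0 1 + B1 1 * (y - 1)" if "y \<ge> 1" for y
    unfolding D by (rule r0[OF that])
  moreover have "D 1 y = B1 1" if "y \<ge> 1" for y
    unfolding D by (rule r1[OF that])
  moreover have "D 2 y \<ge> 0" for y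
    unfolding D by (rule \<eta>(2))
  moreover have "D 2 y = 0" if "\<bar>y\<bar> \<ge> 1" for y
    unfolding D by (rule \<eta>(3)[OF that])
  moreover note \<open>B1 1 > 0\<close>
  ultimately show thesis
    by - (rule that[of D "B1 1"]; assumption)
qed

lemma has_integral_norm_le:
  fixes f :: "real \<Rightarrow> complex"
  assumes f: "(f has_integral I) S" and g: "(g has_integral J) S" and le: "\<And>s. s \<in> S \<Longrightarrow> cmod (f s) \<le> g s"
  shows "cmod I \<le> J"
proof -
  have "norm (integral S f) \<le> integral S g"
    by (rule integral_norm_bound_integral[OF has_integral_integrable[OF f] has_integral_integrable[OF g] le])
  thus ?thesis
    unfolding integral_unique[OF f] integral_unique[OF g] .
qed

text \<open>A continuous function with vanishing weak second derivative is affine, stated as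
  collinearity of three values. Ramps at x, y, z carry the weights z - y, x - z, y - x, whose sum
  and first moment are zero, so the combination has compact support; shrinking the kernels leaves
  the three values of \<open>G\<close>.\<close>

lemma weak_affine:
  fixes G :: "real \<Rightarrow> complex"
  assumes G: "continuous_on {0<..} G"
    and weak: "\<And>\<psi> a b. smooth_seq \<psi> \<Longrightarrow> 0 < a \<Longrightarrow> a < b \<Longrightarrow> (\<And>j s. j \<le> 2 \<Longrightarrow> s \<le> a \<or> s \<ge> b \<Longrightarrow> \<psi> j s = 0) \<Longrightarrow>
      ((\<lambda>s. G s * of_real (\<psi> 2 s)) has_integral 0) {a..b}"
    and xyz: "0 < x" "x < y" "y < z"
  shows "of_real (z - x) * G y = of_real (z - y) * G x + of_real (y - x) * G z"
proof -
  obtain D m where D: "smooth_seq D" "\<And>y. D 2 y \<ge> 0" "\<And>y. \<bar>y\<bar> \<ge> 1 \<Longrightarrow> D 2 y = 0" and m: "m > 0"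
    and Dl: "\<And>j y. j \<le> 1 \<Longrightarrow> y \<le> -1 \<Longrightarrow> D j y = 0" and Dr: "\<And>y. y \<ge> 1 \<Longrightarrow> D 1 y = m"
    "\<And>y. y \<ge> 1 \<Longrightarrow> D 0 y = D 0 1 + m * (y - 1)"
    using smooth_kernel by blast
  define z0 where "z0 = of_real (z - y) * G x + of_real (x - z) * G y + of_real (y - x) * G z"
  have bound: "cmod z0 \<le> e * (2 * (z - x))" if e: "e > 0" for e
  proof -
    have "\<exists>d>0. \<forall>s>0. \<bar>s - t\<bar> \<le> d \<longrightarrow> cmod (G s - G t) \<le> e" if "t > 0" for t
    proof -
      have "isCont G t" using G that by (simp add: continuous_on_eq_continuous_at)
      then obtain d where "d > 0" "\<And>s. \<bar>s - t\<bar> < d \<Longrightarrow> cmod (G s - G t) < e"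
        using e unfolding continuous_at_eps_delta by (metis dist_norm real_norm_def)
      thus ?thesis by (intro exI[of _ "d / 2"]) (auto intro: less_imp_le)
    qed
    then obtain d where d: "\<And>t. t > 0 \<Longrightarrow> d t > 0"
      "\<And>t s. t > 0 \<Longrightarrow> s > 0 \<Longrightarrow> \<bar>s - t\<bar> \<le> d t \<Longrightarrow> cmod (G s - G t) \<le> e" by metis
    define \<delta> where "\<delta> = Min {d x, d y, d z, x / 2}"
    have \<delta>: "\<delta> > 0" "\<delta> \<le> d x" "\<delta> \<le> d y" "\<delta> \<le> d z" "\<delta> < x"
      using d(1) xyz by (auto simp: \<delta>_def min_less_iff_disj)
    let ?a = "x - \<delta>" and ?b = "z + \<delta>"
    \<comment> \<open>Dividing by \<open>\<delta> ^ j\<close> accounts for the chain rule, so that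
      \<open>\<psi> j\<close> is the j-th derivative of \<open>\<psi> 0\<close>.\<close>
    define \<psi> where "\<psi> j s = ((z - y) * D j ((s - x) / \<delta>) + (x - z) * D j ((s - y) / \<delta>) + (y - x) * D j ((s - z) / \<delta>)) / \<delta> ^ j" for j s
    have "smooth_seq \<psi>"
      unfolding smooth_seq_def
    proof (intro allI)
      fix j s
      have "((\<lambda>s. D j ((s - t) / \<delta>)) has_real_derivative D (Suc j) ((s - t) / \<delta>) * (1 / \<delta>)) (at s)" for t
        by (rule DERIV_chain2[OF D(1)[unfolded smooth_seq_def, rule_format]])
          (use \<delta> in \<open>auto intro!: derivative_eq_intros\<close>)
      note * = this
      show "(\<psi> j has_real_derivative \<psi> (Suc j) s) (at s)"
        unfolding \<psi>_def[abs_def]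
        by (rule derivative_eq_intros * refl)+ (use \<delta> in \<open>auto simp: field_simps\<close>)
    qed
    moreover have "\<psi> j s = 0" if "j \<le> 2" "s \<le> ?a \<or> s \<ge> ?b" for j s
      using that(2)
    proof
      assume "s \<le> ?a"
      hence "(s - t) / \<delta> \<le> -1" if "t \<ge> x" for t using \<delta>(1) that by (simp add: divide_simps)
      hence "D j ((s - t) / \<delta>) = 0" if "t \<ge> x" for t
        using Dl[of j "(s - t) / \<delta>"] D(3)[of "(s - t) / \<delta>"] that \<open>j \<le> 2\<close>
        by (cases "j = 2") (force simp: abs_if)+
      thus ?thesis using xyz by (simp add: \<psi>_def)
    next
      assume "s \<ge> ?b"
      hence ge: "(s - t) / \<delta> \<ge> 1" if "t \<le> z" for t using \<delta>(1) that by (simp add: divide_simps)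
      consider "j = 0" | "j = 1" | "j = 2" using \<open>j \<le> 2\<close> by linarith
      thus ?thesis
      proof cases
        case 1
        have "D 0 ((s - t) / \<delta>) = D 0 1 + m * ((s - t) / \<delta> - 1)" if "t \<le> z" for t
          using Dr(2)[OF ge[OF that]] .
        hence "\<psi> j s = (z - y) * (D 0 1 + m * ((s - x) / \<delta> - 1)) + (x - z) * (D 0 1 + m * ((s - y) / \<delta> - 1))
            + (y - x) * (D 0 1 + m * ((s - z) / \<delta> - 1))"
          using xyz 1 by (simp add: \<psi>_def)
        also have "\<dots> = 0" using \<delta>(1) by (simp add: field_simps)
        finally show ?thesis .
      next
        case 2
        thus ?thesis using Dr(1)[OF ge] xyz by (simp add: \<psi>_def algebra_simps)
      next
        case 3
        have "D 2 ((s - t) / \<delta>) = 0" if "t \<le> z" for t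
          by (intro D(3) order_trans[OF ge[OF that] abs_ge_self])
        thus ?thesis using 3 xyz by (simp add: \<psi>_def)
      qed
    qed
    ultimately have I: "((\<lambda>s. G s * of_real (\<psi> 2 s)) has_integral 0) {?a..?b}"
      by (intro weak) (use xyz \<delta> in auto)
    define K where "K t s = D 2 ((s - t) / \<delta>)" for t s
    have cD: "continuous_on S (D j)" for j S
      using D(1) unfolding smooth_seq_def by (meson DERIV_isCont continuous_at_imp_continuous_on)
    have cK: "continuous_on S (K t)" for t S
      unfolding K_def[abs_def] by (intro continuous_on_compose2[OF cD] continuous_intros) (use \<delta> in auto)
    have cG: "continuous_on {?a..?b} G"
      by (rule continuous_on_subset[OF G]) (use \<delta> in auto)
    have Kint: "(K t has_integral \<delta> * m) {?a..?b}" if "x \<le> t" "t \<le> z" for t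
    proof -
      have "((\<lambda>s. \<delta> * D 1 ((s - t) / \<delta>)) has_vector_derivative K t s) (at s within {?a..?b})" for s
      proof -
        have "((\<lambda>s. \<delta> * D 1 ((s - t) / \<delta>)) has_real_derivative \<delta> * (D (Suc 1) ((s - t) / \<delta>) * (1 / \<delta>))) (at s)"
          by (intro DERIV_cmult DERIV_chain2[OF D(1)[unfolded smooth_seq_def, rule_format]])
            (use \<delta> in \<open>auto intro!: derivative_eq_intros\<close>)
        thus ?thesis using \<delta>(1)
          by (simp add: K_def numeral_2_eq_2 has_real_derivative_iff_has_vector_derivative has_vector_derivative_at_within)
      qed
      from fundamental_theorem_of_calculus[OF _ this]
      have "(K t has_integral \<delta> * D 1 ((?b - t) / \<delta>) - \<delta> * D 1 ((?a - t) / \<delta>)) {?a..?b}"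
        using xyz \<delta> by simp
      moreover have "D 1 ((?b - t) / \<delta>) = m" using that \<delta>(1) by (intro Dr) (simp add: divide_simps)
      moreover have "D 1 ((?a - t) / \<delta>) = 0" using that \<delta>(1) by (intro Dl) (simp_all add: divide_simps)
      ultimately show ?thesis by simp
    qed
    have Gint: "(\<lambda>s. G s * of_real (K t s)) integrable_on {?a..?b}" for t
      by (intro integrable_continuous_real continuous_intros cG cK)
    \<comment> \<open>The kernel is nonnegative, has mass \<delta> m and lives within distance
      \<delta> of t, where \<open>G\<close> varies by at most e.\<close>
    have err: "cmod (integral {?a..?b} (\<lambda>s. G s * of_real (K t s)) - of_real (\<delta> * m) * G t) \<le> e * (\<delta> * m)"
      if t: "x \<le> t" "t \<le> z" "\<delta> \<le> d t" for t
    proof -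
      have h: "((\<lambda>s. of_real (K t s) * G t) has_integral of_real (\<delta> * m) * G t) {?a..?b}"
        using has_integral_mult_left[OF has_integral_of_real[OF Kint[OF t(1,2)]]] by simp
      have "((\<lambda>s. G s * of_real (K t s) - of_real (K t s) * G t) has_integral
          integral {?a..?b} (\<lambda>s. G s * of_real (K t s)) - of_real (\<delta> * m) * G t) {?a..?b}"
        by (intro has_integral_diff integrable_integral Gint h)
      moreover have "((\<lambda>s. e * K t s) has_integral e * (\<delta> * m)) {?a..?b}"
        by (intro has_integral_mult_right Kint t)
      moreover have "cmod (G s * of_real (K t s) - of_real (K t s) * G t) \<le> e * K t s" if "s \<in> {?a..?b}" for s
      proof (cases "\<bar>s - t\<bar> \<le> \<delta>")
        case True
        have "cmod (G s - G t) \<le> e" using True t that xyz \<delta> by (intro d(2)) auto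
        hence "cmod (G s - G t) * \<bar>K t s\<bar> \<le> e * \<bar>K t s\<bar>" by (intro mult_right_mono) auto
        moreover have "K t s \<ge> 0" using D(2) by (simp add: K_def)
        moreover have "G s * of_real (K t s) - of_real (K t s) * G t = (G s - G t) * of_real (K t s)"
          by (simp add: algebra_simps)
        ultimately show ?thesis by (simp add: norm_mult)
      next
        case False
        have "K t s = 0" unfolding K_def
          by (rule D(3)) (use False \<delta>(1) in \<open>simp add: abs_divide\<close>)
        thus ?thesis by simp
      qed
      ultimately show ?thesis
        by (rule has_integral_norm_le)
    qed
    define H where "H t = integral {?a..?b} (\<lambda>s. G s * of_real (K t s))" for t
    have "((\<lambda>s. of_real (1 / \<delta>\<^sup>2) * (of_real (z - y) * (G s * of_real (K x s)) + of_real (x - z) * (G s * of_real (K y s))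
        + of_real (y - x) * (G s * of_real (K z s)))) has_integral
        of_real (1 / \<delta>\<^sup>2) * (of_real (z - y) * H x + of_real (x - z) * H y + of_real (y - x) * H z)) {?a..?b}"
      unfolding H_def by (intro has_integral_mult_right has_integral_add integrable_integral Gint)
    moreover have "of_real (1 / \<delta>\<^sup>2) * (of_real (z - y) * (G s * of_real (K x s)) + of_real (x - z) * (G s * of_real (K y s))
        + of_real (y - x) * (G s * of_real (K z s))) = G s * of_real (\<psi> 2 s)" for s
      unfolding \<psi>_def K_def by (simp add: field_simps)
    ultimately have "((\<lambda>s. G s * of_real (\<psi> 2 s)) has_integral
        of_real (1 / \<delta>\<^sup>2) * (of_real (z - y) * H x + of_real (x - z) * H y + of_real (y - x) * H z)) {?a..?b}"
      by (simp only:)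
    from has_integral_unique[OF this I]
    have "of_real (1 / \<delta>\<^sup>2) * (of_real (z - y) * H x + of_real (x - z) * H y + of_real (y - x) * H z) = (0::complex)" .
    hence 0: "of_real (z - y) * H x + of_real (x - z) * H y + of_real (y - x) * H z = (0::complex)"
      using \<delta>(1) by simp
    have "of_real (\<delta> * m) * z0 = - (of_real (z - y) * (H x - of_real (\<delta> * m) * G x)
        + of_real (x - z) * (H y - of_real (\<delta> * m) * G y) + of_real (y - x) * (H z - of_real (\<delta> * m) * G z))"
    proof -
      have "k * (a * p + b * q + c * r) = - (a * (h1 - k * p) + b * (h2 - k * q) + c * (h3 - k * r))"
        if "a * h1 + b * h2 + c * h3 = 0" for a b c h1 h2 h3 k p q r :: complex
        using that by algebra
      from this[OF 0] show ?thesis unfolding z0_def .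
    qed
    also have "cmod \<dots> \<le> (z - y) * (e * (\<delta> * m)) + (z - x) * (e * (\<delta> * m)) + (y - x) * (e * (\<delta> * m))"
      unfolding norm_minus_cancel
      by (rule order_trans[OF norm_triangle_ineq], rule add_mono, rule order_trans[OF norm_triangle_ineq], rule add_mono)
        (use err xyz \<delta> in \<open>auto simp: norm_mult H_def simp del: of_real_diff intro!: mult_mono\<close>)
    also have "\<dots> = (\<delta> * m) * (e * (2 * (z - x)))" by (simp add: algebra_simps)
    finally have "(\<delta> * m) * cmod z0 \<le> (\<delta> * m) * (e * (2 * (z - x)))"
      using \<delta>(1) m by (simp add: norm_mult)
    thus ?thesis using \<delta>(1) m by simp
  qed
  have "cmod z0 \<le> 0"
  proof (rule field_le_epsilon)
    fix e :: real assume "e > 0"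
    thus "cmod z0 \<le> 0 + e" using bound[of "e / (2 * (z - x))"] xyz by simp
  qed
  hence "of_real (z - y) * G x + of_real (x - z) * G y + of_real (y - x) * G z = 0"
    by (simp add: z0_def)
  moreover have "of_real (x - z) * G y = - (of_real (z - x) * G y)"
    by (simp add: algebra_simps)
  ultimately show ?thesis by algebra
qed

lemma has_vector_derivative_complex_of_real:
  "(f has_real_derivative d) (at x) \<Longrightarrow> ((\<lambda>t. complex_of_real (f t)) has_vector_derivative of_real d) (at x)"
  by (rule has_vector_derivative_of_real) (simp add: has_real_derivative_iff_has_vector_derivative)

text \<open>Two integrations remove all derivatives from the unknown: the weak equation says that s
  W - (k + 1) V + I2 / 4 has zero weak second derivative, where V is an antiderivative of W and I2 a
  double antiderivative of the potential term. Being affine, this combination forces W to be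
  differentiable; c is its slope.\<close>

lemma weak_solution_regular:
  fixes W :: "real \<Rightarrow> complex" and k :: real
  assumes W: "continuous_on {0<..} W" and e: "e > 0"
    and weak: "\<And>\<psi> a b. smooth_seq \<psi> \<Longrightarrow> 0 < a \<Longrightarrow> a < b \<Longrightarrow> (\<And>j s. j \<le> 2 \<Longrightarrow> s \<le> a \<or> s \<ge> b \<Longrightarrow> \<psi> j s = 0) \<Longrightarrow>
      ((\<lambda>s. W s * of_real (4 * (s * \<psi> 2 s + (k + 1) * \<psi> 1 s) + (if s < e then A else B) * \<psi> 0 s)) has_integral 0) {a..b}"
  obtains c Q where "\<And>s. s > 0 \<Longrightarrow> (W has_vector_derivative (c + of_real k * W s - Q s / 4) / of_real s) (at s)"
    "continuous_on {0<..} Q" "\<And>s. s > 0 \<Longrightarrow> s \<noteq> e \<Longrightarrow> (Q has_vector_derivative of_real (if s < e then A else B) * W s) (at s)"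
proof -
  obtain V where V: "\<And>s. s > 0 \<Longrightarrow> (V has_vector_derivative W s) (at s)"
    using antiderivative_ray[OF W] by blast
  have cV: "continuous_on {0<..} V"
    using V by (meson continuous_at_imp_continuous_on greaterThan_iff has_vector_derivative_continuous)
  \<comment> \<open>Subtracting \<open>V e\<close> makes this antiderivative of the discontinuous
    potential term continuous across the interface.\<close>
  define Q where "Q s = of_real (if s < e then A else B) * (V s - V e)" for s
  have Q: "(Q has_vector_derivative of_real (if s < e then A else B) * W s) (at s)" if "s > 0" "s \<noteq> e" for s
  proof (cases "s < e")
    case True
    have "((\<lambda>s. of_real A * (V s - V e)) has_vector_derivative of_real A * W s) (at s)"
      using V[OF \<open>s > 0\<close>] by (auto intro!: derivative_eq_intros)
    hence "(Q has_vector_derivative of_real A * W s) (at s)"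
      by (rule has_vector_derivative_transform_within_open[where S = "{..<e}"]) (use True in \<open>auto simp: Q_def\<close>)
    thus ?thesis using True by simp
  next
    case False
    have "((\<lambda>s. of_real B * (V s - V e)) has_vector_derivative of_real B * W s) (at s)"
      using V[OF \<open>s > 0\<close>] by (auto intro!: derivative_eq_intros)
    hence "(Q has_vector_derivative of_real B * W s) (at s)"
      by (rule has_vector_derivative_transform_within_open[where S = "{e<..}"]) (use False that in \<open>auto simp: Q_def\<close>)
    thus ?thesis using False by simp
  qed
  have cQ: "continuous_on {0<..} Q"
  proof -
    have "continuous_on {0<..} (\<lambda>s. of_real A * (V (min s e) - V e) + of_real B * (V (max s e) - V e))"
      by (intro continuous_intros continuous_on_compose2[OF cV]) (use e in auto)
    thus ?thesis
      by (rule continuous_on_eq) (auto simp: Q_def)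
  qed
  obtain I2 where I2: "\<And>s. s > 0 \<Longrightarrow> (I2 has_vector_derivative Q s) (at s)"
    using antiderivative_ray[OF cQ] by blast
  have cI2: "continuous_on {0<..} I2"
    using I2 by (meson continuous_at_imp_continuous_on greaterThan_iff has_vector_derivative_continuous)
  define G where "G s = of_real s * W s - of_real (k + 1) * V s + I2 s / 4" for s
  have cG: "continuous_on {0<..} G"
    unfolding G_def[abs_def] by (intro continuous_intros W cV cI2) auto
  have wG: "((\<lambda>s. G s * of_real (\<psi> 2 s)) has_integral 0) {a..b}"
    if \<psi>: "smooth_seq \<psi>" "0 < a" "a < b" "\<And>j s. j \<le> 2 \<Longrightarrow> s \<le> a \<or> s \<ge> b \<Longrightarrow> \<psi> j s = 0" for \<psi> a b
  proof -
    let ?P = "\<lambda>s. if s < e then A else B"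
    \<comment> \<open>\<open>?T\<close> collects the boundary terms of the integration by parts; it
      vanishes at both ends together with \<open>\<psi> 0\<close> and
      \<open>\<psi> 1\<close>.\<close>
    let ?T = "\<lambda>s. of_real (4 * (k + 1)) * (V s * of_real (\<psi> 1 s)) + Q s * of_real (\<psi> 0 s) - I2 s * of_real (\<psi> 1 s)"
    let ?T' = "\<lambda>s. of_real (4 * (k + 1)) * (V s * of_real (\<psi> 2 s) + W s * of_real (\<psi> 1 s))
      + (Q s * of_real (\<psi> 1 s) + of_real (?P s) * W s * of_real (\<psi> 0 s)) - (I2 s * of_real (\<psi> 2 s) + Q s * of_real (\<psi> 1 s))"
    have d\<psi>: "((\<lambda>s. complex_of_real (\<psi> j s)) has_vector_derivative of_real (\<psi> (Suc j) s)) (at s)" for j s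
      using \<psi>(1) unfolding smooth_seq_def by (auto intro!: has_vector_derivative_of_real simp: has_real_derivative_iff_has_vector_derivative)
    have c\<psi>: "continuous_on S (\<psi> j)" for S j using smooth_seq_continuous[OF \<psi>(1)] .
    have sub: "{a..b} \<subseteq> {0<..}" using \<psi> by auto
    have "(?T' has_integral (?T b - ?T a)) {a..b}"
    proof (rule fundamental_theorem_of_calculus_interior_strong[where S = "{e}"])
      show "continuous_on {a..b} ?T"
        by (intro continuous_intros continuous_on_subset[OF cV sub] continuous_on_subset[OF cQ sub] continuous_on_subset[OF cI2 sub] c\<psi>)
      fix s assume s: "s \<in> {a<..<b} - {e}"
      hence s0: "s > 0" "s \<noteq> e" using \<psi> by auto
      have *: "Suc 0 = 1" "Suc 1 = 2" by auto
      show "(?T has_vector_derivative ?T' s) (at s)"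
        using d\<psi>[of 0 s] d\<psi>[of 1 s] unfolding *
        by (intro has_vector_derivative_add has_vector_derivative_diff has_vector_derivative_mult_right
            has_vector_derivative_mult V I2 Q s0)
    qed (use \<psi> in auto)
    moreover have "?T b = 0" "?T a = 0" using \<psi>(4) by simp_all
    ultimately have T': "(?T' has_integral 0) {a..b}" by simp
    have "((\<lambda>s. (1/4) * (W s * of_real (4 * (s * \<psi> 2 s + (k + 1) * \<psi> 1 s) + ?P s * \<psi> 0 s) - ?T' s)) has_integral (1/4) * (0 - 0)) {a..b}"
      by (intro has_integral_mult_right has_integral_diff T' weak \<psi>)
    moreover have "(1/4) * (W s * of_real (4 * (s * \<psi> 2 s + (k + 1) * \<psi> 1 s) + ?P s * \<psi> 0 s) - ?T' s) = G s * of_real (\<psi> 2 s)" for s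
      by (simp add: G_def field_simps)
    ultimately show ?thesis by simp
  qed
  have aff: "of_real (z - x) * G y = of_real (z - y) * G x + of_real (y - x) * G z" if "0 < x" "x < y" "y < z" for x y z
    by (rule weak_affine[OF cG _ that]) (rule wG)
  define c1 where "c1 = G 2 - G 1"
  have G: "G s = (G 1 - c1) + of_real s * c1" if "s > 0" for s
  proof -
    consider "s < 1" | "s = 1" | "1 < s" "s < 2" | "s = 2" | "s > 2" by linarith
    thus ?thesis
    proof cases
      case 1
      from aff[of s 1 2] this that have "of_real (2 - s) * G 1 = of_real (2 - 1) * G s + of_real (1 - s) * G 2" by simp
      thus ?thesis unfolding c1_def of_real_diff of_real_1 of_real_numeral by algebra
    next
      case 3
      from aff[of 1 s 2] this have "of_real (2 - 1) * G s = of_real (2 - s) * G 1 + of_real (s - 1) * G 2" by simp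
      thus ?thesis unfolding c1_def of_real_diff of_real_1 of_real_numeral by algebra
    next
      case 5
      from aff[of 1 2 s] this have "of_real (s - 1) * G 2 = of_real (s - 2) * G 1 + of_real (2 - 1) * G s" by simp
      thus ?thesis unfolding c1_def of_real_diff of_real_1 of_real_numeral by algebra
    qed (simp_all add: c1_def)
  qed
  have "(W has_vector_derivative (c1 + of_real k * W s - Q s / 4) / of_real s) (at s)" if s: "s > 0" for s
  proof -
    define c0 where "c0 = G 1 - c1"
    define H where "H s = c0 + of_real s * c1 + of_real (k + 1) * V s - I2 s / 4" for s
    have H: "H s = of_real s * W s" if "s > 0" for s
      using G[OF that] unfolding H_def c0_def G_def by (simp add: algebra_simps)
    have dH: "(H has_vector_derivative (c1 + of_real (k + 1) * W s - Q s / 4)) (at s)"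
      unfolding H_def[abs_def]
      by (rule derivative_eq_intros V[OF s] I2[OF s] refl | simp)+
    have "((\<lambda>t. of_real (inverse t) * H t) has_vector_derivative
        of_real (inverse s) * (c1 + of_real (k + 1) * W s - Q s / 4) + of_real (- inverse (s ^ 2)) * H s) (at s)"
    proof (intro has_vector_derivative_mult dH)
      have "(inverse has_real_derivative - inverse (s ^ 2)) (at s)"
        using s by (auto intro!: derivative_eq_intros simp: power2_eq_square)
      thus "((\<lambda>t. complex_of_real (inverse t)) has_vector_derivative of_real (- inverse (s ^ 2))) (at s)"
        by (rule has_vector_derivative_complex_of_real)
    qed
    moreover have "of_real (inverse s) * (c1 + of_real (k + 1) * W s - Q s / 4) + of_real (- inverse (s ^ 2)) * H s
      = (c1 + of_real k * W s - Q s / 4) / of_real s"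
      using s by (simp add: H field_simps power2_eq_square)
    ultimately have "((\<lambda>t. of_real (inverse t) * H t) has_vector_derivative (c1 + of_real k * W s - Q s / 4) / of_real s) (at s)"
      by simp
    thus ?thesis
      by (rule has_vector_derivative_transform_within_open[where S = "{0<..}"]) (use s in \<open>auto simp: H\<close>)
  qed
  thus ?thesis using cQ Q by (rule that)
qed

text \<open>Back in the variable r = sqrt s. Continuity of \<open>w1\<close> on the whole ray is the
  transmission condition: the radial derivative does not jump at the interface, although the second
  derivative may.\<close>

lemma helmholtz_coeff_ode:
  fixes n :: int and u :: "complex \<Rightarrow> complex"
  assumes u: "helmholtz_solution (\<lambda>z. if cmod z < \<epsilon> then A else B) u" and \<epsilon>: "\<epsilon> > 0"
  obtains w1 where "continuous_on {0<..} w1"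
    "\<And>r. r > 0 \<Longrightarrow> ((\<lambda>r. circle_coeff u r n) has_vector_derivative w1 r) (at r)"
    "\<And>r. r > 0 \<Longrightarrow> r \<noteq> \<epsilon> \<Longrightarrow> (w1 has_vector_derivative
      - w1 r / of_real r - of_real ((if r < \<epsilon> then A else B) - (of_int n)\<^sup>2 / r\<^sup>2) * circle_coeff u r n) (at r)"
proof -
  define N where "N = nat \<bar>n\<bar>"
  define w where "w r = circle_coeff u r n" for r
  define W where "W s = of_real (sqrt s ^ N) * w (sqrt s)" for s
  have cu: "continuous_on UNIV u" using u by (simp add: helmholtz_solution_def)
  have cw: "continuous_on UNIV w" unfolding w_def[abs_def] by (rule continuous_on_circle_coeff[OF cu])
  have cW: "continuous_on {0<..} W"
    unfolding W_def[abs_def] by (intro continuous_intros continuous_on_compose2[OF cw]) auto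
  have Nn: "(of_int n)\<^sup>2 = (real N)\<^sup>2" by (simp add: N_def)
  obtain c Q where W: "\<And>s. s > 0 \<Longrightarrow> (W has_vector_derivative (c + of_real (real N) * W s - Q s / 4) / of_real s) (at s)"
    and cQ: "continuous_on {0<..} Q"
    and Q: "\<And>s. s > 0 \<Longrightarrow> s \<noteq> \<epsilon>\<^sup>2 \<Longrightarrow> (Q has_vector_derivative of_real (if s < \<epsilon>\<^sup>2 then A else B) * W s) (at s)"
  proof (rule weak_solution_regular[OF cW, of "\<epsilon>\<^sup>2" "real N" A B])
    fix \<psi> a b
    assume "smooth_seq \<psi>" "0 < a" "a < b" "\<And>j s. j \<le> 2 \<Longrightarrow> s \<le> a \<or> s \<ge> b \<Longrightarrow> \<psi> j s = 0"
    from coeff_weak_1d[OF u \<epsilon> this, of n]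
    show "((\<lambda>s. W s * of_real (4 * (s * \<psi> 2 s + (real N + 1) * \<psi> 1 s) + (if s < \<epsilon>\<^sup>2 then A else B) * \<psi> 0 s)) has_integral 0) {a..b}"
      by (simp add: W_def w_def N_def)
  qed (use \<epsilon> in auto)
  have w: "w r = of_real (inverse (r ^ N)) * W (r\<^sup>2)" if "r > 0" for r
    using that by (simp add: W_def field_simps)
  define w1 where "w1 r = of_real (inverse (r ^ Suc N)) * (2 * c + of_nat N * W (r\<^sup>2) - Q (r\<^sup>2) / 2)" for r
  have inv: "((\<lambda>t. complex_of_real (inverse (t ^ M))) has_vector_derivative of_real (- real M * inverse (r ^ Suc M))) (at r)"
    if "r > 0" for r M
  proof -
    have "((\<lambda>t. inverse (t ^ M)) has_real_derivative - real M * inverse (r ^ Suc M)) (at r)"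
    proof (cases M)
      case (Suc k)
      have "((\<lambda>t. t ^ Suc k) has_real_derivative real (Suc k) * r ^ k) (at r)"
        using DERIV_pow[of "Suc k" r] by simp
      from DERIV_inverse_fun[OF this] that
      have "((\<lambda>t. inverse (t ^ M)) has_real_derivative - (real (Suc k) * r ^ k * inverse ((r ^ Suc k) ^ Suc (Suc 0)))) (at r)"
        unfolding Suc by simp
      also have "- (real (Suc k) * r ^ k * inverse ((r ^ Suc k) ^ Suc (Suc 0))) = - real M * inverse (r ^ Suc M)"
        unfolding Suc using that by (simp add: field_simps)
      finally show ?thesis .
    qed (auto intro!: derivative_eq_intros)
    thus ?thesis
      by (rule has_vector_derivative_complex_of_real)
  qed
  have sq: "((\<lambda>t. t\<^sup>2) has_vector_derivative 2 * r) (at r)" for r :: real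
    unfolding has_real_derivative_iff_has_vector_derivative[symmetric] by (auto intro!: derivative_eq_intros)
  have comp: "((\<lambda>t. F (t\<^sup>2)) has_vector_derivative of_real (2 * r) * F') (at r)"
    if "(F has_vector_derivative F') (at (r\<^sup>2))" for F :: "real \<Rightarrow> complex" and F' r
    using vector_diff_chain_at[OF sq that] by (simp add: o_def scaleR_conv_of_real)
  have dW: "((\<lambda>t. W (t\<^sup>2)) has_vector_derivative of_real (2 / r) * (c + of_nat N * W (r\<^sup>2) - Q (r\<^sup>2) / 4)) (at r)" if "r > 0" for r
  proof -
    have "of_real (2 * r) * ((c + of_real (real N) * W (r\<^sup>2) - Q (r\<^sup>2) / 4) / of_real (r\<^sup>2))
      = of_real (2 / r) * (c + of_nat N * W (r\<^sup>2) - Q (r\<^sup>2) / 4)"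
      using that by (simp add: power2_eq_square field_simps)
    thus ?thesis using comp[OF W[of "r\<^sup>2"]] that by simp
  qed
  have dw: "(w has_vector_derivative w1 r) (at r)" if r: "r > 0" for r
  proof -
    have "((\<lambda>t. of_real (inverse (t ^ N)) * W (t\<^sup>2)) has_vector_derivative
        of_real (inverse (r ^ N)) * (of_real (2 / r) * (c + of_nat N * W (r\<^sup>2) - Q (r\<^sup>2) / 4))
        + of_real (- real N * inverse (r ^ Suc N)) * W (r\<^sup>2)) (at r)"
      by (intro has_vector_derivative_mult inv dW r)
    also have "of_real (inverse (r ^ N)) * (of_real (2 / r) * (c + of_nat N * W (r\<^sup>2) - Q (r\<^sup>2) / 4))
        + of_real (- real N * inverse (r ^ Suc N)) * W (r\<^sup>2) = w1 r"
      using r by (simp add: w1_def field_simps)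
    finally show ?thesis
      by (rule has_vector_derivative_transform_within_open[where S = "{0<..}"]) (use r w in auto)
  qed
  moreover have "continuous_on {0<..} w1"
    unfolding w1_def[abs_def]
    by (intro continuous_intros continuous_on_compose2[OF cW] continuous_on_compose2[OF cQ]) auto
  moreover have "(w1 has_vector_derivative - w1 r / of_real r - of_real ((if r < \<epsilon> then A else B) - (of_int n)\<^sup>2 / r\<^sup>2) * w r) (at r)"
    if r: "r > 0" "r \<noteq> \<epsilon>" for r
  proof -
    let ?P = "if r < \<epsilon> then A else B"
    have "r < \<epsilon> \<longleftrightarrow> r\<^sup>2 < \<epsilon>\<^sup>2" using r \<epsilon>
      by (metis less_imp_le power_less_imp_less_base power_strict_mono pos2)
    moreover have "r\<^sup>2 \<noteq> \<epsilon>\<^sup>2" using r \<epsilon> by simp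
    ultimately have dQ: "((\<lambda>t. Q (t\<^sup>2)) has_vector_derivative of_real (2 * r) * (of_real ?P * W (r\<^sup>2))) (at r)"
      using comp[OF Q[of "r\<^sup>2"]] r by simp
    have "(w1 has_vector_derivative of_real (inverse (r ^ Suc N)) * (of_nat N * (of_real (2 / r) * (c + of_nat N * W (r\<^sup>2) - Q (r\<^sup>2) / 4))
        - of_real (2 * r) * (of_real ?P * W (r\<^sup>2)) / 2)
        + of_real (- real (Suc N) * inverse (r ^ Suc (Suc N))) * (2 * c + of_nat N * W (r\<^sup>2) - Q (r\<^sup>2) / 2)) (at r)"
    proof -
      have "((\<lambda>t. 2 * c + of_nat N * W (t\<^sup>2) - Q (t\<^sup>2) / 2) has_vector_derivative
         of_nat N * (of_real (2 / r) * (c + of_nat N * W (r\<^sup>2) - Q (r\<^sup>2) / 4)) - of_real (2 * r) * (of_real ?P * W (r\<^sup>2)) / 2) (at r)"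
        by (rule derivative_eq_intros dW[OF r(1)] dQ refl | simp)+
      thus ?thesis
        unfolding w1_def[abs_def] by (intro has_vector_derivative_mult inv r)
    qed
    also have "of_real (inverse (r ^ Suc N)) * (of_nat N * (of_real (2 / r) * (c + of_nat N * W (r\<^sup>2) - Q (r\<^sup>2) / 4))
        - of_real (2 * r) * (of_real ?P * W (r\<^sup>2)) / 2)
        + of_real (- real (Suc N) * inverse (r ^ Suc (Suc N))) * (2 * c + of_nat N * W (r\<^sup>2) - Q (r\<^sup>2) / 2)
      = - w1 r / of_real r - of_real (?P - (of_int n)\<^sup>2 / r\<^sup>2) * w r"
    proof -
      have "complex_of_real r \<noteq> 0" using r by simp
      thus ?thesis unfolding w[OF r(1)] w1_def Nn
        by (simp add: field_simps power2_eq_square)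
    qed
    finally show ?thesis .
  qed
  ultimately show ?thesis unfolding w_def[abs_def] by - (rule that; assumption)
qed

section \<open>Fourier coefficients on circles\<close>

lemma has_vector_derivative_cis:
  "((\<lambda>s. cis (c * s)) has_vector_derivative (\<i> * of_real c) * cis (c * s)) (at s within S)"
proof -
  have "((\<lambda>z. exp (\<i> * (of_real c * z))) has_field_derivative (\<i> * of_real c) * exp (\<i> * (of_real c * of_real s))) (at (of_real s))"
    by (auto intro!: derivative_eq_intros)
  from has_vector_derivative_real_field[OF this] show ?thesis
    by (simp add: cis_conv_exp)
qed

lemma integral_cis_int:
  "((\<lambda>\<theta>. cis (of_int k * \<theta>)) has_integral (if k = 0 then of_real (2 * pi) else 0)) {0..2 * pi}"
proof (cases "k = 0")
  case True
  thus ?thesis using has_integral_const_real[of "1::complex" 0 "2 * pi"] by (simp add: scaleR_conv_of_real)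
next
  case False
  have "((\<lambda>\<theta>. cis (of_int k * \<theta>) / (\<i> * of_int k)) has_vector_derivative cis (of_int k * \<theta>)) (at \<theta> within {0..2 * pi})" for \<theta>
  proof -
    from has_vector_derivative_divide[OF has_vector_derivative_cis[of "of_int k"], of "\<i> * of_int k"] False show ?thesis by simp
  qed
  from fundamental_theorem_of_calculus[OF _ this]
  have "((\<lambda>\<theta>. cis (of_int k * \<theta>)) has_integral (cis (of_int k * (2 * pi)) / (\<i> * of_int k) - cis (of_int k * 0) / (\<i> * of_int k))) {0..2 * pi}"
    by simp
  moreover have "cis (of_int k * (2 * pi)) = 1"
    using cis_multiple_2pi[of "of_int k"] by (simp add: mult.commute mult.left_commute)
  ultimately show ?thesis using False by simp
qed

text \<open>At \<theta> = 0 the expansion says that the c n are summable, and unconditional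
  summability of complex numbers is absolute; the M-test then permits integration term by
  term.\<close>

lemma circle_coeff_has_sum:
  fixes c :: "int \<Rightarrow> complex"
  assumes "\<And>\<theta>. ((\<lambda>n. c n * cis (of_int n * \<theta>)) has_sum f (rcis r \<theta>)) UNIV"
  shows "circle_coeff f r m = c m"
proof -
  have "(\<lambda>n. c n) summable_on UNIV"
    using assms[of 0] by (auto simp: summable_on_def)
  hence sm: "(\<lambda>n. norm (c n)) summable_on UNIV"
    using summable_on_iff_abs_summable_on_complex by blast
  have ul: "uniform_limit {0..2 * pi} (\<lambda>F \<theta>. \<Sum>n\<in>F. c n * cis (of_int n * \<theta>) * cis (- of_int m * \<theta>))
     (\<lambda>\<theta>. \<Sum>\<^sub>\<infinity>n\<in>UNIV. c n * cis (of_int n * \<theta>) * cis (- of_int m * \<theta>)) (finite_subsets_at_top UNIV)"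
    by (rule Weierstrass_m_test_general[where M = "\<lambda>n. norm (c n)"]) (use sm in \<open>auto simp: norm_mult\<close>)
  have lim: "(\<Sum>\<^sub>\<infinity>n\<in>UNIV. c n * cis (of_int n * \<theta>) * cis (- of_int m * \<theta>)) = f (rcis r \<theta>) * cis (- of_int m * \<theta>)" for \<theta>
    by (rule infsumI) (intro has_sum_cmult_left assms)
  have cont: "continuous_on {0..2 * pi} (\<lambda>\<theta>. \<Sum>n\<in>F. c n * cis (of_int n * \<theta>) * cis (- of_int m * \<theta>))" for F
    by (intro continuous_intros)
  obtain I J where I: "\<And>F. ((\<lambda>\<theta>. \<Sum>n\<in>F. c n * cis (of_int n * \<theta>) * cis (- of_int m * \<theta>)) has_integral I F) {0..2 * pi}"
    and J: "((\<lambda>\<theta>. f (rcis r \<theta>) * cis (- of_int m * \<theta>)) has_integral J) {0..2 * pi}"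
    and IJ: "(I \<longlongrightarrow> J) (finite_subsets_at_top UNIV)"
    using uniform_limit_integral[OF ul[unfolded lim] cont finite_subsets_at_top_neq_bot] by blast
  have IF: "I F = of_real (2 * pi) * c m" if F: "finite F" "m \<in> F" for F
  proof -
    have "((\<lambda>\<theta>. \<Sum>n\<in>F. c n * cis (of_int (n - m) * \<theta>)) has_integral
        (\<Sum>n\<in>F. c n * (if n - m = 0 then of_real (2 * pi) else 0))) {0..2 * pi}"
      by (intro has_integral_sum has_integral_mult_right integral_cis_int F)
    moreover have "c n * cis (of_int n * \<theta>) * cis (- of_int m * \<theta>) = c n * cis (of_int (n - m) * \<theta>)" for n \<theta>
      by (simp add: mult.assoc cis_mult algebra_simps)
    ultimately have "((\<lambda>\<theta>. \<Sum>n\<in>F. c n * cis (of_int n * \<theta>) * cis (- of_int m * \<theta>)) has_integral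
        (\<Sum>n\<in>F. c n * (if n - m = 0 then of_real (2 * pi) else 0))) {0..2 * pi}"
      by (simp only:)
    from has_integral_unique[OF I this]
    have "I F = (\<Sum>n\<in>F. c n * (if n - m = 0 then of_real (2 * pi) else 0))" .
    also have "\<dots> = (\<Sum>n\<in>F. if n = m then of_real (2 * pi) * c m else 0)"
      by (intro sum.cong) auto
    finally show ?thesis using F by simp
  qed
  have "\<forall>\<^sub>F F in finite_subsets_at_top UNIV. I F = of_real (2 * pi) * c m"
    unfolding eventually_finite_subsets_at_top by (intro exI[of _ "{m}"] conjI allI impI IF) auto
  hence "(I \<longlongrightarrow> of_real (2 * pi) * c m) (finite_subsets_at_top UNIV)"
    by (rule tendsto_eventually)
  with IJ have "J = of_real (2 * pi) * c m"
    using tendsto_unique finite_subsets_at_top_neq_bot by blast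
  thus ?thesis
    using integral_unique[OF J] by (simp add: circle_coeff_def)
qed

text \<open>Increments to the right suffice: if |f'| exceeded B, the projection of the increment on
  the direction of f' would exceed B (s - r) just after r.\<close>

lemma vector_derivative_norm_le:
  fixes f :: "real \<Rightarrow> complex"
  assumes f: "(f has_vector_derivative f') (at r)" and le: "\<And>s. s > r \<Longrightarrow> cmod (f s - f r) \<le> B * (s - r)"
  shows "cmod f' \<le> B"
proof (rule ccontr)
  assume c: "\<not> cmod f' \<le> B"
  have "((\<lambda>s. Re (f s)) has_vector_derivative Re f') (at r)"
    by (rule bounded_linear.has_vector_derivative[OF bounded_linear_Re f])
  hence Re: "((\<lambda>s. Re (f s)) has_real_derivative Re f') (at r)"
    by (simp add: has_real_derivative_iff_has_vector_derivative)
  have "((\<lambda>s. Im (f s)) has_vector_derivative Im f') (at r)"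
    by (rule bounded_linear.has_vector_derivative[OF bounded_linear_Im f])
  hence Im: "((\<lambda>s. Im (f s)) has_real_derivative Im f') (at r)"
    by (simp add: has_real_derivative_iff_has_vector_derivative)
  let ?\<phi> = "\<lambda>s. Re f' * Re (f s) + Im f' * Im (f s) - B * cmod f' * s"
  have d\<phi>: "(?\<phi> has_real_derivative Re f' * Re f' + Im f' * Im f' - B * cmod f') (at r)"
    using DERIV_diff[OF DERIV_add[OF DERIV_cmult[OF Re, of "Re f'"] DERIV_cmult[OF Im, of "Im f'"]]
        DERIV_cmult[OF DERIV_ident, of "B * cmod f'"]] by simp
  have "Re f' * Re f' + Im f' * Im f' - B * cmod f' = cmod f' * (cmod f' - B)"
    using cmod_power2[of f'] by (simp add: power2_eq_square algebra_simps)
  moreover have "B \<ge> 0" using order_trans[OF norm_ge_zero le[of "r + 1"]] by simp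
  hence "cmod f' * (cmod f' - B) > 0" using c by (intro mult_pos_pos) auto
  ultimately have "\<exists>d>0. \<forall>h>0. h < d \<longrightarrow> ?\<phi> r < ?\<phi> (r + h)"
    using DERIV_pos_inc_right[OF d\<phi>] by simp
  then obtain d where d: "d > 0" "\<And>h. 0 < h \<Longrightarrow> h < d \<Longrightarrow> ?\<phi> r < ?\<phi> (r + h)"
    by blast
  define h where "h = d / 2"
  have h: "0 < h" "h < d" using d(1) by (auto simp: h_def)
  have "B * cmod f' * h < Re f' * (Re (f (r + h)) - Re (f r)) + Im f' * (Im (f (r + h)) - Im (f r))"
    using d(2)[OF h] by (simp add: algebra_simps)
  also have "\<dots> = Re (cnj f' * (f (r + h) - f r))" by simp
  also have "\<dots> \<le> cmod f' * cmod (f (r + h) - f r)"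
    using complex_Re_le_cmod[of "cnj f' * (f (r + h) - f r)"] by (simp add: norm_mult)
  also have "\<dots> \<le> cmod f' * (B * h)"
    using le[of "r + h"] h by (intro mult_left_mono) auto
  finally show False by (simp add: mult_ac)
qed

text \<open>Differentiation under the integral sign is avoided. Multiplication by exp (-\<i>
  \<kappa> s) turns the radiation expression into a derivative, the mean value inequality bounds its
  increments for every \<theta>, these are integrated over \<theta>, and the bound passes back to
  the derivative of the coefficient.\<close>

lemma coeff_radiation:
  fixes n :: int
  assumes U: "continuous_on UNIV U" and out: "outgoing \<epsilon> \<kappa> U"
    and v: "\<And>r. r > \<epsilon> \<Longrightarrow> ((\<lambda>r. circle_coeff U r n) has_vector_derivative v1 r) (at r)"
  shows "((\<lambda>r. of_real (sqrt r) * (v1 r - \<i> * of_real \<kappa> * circle_coeff U r n)) \<longlongrightarrow> 0) at_top"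
proof (rule tendstoI)
  define v where "v r = circle_coeff U r n" for r
  define D where "D r \<theta> = vector_derivative (\<lambda>s. U (rcis s \<theta>)) (at r)" for r \<theta>
  fix e :: real assume e: "e > 0"
  have D: "((\<lambda>s. U (rcis s \<theta>)) has_vector_derivative D r \<theta>) (at r)" if "r > \<epsilon>" for r \<theta>
    using out that unfolding outgoing_def D_def by (simp add: vector_derivative_works)
  have "\<forall>\<^sub>F r in at_top. \<forall>\<theta>. cmod (of_real (sqrt r) * (D r \<theta> - \<i> * of_real \<kappa> * U (rcis r \<theta>))) < e / 2"
    using out e unfolding outgoing_def uniform_limit_iff D_def by (auto dest!: spec[of _ "e / 2"])
  then obtain R where R: "\<And>r \<theta>. r \<ge> R \<Longrightarrow> cmod (of_real (sqrt r) * (D r \<theta> - \<i> * of_real \<kappa> * U (rcis r \<theta>))) < e / 2"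
    by (auto simp: eventually_at_top_linorder)
  have "cmod (of_real (sqrt r) * (v1 r - \<i> * of_real \<kappa> * v r)) < e" if r: "r > R" "r > \<epsilon>" "r > 0" for r
  proof -
    \<comment> \<open>Because 1 / sqrt t decreases, this one constant is valid on the whole ray
      beyond r.\<close>
    define B where "B = (e / 2) / sqrt r"
    have B0: "B \<ge> 0" using e r by (simp add: B_def)
    have E: "((\<lambda>s. cis (- \<kappa> * s)) has_vector_derivative (- (\<i> * of_real \<kappa>) * cis (- \<kappa> * s))) (at s)" for s
      using has_vector_derivative_cis[of "- \<kappa>" s UNIV] by simp
    have step: "cmod (cis (- \<kappa> * s) * U (rcis s \<theta>) - cis (- \<kappa> * r) * U (rcis r \<theta>)) \<le> B * (s - r)" if s: "s > r" for s \<theta>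
    proof -
      have "norm (cis (- \<kappa> * s) * U (rcis s \<theta>) - cis (- \<kappa> * r) * U (rcis r \<theta>)) \<le> B * norm (s - r)"
      proof (rule differentiable_bound[where S = "{r..s}" and f' = "\<lambda>t h. h *\<^sub>R (cis (- \<kappa> * t) * D t \<theta> + - (\<i> * of_real \<kappa>) * cis (- \<kappa> * t) * U (rcis t \<theta>))"])
        fix t assume t: "t \<in> {r..s}"
        have "((\<lambda>s. cis (- \<kappa> * s) * U (rcis s \<theta>)) has_vector_derivative
            cis (- \<kappa> * t) * D t \<theta> + - (\<i> * of_real \<kappa>) * cis (- \<kappa> * t) * U (rcis t \<theta>)) (at t)"
          by (intro has_vector_derivative_mult E D) (use t r in auto)
        thus "((\<lambda>s. cis (- \<kappa> * s) * U (rcis s \<theta>)) has_derivative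
            (\<lambda>h. h *\<^sub>R (cis (- \<kappa> * t) * D t \<theta> + - (\<i> * of_real \<kappa>) * cis (- \<kappa> * t) * U (rcis t \<theta>)))) (at t within {r..s})"
          unfolding has_vector_derivative_def by (rule has_derivative_at_withinI)
        have "cmod (cis (- \<kappa> * t) * D t \<theta> + - (\<i> * of_real \<kappa>) * cis (- \<kappa> * t) * U (rcis t \<theta>))
          = cmod (cis (- \<kappa> * t) * (D t \<theta> - \<i> * of_real \<kappa> * U (rcis t \<theta>)))"
          by (simp add: algebra_simps)
        also have "\<dots> = cmod (D t \<theta> - \<i> * of_real \<kappa> * U (rcis t \<theta>))" by (simp add: norm_mult)
        also have "\<dots> \<le> (e / 2) / sqrt t"
        proof -
          have "cmod (of_real (sqrt t) * (D t \<theta> - \<i> * of_real \<kappa> * U (rcis t \<theta>))) = sqrt t * cmod (D t \<theta> - \<i> * of_real \<kappa> * U (rcis t \<theta>))"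
            using t r by (simp only: norm_mult norm_of_real) simp
          moreover have "sqrt t > 0" using t r by simp
          ultimately show ?thesis using R[of t \<theta>] t r by (simp add: pos_le_divide_eq mult.commute)
        qed
        also have "\<dots> \<le> B"
          unfolding B_def using t r e by (intro divide_left_mono mult_pos_pos) auto
        finally show "onorm (\<lambda>h. h *\<^sub>R (cis (- \<kappa> * t) * D t \<theta> + - (\<i> * of_real \<kappa>) * cis (- \<kappa> * t) * U (rcis t \<theta>))) \<le> B"
          by (intro onorm_bound) (use B0 in \<open>auto simp only: norm_scaleR real_norm_def mult.commute[of B] intro!: mult_left_mono\<close>)
      qed (use s in auto)
      thus ?thesis using s by simp
    qed
    have cU: "continuous_on {0..2 * pi} (\<lambda>\<theta>. U (rcis s \<theta>) * cis (- of_int n * \<theta>))" for s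
      unfolding rcis_def by (intro continuous_intros continuous_on_compose2[OF U]) auto
    have le: "cmod (cis (- \<kappa> * s) * v s - cis (- \<kappa> * r) * v r) \<le> B * (s - r)" if s: "s > r" for s
    proof -
      let ?h = "\<lambda>\<theta>. cis (- \<kappa> * s) * (U (rcis s \<theta>) * cis (- of_int n * \<theta>)) - cis (- \<kappa> * r) * (U (rcis r \<theta>) * cis (- of_int n * \<theta>))"
      have "cis (- \<kappa> * s) * v s - cis (- \<kappa> * r) * v r = of_real (1 / (2 * pi)) * integral {0..2 * pi} ?h"
      proof -
        have "(\<lambda>\<theta>. cis (- \<kappa> * t) * (U (rcis t \<theta>) * cis (- of_int n * \<theta>))) integrable_on {0..2 * pi}" for t
          by (intro integrable_continuous_real continuous_on_mult continuous_on_const cU)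
        hence "integral {0..2 * pi} ?h = cis (- \<kappa> * s) * integral {0..2 * pi} (\<lambda>\<theta>. U (rcis s \<theta>) * cis (- of_int n * \<theta>))
            - cis (- \<kappa> * r) * integral {0..2 * pi} (\<lambda>\<theta>. U (rcis r \<theta>) * cis (- of_int n * \<theta>))"
          by (simp only: integral_diff integral_mult_right)
        moreover have "e1 * (k * i1) - e2 * (k * i2) = k * (e1 * i1 - e2 * i2)" for e1 e2 i1 i2 k :: complex
          by (simp add: algebra_simps)
        ultimately show ?thesis
          unfolding v_def circle_coeff_def by presburger
      qed
      moreover have bound: "cmod (integral {0..2 * pi} ?h) \<le> (B * (s - r)) * (2 * pi - 0)"
      proof (rule integral_bound)
        show "continuous_on {0..2 * pi} ?h" by (intro continuous_intros cU)
        fix \<theta>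
        have "?h \<theta> = (cis (- \<kappa> * s) * U (rcis s \<theta>) - cis (- \<kappa> * r) * U (rcis r \<theta>)) * cis (- of_int n * \<theta>)"
          by (simp add: algebra_simps)
        thus "cmod (?h \<theta>) \<le> B * (s - r)" using step[OF s, of \<theta>] by (simp add: norm_mult)
      qed simp
      ultimately have "cmod (cis (- \<kappa> * s) * v s - cis (- \<kappa> * r) * v r) = 1 / (2 * pi) * cmod (integral {0..2 * pi} ?h)"
        by (simp only: norm_mult norm_of_real) simp
      also have "\<dots> \<le> 1 / (2 * pi) * (B * (s - r) * (2 * pi - 0))"
        by (intro mult_left_mono bound) simp
      finally show ?thesis by simp
    qed
    have "((\<lambda>s. cis (- \<kappa> * s) * v s) has_vector_derivative
        cis (- \<kappa> * r) * v1 r + - (\<i> * of_real \<kappa>) * cis (- \<kappa> * r) * v r) (at r)"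
      using v[OF r(2)] by (intro has_vector_derivative_mult E) (simp add: v_def[abs_def])
    from vector_derivative_norm_le[OF this le]
    have "cmod (cis (- \<kappa> * r) * v1 r + - (\<i> * of_real \<kappa>) * cis (- \<kappa> * r) * v r) \<le> B" .
    also have "cis (- \<kappa> * r) * v1 r + - (\<i> * of_real \<kappa>) * cis (- \<kappa> * r) * v r = cis (- \<kappa> * r) * (v1 r - \<i> * of_real \<kappa> * v r)"
      by (simp add: algebra_simps)
    finally have "cmod (v1 r - \<i> * of_real \<kappa> * v r) \<le> B" by (simp only: norm_mult norm_cis mult_1_left)
    hence "sqrt r * cmod (v1 r - \<i> * of_real \<kappa> * v r) \<le> sqrt r * B"
      using r by (intro mult_left_mono) auto
    also have "sqrt r * B = e / 2" using r by (simp add: B_def)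
    finally show ?thesis using e r by (simp only: norm_mult norm_of_real) simp
  qed
  hence "\<forall>r > max R (max \<epsilon> 0). cmod (of_real (sqrt r) * (v1 r - \<i> * of_real \<kappa> * v r)) < e" by auto
  thus "\<forall>\<^sub>F r in at_top. dist (of_real (sqrt r) * (v1 r - \<i> * of_real \<kappa> * circle_coeff U r n)) 0 < e"
    unfolding eventually_at_top_dense v_def dist_norm by (intro exI[of _ "max R (max \<epsilon> 0)"]) simp
qed

section \<open>Outgoing solutions of the radial equation\<close>

definition qpot :: "real \<Rightarrow> real \<Rightarrow> real" where
  "qpot \<mu> s = 1 - \<mu> / s\<^sup>2"

lemma qpot_deriv [derivative_intros]:
  "s \<noteq> 0 \<Longrightarrow> (qpot \<mu> has_real_derivative 2 * \<mu> / s ^ 3) (at s)"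
  unfolding qpot_def[abs_def]
  by (auto intro!: derivative_eq_intros simp: field_simps power2_eq_square power3_eq_cube)

lemma qpot_tendsto: "(qpot \<mu> \<longlongrightarrow> 1) at_top"
proof -
  have "((\<lambda>s::real. 1 - \<mu> / s\<^sup>2) \<longlongrightarrow> 1 - 0) at_top"
    by (intro tendsto_intros tendsto_divide_0[OF tendsto_const] filterlim_at_top_imp_at_infinity
        filterlim_pow_at_top filterlim_ident) auto
  thus ?thesis by (simp add: qpot_def[abs_def])
qed

lemma deriv_nonneg_mono:
  fixes h :: "real \<Rightarrow> real"
  assumes "continuous_on {a..b} h" "a \<le> b"
    "\<And>t. a < t \<Longrightarrow> t < b \<Longrightarrow> (h has_real_derivative h' t) (at t)" "\<And>t. a < t \<Longrightarrow> t < b \<Longrightarrow> h' t \<ge> 0"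
  shows "h a \<le> h b"
  using DERIV_nonneg_imp_increasing_open[OF assms(2), of h] assms by blast

lemma ray_mono:
  fixes h :: "real \<Rightarrow> real"
  assumes "continuous_on {x..} h" "\<And>t. t > x \<Longrightarrow> (h has_real_derivative h' t) (at t)" "\<And>t. t > x \<Longrightarrow> h' t \<ge> 0"
    and "x \<le> a" "a \<le> b"
  shows "h a \<le> h b"
  using assms by (intro deriv_nonneg_mono[of a b h h'] continuous_on_subset[OF assms(1)]) auto

text \<open>The common mechanism of the energy estimates: a monotone quantity is compared with its
  limit at infinity, where the radiation condition makes it explicit.\<close>

lemma ray_le_limit:
  fixes h :: "real \<Rightarrow> real"
  assumes "continuous_on {x..} h" "\<And>t. t > x \<Longrightarrow> (h has_real_derivative h' t) (at t)" "\<And>t. t > x \<Longrightarrow> h' t \<ge> 0"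
    and "(h \<longlongrightarrow> L) at_top" "x \<le> a"
  shows "h a \<le> L"
proof (rule tendsto_lowerbound[OF assms(4)])
  show "\<forall>\<^sub>F t in at_top. h a \<le> h t"
    using ray_mono[OF assms(1-3)] assms(5) by (auto simp: eventually_at_top_linorder)
qed simp

lemma ray_ge_limit:
  fixes h :: "real \<Rightarrow> real"
  assumes "continuous_on {x..} h" "\<And>t. t > x \<Longrightarrow> (h has_real_derivative h' t) (at t)" "\<And>t. t > x \<Longrightarrow> h' t \<le> 0"
    and "(h \<longlongrightarrow> L) at_top" "x \<le> a"
  shows "L \<le> h a"
proof -
  have "- h a \<le> - L"
    by (rule ray_le_limit[where h = "\<lambda>t. - h t" and h' = "\<lambda>t. - h' t" and x = x])
      (use assms in \<open>auto intro!: continuous_intros derivative_intros tendsto_intros\<close>)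
  thus ?thesis by simp
qed

lemma ray_const:
  fixes h :: "real \<Rightarrow> real"
  assumes "continuous_on {x..} h" "\<And>t. t > x \<Longrightarrow> (h has_real_derivative 0) (at t)" "x \<le> a"
  shows "h a = h x"
proof (rule antisym)
  show "h x \<le> h a" by (rule ray_mono[OF assms(1,2)]) (use assms(3) in auto)
  have "- h x \<le> - h a"
    by (rule ray_mono[where h = "\<lambda>t. - h t" and h' = "\<lambda>_. 0" and x = x])
      (use assms in \<open>auto intro!: continuous_intros derivative_eq_intros\<close>)
  thus "h a \<le> h x" by simp
qed

text \<open>Derivatives are required only in the interior, with continuity up to x: the left end
  will be the interface, where the second derivative may jump.\<close>

definition osc :: "real \<Rightarrow> real \<Rightarrow> (real \<Rightarrow> real) \<Rightarrow> (real \<Rightarrow> real) \<Rightarrow> bool" where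
  "osc \<mu> x f f1 \<longleftrightarrow> continuous_on {x..} f \<and> continuous_on {x..} f1 \<and>
    (\<forall>t>x. (f has_real_derivative f1 t) (at t) \<and> (f1 has_real_derivative - qpot \<mu> t * f t) (at t))"

lemma osc_mono: "osc \<mu> x f f1 \<Longrightarrow> x \<le> y \<Longrightarrow> osc \<mu> y f f1"
  unfolding osc_def by (auto elim: continuous_on_subset)

lemma osc_wronskian:
  assumes "osc \<mu> x f f1" "osc \<mu> x g g1" "x \<le> a"
  shows "f a * g1 a - g a * f1 a = f x * g1 x - g x * f1 x"
proof (rule ray_const[where h = "\<lambda>a. f a * g1 a - g a * f1 a" and x = x])
  show "continuous_on {x..} (\<lambda>a. f a * g1 a - g a * f1 a)"
    using assms unfolding osc_def by (auto intro!: continuous_intros)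
  fix t assume "t > x"
  thus "((\<lambda>a. f a * g1 a - g a * f1 a) has_real_derivative 0) (at t)"
    using assms unfolding osc_def by (auto intro!: derivative_eq_intros)
qed (use assms in auto)

text \<open>With u = f + \<i> g, \<open>lim1\<close> and \<open>lim2\<close> say that the real and
  imaginary parts of u' - \<i> u tend to 0.\<close>

locale outgoing_pair =
  fixes \<mu> x0 :: real and f f1 g g1 :: "real \<Rightarrow> real"
  assumes x0: "x0 > 0" and oscf: "osc \<mu> x0 f f1" and oscg: "osc \<mu> x0 g g1"
    and lim1: "((\<lambda>s. f1 s + g s) \<longlongrightarrow> 0) at_top" and lim2: "((\<lambda>s. g1 s - f s) \<longlongrightarrow> 0) at_top"
begin

text \<open>The flux Im (cnj u u'), which does not depend on s; for an outgoing solution it is also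
  the limit of |u|^2.\<close>

definition c where "c = f x0 * g1 x0 - g x0 * f1 x0"

definition p where "p s = (f s)\<^sup>2 + (g s)\<^sup>2"

definition p1 where "p1 s = 2 * (f s * f1 s + g s * g1 s)"

lemma cont [continuous_intros]: 
  "continuous_on S f" "continuous_on S f1" "continuous_on S g" "continuous_on S g1" if "S \<subseteq> {x0..}"
  using oscf oscg that unfolding osc_def by (auto elim: continuous_on_subset)

lemma deriv [derivative_intros]: 
  assumes "t > x0"
  shows "(f has_real_derivative f1 t) (at t)" "(f1 has_real_derivative - qpot \<mu> t * f t) (at t)"
    "(g has_real_derivative g1 t) (at t)" "(g1 has_real_derivative - qpot \<mu> t * g t) (at t)"
  using oscf oscg assms unfolding osc_def by auto

lemma cont_qpot [continuous_intros]: "S \<subseteq> {x0..} \<Longrightarrow> continuous_on S (qpot \<mu>)"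
  using x0 unfolding qpot_def[abs_def] by (auto intro!: continuous_intros)

lemma wr: "s \<ge> x0 \<Longrightarrow> f s * g1 s - g s * f1 s = c"
  unfolding c_def by (rule osc_wronskian[OF oscf oscg])

lemma p_nonneg: "p s \<ge> 0" by (simp add: p_def)

lemma p_deriv: "t > x0 \<Longrightarrow> (p has_real_derivative p1 t) (at t)"
  unfolding p_def[abs_def] p1_def by (auto intro!: derivative_eq_intros)

lemma p_cont: "S \<subseteq> {x0..} \<Longrightarrow> continuous_on S p"
  unfolding p_def[abs_def] by (intro continuous_intros)

lemma p1_cont: "S \<subseteq> {x0..} \<Longrightarrow> continuous_on S p1"
  unfolding p1_def[abs_def] by (intro continuous_intros)

text \<open>Expanding |u' - \<i> u|^2 gives |u|^2 + |u'|^2 - 2 c.\<close>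

lemma energy_lim: "((\<lambda>s. (f s)\<^sup>2 + (g s)\<^sup>2 + (f1 s)\<^sup>2 + (g1 s)\<^sup>2) \<longlongrightarrow> 2 * c) at_top"
proof -
  have "((\<lambda>s. (f1 s + g s)\<^sup>2 + (g1 s - f s)\<^sup>2 + 2 * c) \<longlongrightarrow> 0\<^sup>2 + 0\<^sup>2 + 2 * c) at_top"
    by (intro tendsto_intros lim1 lim2)
  moreover have "\<forall>\<^sub>F s in at_top. (f1 s + g s)\<^sup>2 + (g1 s - f s)\<^sup>2 + 2 * c = (f s)\<^sup>2 + (g s)\<^sup>2 + (f1 s)\<^sup>2 + (g1 s)\<^sup>2"
    using eventually_ge_at_top[of x0] by eventually_elim (simp add: wr[symmetric] power2_eq_square algebra_simps)
  ultimately show ?thesis using Lim_transform_eventually by fastforce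
qed

lemma bounded: "\<exists>B. \<forall>\<^sub>F s in at_top. \<bar>f s\<bar> \<le> B \<and> \<bar>g s\<bar> \<le> B"
proof -
  have "\<forall>\<^sub>F s in at_top. (f s)\<^sup>2 + (g s)\<^sup>2 + (f1 s)\<^sup>2 + (g1 s)\<^sup>2 < 2 * \<bar>c\<bar> + 1"
    by (rule order_tendstoD[OF energy_lim]) linarith
  hence "\<forall>\<^sub>F s in at_top. \<bar>f s\<bar> \<le> sqrt (2 * \<bar>c\<bar> + 1) \<and> \<bar>g s\<bar> \<le> sqrt (2 * \<bar>c\<bar> + 1)"
  proof eventually_elim
    case (elim s)
    have "(f s)\<^sup>2 \<le> 2 * \<bar>c\<bar> + 1" "(g s)\<^sup>2 \<le> 2 * \<bar>c\<bar> + 1"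
      using elim zero_le_power2[of "f s"] zero_le_power2[of "g s"] zero_le_power2[of "f1 s"] zero_le_power2[of "g1 s"] by linarith+
    thus ?case by (metis real_sqrt_abs real_sqrt_le_iff)
  qed
  thus ?thesis by blast
qed

lemma bz: "((\<lambda>s. e s * f s) \<longlongrightarrow> 0) at_top" "((\<lambda>s. e s * g s) \<longlongrightarrow> 0) at_top"
  if "(e \<longlongrightarrow> 0) at_top" for e :: "real \<Rightarrow> real"
proof -
  obtain B where B: "\<forall>\<^sub>F s in at_top. \<bar>f s\<bar> \<le> B \<and> \<bar>g s\<bar> \<le> B" using bounded by blast
  show "((\<lambda>s. e s * f s) \<longlongrightarrow> 0) at_top"
    by (rule tendsto_0_le[OF that, of _ B]) (use B in eventually_elim, auto simp: abs_mult intro: mult_left_mono)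
  show "((\<lambda>s. e s * g s) \<longlongrightarrow> 0) at_top"
    by (rule tendsto_0_le[OF that, of _ B]) (use B in eventually_elim, auto simp: abs_mult intro: mult_left_mono)
qed

lemma q0: "((\<lambda>s. qpot \<mu> s - 1) \<longlongrightarrow> 0) at_top"
  using tendsto_diff[OF qpot_tendsto tendsto_const[of 1]] by simp

lemma p_lim: "(p \<longlongrightarrow> c) at_top"
proof -
  have "((\<lambda>s. c - (g1 s - f s) * f s + (f1 s + g s) * g s) \<longlongrightarrow> c - 0 + 0) at_top"
    by (intro tendsto_intros bz lim1 lim2)
  moreover have "\<forall>\<^sub>F s in at_top. c - (g1 s - f s) * f s + (f1 s + g s) * g s = p s"
    using eventually_ge_at_top[of x0]
    by eventually_elim (simp add: wr[symmetric] p_def power2_eq_square algebra_simps)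
  ultimately show ?thesis using Lim_transform_eventually by fastforce
qed

lemma qp_lim: "((\<lambda>s. (qpot \<mu> s - 1) * (f s * f s)) \<longlongrightarrow> 0) at_top" "((\<lambda>s. (qpot \<mu> s - 1) * (f s * g s)) \<longlongrightarrow> 0) at_top"
  "((\<lambda>s. (qpot \<mu> s - 1) * (g s * g s)) \<longlongrightarrow> 0) at_top"
  using bz(1)[OF bz(1)[OF q0]] bz(2)[OF bz(1)[OF q0]] bz(2)[OF bz(2)[OF q0]] by (simp_all add: mult.assoc)

text \<open>The energy changes at relative rate at most |\<mu>| / s^2, which the weight exp
  (-|\<mu>| / s) absorbs. The weighted energy therefore increases to 2 c; in particular c \<ge> 0,
  and c = 0 forces u = 0.\<close>

lemma weighted_energy_le:
  assumes "s \<ge> x0"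
  shows "((f s)\<^sup>2 + (g s)\<^sup>2 + (f1 s)\<^sup>2 + (g1 s)\<^sup>2) * exp (- \<bar>\<mu>\<bar> / s) \<le> 2 * c"
proof -
  let ?H = "\<lambda>s. (f s)\<^sup>2 + (g s)\<^sup>2 + (f1 s)\<^sup>2 + (g1 s)\<^sup>2"
  show ?thesis
  proof (rule ray_le_limit[where x = x0 and h = "\<lambda>s. ?H s * exp (- \<bar>\<mu>\<bar> / s)"])
  show "continuous_on {x0..} (\<lambda>s. ?H s * exp (- \<bar>\<mu>\<bar> / s))"
    using x0 by (intro continuous_intros) auto
  show "((\<lambda>s. ?H s * exp (- \<bar>\<mu>\<bar> / s)) has_real_derivative
      (2 * \<mu> / t\<^sup>2 * (f t * f1 t + g t * g1 t) + \<bar>\<mu>\<bar> / t\<^sup>2 * ?H t) * exp (- \<bar>\<mu>\<bar> / t)) (at t)" if "t > x0" for t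
    using that x0 by (auto intro!: derivative_eq_intros simp: qpot_def field_simps power2_eq_square)
  show "(2 * \<mu> / t\<^sup>2 * (f t * f1 t + g t * g1 t) + \<bar>\<mu>\<bar> / t\<^sup>2 * ?H t) * exp (- \<bar>\<mu>\<bar> / t) \<ge> 0" if "t > x0" for t
  proof -
    have "2 * f t * f1 t \<le> (f t)\<^sup>2 + (f1 t)\<^sup>2" "2 * g t * g1 t \<le> (g t)\<^sup>2 + (g1 t)\<^sup>2"
      "- (2 * f t * f1 t) \<le> (f t)\<^sup>2 + (f1 t)\<^sup>2" "- (2 * g t * g1 t) \<le> (g t)\<^sup>2 + (g1 t)\<^sup>2"
      using sum_squares_bound[of "f t" "f1 t"] sum_squares_bound[of "g t" "g1 t"]
        sum_squares_bound[of "- f t" "f1 t"] sum_squares_bound[of "- g t" "g1 t"] by simp_all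
    hence "\<bar>2 * (f t * f1 t + g t * g1 t)\<bar> \<le> ?H t"
      by (intro abs_leI) (simp_all add: algebra_simps)
    hence "\<bar>\<mu>\<bar> / t\<^sup>2 * \<bar>2 * (f t * f1 t + g t * g1 t)\<bar> \<le> \<bar>\<mu>\<bar> / t\<^sup>2 * ?H t"
      by (intro mult_left_mono) auto
    moreover have "\<bar>2 * \<mu> / t\<^sup>2 * (f t * f1 t + g t * g1 t)\<bar> = \<bar>\<mu>\<bar> / t\<^sup>2 * \<bar>2 * (f t * f1 t + g t * g1 t)\<bar>"
    proof -
      have "2 * \<mu> / t\<^sup>2 * (f t * f1 t + g t * g1 t) = \<mu> / t\<^sup>2 * (2 * (f t * f1 t + g t * g1 t))" by simp
      thus ?thesis by (simp only: abs_mult abs_divide abs_power2)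
    qed
    moreover have "0 \<le> X + C" if "B \<le> C" "\<bar>X\<bar> = B" for X B C :: real
      using that by (simp add: abs_if split: if_splits)
    ultimately have "2 * \<mu> / t\<^sup>2 * (f t * f1 t + g t * g1 t) + \<bar>\<mu>\<bar> / t\<^sup>2 * ?H t \<ge> 0"
      by blast
    thus ?thesis by (intro mult_nonneg_nonneg) auto
  qed
  have "((\<lambda>s. ?H s * exp (- \<bar>\<mu>\<bar> / s)) \<longlongrightarrow> 2 * c * exp 0) at_top"
    by (intro tendsto_intros energy_lim tendsto_divide_0[OF tendsto_const] filterlim_at_top_imp_at_infinity filterlim_ident)
  thus "((\<lambda>s. ?H s * exp (- \<bar>\<mu>\<bar> / s)) \<longlongrightarrow> 2 * c) at_top" by simp
  qed (rule assms)
qed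

lemma c_nonneg: "c \<ge> 0"
proof -
  have "0 \<le> ((f x0)\<^sup>2 + (g x0)\<^sup>2 + (f1 x0)\<^sup>2 + (g1 x0)\<^sup>2) * exp (- \<bar>\<mu>\<bar> / x0)" by simp
  also have "\<dots> \<le> 2 * c" by (rule weighted_energy_le) simp
  finally show ?thesis by simp
qed

lemma c_zero: "c = 0 \<Longrightarrow> s \<ge> x0 \<Longrightarrow> f s = 0 \<and> g s = 0"
  using weighted_energy_le[of s] by (simp add: mult_le_0_iff sum_power2_le_zero_iff)
    (smt (verit) zero_le_power2 power2_eq_iff_nonneg zero_eq_power2)

text \<open>For \<mu> \<ge> 0 the potential increases, so |u'|^2 + q |u|^2 increases to 2 c, and no
  exponential constant is lost.\<close>

lemma F_le:
  assumes "\<mu> \<ge> 0" "s \<ge> x0"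
  shows "(f1 s)\<^sup>2 + (g1 s)\<^sup>2 + qpot \<mu> s * p s \<le> 2 * c"
proof (rule ray_le_limit[where x = x0 and h = "\<lambda>s. (f1 s)\<^sup>2 + (g1 s)\<^sup>2 + qpot \<mu> s * p s" and h' = "\<lambda>t. 2 * \<mu> / t ^ 3 * p t"])
  show "continuous_on {x0..} (\<lambda>s. (f1 s)\<^sup>2 + (g1 s)\<^sup>2 + qpot \<mu> s * p s)"
    by (intro continuous_intros p_cont) auto
  show "((\<lambda>s. (f1 s)\<^sup>2 + (g1 s)\<^sup>2 + qpot \<mu> s * p s) has_real_derivative 2 * \<mu> / t ^ 3 * p t) (at t)" if "t > x0" for t
    using that x0 unfolding p_def
    by (auto intro!: derivative_eq_intros simp: algebra_simps)
  show "2 * \<mu> / t ^ 3 * p t \<ge> 0" if "t > x0" for t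
    using that x0 assms p_nonneg by (intro mult_nonneg_nonneg) auto
  have "((\<lambda>s. ((f s)\<^sup>2 + (g s)\<^sup>2 + (f1 s)\<^sup>2 + (g1 s)\<^sup>2) + (qpot \<mu> s - 1) * (f s * f s) + (qpot \<mu> s - 1) * (g s * g s)) \<longlongrightarrow> 2 * c + 0 + 0) at_top"
    by (intro tendsto_add energy_lim qp_lim)
  thus "((\<lambda>s. (f1 s)\<^sup>2 + (g1 s)\<^sup>2 + qpot \<mu> s * p s) \<longlongrightarrow> 2 * c) at_top"
    by (simp add: p_def algebra_simps power2_eq_square)
qed (rule assms)

text \<open>Here a g - b f = Im (cnj (a + \<i> b) u) is a real solution of the same equation, and
  the quantity is its energy. Since u' is close to \<i> u and |u|^2 to c, the limit is |a + \<i>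
  b|^2 c.\<close>

lemma phi_lim:
  "((\<lambda>t. (a * g1 t - b * f1 t)\<^sup>2 + qpot \<mu> t * (a * g t - b * f t)\<^sup>2) \<longlongrightarrow> (a\<^sup>2 + b\<^sup>2) * c) at_top"
proof -
  let ?e1 = "\<lambda>t. f1 t + g t" and ?e2 = "\<lambda>t. g1 t - f t" and ?q = "\<lambda>t. qpot \<mu> t - 1"
  have "((\<lambda>t. (a\<^sup>2 + b\<^sup>2) * p t + (a * ?e2 t - b * ?e1 t)\<^sup>2
      + 2 * (a * (a * (?e2 t * f t) - b * (?e1 t * f t)) + b * (a * (?e2 t * g t) - b * (?e1 t * g t)))
      + (a\<^sup>2 * (?q t * (g t * g t)) - 2 * a * b * (?q t * (f t * g t)) + b\<^sup>2 * (?q t * (f t * f t))))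
      \<longlongrightarrow> (a\<^sup>2 + b\<^sup>2) * c + (a * 0 - b * 0)\<^sup>2
      + 2 * (a * (a * 0 - b * 0) + b * (a * 0 - b * 0)) + (a\<^sup>2 * 0 - 2 * a * b * 0 + b\<^sup>2 * 0)) at_top"
    by (intro tendsto_intros p_lim lim1 lim2 bz qp_lim)
  moreover have "(a\<^sup>2 + b\<^sup>2) * p t + (a * ?e2 t - b * ?e1 t)\<^sup>2
      + 2 * (a * (a * (?e2 t * f t) - b * (?e1 t * f t)) + b * (a * (?e2 t * g t) - b * (?e1 t * g t)))
      + (a\<^sup>2 * (?q t * (g t * g t)) - 2 * a * b * (?q t * (f t * g t)) + b\<^sup>2 * (?q t * (f t * f t)))
    = (a * g1 t - b * f1 t)\<^sup>2 + qpot \<mu> t * (a * g t - b * f t)\<^sup>2" for t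
    unfolding p_def by (simp add: power2_eq_square algebra_simps)
  ultimately show ?thesis by simp
qed

lemma phi_deriv:
  assumes "t > x0"
  shows "((\<lambda>t. (a * g1 t - b * f1 t)\<^sup>2 + qpot \<mu> t * (a * g t - b * f t)\<^sup>2) has_real_derivative
    2 * \<mu> / t ^ 3 * (a * g t - b * f t)\<^sup>2) (at t)"
  using assms x0 by (auto intro!: derivative_eq_intros simp: algebra_simps)

lemma phi_cont: "continuous_on {x..} (\<lambda>t. (a * g1 t - b * f1 t)\<^sup>2 + qpot \<mu> t * (a * g t - b * f t)\<^sup>2)" if "x \<ge> x0"
  using that by (intro continuous_intros) auto

text \<open>Take a + \<i> b = u x. The real solution then vanishes at x with slope c, so its energy
  is c^2 there and rises to p x * c.\<close>

lemma p_ge_c: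
  assumes "\<mu> \<ge> 0" "x \<ge> x0"
  shows "c \<le> p x"
proof -
  have "(f x * g1 x - g x * f1 x)\<^sup>2 + qpot \<mu> x * (f x * g x - g x * f x)\<^sup>2 \<le> ((f x)\<^sup>2 + (g x)\<^sup>2) * c"
    by (rule ray_le_limit[OF phi_cont[OF assms(2)] phi_deriv _ phi_lim]) (use assms x0 in auto)
  hence "c * c \<le> p x * c" using wr[OF assms(2)] by (simp add: p_def power2_eq_square mult.commute)
  thus ?thesis using c_nonneg p_nonneg[of x] by (cases "c = 0") auto
qed

text \<open>For \<mu> \<le> 0 the potential decreases and the comparison reverses: c dominates p,
  which is how the radially symmetric mode is estimated away from the interface.\<close>

lemma p_le_c:
  assumes "\<mu> \<le> 0" "x \<ge> x0"
  shows "p x \<le> c"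
proof -
  have "((f x)\<^sup>2 + (g x)\<^sup>2) * c \<le> (f x * g1 x - g x * f1 x)\<^sup>2 + qpot \<mu> x * (f x * g x - g x * f x)\<^sup>2"
  proof (rule ray_ge_limit[OF phi_cont[OF assms(2)] phi_deriv _ phi_lim])
    show "2 * \<mu> / t ^ 3 * (f x * g t - g x * f t)\<^sup>2 \<le> 0" if "t > x" for t
      by (rule mult_nonpos_nonneg, rule divide_nonpos_pos) (use assms x0 that in auto)
  qed (use assms in auto)
  hence "p x * c \<le> c * c" using wr[OF assms(2)] by (simp add: p_def power2_eq_square mult.commute)
  thus ?thesis using c_nonneg c_zero[of x] assms(2) by (cases "c = 0") (auto simp: p_def)
qed

end

context outgoing_pair
begin

text \<open>The polarised energy of the real solutions Im (cnj (a + \<i> b) u) and Re (cnj (a + \<i>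
  b) u). At infinity they are a quarter period apart, so it tends to 0.\<close>

lemma K_lim:
  "((\<lambda>t. (a * g1 t - b * f1 t) * (a * f1 t + b * g1 t) + qpot \<mu> t * ((a * g t - b * f t) * (a * f t + b * g t))) \<longlongrightarrow> 0) at_top"
proof -
  let ?e1 = "\<lambda>t. f1 t + g t" and ?e2 = "\<lambda>t. g1 t - f t" and ?q = "\<lambda>t. qpot \<mu> t - 1"
  have "((\<lambda>t. a * b * (?q t * (g t * g t)) - a * b * (?q t * (f t * f t)) + (a\<^sup>2 - b\<^sup>2) * (?q t * (f t * g t))
      + (a * (a * (?e1 t * f t) + b * (?e2 t * f t)) + b * (a * (?e1 t * g t) + b * (?e2 t * g t)))
      - (a * (a * (?e2 t * g t) - b * (?e1 t * g t)) - b * (a * (?e2 t * f t) - b * (?e1 t * f t)))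
      + (a * ?e2 t - b * ?e1 t) * (a * ?e1 t + b * ?e2 t)) \<longlongrightarrow>
      a * b * 0 - a * b * 0 + (a\<^sup>2 - b\<^sup>2) * 0 + (a * (a * 0 + b * 0) + b * (a * 0 + b * 0))
      - (a * (a * 0 - b * 0) - b * (a * 0 - b * 0)) + (a * 0 - b * 0) * (a * 0 + b * 0)) at_top"
    by (intro tendsto_intros lim1 lim2 bz qp_lim)
  moreover have "a * b * (?q t * (g t * g t)) - a * b * (?q t * (f t * f t)) + (a\<^sup>2 - b\<^sup>2) * (?q t * (f t * g t))
      + (a * (a * (?e1 t * f t) + b * (?e2 t * f t)) + b * (a * (?e1 t * g t) + b * (?e2 t * g t)))
      - (a * (a * (?e2 t * g t) - b * (?e1 t * g t)) - b * (a * (?e2 t * f t) - b * (?e1 t * f t)))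
      + (a * ?e2 t - b * ?e1 t) * (a * ?e1 t + b * ?e2 t)
    = (a * g1 t - b * f1 t) * (a * f1 t + b * g1 t) + qpot \<mu> t * ((a * g t - b * f t) * (a * f t + b * g t))" for t
    by (simp add: power2_eq_square algebra_simps)
  ultimately show ?thesis by simp
qed

lemma K_deriv:
  assumes "t > x0"
  shows "((\<lambda>t. (a * g1 t - b * f1 t) * (a * f1 t + b * g1 t) + qpot \<mu> t * ((a * g t - b * f t) * (a * f t + b * g t)))
    has_real_derivative 2 * \<mu> / t ^ 3 * ((a * g t - b * f t) * (a * f t + b * g t))) (at t)"
  using assms x0 by (auto intro!: derivative_eq_intros simp: algebra_simps)

lemma K_cont: "x \<ge> x0 \<Longrightarrow> continuous_on {x..}
    (\<lambda>t. (a * g1 t - b * f1 t) * (a * f1 t + b * g1 t) + qpot \<mu> t * ((a * g t - b * f t) * (a * f t + b * g t)))"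
  by (intro continuous_intros) auto

end

locale outgoing_pos = outgoing_pair +
  assumes cpos: "c > 0" and mu: "\<mu> \<ge> 0"
begin

lemma p_pos: "x \<ge> x0 \<Longrightarrow> p x > 0"
  using p_ge_c[OF mu] cpos by force

text \<open>With \<open>\<phi> = Im (conj (u x) u)\<close> and \<open>\<xi> = Re (conj (u x) u)\<close> one has \<open>(\<phi>\<^sup>2 / p)' = 2 c \<phi> \<xi> / p\<^sup>2\<close>, so the derivative
  \<open>q' \<phi> \<xi>\<close> of the bilinear energy of \<open>\<phi>\<close> and \<open>\<xi>\<close> can be integrated by parts.\<close>

lemma p1_nonpos_step:
  assumes x: "x \<ge> x0" and le: "\<And>t. t > x \<Longrightarrow> 2 * t * p1 t \<le> 3 * p t"
  shows "p1 x \<le> 0"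
proof -
  define a where "a = f x"
  define b where "b = g x"
  define \<phi> where "\<phi> t = a * g t - b * f t" for t
  define \<xi> where "\<xi> t = a * f t + b * g t" for t
  define K where "K t = (a * g1 t - b * f1 t) * (a * f1 t + b * g1 t) + qpot \<mu> t * (\<phi> t * \<xi> t)" for t
  \<comment> \<open>By \<open>key\<close>, the derivative of p \<phi>^2 is 2 p' \<phi>^2 + 2 c
    \<phi> \<xi>. The subtracted term therefore cancels the product \<phi> \<xi> of unknown sign in
    K' and leaves \<phi>^2 times 3 p - 2 t p', whose sign is the hypothesis
    \<open>le\<close>.\<close>
  define h where "h t = K t - \<mu> / (c * t ^ 3) * (p t * (\<phi> t)\<^sup>2)" for t
  have d\<phi>: "(\<phi> has_real_derivative a * g1 t - b * f1 t) (at t)" if "t > x0" for t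
    unfolding \<phi>_def[abs_def] using that by (auto intro!: derivative_eq_intros)
  have key: "p t * (a * g1 t - b * f1 t) = p1 t / 2 * \<phi> t + c * \<xi> t" if "t > x0" for t
  proof -
    have c: "c = f t * g1 t - g t * f1 t" using wr[of t] that by simp
    have p1: "p1 t / 2 = f t * f1 t + g t * g1 t" by (simp add: p1_def)
    show ?thesis unfolding p1 c p_def \<phi>_def \<xi>_def by (simp add: power2_eq_square algebra_simps)
  qed
  have dh: "(h has_real_derivative \<mu> / (c * t ^ 4) * (\<phi> t)\<^sup>2 * (3 * p t - 2 * t * p1 t)) (at t)" if t: "t > x0" for t
  proof -
    have t0: "t > 0" using t x0 by simp
    have "(h has_real_derivative 2 * \<mu> / t ^ 3 * (\<phi> t * \<xi> t)
        - ((- 3 * \<mu> / (c * t ^ 4)) * (p t * (\<phi> t)\<^sup>2) + \<mu> / (c * t ^ 3) * (p1 t * (\<phi> t)\<^sup>2 + p t * (2 * \<phi> t * (a * g1 t - b * f1 t))))) (at t)"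
      unfolding h_def[abs_def] K_def \<xi>_def[abs_def]
    proof (intro DERIV_diff)
      show "((\<lambda>t. (a * g1 t - b * f1 t) * (a * f1 t + b * g1 t) + qpot \<mu> t * (\<phi> t * (a * f t + b * g t)))
        has_real_derivative 2 * \<mu> / t ^ 3 * (\<phi> t * (a * f t + b * g t))) (at t)"
        using K_deriv[OF t, of a b] by (simp add: \<phi>_def)
      show "((\<lambda>t. \<mu> / (c * t ^ 3) * (p t * (\<phi> t)\<^sup>2)) has_real_derivative
         ((- 3 * \<mu> / (c * t ^ 4)) * (p t * (\<phi> t)\<^sup>2) + \<mu> / (c * t ^ 3) * (p1 t * (\<phi> t)\<^sup>2 + p t * (2 * \<phi> t * (a * g1 t - b * f1 t))))) (at t)"
        using t0 cpos
        by (auto intro!: derivative_eq_intros p_deriv[OF t] d\<phi>[OF t] simp: field_simps power2_eq_square power3_eq_cube power4_eq_xxxx)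
    qed
    also have "2 * \<mu> / t ^ 3 * (\<phi> t * \<xi> t)
        - ((- 3 * \<mu> / (c * t ^ 4)) * (p t * (\<phi> t)\<^sup>2) + \<mu> / (c * t ^ 3) * (p1 t * (\<phi> t)\<^sup>2 + p t * (2 * \<phi> t * (a * g1 t - b * f1 t))))
      = \<mu> / (c * t ^ 4) * (\<phi> t)\<^sup>2 * (3 * p t - 2 * t * p1 t)"
    proof -
      have E: "p t * (2 * \<phi> t * (a * g1 t - b * f1 t)) = 2 * \<phi> t * (p1 t / 2 * \<phi> t + c * \<xi> t)"
      proof -
        have "p t * (2 * \<phi> t * (a * g1 t - b * f1 t)) = 2 * \<phi> t * (p t * (a * g1 t - b * f1 t))"
          by (simp only: mult_ac)
        thus ?thesis by (simp only: key[OF t])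
      qed
      show ?thesis unfolding E using t0 cpos
        by (simp add: field_simps power2_eq_square power3_eq_cube power4_eq_xxxx)
    qed
    finally show ?thesis .
  qed
  \<comment> \<open>At x the function \<phi> vanishes with slope c, and \<xi> has slope p' /
    2.\<close>
  have hx: "h x = c * (p1 x / 2)"
    using wr[OF x] unfolding h_def K_def \<phi>_def p1_def a_def b_def by (simp add: algebra_simps)
  have lim: "(h \<longlongrightarrow> 0) at_top"
  proof -
    have "((\<lambda>t. \<mu> / (c * t ^ 3)) \<longlongrightarrow> 0) at_top"
      using cpos by (intro tendsto_divide_0[OF tendsto_const] filterlim_at_top_imp_at_infinity
          filterlim_tendsto_pos_mult_at_top[OF tendsto_const] filterlim_pow_at_top filterlim_ident) auto
    from tendsto_mult[OF bz(2)[OF bz(2)[OF this]] p_lim] tendsto_mult[OF bz(1)[OF bz(2)[OF this]] p_lim]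
      tendsto_mult[OF bz(1)[OF bz(1)[OF this]] p_lim]
    have l: "((\<lambda>t. \<mu> / (c * t ^ 3) * g t * g t * p t) \<longlongrightarrow> 0) at_top" "((\<lambda>t. \<mu> / (c * t ^ 3) * g t * f t * p t) \<longlongrightarrow> 0) at_top"
      "((\<lambda>t. \<mu> / (c * t ^ 3) * f t * f t * p t) \<longlongrightarrow> 0) at_top" by simp_all
    have "((\<lambda>t. K t - (a\<^sup>2 * (\<mu> / (c * t ^ 3) * g t * g t * p t) - 2 * a * b * (\<mu> / (c * t ^ 3) * g t * f t * p t)
        + b\<^sup>2 * (\<mu> / (c * t ^ 3) * f t * f t * p t))) \<longlongrightarrow> 0 - (a\<^sup>2 * 0 - 2 * a * b * 0 + b\<^sup>2 * 0)) at_top"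
      using K_lim[of a b] by (intro tendsto_intros l) (simp add: K_def[abs_def] \<phi>_def \<xi>_def)
    moreover have "K t - (a\<^sup>2 * (\<mu> / (c * t ^ 3) * g t * g t * p t) - 2 * a * b * (\<mu> / (c * t ^ 3) * g t * f t * p t)
        + b\<^sup>2 * (\<mu> / (c * t ^ 3) * f t * f t * p t)) = h t" for t
      unfolding h_def \<phi>_def by (simp add: power2_eq_square algebra_simps)
    ultimately show ?thesis by simp
  qed
  have "h x \<le> 0"
  proof (rule ray_le_limit[OF _ dh _ lim])
    show "continuous_on {x..} h"
      unfolding h_def[abs_def] K_def \<phi>_def \<xi>_def using x x0 cpos by (intro continuous_intros p_cont) auto
    show "\<mu> / (c * t ^ 4) * (\<phi> t)\<^sup>2 * (3 * p t - 2 * t * p1 t) \<ge> 0" if "t > x" for t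
      using le[OF that] mu cpos that by (intro mult_nonneg_nonneg) auto
  qed (use x in auto)
  thus ?thesis using cpos hx by (simp add: mult_le_0_iff)
qed

text \<open>Where x^2 \<ge> 2 \<mu> the potential is at least 1/2, so p \<le> 4 c from there on and
  the polarised energy is controlled crudely. For large arguments this yields the hypothesis of
  \<open>p1_nonpos_step\<close>.\<close>

lemma p1_bound_far:
  assumes x: "x \<ge> x0" "x\<^sup>2 \<ge> 2 * \<mu>"
  shows "x\<^sup>2 * p1 x \<le> 4 * \<mu> * p x"
proof -
  define a where "a = f x"
  define b where "b = g x"
  have qh: "qpot \<mu> t \<ge> 1 / 2" if "t \<ge> x" for t
  proof -
    have "x\<^sup>2 \<le> t\<^sup>2" using that x x0 by (intro power_mono) auto
    hence "2 * \<mu> \<le> t\<^sup>2" using x(2) by linarith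
    thus ?thesis using that x x0 by (simp add: qpot_def field_simps)
  qed
  have p4: "p t \<le> 4 * c" if "t \<ge> x" for t
  proof -
    have "1 / 2 * p t \<le> qpot \<mu> t * p t" using qh[OF that] p_nonneg by (intro mult_right_mono) auto
    also have "\<dots> \<le> 2 * c" using F_le[OF mu, of t] that x zero_le_power2[of "f1 t"] zero_le_power2[of "g1 t"] by linarith
    finally show ?thesis by simp
  qed
  let ?K = "\<lambda>t. (a * g1 t - b * f1 t) * (a * f1 t + b * g1 t) + qpot \<mu> t * ((a * g t - b * f t) * (a * f t + b * g t))"
  let ?h = "\<lambda>t. ?K t + 2 * c * p x * qpot \<mu> t"
  have "?h x \<le> 0 + 2 * c * p x * 1"
  proof (rule ray_le_limit[where h = ?h and x = x and h' = "\<lambda>t. 2 * \<mu> / t ^ 3 * ((a * g t - b * f t) * (a * f t + b * g t)) + 2 * c * p x * (2 * \<mu> / t ^ 3)"])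
    show "continuous_on {x..} ?h" using x by (intro continuous_on_add K_cont continuous_intros) auto
    show "(?h \<longlongrightarrow> 0 + 2 * c * p x * 1) at_top" by (intro tendsto_add K_lim tendsto_mult tendsto_const qpot_tendsto)
    fix t assume t: "t > x"
    hence t0: "t > x0" "t > 0" using x x0 by auto
    show "(?h has_real_derivative 2 * \<mu> / t ^ 3 * ((a * g t - b * f t) * (a * f t + b * g t)) + 2 * c * p x * (2 * \<mu> / t ^ 3)) (at t)"
      using t0 by (intro DERIV_add K_deriv DERIV_cmult qpot_deriv) auto
    have "(a * g t - b * f t)\<^sup>2 + (a * f t + b * g t)\<^sup>2 = p x * p t"
      unfolding p_def a_def b_def by (simp add: power2_eq_square algebra_simps)
    moreover have "- (2 * (A * B)) \<le> A\<^sup>2 + B\<^sup>2" for A B :: real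
      using sum_squares_bound[of "- A" B] by simp
    ultimately have "- (2 * ((a * g t - b * f t) * (a * f t + b * g t))) \<le> p x * p t"
      by metis
    also have "\<dots> \<le> p x * (4 * c)" using p4[of t] t p_nonneg by (intro mult_left_mono) auto
    finally have "0 \<le> (a * g t - b * f t) * (a * f t + b * g t) + 2 * c * p x" by (simp add: mult_ac)
    hence "0 \<le> 2 * \<mu> / t ^ 3 * ((a * g t - b * f t) * (a * f t + b * g t) + 2 * c * p x)"
      using mu t0 by (intro mult_nonneg_nonneg) auto
    thus "0 \<le> 2 * \<mu> / t ^ 3 * ((a * g t - b * f t) * (a * f t + b * g t)) + 2 * c * p x * (2 * \<mu> / t ^ 3)"
      by (simp add: algebra_simps)
  qed simp
  moreover have "?K x = c * (p1 x / 2)"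
    using wr[OF x(1)] unfolding p1_def a_def b_def by (simp add: algebra_simps)
  ultimately have "c * (p1 x / 2) \<le> c * (2 * p x * (1 - qpot \<mu> x))" by (simp add: algebra_simps)
  hence "p1 x / 2 \<le> 2 * p x * (1 - qpot \<mu> x)" using cpos by simp
  thus ?thesis using x x0 by (simp add: qpot_def field_simps)
qed

text \<open>Continuation from infinity. If p' > 0 somewhere, let s be the supremum of such points.
  There p' \<le> 0 < p, so 2 t p' < 3 p persists slightly to the left of s, and
  \<open>p1_nonpos_step\<close> contradicts p' > 0 at points of the set close to s.\<close>

lemma p1_nonpos:
  assumes "x \<ge> x0"
  shows "p1 x \<le> 0"
proof (rule ccontr)
  assume "\<not> p1 x \<le> 0"
  define X where "X = max x0 (1 + 8 * \<mu>)"
  have far: "p1 y \<le> 0" if y: "y \<ge> X" for y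
  proof (rule p1_nonpos_step)
    show "y \<ge> x0" using y by (simp add: X_def)
    fix t assume t: "t > y"
    hence t1: "t \<ge> 1" "t \<ge> 8 * \<mu>" "t \<ge> x0" using y mu by (auto simp: X_def)
    hence "t * t \<ge> t * (8 * \<mu>)" by (intro mult_left_mono) auto
    moreover have "t * (8 * \<mu>) \<ge> 1 * (8 * \<mu>)" using t1 mu by (intro mult_right_mono) auto
    ultimately have "t\<^sup>2 \<ge> 2 * \<mu>" using mu by (simp add: power2_eq_square)
    hence "t\<^sup>2 * p1 t \<le> 4 * \<mu> * p t" using t1 by (intro p1_bound_far) auto
    also have "\<dots> \<le> t / 2 * p t" using t1 p_nonneg[of t] by (intro mult_right_mono) auto
    finally have "t * (t * p1 t) \<le> t * (p t / 2)" by (simp add: power2_eq_square)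
    hence "t * p1 t \<le> p t / 2" using t1 by simp
    thus "2 * t * p1 t \<le> 3 * p t" using p_nonneg[of t] by simp
  qed
  define S where "S = {t. t \<ge> x0 \<and> p1 t > 0}"
  have xS: "x \<in> S" using \<open>\<not> p1 x \<le> 0\<close> assms by (simp add: S_def)
  have bdd: "bdd_above S"
  proof (rule bdd_aboveI)
    fix t assume "t \<in> S"
    thus "t \<le> X" using far[of t] by (cases "t \<le> X") (auto simp: S_def)
  qed
  define s where "s = Sup S"
  have sx: "s \<ge> x0" using cSup_upper[OF xS bdd] assms by (simp add: s_def)
  have above: "p1 t \<le> 0" if "t > s" for t
  proof (rule ccontr)
    assume "\<not> p1 t \<le> 0"
    hence "t \<in> S" using that sx by (simp add: S_def)
    hence "t \<le> s" using bdd by (simp add: s_def cSup_upper)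
    thus False using that by simp
  qed
  have ps: "p s > 0" using p_pos[OF sx] .
  have p1s: "p1 s \<le> 0"
  proof (rule p1_nonpos_step[OF sx])
    fix t assume t: "t > s"
    hence "t * p1 t \<le> 0" using above[OF t] sx x0 by (simp add: mult_nonneg_nonpos)
    thus "2 * t * p1 t \<le> 3 * p t" using p_nonneg[of t] by simp
  qed
  have cont: "continuous_on {x0..} (\<lambda>t. 3 * p t - 2 * t * p1 t)"
    by (intro continuous_intros p_cont p1_cont) auto
  have "3 * p s - 2 * s * p1 s > 0" using ps p1s sx x0 by (simp add: mult_nonneg_nonpos add_pos_nonneg) (smt (verit) mult_nonneg_nonpos)
  then obtain d where d: "d > 0" "\<And>t. t \<ge> x0 \<Longrightarrow> \<bar>t - s\<bar> < d \<Longrightarrow> 3 * p t - 2 * t * p1 t > 0"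
  proof -
    assume pos: "3 * p s - 2 * s * p1 s > 0"
    have "((\<lambda>t. 3 * p t - 2 * t * p1 t) \<longlongrightarrow> 3 * p s - 2 * s * p1 s) (at s within {x0..})"
      using cont sx by (simp add: continuous_on_def)
    from order_tendstoD(1)[OF this pos] obtain d where "d > 0" "\<And>t. t \<in> {x0..} \<Longrightarrow> t \<noteq> s \<Longrightarrow> dist t s < d \<Longrightarrow> 0 < 3 * p t - 2 * t * p1 t"
      unfolding eventually_at by blast
    thus thesis using that[of d] pos by (metis atLeast_iff dist_real_def)
  qed
  obtain y where y: "y \<in> S" "s - d < y"
    using less_cSupD[of S "s - d"] xS d(1) unfolding s_def by auto
  have "p1 y \<le> 0"
  proof (rule p1_nonpos_step)
    show yx: "y \<ge> x0" using y by (simp add: S_def)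
    fix t assume t: "t > y"
    show "2 * t * p1 t \<le> 3 * p t"
    proof (cases "t > s")
      case True
      hence "t * p1 t \<le> 0" using above[OF True] sx x0 by (simp add: mult_nonneg_nonpos)
      thus ?thesis using p_nonneg[of t] by simp
    next
      case False
      thus ?thesis using d(2)[of t] t y yx by simp
    qed
  qed
  thus False using y by (simp add: S_def)
qed

lemma p_antimono:
  assumes "x0 \<le> x" "x \<le> y"
  shows "p y \<le> p x"
proof -
  have "- p x \<le> - p y"
    by (rule ray_mono[where h = "\<lambda>t. - p t" and h' = "\<lambda>t. - p1 t" and x = x0])
      (use assms p1_nonpos in \<open>auto intro!: continuous_intros p_cont derivative_intros p_deriv\<close>)
  thus ?thesis by simp
qed

end

lemma const_tendsto_unique:
  fixes h :: "real \<Rightarrow> real"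
  assumes "(h \<longlongrightarrow> L) at_top" "\<And>s. s \<ge> x \<Longrightarrow> h s = h x"
  shows "h x = L"
proof -
  have "\<forall>\<^sub>F s in at_top. h s = h x"
    using eventually_ge_at_top[of x] by eventually_elim (rule assms(2))
  hence "(h \<longlongrightarrow> h x) at_top" by (rule tendsto_eventually)
  from tendsto_unique[OF trivial_limit_at_top_linorder this assms(1)] show ?thesis .
qed

section \<open>Real solutions on the whole positive axis and their wronskian with the outgoing
  one\<close>

definition osc_all :: "real \<Rightarrow> (real \<Rightarrow> real) \<Rightarrow> (real \<Rightarrow> real) \<Rightarrow> bool" where
  "osc_all \<mu> U U1 \<longleftrightarrow>
    (\<forall>t>0. (U has_real_derivative U1 t) (at t) \<and> (U1 has_real_derivative - qpot \<mu> t * U t) (at t))"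

lemma osc_all_deriv:
  assumes "osc_all \<mu> U U1" "t > 0"
  shows "(U has_real_derivative U1 t) (at t)" "(U1 has_real_derivative - qpot \<mu> t * U t) (at t)"
  using assms by (auto simp: osc_all_def)

lemma osc_all_cont:
  assumes "osc_all \<mu> U U1" "S \<subseteq> {0<..}"
  shows "continuous_on S U" "continuous_on S U1"
  using assms unfolding osc_all_def by (auto intro!: continuous_at_imp_continuous_on dest: DERIV_isCont)

lemma osc_all_osc: "osc_all \<mu> U U1 \<Longrightarrow> x > 0 \<Longrightarrow> osc \<mu> x U U1"
  unfolding osc_def using osc_all_deriv[of \<mu> U U1] by (auto intro!: osc_all_cont[of \<mu> U U1])

lemma energy_weighted_deriv:
  assumes U: "osc_all \<mu> U U1" and t: "t > 0"
  shows "((\<lambda>s. ((U s)\<^sup>2 + (U1 s)\<^sup>2) * exp (d / s)) has_real_derivative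
      (2 * \<mu> / t\<^sup>2 * (U t * U1 t) - d / t\<^sup>2 * ((U t)\<^sup>2 + (U1 t)\<^sup>2)) * exp (d / t)) (at t)"
  using t osc_all_deriv[OF U t]
  by (auto intro!: derivative_eq_intros simp: qpot_def field_simps power2_eq_square)

text \<open>Gronwall's inequality in monotone form: the weights exp (|\<mu>| / s) and exp (-|\<mu>|
  / s) compensate the largest possible growth and decay rates of the energy.\<close>

lemma osc_energy_antimono:
  assumes U: "osc_all \<mu> U U1" and ab: "0 < a" "a \<le> b"
  shows "((U b)\<^sup>2 + (U1 b)\<^sup>2) * exp (\<bar>\<mu>\<bar> / b) \<le> ((U a)\<^sup>2 + (U1 a)\<^sup>2) * exp (\<bar>\<mu>\<bar> / a)"
    and "((U a)\<^sup>2 + (U1 a)\<^sup>2) * exp (- \<bar>\<mu>\<bar> / a) \<le> ((U b)\<^sup>2 + (U1 b)\<^sup>2) * exp (- \<bar>\<mu>\<bar> / b)"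
proof -
  have bound: "\<bar>2 * \<mu> / t\<^sup>2 * (U t * U1 t)\<bar> \<le> \<bar>\<mu>\<bar> / t\<^sup>2 * ((U t)\<^sup>2 + (U1 t)\<^sup>2)" for t
  proof -
    have "2 * U t * U1 t \<le> (U t)\<^sup>2 + (U1 t)\<^sup>2" "- (2 * U t * U1 t) \<le> (U t)\<^sup>2 + (U1 t)\<^sup>2"
      using sum_squares_bound[of "U t" "U1 t"] sum_squares_bound[of "- U t" "U1 t"] by simp_all
    hence "\<bar>2 * (U t * U1 t)\<bar> \<le> (U t)\<^sup>2 + (U1 t)\<^sup>2" by (intro abs_leI) simp_all
    hence "\<bar>\<mu>\<bar> / t\<^sup>2 * \<bar>2 * (U t * U1 t)\<bar> \<le> \<bar>\<mu>\<bar> / t\<^sup>2 * ((U t)\<^sup>2 + (U1 t)\<^sup>2)" by (intro mult_left_mono) auto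
    moreover have "2 * \<mu> / t\<^sup>2 * (U t * U1 t) = \<mu> / t\<^sup>2 * (2 * (U t * U1 t))" by simp
    ultimately show ?thesis by (simp only: abs_mult abs_divide abs_power2)
  qed
  have c: "continuous_on {a..b} (\<lambda>s. ((U s)\<^sup>2 + (U1 s)\<^sup>2) * exp (d / s))" for d
    using ab by (intro continuous_intros osc_all_cont[OF U]) auto
  have g: "X - B \<le> 0" "0 \<le> X + B" if "\<bar>X\<bar> \<le> B" for X B :: real using that by (auto simp: abs_le_iff)
  have "- (((U a)\<^sup>2 + (U1 a)\<^sup>2) * exp (\<bar>\<mu>\<bar> / a)) \<le> - (((U b)\<^sup>2 + (U1 b)\<^sup>2) * exp (\<bar>\<mu>\<bar> / b))"
  proof (rule deriv_nonneg_mono[where h = "\<lambda>s. - (((U s)\<^sup>2 + (U1 s)\<^sup>2) * exp (\<bar>\<mu>\<bar> / s))"])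
    show "continuous_on {a..b} (\<lambda>s. - (((U s)\<^sup>2 + (U1 s)\<^sup>2) * exp (\<bar>\<mu>\<bar> / s)))"
      by (intro continuous_on_minus c)
    fix t assume t: "a < t" "t < b"
    show "((\<lambda>s. - (((U s)\<^sup>2 + (U1 s)\<^sup>2) * exp (\<bar>\<mu>\<bar> / s))) has_real_derivative
      - ((2 * \<mu> / t\<^sup>2 * (U t * U1 t) - \<bar>\<mu>\<bar> / t\<^sup>2 * ((U t)\<^sup>2 + (U1 t)\<^sup>2)) * exp (\<bar>\<mu>\<bar> / t))) (at t)"
      using t ab by (intro DERIV_minus energy_weighted_deriv[OF U]) auto
    show "- ((2 * \<mu> / t\<^sup>2 * (U t * U1 t) - \<bar>\<mu>\<bar> / t\<^sup>2 * ((U t)\<^sup>2 + (U1 t)\<^sup>2)) * exp (\<bar>\<mu>\<bar> / t)) \<ge> 0"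
      using mult_nonpos_nonneg[OF g(1)[OF bound[of t]], of "exp (\<bar>\<mu>\<bar> / t)"] by (simp only: neg_0_le_iff_le exp_ge_zero)
  qed (rule ab)
  thus "((U b)\<^sup>2 + (U1 b)\<^sup>2) * exp (\<bar>\<mu>\<bar> / b) \<le> ((U a)\<^sup>2 + (U1 a)\<^sup>2) * exp (\<bar>\<mu>\<bar> / a)" by simp
  show "((U a)\<^sup>2 + (U1 a)\<^sup>2) * exp (- \<bar>\<mu>\<bar> / a) \<le> ((U b)\<^sup>2 + (U1 b)\<^sup>2) * exp (- \<bar>\<mu>\<bar> / b)"
  proof (rule deriv_nonneg_mono[where h = "\<lambda>s. ((U s)\<^sup>2 + (U1 s)\<^sup>2) * exp (- \<bar>\<mu>\<bar> / s)"])
    fix t assume t: "a < t" "t < b"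
    show "((\<lambda>s. ((U s)\<^sup>2 + (U1 s)\<^sup>2) * exp (- \<bar>\<mu>\<bar> / s)) has_real_derivative
      ((2 * \<mu> / t\<^sup>2 * (U t * U1 t) - - \<bar>\<mu>\<bar> / t\<^sup>2 * ((U t)\<^sup>2 + (U1 t)\<^sup>2)) * exp (- \<bar>\<mu>\<bar> / t))) (at t)"
      using t ab by (intro energy_weighted_deriv[OF U]) auto
    have "0 \<le> (2 * \<mu> / t\<^sup>2 * (U t * U1 t) + \<bar>\<mu>\<bar> / t\<^sup>2 * ((U t)\<^sup>2 + (U1 t)\<^sup>2)) * exp (- \<bar>\<mu>\<bar> / t)"
      by (rule mult_nonneg_nonneg[OF g(2)[OF bound[of t]]]) simp
    thus "((2 * \<mu> / t\<^sup>2 * (U t * U1 t) - - \<bar>\<mu>\<bar> / t\<^sup>2 * ((U t)\<^sup>2 + (U1 t)\<^sup>2)) * exp (- \<bar>\<mu>\<bar> / t)) \<ge> 0"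
      by simp
  next
    show "continuous_on {a..b} (\<lambda>s. ((U s)\<^sup>2 + (U1 s)\<^sup>2) * exp (- \<bar>\<mu>\<bar> / s))" by (rule c)
  qed (rule ab)
qed

lemma osc_all_vanish:
  assumes U: "osc_all \<mu> U U1" and z: "z > 0" "U z = 0" "U1 z = 0" and s: "0 < s" "s \<le> z"
  shows "U s = 0"
proof -
  have "((U s)\<^sup>2 + (U1 s)\<^sup>2) * exp (- \<bar>\<mu>\<bar> / s) \<le> 0"
    using osc_energy_antimono(2)[OF U s] z by simp
  hence "(U s)\<^sup>2 + (U1 s)\<^sup>2 \<le> 0" by (simp add: mult_le_0_iff)
  thus ?thesis by (simp add: sum_power2_le_zero_iff)
qed

lemma osc_all_bounded:
  assumes U: "osc_all \<mu> U U1"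
  shows "\<exists>B. \<forall>s\<ge>1. \<bar>U s\<bar> \<le> B \<and> \<bar>U1 s\<bar> \<le> B"
proof -
  define C where "C = ((U 1)\<^sup>2 + (U1 1)\<^sup>2) * exp \<bar>\<mu>\<bar>"
  have "\<bar>U s\<bar> \<le> sqrt C \<and> \<bar>U1 s\<bar> \<le> sqrt C" if "s \<ge> 1" for s
  proof -
    have "((U s)\<^sup>2 + (U1 s)\<^sup>2) * 1 \<le> ((U s)\<^sup>2 + (U1 s)\<^sup>2) * exp (\<bar>\<mu>\<bar> / s)"
      using that by (intro mult_left_mono) auto
    also have "\<dots> \<le> C" using osc_energy_antimono(1)[OF U, of 1 s] that by (simp add: C_def)
    finally have "(U s)\<^sup>2 + (U1 s)\<^sup>2 \<le> C" by simp
    hence "(U s)\<^sup>2 \<le> C" "(U1 s)\<^sup>2 \<le> C"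
      using zero_le_power2[of "U s"] zero_le_power2[of "U1 s"] by linarith+
    thus ?thesis by (metis real_sqrt_abs real_sqrt_le_iff)
  qed
  thus ?thesis by blast
qed

context outgoing_pair
begin

text \<open>\<open>gr\<close> and \<open>gi\<close> are the real and imaginary parts of the constant
  wronskian u' U - U' u of the outgoing solution with a real one.\<close>

definition gr where "gr U U1 = f1 x0 * U x0 - U1 x0 * f x0"
definition gi where "gi U U1 = g1 x0 * U x0 - U1 x0 * g x0"

lemma gr_gi:
  assumes U: "osc_all \<mu> U U1" and s: "s \<ge> x0"
  shows "f1 s * U s - U1 s * f s = gr U U1" "g1 s * U s - U1 s * g s = gi U U1"
  using osc_wronskian[OF osc_all_osc[OF U x0] oscf s] osc_wronskian[OF osc_all_osc[OF U x0] oscg s]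
  by (simp_all add: gr_def gi_def algebra_simps)

text \<open>Near infinity u' may be replaced by \<i> u in the wronskian, and |\<i> u U - U' u|^2 = p
  (U^2 + U'^2), where p tends to c.\<close>

lemma real_energy_lim:
  assumes U: "osc_all \<mu> U U1" and c: "c > 0"
  shows "((\<lambda>s. (U s)\<^sup>2 + (U1 s)\<^sup>2) \<longlongrightarrow> ((gr U U1)\<^sup>2 + (gi U U1)\<^sup>2) / c) at_top"
proof -
  obtain B where B: "\<And>s. s \<ge> 1 \<Longrightarrow> \<bar>U s\<bar> \<le> B \<and> \<bar>U1 s\<bar> \<le> B" using osc_all_bounded[OF U] by blast
  have eB: "((\<lambda>s. e s * U s) \<longlongrightarrow> 0) at_top" "((\<lambda>s. e s * U1 s) \<longlongrightarrow> 0) at_top" if "(e \<longlongrightarrow> 0) at_top" for e :: "real \<Rightarrow> real"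
  proof -
    have ev: "\<forall>\<^sub>F s in at_top. \<bar>U s\<bar> \<le> B \<and> \<bar>U1 s\<bar> \<le> B"
      using eventually_ge_at_top[of 1] by eventually_elim (use B in auto)
    show "((\<lambda>s. e s * U s) \<longlongrightarrow> 0) at_top"
      by (rule tendsto_0_le[OF that, of _ B]) (use ev in eventually_elim, auto simp: abs_mult intro: mult_left_mono)
    show "((\<lambda>s. e s * U1 s) \<longlongrightarrow> 0) at_top"
      by (rule tendsto_0_le[OF that, of _ B]) (use ev in eventually_elim, auto simp: abs_mult intro: mult_left_mono)
  qed
  let ?G = "(gr U U1)\<^sup>2 + (gi U U1)\<^sup>2"
  let ?e1 = "\<lambda>s. f1 s + g s" and ?e2 = "\<lambda>s. g1 s - f s"
  have l1: "((\<lambda>s. ?e1 s * U s) \<longlongrightarrow> 0) at_top" "((\<lambda>s. ?e2 s * U s) \<longlongrightarrow> 0) at_top"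
    using eB lim1 lim2 by auto
  \<comment> \<open>\<open>gr = e1 U - (g U + U1 f)\<close> and \<open>gi = e2 U + (f U - U1 g)\<close>\<close>
  have "((\<lambda>s. ?G + (2 * gr U U1 * (- (?e1 s * U s)) + (?e1 s * U s)\<^sup>2) + (2 * gi U U1 * (- (?e2 s * U s)) + (?e2 s * U s)\<^sup>2)) \<longlongrightarrow>
      ?G + (2 * gr U U1 * (- 0) + 0\<^sup>2) + (2 * gi U U1 * (- 0) + 0\<^sup>2)) at_top"
    by (intro tendsto_intros l1)
  moreover have "\<forall>\<^sub>F s in at_top. ?G + (2 * gr U U1 * (- (?e1 s * U s)) + (?e1 s * U s)\<^sup>2) + (2 * gi U U1 * (- (?e2 s * U s)) + (?e2 s * U s)\<^sup>2)
      = p s * ((U s)\<^sup>2 + (U1 s)\<^sup>2)"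
    using eventually_ge_at_top[of x0]
  proof eventually_elim
    case (elim s)
    have "(gr U U1 - ?e1 s * U s)\<^sup>2 + (gi U U1 - ?e2 s * U s)\<^sup>2 = p s * ((U s)\<^sup>2 + (U1 s)\<^sup>2)"
      unfolding gr_gi[OF U elim, symmetric] p_def by (simp add: power2_eq_square algebra_simps)
    thus ?case by (simp add: power2_eq_square algebra_simps)
  qed
  ultimately have "((\<lambda>s. p s * ((U s)\<^sup>2 + (U1 s)\<^sup>2)) \<longlongrightarrow> ?G + (2 * gr U U1 * (- 0) + 0\<^sup>2) + (2 * gi U U1 * (- 0) + 0\<^sup>2)) at_top"
    by (rule Lim_transform_eventually)
  hence "((\<lambda>s. p s * ((U s)\<^sup>2 + (U1 s)\<^sup>2)) \<longlongrightarrow> ?G) at_top" by simp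
  from tendsto_divide[OF this p_lim] c
  have "((\<lambda>s. p s * ((U s)\<^sup>2 + (U1 s)\<^sup>2) / p s) \<longlongrightarrow> ?G / c) at_top" by simp
  moreover have "\<forall>\<^sub>F s in at_top. p s * ((U s)\<^sup>2 + (U1 s)\<^sup>2) / p s = (U s)\<^sup>2 + (U1 s)\<^sup>2"
    using order_tendstoD(1)[OF p_lim c] by eventually_elim simp
  ultimately show ?thesis by (rule Lim_transform_eventually)
qed

text \<open>Equals -Re (s v' / v) for v = u / sqrt s; the 1 / 2 comes from the factor sqrt
  s.\<close>

definition k where "k s = 1 / 2 - s * p1 s / (2 * p s)"

lemma k_deriv:
  assumes s: "s > x0" and ps: "p s > 0"
  shows "(k has_real_derivative ((k s)\<^sup>2 - (\<mu> + 1 / 4) + s\<^sup>2 - (c * s / p s)\<^sup>2) / s) (at s)"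
proof -
  define A where "A = f s * f1 s + g s * g1 s"
  have s0: "s > 0" using s x0 by simp
  \<comment> \<open>Lagrange's identity: |u|^2 |u'|^2 splits into the squares of the real and
    imaginary parts of cnj u u'.\<close>
  have id: "((f1 s)\<^sup>2 + (g1 s)\<^sup>2) * p s = A\<^sup>2 + c\<^sup>2"
  proof -
    have c: "c = f s * g1 s - g s * f1 s" using wr[of s] s by simp
    show ?thesis unfolding A_def p_def c by (simp add: power2_eq_square algebra_simps)
  qed
  have p1A: "p1 s = 2 * A" by (simp add: p1_def A_def)
  have dp1: "(p1 has_real_derivative 2 * ((f1 s)\<^sup>2 + (g1 s)\<^sup>2 - qpot \<mu> s * p s)) (at s)"
    unfolding p1_def[abs_def] p_def using s by (auto intro!: derivative_eq_intros simp: power2_eq_square algebra_simps)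
  define D where "D = (1 * p1 s + s * (2 * ((f1 s)\<^sup>2 + (g1 s)\<^sup>2 - qpot \<mu> s * p s))) * (2 * p s) - s * p1 s * (2 * p1 s)"
  have "((\<lambda>s. s * p1 s / (2 * p s)) has_real_derivative D / (2 * p s * (2 * p s))) (at s)"
    unfolding D_def using ps
    by (intro DERIV_divide DERIV_cmult p_deriv s) (auto intro!: derivative_eq_intros dp1)
  from DERIV_diff[OF DERIV_const this]
  have "(k has_real_derivative - (D / (2 * p s * (2 * p s)))) (at s)"
    by (simp add: k_def[abs_def])
  moreover have "- (D / (2 * p s * (2 * p s))) = ((k s)\<^sup>2 - (\<mu> + 1 / 4) + s\<^sup>2 - (c * s / p s)\<^sup>2) / s"
  proof -
    define X Y where "X = A / p s" and "Y = c / p s"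
    have "- D = - 4 * A * p s - 4 * s * (((f1 s)\<^sup>2 + (g1 s)\<^sup>2) * p s) + 4 * s * qpot \<mu> s * (p s)\<^sup>2 + 8 * s * A\<^sup>2"
      unfolding p1A D_def by (simp add: power2_eq_square algebra_simps)
    hence D: "D = 4 * A * p s + 4 * s * (A\<^sup>2 + c\<^sup>2) - 4 * s * qpot \<mu> s * (p s)\<^sup>2 - 8 * s * A\<^sup>2"
      unfolding id by simp
    have 1: "- (D / (2 * p s * (2 * p s))) = - X + s * X\<^sup>2 - s * Y\<^sup>2 + s * qpot \<mu> s"
      unfolding D X_def Y_def using ps by (simp add: field_simps power2_eq_square)
    have kX: "k s = 1 / 2 - s * X"
      unfolding k_def p1A X_def by simp
    have cY: "c * s / p s = s * Y" unfolding Y_def by simp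
    have "((1 / 2 - s * X)\<^sup>2 - (\<mu> + 1 / 4) + s\<^sup>2 - (s * Y)\<^sup>2) / s = - X + s * X\<^sup>2 - s * Y\<^sup>2 + s * qpot \<mu> s"
      using s0 unfolding qpot_def by (simp add: field_simps power2_eq_square)
    thus ?thesis unfolding 1 kX cY by simp
  qed
  ultimately show ?thesis by simp
qed

lemma k_cont: "S \<subseteq> {x0..} \<Longrightarrow> (\<And>s. s \<in> S \<Longrightarrow> p s \<noteq> 0) \<Longrightarrow> continuous_on S k"
  unfolding k_def[abs_def] by (intro continuous_intros p_cont p1_cont) auto

end

lemma outgoing_pair_restrict:
  assumes "outgoing_pair \<mu> x f f1 g g1" "x \<le> y"
  shows "outgoing_pair \<mu> y f f1 g g1" "outgoing_pair.c y f f1 g g1 = outgoing_pair.c x f f1 g g1"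
proof -
  interpret outgoing_pair \<mu> x f f1 g g1 by fact
  show 1: "outgoing_pair \<mu> y f f1 g g1"
    using x0 assms(2) by unfold_locales (simp, (rule lim1 lim2 osc_mono[OF oscf] osc_mono[OF oscg], assumption?)+)
  show "outgoing_pair.c y f f1 g g1 = outgoing_pair.c x f f1 g g1"
    using wr[OF assms(2)] unfolding outgoing_pair.c_def[OF 1] c_def by simp
qed

text \<open>The wronskian of two outgoing solutions, taken without conjugation, is constant and
  tends to 0, so they are proportional and share the logarithmic derivative. Resonances at different
  frequencies can thus be compared along a single solution.\<close>

lemma outgoing_pair_unique_k:
  assumes "outgoing_pair \<mu> x f f1 g g1" "outgoing_pair \<mu> x F F1 G G1"
    and p: "outgoing_pair.p f g x > 0" "outgoing_pair.p F G x > 0"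
  shows "outgoing_pair.k f f1 g g1 x = outgoing_pair.k F F1 G G1 x"
proof -
  interpret a: outgoing_pair \<mu> x f f1 g g1 by fact
  interpret b: outgoing_pair \<mu> x F F1 G G1 by fact
  let ?R = "\<lambda>s. (f1 s * F s - F1 s * f s) - (g1 s * G s - G1 s * g s)"
  let ?I = "\<lambda>s. (f1 s * G s - G1 s * f s) + (g1 s * F s - F1 s * g s)"
  have lim: "(?R \<longlongrightarrow> 0) at_top" "(?I \<longlongrightarrow> 0) at_top"
  proof -
    let ?e1 = "\<lambda>s. f1 s + g s" and ?e2 = "\<lambda>s. g1 s - f s" and ?E1 = "\<lambda>s. F1 s + G s" and ?E2 = "\<lambda>s. G1 s - F s"
    have "((\<lambda>s. ?e1 s * F s - ?e2 s * G s - ?E1 s * f s + ?E2 s * g s) \<longlongrightarrow> 0 - 0 - 0 + 0) at_top"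
      by (intro tendsto_intros a.bz b.bz a.lim1 a.lim2 b.lim1 b.lim2)
    moreover have "?e1 s * F s - ?e2 s * G s - ?E1 s * f s + ?E2 s * g s = ?R s" for s by (simp add: algebra_simps)
    ultimately show "(?R \<longlongrightarrow> 0) at_top" by simp
    have "((\<lambda>s. ?e1 s * G s + ?e2 s * F s - ?E1 s * g s - ?E2 s * f s) \<longlongrightarrow> 0 + 0 - 0 - 0) at_top"
      by (intro tendsto_intros a.bz b.bz a.lim1 a.lim2 b.lim1 b.lim2)
    moreover have "?e1 s * G s + ?e2 s * F s - ?E1 s * g s - ?E2 s * f s = ?I s" for s by (simp add: algebra_simps)
    ultimately show "(?I \<longlongrightarrow> 0) at_top" by simp
  qed
  have const: "?R s = ?R x" "?I s = ?I x" if "s \<ge> x" for s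
    using osc_wronskian[OF b.oscf a.oscf that] osc_wronskian[OF b.oscg a.oscg that]
      osc_wronskian[OF b.oscf a.oscg that] osc_wronskian[OF b.oscg a.oscf that] by (simp_all add: algebra_simps)
  have RI: "?R x = 0" "?I x = 0"
    by (rule const_tendsto_unique[of ?R 0 x, OF lim(1) const(1)], assumption)
      (rule const_tendsto_unique[of ?I 0 x, OF lim(2) const(2)], assumption)
  have "a.p1 x * b.p x - b.p1 x * a.p x = 2 * (?R x * (f x * F x - g x * G x) + ?I x * (f x * G x + g x * F x))"
    unfolding a.p1_def b.p1_def a.p_def b.p_def by (simp add: power2_eq_square algebra_simps)
  hence "a.p1 x * b.p x = b.p1 x * a.p x"
    unfolding RI by simp
  hence "a.p1 x / a.p x = b.p1 x / b.p x"
    using p by (subst frac_eq_eq) auto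
  moreover have "x * r / (2 * t) = x / 2 * (r / t)" for r t :: real by simp
  ultimately show ?thesis unfolding a.k_def b.k_def by (simp only:)
qed

section \<open>Resonances\<close>

text \<open>Let m be the maximum of |U| between the zeros. A critical point and |q| \<le> 5/4 give
  |U'| \<le> 5/4 m, so m is at most 5/4 m times the distance from the maximum to either zero; adding
  both, 2 m \<le> 5/4 m. Then U vanishes together with U' at an interior point, hence also to its
  left, contrary to \<open>nz\<close>.\<close>

lemma zero_spacing:
  assumes U: "osc_all \<mu> U U1" and z: "0 < z1" "z1 < z2" "U z1 = 0" "U z2 = 0" "z2 - z1 \<le> 1"
    and q: "\<And>t. z1 \<le> t \<Longrightarrow> t \<le> z2 \<Longrightarrow> \<bar>qpot \<mu> t\<bar> \<le> 5 / 4"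
    and nz: "0 < s" "s \<le> z1" "U s \<noteq> 0"
  shows False
proof -
  have d: "(U has_real_derivative U1 t) (at t)" "(U1 has_real_derivative - qpot \<mu> t * U t) (at t)" if "t \<ge> z1" for t
    using osc_all_deriv[OF U, of t] that z by auto
  have cU: "continuous_on {z1..z2} U"
    using z by (intro osc_all_cont[OF U]) auto
  obtain tm where tm: "tm \<in> {z1..z2}" "\<And>t. t \<in> {z1..z2} \<Longrightarrow> \<bar>U t\<bar> \<le> \<bar>U tm\<bar>"
  proof -
    have "continuous_on {z1..z2} (\<lambda>t. \<bar>U t\<bar>)" by (intro continuous_intros cU)
    from continuous_attains_sup[OF compact_Icc _ this] z
    have "\<exists>x\<in>{z1..z2}. \<forall>y\<in>{z1..z2}. \<bar>U y\<bar> \<le> \<bar>U x\<bar>" by simp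
    thus thesis using that by blast
  qed
  define m where "m = \<bar>U tm\<bar>"
  have m0: "m \<ge> 0" by (simp add: m_def)
  have "\<exists>\<xi>. z1 < \<xi> \<and> \<xi> < z2 \<and> (U has_real_derivative 0) (at \<xi>)"
  proof (rule Rolle)
    fix x assume "z1 < x" "x < z2"
    thus "U differentiable (at x)" using d(1)[of x] by (auto simp: real_differentiable_def)
  qed (use z cU in auto)
  then obtain \<xi> where \<xi>: "z1 < \<xi>" "\<xi> < z2" "(U has_real_derivative 0) (at \<xi>)" by blast
  have \<xi>0: "U1 \<xi> = 0" using DERIV_unique[OF d(1)[of \<xi>] \<xi>(3)] \<xi> by simp
  have U1b: "\<bar>U1 t\<bar> \<le> 5 / 4 * m" if t: "t \<in> {z1..z2}" for t
  proof -
    have "norm (U1 t - U1 \<xi>) \<le> 5 / 4 * m * norm (t - \<xi>)"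
    proof (rule field_differentiable_bound[where S = "{z1..z2}" and f' = "\<lambda>t. - qpot \<mu> t * U t"])
      show "(U1 has_field_derivative - qpot \<mu> y * U y) (at y within {z1..z2})" if "y \<in> {z1..z2}" for y
        using d(2)[of y] that by (auto intro: has_field_derivative_at_within)
      show "norm (- qpot \<mu> y * U y) \<le> 5 / 4 * m" if "y \<in> {z1..z2}" for y
      proof -
        have "\<bar>qpot \<mu> y\<bar> * \<bar>U y\<bar> \<le> 5 / 4 * \<bar>U tm\<bar>"
          using q[of y] tm(2)[OF that] that by (intro mult_mono) auto
        thus ?thesis by (simp add: abs_mult m_def)
      qed
    qed (use t \<xi> in auto)
    also have "\<dots> \<le> 5 / 4 * m * 1"
      using t \<xi> z m0 by (intro mult_left_mono) auto
    finally show ?thesis using \<xi>0 by simp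
  qed
  have near: "\<bar>U t - U r\<bar> \<le> 5 / 4 * m * \<bar>t - r\<bar>" if "t \<in> {z1..z2}" "r \<in> {z1..z2}" for t r
  proof -
    have "norm (U t - U r) \<le> 5 / 4 * m * norm (t - r)"
    proof (rule field_differentiable_bound[where S = "{z1..z2}" and f' = U1])
      show "(U has_field_derivative U1 y) (at y within {z1..z2})" if "y \<in> {z1..z2}" for y
        using d(1)[of y] that by (auto intro: has_field_derivative_at_within)
    qed (use that U1b in auto)
    thus ?thesis by simp
  qed
  have "m \<le> 5 / 4 * m * (tm - z1)" "m \<le> 5 / 4 * m * (z2 - tm)"
    using near[of tm z1] near[of tm z2] tm(1) z by (auto simp: m_def)
  hence "2 * m \<le> 5 / 4 * m * (z2 - z1)" by (simp add: algebra_simps)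
  also have "\<dots> \<le> 5 / 4 * m * 1" using z m0 by (intro mult_left_mono) auto
  finally have m: "m = 0" using m0 by simp
  have "U \<xi> = 0" using tm(2)[of \<xi>] \<xi> m by (simp add: m_def)
  with osc_all_vanish[OF U _ this \<xi>0, of s] nz \<xi> z show False by simp
qed

text \<open>The differential inequality is required only above \<delta>. After the last time with
  \<sigma> \<le> \<delta>, the quantity (\<sigma> - \<delta>) exp (-L t) cannot increase, so
  \<sigma> never rises above \<delta>.\<close>

lemma barrier:
  fixes \<sigma> \<sigma>' :: "real \<Rightarrow> real"
  assumes ab: "a \<le> b" and cont: "continuous_on {a..b} \<sigma>"
    and deriv: "\<And>t. a < t \<Longrightarrow> t < b \<Longrightarrow> (\<sigma> has_real_derivative \<sigma>' t) (at t)"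
    and up: "\<And>t. a < t \<Longrightarrow> t < b \<Longrightarrow> \<sigma> t > \<delta> \<Longrightarrow> \<sigma>' t \<le> L * (\<sigma> t - \<delta>)"
    and start: "\<sigma> a \<le> \<delta>"
  shows "\<sigma> b \<le> \<delta>"
proof (rule ccontr)
  assume b: "\<not> \<sigma> b \<le> \<delta>"
  define S where "S = {t \<in> {a..b}. \<sigma> t \<le> \<delta>}"
  have aS: "a \<in> S" using ab start by (simp add: S_def)
  have "compact S"
  proof -
    have "S = {a..b} \<inter> ({a..b} \<inter> \<sigma> -` {..\<delta>})" by (auto simp: S_def)
    moreover have "closed ({a..b} \<inter> \<sigma> -` {..\<delta>})"
      by (intro continuous_closed_preimage cont) auto
    ultimately show ?thesis using compact_Int_closed[OF compact_Icc] by metis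
  qed
  then obtain \<tau> where \<tau>: "\<tau> \<in> S" "\<And>t. t \<in> S \<Longrightarrow> t \<le> \<tau>"
    using compact_attains_sup[of S] aS by blast
  have \<tau>b: "a \<le> \<tau>" "\<tau> < b" using \<tau>(1) b by (auto simp: S_def order.order_iff_strict)
  have gt: "\<sigma> t > \<delta>" if "\<tau> < t" "t < b" for t
    using \<tau>(2)[of t] that \<tau>b by (force simp: S_def)
  let ?h = "\<lambda>t. - ((\<sigma> t - \<delta>) * exp (- L * t))"
  have "?h \<tau> \<le> ?h b"
  proof (rule deriv_nonneg_mono[where h = ?h and h' = "\<lambda>t. - ((\<sigma>' t - L * (\<sigma> t - \<delta>)) * exp (- L * t))"])
    show "continuous_on {\<tau>..b} ?h"
      using \<tau>b by (intro continuous_intros continuous_on_subset[OF cont]) auto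
    fix t assume t: "\<tau> < t" "t < b"
    show "(?h has_real_derivative - ((\<sigma>' t - L * (\<sigma> t - \<delta>)) * exp (- L * t))) (at t)"
      using t \<tau>b by (auto intro!: derivative_eq_intros deriv[of t] simp: algebra_simps)
    have "\<sigma>' t - L * (\<sigma> t - \<delta>) \<le> 0" using up[of t] gt[OF t] t \<tau>b by simp
    thus "- ((\<sigma>' t - L * (\<sigma> t - \<delta>)) * exp (- L * t)) \<ge> 0"
      by (simp add: mult_nonpos_nonneg)
  qed (use \<tau>b in simp)
  moreover have "?h \<tau> \<ge> 0" using \<tau>(1) by (simp add: S_def mult_nonpos_nonneg)
  moreover have "?h b < 0" using b by simp
  ultimately show False by linarith
qed

text \<open>Between zeros of U the two Riccati equations are added and their n^2 cancels. While
  \<sigma> \<le> \<delta>, the only positive contribution is at most 2 kb \<delta>; it is absorbed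
  by \<theta> t^2, which leaves \<sigma>' \<le> -\<rho> t. This also keeps \<sigma> below \<delta>
  once it starts there, and falling from \<delta> to -\<delta> at that rate takes at most the stated
  length.\<close>

lemma bad_pair_dist:
  assumes U: "osc_all \<mu> U U1" and op: "outgoing_pair \<mu> (\<epsilon> * \<kappa>1) f f1 g g1"
    and \<epsilon>: "0 < \<epsilon>" and \<kappa>: "0 < \<kappa>1" "\<kappa>1 < \<kappa>2" and nz: "\<And>t. \<kappa>1 \<le> t \<Longrightarrow> t \<le> \<kappa>2 \<Longrightarrow> U t \<noteq> 0"
    and p: "\<And>t. t \<ge> \<epsilon> * \<kappa>1 \<Longrightarrow> outgoing_pair.p f g t > 0"
    and k: "\<And>t. \<epsilon> * \<kappa>1 \<le> t \<Longrightarrow> t \<le> \<epsilon> * \<kappa>2 \<Longrightarrow> 0 \<le> outgoing_pair.k f f1 g g1 t \<and> outgoing_pair.k f f1 g g1 t \<le> kb"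
    and s1: "\<bar>outgoing_pair.k f f1 g g1 (\<epsilon> * \<kappa>1) + \<kappa>1 * U1 \<kappa>1 / U \<kappa>1 - 1 / 2\<bar> \<le> \<delta>"
    and s2: "\<bar>outgoing_pair.k f f1 g g1 (\<epsilon> * \<kappa>2) + \<kappa>2 * U1 \<kappa>2 / U \<kappa>2 - 1 / 2\<bar> \<le> \<delta>"
    and \<theta>: "2 * kb * \<delta> \<le> \<theta> * \<kappa>1\<^sup>2" "\<rho> = 1 - \<epsilon>\<^sup>2 - \<theta>" "\<rho> > 0"
  shows "\<kappa>1 * (\<kappa>2 - \<kappa>1) \<le> 2 * \<delta> / \<rho>"
proof -
  interpret outgoing_pair \<mu> "\<epsilon> * \<kappa>1" f f1 g g1 by fact
  define M where "M t = t * U1 t / U t - 1 / 2" for t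
  define \<sigma> where "\<sigma> t = k (\<epsilon> * t) + M t" for t
  define \<sigma>' where "\<sigma>' t = ((k (\<epsilon> * t))\<^sup>2 - (M t)\<^sup>2 - t\<^sup>2 * (1 - \<epsilon>\<^sup>2) - (c * (\<epsilon> * t) / p (\<epsilon> * t))\<^sup>2) / t" for t
  have \<delta>0: "\<delta> \<ge> 0" using s1 abs_ge_zero order_trans by blast
  have kb0: "kb \<ge> 0" using k[of "\<epsilon> * \<kappa>1"] \<epsilon> \<kappa> by (auto intro: order_trans)
  have d\<sigma>: "(\<sigma> has_real_derivative \<sigma>' t) (at t)" if t: "\<kappa>1 < t" "t < \<kappa>2" for t
  proof -
    have t0: "t > 0" "\<epsilon> * t > \<epsilon> * \<kappa>1" "U t \<noteq> 0" using t \<kappa> \<epsilon> nz[of t] by auto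
    have pt: "p (\<epsilon> * t) > 0" using p[of "\<epsilon> * t"] t0 by simp
    have "((\<lambda>t. k (\<epsilon> * t)) has_real_derivative
        ((k (\<epsilon> * t))\<^sup>2 - (\<mu> + 1 / 4) + (\<epsilon> * t)\<^sup>2 - (c * (\<epsilon> * t) / p (\<epsilon> * t))\<^sup>2) / (\<epsilon> * t) * \<epsilon>) (at t)"
      by (rule DERIV_chain2[where f = k and g = "\<lambda>t. \<epsilon> * t", OF k_deriv[OF t0(2) pt]]) (auto intro!: derivative_eq_intros)
    moreover have "(M has_real_derivative ((\<mu> + 1 / 4) - t\<^sup>2 - (M t)\<^sup>2) / t) (at t)"
    proof -
      have "(M has_real_derivative ((1 * U1 t + - qpot \<mu> t * U t * t) * U t - t * U1 t * U1 t) / (U t * U t)) (at t)"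
        unfolding M_def[abs_def] using t0 osc_all_deriv[OF U t0(1)]
        by (auto intro!: derivative_eq_intros)
      moreover have "((1 * U1 t + - qpot \<mu> t * U t * t) * U t - t * U1 t * U1 t) / (U t * U t) = ((\<mu> + 1 / 4) - t\<^sup>2 - (M t)\<^sup>2) / t"
        using t0 unfolding M_def qpot_def by (simp add: divide_simps power2_eq_square) (simp add: algebra_simps)
      ultimately show ?thesis by simp
    qed
    ultimately have "(\<sigma> has_real_derivative ((k (\<epsilon> * t))\<^sup>2 - (\<mu> + 1 / 4) + (\<epsilon> * t)\<^sup>2 - (c * (\<epsilon> * t) / p (\<epsilon> * t))\<^sup>2) / (\<epsilon> * t) * \<epsilon>
      + ((\<mu> + 1 / 4) - t\<^sup>2 - (M t)\<^sup>2) / t) (at t)"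
      unfolding \<sigma>_def[abs_def] by (rule DERIV_add)
    moreover have "(x - (\<mu> + 1 / 4) + (\<epsilon> * t)\<^sup>2 - y) / (\<epsilon> * t) * \<epsilon> + ((\<mu> + 1 / 4) - t\<^sup>2 - z) / t
      = (x - z - t\<^sup>2 * (1 - \<epsilon>\<^sup>2) - y) / t" for x y z
      using t0 \<epsilon> by (simp add: field_simps power2_eq_square)
    ultimately show ?thesis by (simp only: \<sigma>'_def)
  qed
  \<comment> \<open>Substituting M = \<sigma> - k turns k^2 - M^2 into 2 k \<sigma> - \<sigma>^2;
    the flux term has the favourable sign and is dropped.\<close>
  have \<sigma>'_le: "\<sigma>' t \<le> (2 * k (\<epsilon> * t) * \<sigma> t - (\<sigma> t)\<^sup>2 - t\<^sup>2 * (1 - \<epsilon>\<^sup>2)) / t" if "\<kappa>1 < t" for t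
  proof -
    have M: "M t = \<sigma> t - k (\<epsilon> * t)" by (simp add: \<sigma>_def)
    have "(k (\<epsilon> * t))\<^sup>2 - (M t)\<^sup>2 - t\<^sup>2 * (1 - \<epsilon>\<^sup>2) - (c * (\<epsilon> * t) / p (\<epsilon> * t))\<^sup>2
      \<le> 2 * k (\<epsilon> * t) * \<sigma> t - (\<sigma> t)\<^sup>2 - t\<^sup>2 * (1 - \<epsilon>\<^sup>2)"
      unfolding M using zero_le_power2[of "c * (\<epsilon> * t) / p (\<epsilon> * t)"] by (simp add: power2_eq_square algebra_simps)
    thus ?thesis unfolding \<sigma>'_def using that \<kappa> by (intro divide_right_mono) auto
  qed
  have kt: "0 \<le> k (\<epsilon> * t)" "k (\<epsilon> * t) \<le> kb" if "\<kappa>1 \<le> t" "t \<le> \<kappa>2" for t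
    using k[of "\<epsilon> * t"] that \<epsilon> by auto
  have cont: "continuous_on {\<kappa>1..\<kappa>2} \<sigma>"
  proof -
    have "continuous_on {\<epsilon> * \<kappa>1..} k" by (rule k_cont) (use p in force)+
    hence "continuous_on {\<kappa>1..\<kappa>2} (\<lambda>t. k (\<epsilon> * t))"
      by (rule continuous_on_compose2) (use \<epsilon> in \<open>auto intro!: continuous_intros\<close>)
    moreover have "continuous_on {\<kappa>1..\<kappa>2} U"
      by (rule osc_all_cont(1)[OF U]) (use \<kappa> in auto)
    moreover have "continuous_on {\<kappa>1..\<kappa>2} U1"
      by (rule osc_all_cont(2)[OF U]) (use \<kappa> in auto)
    ultimately show ?thesis
      unfolding \<sigma>_def[abs_def] M_def
      by (intro continuous_on_add continuous_on_diff continuous_on_divide continuous_on_mult continuous_on_id continuous_on_const)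
        (use nz in auto)
  qed
  have \<rho>': "1 - \<epsilon>\<^sup>2 = \<rho> + \<theta>" using \<theta> by simp
  have below: "\<sigma> t \<le> \<delta>" if t: "\<kappa>1 \<le> t" "t \<le> \<kappa>2" for t
  proof (rule barrier[where a = \<kappa>1 and b = t and \<sigma> = \<sigma> and \<delta> = \<delta> and \<sigma>' = \<sigma>' and L = "2 * kb / \<kappa>1"])
    show "continuous_on {\<kappa>1..t} \<sigma>" by (rule continuous_on_subset[OF cont]) (use t in auto)
    show "\<sigma> \<kappa>1 \<le> \<delta>" using s1 by (simp add: \<sigma>_def M_def abs_le_iff)
    fix r assume r: "\<kappa>1 < r" "r < t"
    show "(\<sigma> has_real_derivative \<sigma>' r) (at r)" using d\<sigma> r t by auto
    assume gt: "\<sigma> r > \<delta>"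
    have r0: "r > 0" using r \<kappa> by simp
    have "\<sigma>' r \<le> (2 * k (\<epsilon> * r) * \<sigma> r - (\<sigma> r)\<^sup>2 - r\<^sup>2 * (1 - \<epsilon>\<^sup>2)) / r" by (rule \<sigma>'_le[OF r(1)])
    also have "\<dots> \<le> (2 * kb * \<sigma> r - r\<^sup>2 * \<theta>) / r"
    proof (rule divide_right_mono)
      have "2 * k (\<epsilon> * r) * \<sigma> r \<le> 2 * kb * \<sigma> r" using kt[of r] r t gt \<delta>0 by (intro mult_right_mono) auto
      moreover have "r\<^sup>2 * \<theta> \<le> r\<^sup>2 * (1 - \<epsilon>\<^sup>2)" unfolding \<rho>' using \<theta>(3) by (intro mult_left_mono) auto
      ultimately show "2 * k (\<epsilon> * r) * \<sigma> r - (\<sigma> r)\<^sup>2 - r\<^sup>2 * (1 - \<epsilon>\<^sup>2) \<le> 2 * kb * \<sigma> r - r\<^sup>2 * \<theta>"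
        using zero_le_power2[of "\<sigma> r"] by linarith
    qed (use r0 in simp)
    also have "\<dots> = 2 * kb * \<sigma> r / r - r * \<theta>" using r0 by (simp add: field_simps power2_eq_square)
    also have "\<dots> \<le> 2 * kb * \<sigma> r / \<kappa>1 - \<kappa>1 * \<theta>"
    proof -
      have "2 * kb * \<sigma> r / r \<le> 2 * kb * \<sigma> r / \<kappa>1"
        using r \<kappa> kb0 gt \<delta>0 by (intro divide_left_mono mult_nonneg_nonneg) auto
      moreover have "\<theta> \<ge> 0"
      proof -
        have "0 \<le> 2 * kb * \<delta>" using kb0 \<delta>0 by simp
        hence "0 \<le> \<theta> * \<kappa>1\<^sup>2" using \<theta>(1) by linarith
        thus ?thesis using \<kappa> by (simp add: zero_le_mult_iff)
      qed
      hence "\<kappa>1 * \<theta> \<le> r * \<theta>" using r by (intro mult_right_mono) auto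
      ultimately show ?thesis by linarith
    qed
    also have "\<dots> \<le> 2 * kb * \<sigma> r / \<kappa>1 - 2 * kb * \<delta> / \<kappa>1"
      using \<theta>(1) \<kappa> by (simp add: field_simps power2_eq_square)
    also have "\<dots> = 2 * kb / \<kappa>1 * (\<sigma> r - \<delta>)" by (simp add: diff_divide_distrib algebra_simps)
    finally show "\<sigma>' r \<le> 2 * kb / \<kappa>1 * (\<sigma> r - \<delta>)" .
  qed (use t in auto)
  have slope: "\<sigma>' t \<le> - (\<rho> * \<kappa>1)" if t: "\<kappa>1 < t" "t < \<kappa>2" for t
  proof -
    have t0: "t > 0" using t \<kappa> by simp
    have "2 * k (\<epsilon> * t) * \<sigma> t - (\<sigma> t)\<^sup>2 \<le> \<theta> * t\<^sup>2"
    proof (cases "\<sigma> t \<ge> 0")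
      case True
      have "2 * k (\<epsilon> * t) * \<sigma> t \<le> 2 * kb * \<delta>"
        using kt[of t] t below[of t] True kb0 by (intro mult_mono) auto
      also have "\<dots> \<le> \<theta> * \<kappa>1\<^sup>2" by (rule \<theta>(1))
      also have "\<dots> \<le> \<theta> * t\<^sup>2"
      proof (rule mult_left_mono)
        show "\<kappa>1\<^sup>2 \<le> t\<^sup>2" using t \<kappa> by (intro power_mono) auto
        have "0 \<le> 2 * kb * \<delta>" using kb0 \<delta>0 by simp
        hence "0 \<le> \<theta> * \<kappa>1\<^sup>2" using \<theta>(1) by linarith
        thus "0 \<le> \<theta>" using \<kappa> by (simp add: zero_le_mult_iff)
      qed
      finally show ?thesis using zero_le_power2[of "\<sigma> t"] by linarith
    next
      case False
      have "2 * k (\<epsilon> * t) * \<sigma> t \<le> 0" using kt[of t] t False by (simp add: mult_nonneg_nonpos)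
      moreover have "0 \<le> \<theta> * t\<^sup>2"
      proof -
        have "0 \<le> 2 * kb * \<delta>" using kb0 \<delta>0 by simp
        hence "0 \<le> \<theta> * \<kappa>1\<^sup>2" using \<theta>(1) by linarith
        thus ?thesis using \<kappa> by (simp add: zero_le_mult_iff)
      qed
      ultimately show ?thesis using zero_le_power2[of "\<sigma> t"] by linarith
    qed
    hence "2 * k (\<epsilon> * t) * \<sigma> t - (\<sigma> t)\<^sup>2 - t\<^sup>2 * (1 - \<epsilon>\<^sup>2) \<le> - (\<rho> * t\<^sup>2)"
      unfolding \<rho>' by (simp add: algebra_simps)
    hence "(2 * k (\<epsilon> * t) * \<sigma> t - (\<sigma> t)\<^sup>2 - t\<^sup>2 * (1 - \<epsilon>\<^sup>2)) / t \<le> - (\<rho> * t\<^sup>2) / t"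
      using t0 by (intro divide_right_mono) auto
    also have "\<dots> = - (\<rho> * t)" using t0 by (simp add: power2_eq_square)
    also have "\<dots> \<le> - (\<rho> * \<kappa>1)" using t \<theta>(3) by simp
    finally show ?thesis using \<sigma>'_le[OF t(1)] by linarith
  qed
  have "- (\<sigma> \<kappa>1 + \<rho> * \<kappa>1 * \<kappa>1) \<le> - (\<sigma> \<kappa>2 + \<rho> * \<kappa>1 * \<kappa>2)"
  proof (rule deriv_nonneg_mono[where h = "\<lambda>t. - (\<sigma> t + \<rho> * \<kappa>1 * t)" and h' = "\<lambda>t. - (\<sigma>' t + \<rho> * \<kappa>1)"])
    show "continuous_on {\<kappa>1..\<kappa>2} (\<lambda>t. - (\<sigma> t + \<rho> * \<kappa>1 * t))" by (intro continuous_intros cont)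
    fix t assume t: "\<kappa>1 < t" "t < \<kappa>2"
    show "((\<lambda>t. - (\<sigma> t + \<rho> * \<kappa>1 * t)) has_real_derivative - (\<sigma>' t + \<rho> * \<kappa>1)) (at t)"
      using d\<sigma>[OF t] by (auto intro!: derivative_eq_intros)
    show "0 \<le> - (\<sigma>' t + \<rho> * \<kappa>1)" using slope[OF t] by simp
  qed (use \<kappa> in simp)
  moreover have "\<sigma> \<kappa>1 \<le> \<delta>" "- \<delta> \<le> \<sigma> \<kappa>2" using s1 s2 by (simp_all add: \<sigma>_def M_def abs_le_iff)
  ultimately have "\<rho> * (\<kappa>1 * (\<kappa>2 - \<kappa>1)) \<le> 2 * \<delta>" by (simp add: algebra_simps)
  thus ?thesis using \<theta>(3) by (simp add: field_simps)
qed

section \<open>Covering the resonant frequencies by intervals\<close>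

lemma cover_small_diameter:
  fixes A :: "real set"
  assumes A: "A \<subseteq> {y..}" and y: "y > 0" and e: "e \<ge> 0"
    and diam: "\<And>s t. s \<in> A \<Longrightarrow> t \<in> A \<Longrightarrow> s < t \<Longrightarrow> t - s \<le> e"
  shows "\<exists>I\<in>sets borel. A \<subseteq> I \<and> I \<subseteq> {0<..} \<and> emeasure lborel I \<le> ennreal e"
proof (cases "A = {}")
  case True
  thus ?thesis by (intro bexI[of _ "{}"]) auto
next
  case False
  have bdd: "bdd_below A" using A by (intro bdd_belowI[of _ y]) auto
  have "y \<le> Inf A" using False A by (intro cInf_greatest) auto
  moreover have "t \<le> Inf A + e" if "t \<in> A" for t
  proof -
    have "t - e \<le> Inf A"
    proof (rule cInf_greatest[OF False])
      fix s assume "s \<in> A"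
      thus "t - e \<le> s" using diam[of s t] that e by (cases "s < t") auto
    qed
    thus ?thesis by simp
  qed
  moreover have "Inf A \<le> t" if "t \<in> A" for t using that bdd by (rule cInf_lower)
  ultimately show ?thesis
    using y e by (intro bexI[of _ "{Inf A..Inf A + e}"]) (auto simp: emeasure_lborel_Icc_eq)
qed

lemma sum_inverse_le_ln:
  fixes y :: real
  assumes "y > 0"
  shows "(\<Sum>j\<le>J. 1 / (y + real j)) \<le> 1 / y + ln ((y + real J) / y)"
proof (induction J)
  case 0
  thus ?case using assms by simp
next
  case (Suc J)
  have pos: "y + real J > 0" using assms by (simp add: add_pos_nonneg)
  have "1 / (y + real (Suc J)) \<le> ln ((y + real (Suc J)) / (y + real J))"
  proof -
    have "ln ((y + real J) / (y + real (Suc J))) \<le> (y + real J) / (y + real (Suc J)) - 1"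
      using pos by (intro ln_le_minus_one) auto
    also have "\<dots> = - (1 / (y + real (Suc J)))" using pos by (simp add: field_simps)
    finally show ?thesis using pos by (simp add: ln_div)
  qed
  moreover have "ln ((y + real (Suc J)) / y) = ln ((y + real J) / y) + ln ((y + real (Suc J)) / (y + real J))"
    using pos assms by (simp add: ln_div)
  ultimately show ?case using Suc by simp
qed

text \<open>A unit cell starting at lo + j contains at most one zero, so S splits there into two
  pieces of diameter at most d / (lo + j); the sum over the cells is a harmonic sum.\<close>

lemma cover_cells:
  fixes S :: "real set" and Z :: "real \<Rightarrow> bool"
  assumes lo: "lo > 0" and d: "d \<ge> 0" and S: "S \<subseteq> {lo..hi}" and SZ: "\<And>s. s \<in> S \<Longrightarrow> \<not> Z s"
    and Z: "\<And>z1 z2. lo \<le> z1 \<Longrightarrow> z1 < z2 \<Longrightarrow> z2 - z1 \<le> 1 \<Longrightarrow> Z z1 \<Longrightarrow> Z z2 \<Longrightarrow> False"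
    and dist: "\<And>s t. s \<in> S \<Longrightarrow> t \<in> S \<Longrightarrow> s < t \<Longrightarrow> (\<And>z. s \<le> z \<Longrightarrow> z \<le> t \<Longrightarrow> \<not> Z z) \<Longrightarrow> s * (t - s) \<le> d"
    and B: "lo \<le> hi \<Longrightarrow> 2 * d * (1 / lo + ln (hi / lo)) \<le> B"
  shows "\<exists>I\<in>sets borel. S \<subseteq> I \<and> I \<subseteq> {0<..} \<and> emeasure lborel I \<le> ennreal B"
proof (cases "lo \<le> hi")
  case False
  thus ?thesis using S by (intro bexI[of _ "{}"]) auto
next
  case True
  define J where "J = nat \<lfloor>hi - lo\<rfloor>"
  have J: "real J \<le> hi - lo" "hi - lo < real J + 1" using True by (auto simp: J_def)
  define cell where "cell j = {lo + real j..<lo + real j + 1}" for j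
  have pos: "lo + real j > 0" for j using lo by (simp add: add_pos_nonneg)
  have "\<exists>I\<in>sets borel. S \<inter> cell j \<subseteq> I \<and> I \<subseteq> {0<..} \<and> emeasure lborel I \<le> ennreal (2 * d * (1 / (lo + real j)))" for j
  proof -
    let ?y = "lo + real j"
    have diam: "t - s \<le> d / ?y" if "s \<in> S \<inter> cell j" "t \<in> S \<inter> cell j" "s < t" "\<And>z. s \<le> z \<Longrightarrow> z \<le> t \<Longrightarrow> \<not> Z z" for s t
    proof -
      have "?y * (t - s) \<le> s * (t - s)" using that by (intro mult_right_mono) (auto simp: cell_def)
      also have "\<dots> \<le> d" using that by (intro dist) auto
      finally show ?thesis using pos[of j] by (simp add: field_simps)
    qed
    have e0: "d / ?y \<ge> 0" using d pos[of j] by simp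
    \<comment> \<open>If the cell contains no zero, any number serves as z.\<close>
    obtain z where z: "\<And>z'. z' \<in> cell j \<Longrightarrow> Z z' \<Longrightarrow> z' = z"
    proof (cases "\<exists>z\<in>cell j. Z z")
      case True
      then obtain z where z: "z \<in> cell j" "Z z" by blast
      have "z' = z" if "z' \<in> cell j" "Z z'" for z'
        using Z[of z z'] Z[of z' z] z that by (cases z z' rule: linorder_cases) (auto simp: cell_def)
      thus ?thesis by (rule that)
    qed (use that in blast)
    have sub: "S \<inter> cell j \<inter> {..<z} \<subseteq> {?y..}" "S \<inter> cell j \<inter> {z<..} \<subseteq> {?y..}" by (auto simp: cell_def)
    obtain I1 where I1: "I1 \<in> sets borel" "S \<inter> cell j \<inter> {..<z} \<subseteq> I1" "I1 \<subseteq> {0<..}" "emeasure lborel I1 \<le> ennreal (d / ?y)"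
    proof -
      have "t - s \<le> d / ?y" if "s \<in> S \<inter> cell j \<inter> {..<z}" "t \<in> S \<inter> cell j \<inter> {..<z}" "s < t" for s t
      proof (rule diam)
        fix za assume za: "s \<le> za" "za \<le> t"
        show "\<not> Z za"
        proof
          assume "Z za"
          hence "za = z" using that za by (intro z) (auto simp: cell_def)
          thus False using that za by auto
        qed
      qed (use that in auto)
      from cover_small_diameter[OF sub(1) pos e0 this] that show ?thesis by blast
    qed
    obtain I2 where I2: "I2 \<in> sets borel" "S \<inter> cell j \<inter> {z<..} \<subseteq> I2" "I2 \<subseteq> {0<..}" "emeasure lborel I2 \<le> ennreal (d / ?y)"
    proof -
      have "t - s \<le> d / ?y" if "s \<in> S \<inter> cell j \<inter> {z<..}" "t \<in> S \<inter> cell j \<inter> {z<..}" "s < t" for s t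
      proof (rule diam)
        fix za assume za: "s \<le> za" "za \<le> t"
        show "\<not> Z za"
        proof
          assume "Z za"
          hence "za = z" using that za by (intro z) (auto simp: cell_def)
          thus False using that za by auto
        qed
      qed (use that in auto)
      from cover_small_diameter[OF sub(2) pos e0 this] that show ?thesis by blast
    qed
    show ?thesis
    \<comment> \<open>If z lies in S it is not a zero, so the cell contains none and one interval
      covers all of it. Otherwise removing z loses no point of S.\<close>
    proof (cases "z \<in> S \<inter> cell j")
      case False
      have "emeasure lborel (I1 \<union> I2) \<le> ennreal (d / ?y) + ennreal (d / ?y)"
        using I1 I2 by (intro order_trans[OF emeasure_subadditive] add_mono) auto
      also have "\<dots> = ennreal (2 * d * (1 / ?y))" using e0 by (simp add: ennreal_plus[symmetric] del: ennreal_plus)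
      finally have "emeasure lborel (I1 \<union> I2) \<le> ennreal (2 * d * (1 / ?y))" .
      moreover have "S \<inter> cell j \<subseteq> I1 \<union> I2"
      proof
        fix s assume s: "s \<in> S \<inter> cell j"
        thus "s \<in> I1 \<union> I2" using I1(2) I2(2) False by (cases s z rule: linorder_cases) auto
      qed
      ultimately show ?thesis using I1 I2 by (intro bexI[of _ "I1 \<union> I2"]) auto
    next
      case True
      hence nz: "\<not> Z z'" if "z' \<in> cell j" for z' using z[OF that] SZ by auto
      have "t - s \<le> d / ?y" if "s \<in> S \<inter> cell j" "t \<in> S \<inter> cell j" "s < t" for s t
        using that nz by (intro diam) (auto simp: cell_def)
      moreover have "S \<inter> cell j \<subseteq> {?y..}" by (auto simp: cell_def)
      ultimately obtain I where "I \<in> sets borel" "S \<inter> cell j \<subseteq> I" "I \<subseteq> {0<..}" "emeasure lborel I \<le> ennreal (d / ?y)"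
        using cover_small_diameter[OF _ pos e0, of "S \<inter> cell j" j] by blast
      moreover have "ennreal (d / ?y) \<le> ennreal (2 * d * (1 / ?y))" using e0 by (intro ennreal_leI) simp
      ultimately show ?thesis by (meson order_trans)
    qed
  qed
  then obtain I where I: "\<And>j. I j \<in> sets borel" "\<And>j. S \<inter> cell j \<subseteq> I j" "\<And>j. I j \<subseteq> {0<..}"
    "\<And>j. emeasure lborel (I j) \<le> ennreal (2 * d * (1 / (lo + real j)))" by metis
  have "S \<subseteq> (\<Union>j\<le>J. I j)"
  proof
    fix s assume s: "s \<in> S"
    define j where "j = nat \<lfloor>s - lo\<rfloor>"
    have sl: "lo \<le> s" "s \<le> hi" using S s by auto
    have jr: "real j = of_int \<lfloor>s - lo\<rfloor>" using sl by (simp add: j_def)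
    have "of_int \<lfloor>s - lo\<rfloor> \<le> s - lo" "s - lo < of_int \<lfloor>s - lo\<rfloor> + 1" by linarith+
    hence "s \<in> cell j" unfolding cell_def jr atLeastLessThan_iff by linarith
    moreover have "j \<le> J" unfolding j_def J_def using sl by (intro nat_mono floor_mono) auto
    ultimately show "s \<in> (\<Union>j\<le>J. I j)" using I(2)[of j] s by auto
  qed
  moreover have "emeasure lborel (\<Union>j\<le>J. I j) \<le> ennreal B"
  proof -
    have "emeasure lborel (\<Union>j\<le>J. I j) \<le> (\<Sum>j\<le>J. emeasure lborel (I j))"
      using I(1) by (intro emeasure_subadditive_finite) auto
    also have "\<dots> \<le> (\<Sum>j\<le>J. ennreal (2 * d * (1 / (lo + real j))))" by (intro sum_mono I(4))
    also have "\<dots> = ennreal (2 * d * (\<Sum>j\<le>J. 1 / (lo + real j)))"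
      using d pos by (subst sum_ennreal) (auto simp: sum_distrib_left less_imp_le)
    also have "\<dots> \<le> ennreal B"
    proof (rule ennreal_leI)
      have "(\<Sum>j\<le>J. 1 / (lo + real j)) \<le> 1 / lo + ln ((lo + real J) / lo)" by (rule sum_inverse_le_ln[OF lo])
      also have "\<dots> \<le> 1 / lo + ln (hi / lo)"
        using J lo by (intro add_left_mono ln_mono divide_right_mono) auto
      finally have "2 * d * (\<Sum>j\<le>J. 1 / (lo + real j)) \<le> 2 * d * (1 / lo + ln (hi / lo))"
        using d by (intro mult_left_mono) auto
      thus "2 * d * (\<Sum>j\<le>J. 1 / (lo + real j)) \<le> B" using B[OF True] by linarith
    qed
    finally show ?thesis .
  qed
  moreover have "(\<Union>j\<le>J. I j) \<subseteq> {0<..}" using I(3) by auto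
  ultimately show ?thesis using I(1) by (intro bexI[of _ "\<Union>j\<le>J. I j"]) auto
qed

section \<open>Consequences of the matching condition at the interface\<close>

context outgoing_pair
begin

definition \<gamma> where "\<gamma> U U1 = Complex (gr U U1) (gi U U1)"

text \<open>The matching ratio is real, so the total field w carries no flux: Im (cnj w w') = 0.
  Expanding into scattered and incident parts, the scattered flux c is minus an interference term of
  size at most |a| |\<gamma>|.\<close>

lemma incident_energy_bound:
  assumes U: "U \<kappa> \<noteq> 0 \<or> U1 \<kappa> \<noteq> (0::real)"
    and match: "of_real x0 * (Complex (f1 x0) (g1 x0) + a * of_real (U1 x0)) * of_real (U \<kappa>)
      = of_real (\<kappa> * U1 \<kappa>) * (Complex (f x0) (g x0) + a * of_real (U x0))" and \<kappa>: "\<kappa> > 0"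
  shows "c \<le> cmod a * cmod (\<gamma> U U1)"
proof -
  define w where "w = Complex (f x0) (g x0) + a * of_real (U x0)"
  define w1 where "w1 = Complex (f1 x0) (g1 x0) + a * of_real (U1 x0)"
  have m: "of_real x0 * w1 * of_real (U \<kappa>) = of_real (\<kappa> * U1 \<kappa>) * w"
    using match by (simp add: w_def w1_def)
  have "Im (cnj w * w1) = 0"
  proof (cases "U \<kappa> = 0")
    case True
    hence "w = 0" using m U \<kappa> by simp
    thus ?thesis by simp
  next
    case False
    define r where "r = \<kappa> * U1 \<kappa> / (x0 * U \<kappa>)"
    have "w1 = of_real r * w"
      using m False x0 by (simp add: r_def field_simps)
    hence "cnj w * w1 = of_real (r * (cmod w)\<^sup>2)"
      by (simp add: complex_norm_square mult_ac del: of_real_power)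
    thus ?thesis by simp
  qed
  moreover have "Im (cnj w * w1) = c + Im (cnj a * \<gamma> U U1)"
    unfolding w_def w1_def \<gamma>_def gr_def gi_def c_def by (simp add: algebra_simps)
  ultimately have "c = - Im (cnj a * \<gamma> U U1)" by simp
  also have "\<dots> \<le> cmod (cnj a * \<gamma> U U1)"
    using abs_Im_le_cmod[of "cnj a * \<gamma> U U1"] by linarith
  finally show ?thesis by (simp add: norm_mult)
qed

text \<open>Combining the matching condition with the wronskian gives w (x u' - r u) = x a \<gamma>
  with r = \<kappa> U'(\<kappa>) / U(\<kappa>), and Re (cnj u (x u' - r u)) = -p \<sigma>. The total
  field can therefore be large only where \<sigma> is small.\<close>

lemma total_field_bound:
  assumes U: "U \<kappa> \<noteq> (0::real)" and p: "p x0 > 0"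
    and match: "of_real x0 * (Complex (f1 x0) (g1 x0) + a * of_real (U1 x0)) * of_real (U \<kappa>)
      = of_real (\<kappa> * U1 \<kappa>) * (Complex (f x0) (g x0) + a * of_real (U x0))"
  shows "cmod (Complex (f x0) (g x0) + a * of_real (U x0)) * sqrt (p x0) * \<bar>k x0 + \<kappa> * U1 \<kappa> / U \<kappa> - 1 / 2\<bar>
    \<le> x0 * cmod a * cmod (\<gamma> U U1)"
proof -
  define u where "u = Complex (f x0) (g x0)"
  define u1 where "u1 = Complex (f1 x0) (g1 x0)"
  define w where "w = u + a * of_real (U x0)"
  define r where "r = \<kappa> * U1 \<kappa> / U \<kappa>"
  have cu: "cmod u = sqrt (p x0)" by (simp add: u_def p_def cmod_def)
  have g: "\<gamma> U U1 = u1 * of_real (U x0) - of_real (U1 x0) * u"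
    by (simp add: \<gamma>_def gr_def gi_def u_def u1_def complex_eq_iff)
  have m: "of_real x0 * (u1 + a * of_real (U1 x0)) = of_real r * w"
    using match U unfolding r_def w_def u_def u1_def by (simp add: field_simps)
  have id: "w * (of_real x0 * u1 - of_real r * u) = of_real x0 * a * \<gamma> U U1"
  proof -
    have "w * (of_real x0 * u1 - of_real r * u) = of_real x0 * u1 * w - (of_real r * w) * u" by (simp add: algebra_simps)
    also have "\<dots> = of_real x0 * u1 * w - (of_real x0 * (u1 + a * of_real (U1 x0))) * u" by (simp only: m)
    also have "\<dots> = of_real x0 * a * \<gamma> U U1" unfolding g w_def by (simp add: algebra_simps)
    finally show ?thesis .
  qed
  have "Re (cnj u * (of_real x0 * u1 - of_real r * u)) = - (p x0 * (k x0 + r - 1 / 2))"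
    using p unfolding k_def p1_def by (simp add: u_def u1_def p_def field_simps power2_eq_square)
  hence "p x0 * \<bar>k x0 + r - 1 / 2\<bar> \<le> cmod (cnj u * (of_real x0 * u1 - of_real r * u))"
    using abs_Re_le_cmod[of "cnj u * (of_real x0 * u1 - of_real r * u)"] p by (simp add: abs_mult)
  hence "sqrt (p x0) * (sqrt (p x0) * \<bar>k x0 + r - 1 / 2\<bar>) \<le> sqrt (p x0) * cmod (of_real x0 * u1 - of_real r * u)"
    using p by (simp add: norm_mult cu mult.assoc[symmetric])
  hence "sqrt (p x0) * \<bar>k x0 + r - 1 / 2\<bar> \<le> cmod (of_real x0 * u1 - of_real r * u)"
    using p by simp
  hence "cmod w * (sqrt (p x0) * \<bar>k x0 + r - 1 / 2\<bar>) \<le> cmod w * cmod (of_real x0 * u1 - of_real r * u)"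
    by (intro mult_left_mono) auto
  also have "\<dots> = x0 * cmod a * cmod (\<gamma> U U1)"
    using arg_cong[OF id, of cmod] x0 by (simp add: norm_mult)
  finally show ?thesis by (simp add: w_def u_def r_def mult.assoc)
qed

text \<open>To the right of t the quantity U^2 + U'^2 / q decreases because q increases. It equals
  U(t)^2 at the critical point and |\<gamma>|^2 / c at infinity, so one value of U controls the
  asymptotic amplitude.\<close>

lemma energy_limit_le_critical:
  assumes U: "osc_all \<mu> U U1" and c: "c > 0" and mu: "\<mu> \<ge> 0" and t: "t > 0" "\<mu> < t\<^sup>2" "U1 t = 0"
  shows "(cmod (\<gamma> U U1))\<^sup>2 \<le> c * (U t)\<^sup>2"
proof -
  have q0: "qpot \<mu> s > 0" if "s \<ge> t" for s
  proof -
    have "t\<^sup>2 \<le> s\<^sup>2" using that t by (intro power_mono) auto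
    hence "\<mu> < s\<^sup>2" using t by linarith
    thus ?thesis using that t by (simp add: qpot_def)
  qed
  let ?h = "\<lambda>s. (U s)\<^sup>2 + (U1 s)\<^sup>2 / qpot \<mu> s"
  have "((\<lambda>s. ((U s)\<^sup>2 + (U1 s)\<^sup>2) + (U1 s)\<^sup>2 * (inverse (qpot \<mu> s) - 1)) \<longlongrightarrow> (cmod (\<gamma> U U1))\<^sup>2 / c + 0) at_top"
  proof (intro tendsto_add)
    show "((\<lambda>s. (U s)\<^sup>2 + (U1 s)\<^sup>2) \<longlongrightarrow> (cmod (\<gamma> U U1))\<^sup>2 / c) at_top"
      using real_energy_lim[OF U c] by (simp add: \<gamma>_def cmod_power2)
    obtain B where B: "\<And>s. s \<ge> 1 \<Longrightarrow> \<bar>U s\<bar> \<le> B \<and> \<bar>U1 s\<bar> \<le> B" using osc_all_bounded[OF U] by blast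
    have "((\<lambda>s. inverse (qpot \<mu> s) - 1) \<longlongrightarrow> inverse 1 - 1) at_top"
      by (intro tendsto_intros qpot_tendsto) simp
    hence l: "((\<lambda>s. inverse (qpot \<mu> s) - 1) \<longlongrightarrow> 0) at_top" by simp
    show "((\<lambda>s. (U1 s)\<^sup>2 * (inverse (qpot \<mu> s) - 1)) \<longlongrightarrow> 0) at_top"
    proof (rule tendsto_0_le[OF l, of _ "B\<^sup>2"])
      show "\<forall>\<^sub>F s in at_top. norm ((U1 s)\<^sup>2 * (inverse (qpot \<mu> s) - 1)) \<le> norm (inverse (qpot \<mu> s) - 1) * B\<^sup>2"
        using eventually_ge_at_top[of 1]
      proof eventually_elim
        case (elim s)
        have "(U1 s)\<^sup>2 \<le> B\<^sup>2" using B[OF elim] abs_le_square_iff[of "U1 s" B] by (auto intro: order_trans[OF _ abs_ge_self])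
        from mult_right_mono[OF this, of "\<bar>inverse (qpot \<mu> s) - 1\<bar>"] show ?case
          by (simp add: abs_mult mult.commute)
      qed
    qed
  qed
  moreover have "((U s)\<^sup>2 + (U1 s)\<^sup>2) + (U1 s)\<^sup>2 * (inverse (qpot \<mu> s) - 1) = ?h s" for s
    by (simp add: divide_inverse algebra_simps)
  ultimately have lim: "(?h \<longlongrightarrow> (cmod (\<gamma> U U1))\<^sup>2 / c) at_top" by simp
  have "(cmod (\<gamma> U U1))\<^sup>2 / c \<le> ?h t"
  proof (rule ray_ge_limit[where h = ?h and x = t and h' = "\<lambda>s. - (2 * \<mu> / s ^ 3) * (U1 s)\<^sup>2 / (qpot \<mu> s)\<^sup>2"])
    have "continuous_on {t..} (qpot \<mu>)" unfolding qpot_def[abs_def] using t by (intro continuous_intros) auto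
    moreover have "\<forall>s\<in>{t..}. qpot \<mu> s \<noteq> 0" using q0 by fastforce
    moreover have "{t..} \<subseteq> {0<..}" using t by auto
    ultimately show "continuous_on {t..} ?h"
      by (intro continuous_on_add continuous_on_divide continuous_on_power osc_all_cont[OF U])
    fix s assume s: "s > t"
    hence s0: "s > 0" using t by simp
    show "(?h has_real_derivative - (2 * \<mu> / s ^ 3) * (U1 s)\<^sup>2 / (qpot \<mu> s)\<^sup>2) (at s)"
      using s0 q0[of s] s osc_all_deriv[OF U s0]
      by (auto intro!: derivative_eq_intros simp: field_simps power2_eq_square)
    show "- (2 * \<mu> / s ^ 3) * (U1 s)\<^sup>2 / (qpot \<mu> s)\<^sup>2 \<le> 0"
      using s0 mu by (simp add: divide_nonpos_nonneg mult_nonpos_nonneg)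
  qed (use lim in auto)
  thus ?thesis using t c by (simp add: field_simps)
qed

end

context outgoing_pos
begin

lemma k_ge_half: "s \<ge> x0 \<Longrightarrow> k s \<ge> 1 / 2"
  using p1_nonpos[of s] p_pos[of s] x0 unfolding k_def
  by (simp add: divide_nonpos_pos mult_nonneg_nonpos)

text \<open>From |u'|^2 + q p \<le> 2 c \<le> 2 p follows |u'|^2 \<le> (2 - q) p, and k - 1/2 is at
  most s |u'| / |u|.\<close>

lemma k_le:
  assumes s: "s \<ge> x0"
  shows "k s \<le> 1 / 2 + sqrt (s\<^sup>2 + \<mu>)"
proof -
  have s0: "s > 0" using s x0 by simp
  define A where "A = f s * f1 s + g s * g1 s"
  have id: "((f1 s)\<^sup>2 + (g1 s)\<^sup>2) * p s = A\<^sup>2 + c\<^sup>2"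
  proof -
    have c: "c = f s * g1 s - g s * f1 s" using wr[of s] s by simp
    show ?thesis unfolding A_def p_def c by (simp add: power2_eq_square algebra_simps)
  qed
  have "(f1 s)\<^sup>2 + (g1 s)\<^sup>2 \<le> (2 - qpot \<mu> s) * p s"
    using F_le[OF mu s] p_ge_c[OF mu s] by (simp add: algebra_simps)
  hence "((f1 s)\<^sup>2 + (g1 s)\<^sup>2) * p s \<le> (2 - qpot \<mu> s) * p s * p s"
    using p_nonneg by (intro mult_right_mono)
  hence "A\<^sup>2 + c\<^sup>2 \<le> (2 - qpot \<mu> s) * (p s)\<^sup>2"
    unfolding id by (simp add: power2_eq_square mult.assoc)
  hence "A\<^sup>2 \<le> (2 - qpot \<mu> s) * (p s)\<^sup>2"
    using zero_le_power2[of c] by linarith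
  hence "s\<^sup>2 * A\<^sup>2 \<le> s\<^sup>2 * ((2 - qpot \<mu> s) * (p s)\<^sup>2)" by (intro mult_left_mono) auto
  also have "\<dots> = (s\<^sup>2 + \<mu>) * (p s)\<^sup>2" using s0 by (simp add: qpot_def field_simps)
  finally have "(s * A)\<^sup>2 \<le> (s\<^sup>2 + \<mu>) * (p s)\<^sup>2" by (simp add: power_mult_distrib)
  hence "sqrt ((s * A)\<^sup>2) \<le> sqrt ((s\<^sup>2 + \<mu>) * (p s)\<^sup>2)" by (rule real_sqrt_le_mono)
  hence "\<bar>s * A\<bar> \<le> sqrt (s\<^sup>2 + \<mu>) * p s" using p_nonneg[of s] by (simp add: real_sqrt_mult)
  hence "- (s * A) \<le> sqrt (s\<^sup>2 + \<mu>) * p s" by (simp add: abs_le_iff)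
  hence "- (s * A) / p s \<le> sqrt (s\<^sup>2 + \<mu>)" using p_pos[OF s] by (simp add: field_simps)
  moreover have p1: "p1 s = 2 * A" by (simp add: p1_def A_def)
  have "k s = 1 / 2 + - (s * A) / p s" unfolding k_def p1 by simp
  ultimately show ?thesis by simp
qed

end

section \<open>Bessel functions\<close>

definition bcoeff :: "nat \<Rightarrow> nat \<Rightarrow> real" where
  "bcoeff N k = (-1) ^ k / (fact k * fact (k + N))"

text \<open>The entire factor of J_N in the variable z = x^2 / 4; in this form differentiation only
  shifts the order, up to sign.\<close>

definition bser :: "nat \<Rightarrow> real \<Rightarrow> real" where
  "bser N z = (\<Sum>k. bcoeff N k * z ^ k)"

lemma bser_summable: "summable (\<lambda>k. bcoeff N k * z ^ k)"
proof (rule summable_comparison_test')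
  show "summable (\<lambda>k. \<bar>z\<bar> ^ k / fact k)"
    using summable_exp_generic[of "\<bar>z\<bar>"] by (simp add: divide_inverse mult.commute)
  fix k :: nat
  have "1 \<le> (fact (k + N) :: real)" by (rule fact_ge_1)
  hence "fact k * 1 \<le> fact k * (fact (k + N) :: real)" by (intro mult_left_mono) auto
  hence "\<bar>z\<bar> ^ k / (fact k * fact (k + N)) \<le> \<bar>z\<bar> ^ k / fact k"
    by (intro divide_left_mono mult_pos_pos) auto
  thus "norm (bcoeff N k * z ^ k) \<le> \<bar>z\<bar> ^ k / fact k"
    by (simp add: bcoeff_def abs_mult power_abs)
qed

lemma bser_deriv: "(bser N has_real_derivative - bser (Suc N) z) (at z)"
proof -
  have "(bser N has_real_derivative (\<Sum>k. diffs (bcoeff N) k * z ^ k)) (at z)"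
    unfolding bser_def[abs_def] by (rule termdiffs_strong_converges_everywhere) (rule bser_summable)
  moreover have "diffs (bcoeff N) k * z ^ k = - (bcoeff (Suc N) k * z ^ k)" for k
  proof -
    have f: "fact (Suc k) = real (Suc k) * fact k" "k + Suc N = Suc k + N" by simp_all
    have "real (Suc k) * bcoeff N (Suc k) = - bcoeff (Suc N) k"
      unfolding bcoeff_def f(1) f(2) by (simp del: of_nat_Suc fact_Suc)
    thus ?thesis by (simp add: diffs_def del: of_nat_Suc)
  qed
  ultimately show ?thesis by (simp add: bser_def suminf_minus[OF bser_summable])
qed

lemma bser_rec: "z * bser (Suc (Suc N)) z = real (Suc N) * bser (Suc N) z - bser N z"
proof -
  have s: "(\<lambda>k. real (Suc N) * (bcoeff (Suc N) k * z ^ k) - bcoeff N k * z ^ k) sums (real (Suc N) * bser (Suc N) z - bser N z)"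
    unfolding bser_def by (intro sums_diff sums_mult summable_sums bser_summable)
  have "bcoeff N 0 = real (Suc N) * bcoeff (Suc N) 0" by (simp add: bcoeff_def)
  with s have "(\<lambda>k. real (Suc N) * (bcoeff (Suc N) (Suc k) * z ^ Suc k) - bcoeff N (Suc k) * z ^ Suc k) sums
      (real (Suc N) * bser (Suc N) z - bser N z)"
    by (subst sums_Suc_iff) simp
  moreover have "real (Suc N) * (bcoeff (Suc N) (Suc k) * z ^ Suc k) - bcoeff N (Suc k) * z ^ Suc k
      = z * (bcoeff (Suc (Suc N)) k * z ^ k)" for k
  proof -
    have "real (Suc N) * bcoeff (Suc N) (Suc k) - bcoeff N (Suc k) = bcoeff (Suc (Suc N)) k"
    proof -
      define F where "F = (fact (Suc k + N) :: real)"
      have F: "F > 0" by (simp add: F_def)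
      have f: "fact (Suc k) = real (Suc k) * fact k" "Suc k + Suc N = Suc (Suc k + N)" "k + Suc (Suc N) = Suc (Suc k + N)" by simp_all
      have g: "fact (Suc (Suc k + N)) = (real (Suc k) + real (Suc N)) * F"
        unfolding fact_Suc F_def by (simp add: algebra_simps)
      have "bcoeff (Suc N) (Suc k) = - ((-1) ^ k / (real (Suc k) * fact k * ((real (Suc k) + real (Suc N)) * F)))"
        unfolding bcoeff_def f(2) g unfolding f(1) by simp
      moreover have "bcoeff N (Suc k) = - ((-1) ^ k / (real (Suc k) * fact k * F))"
        unfolding bcoeff_def f(1) F_def by simp
      moreover have "bcoeff (Suc (Suc N)) k = (-1) ^ k / (fact k * ((real (Suc k) + real (Suc N)) * F))"
        unfolding bcoeff_def f(3) g by simp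
      moreover have "b * - (e / (a * h * ((a + b) * F))) - - (e / (a * h * F)) = e / (h * ((a + b) * F))"
        if "a > 0" "b > 0" "h > 0" for a b e h :: real
      proof -
        define s where "s = a + b"
        have b: "b = s - a" and s: "s > 0" using that by (auto simp: s_def)
        show ?thesis unfolding s_def[symmetric] unfolding b using s that F by (simp add: divide_simps) (simp add: algebra_simps)
      qed
      ultimately show ?thesis by (simp del: of_nat_Suc)
    qed
    hence "z * (real (Suc N) * bcoeff (Suc N) (Suc k) - bcoeff N (Suc k)) * z ^ k = z * bcoeff (Suc (Suc N)) k * z ^ k" by simp
    thus ?thesis by (simp add: algebra_simps del: of_nat_Suc)
  qed
  ultimately have "(\<lambda>k. z * (bcoeff (Suc (Suc N)) k * z ^ k)) sums (real (Suc N) * bser (Suc N) z - bser N z)"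
    by simp
  moreover have "(\<lambda>k. z * (bcoeff (Suc (Suc N)) k * z ^ k)) sums (z * bser (Suc (Suc N)) z)"
    unfolding bser_def by (intro sums_mult summable_sums bser_summable)
  ultimately show ?thesis by (rule sums_unique2[THEN sym])
qed

definition Jn :: "nat \<Rightarrow> real \<Rightarrow> real" where
  "Jn N x = (x / 2) ^ N * bser N ((x / 2)\<^sup>2)"

lemma bessel_J_nat:
  assumes "x > 0"
  shows "bessel_J (int N) x = Jn N x"
proof -
  have "(-1) ^ k / fact k * rGamma (of_int (int k + int N + 1)) * (x / 2) powi (2 * int k + int N)
      = (x / 2) ^ N * (bcoeff N k * ((x / 2)\<^sup>2) ^ k)" for k
  proof -
    have "of_int (int k + int N + 1) = (1 + of_nat (k + N) :: real)" by simp
    hence "rGamma (of_int (int k + int N + 1) :: real) = inverse (fact (k + N))"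
      by (simp only: rGamma_inverse_Gamma Gamma_fact)
    moreover have "(x / 2) powi (2 * int k + int N) = (x / 2) ^ N * ((x / 2)\<^sup>2) ^ k"
    proof -
      have "2 * int k + int N = int (N + 2 * k)" by simp
      thus ?thesis by (simp only: power_int_of_nat power_add power_mult)
    qed
    ultimately show ?thesis by (simp only: bcoeff_def) (simp add: field_simps)
  qed
  hence "bessel_J (int N) x = (\<Sum>k. (x / 2) ^ N * (bcoeff N k * ((x / 2)\<^sup>2) ^ k))"
    unfolding bessel_J_def by (simp only:)
  also have "\<dots> = (x / 2) ^ N * bser N ((x / 2)\<^sup>2)"
    unfolding bser_def by (rule suminf_mult[OF bser_summable])
  finally show ?thesis by (simp only: Jn_def)
qed

text \<open>The first N terms vanish at the poles of Gamma, among them all terms with negative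
  powers of x. Shifting the index by N leaves the series of order N with the sign (-1)^N.\<close>

lemma bessel_J_neg:
  assumes "x > 0"
  shows "bessel_J (- int N) x = (-1) ^ N * Jn N x"
proof -
  let ?t = "\<lambda>k. (-1) ^ k / fact k * rGamma (of_int (int k + - int N + 1)) * (x / 2) powi (2 * int k + - int N)"
  have z: "?t k = 0" if "k < N" for k
  proof -
    have e: "int k + - int N + 1 = - int (N - Suc k)" using that by simp
    have "of_int (int k + - int N + 1) \<in> (\<int>\<^sub>\<le>\<^sub>0 :: real set)" unfolding e by simp
    hence "rGamma (of_int (int k + - int N + 1) :: real) = 0" by (simp only: rGamma_eq_zero_iff)
    thus ?thesis by simp
  qed
  have t: "?t (k + N) = (-1) ^ N * (x / 2) ^ N * (bcoeff N k * ((x / 2)\<^sup>2) ^ k)" for k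
  proof -
    have "of_int (int (k + N) + - int N + 1) = (1 + of_nat k :: real)" by simp
    hence "rGamma (of_int (int (k + N) + - int N + 1) :: real) = inverse (fact k)"
      by (simp only: rGamma_inverse_Gamma Gamma_fact)
    moreover have "(x / 2) powi (2 * int (k + N) + - int N) = (x / 2) ^ N * ((x / 2)\<^sup>2) ^ k"
    proof -
      have "2 * int (k + N) + - int N = int (N + 2 * k)" by simp
      thus ?thesis by (simp only: power_int_of_nat power_add power_mult)
    qed
    ultimately show ?thesis by (simp only: bcoeff_def power_add) (simp add: field_simps)
  qed
  have "(\<lambda>k. ?t (k + N)) sums ((-1) ^ N * (x / 2) ^ N * bser N ((x / 2)\<^sup>2))"
    unfolding t bser_def by (intro sums_mult summable_sums bser_summable)
  hence "?t sums ((-1) ^ N * (x / 2) ^ N * bser N ((x / 2)\<^sup>2) + (\<Sum>k<N. ?t k))"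
    by (rule iffD1[OF sums_iff_shift[of ?t N]])
  moreover have "(\<Sum>k<N. ?t k) = 0" by (rule sum.neutral) (use z in blast)
  ultimately have "?t sums ((-1) ^ N * (x / 2) ^ N * bser N ((x / 2)\<^sup>2))" by (simp only: add_0_right)
  from sums_unique[OF this] show ?thesis
    unfolding bessel_J_def Jn_def by (simp only: mult.assoc)
qed

lemma Jn_deriv_at_all: "(Jn N has_real_derivative real N * (x / 2) ^ (N - 1) / 2 * bser N ((x / 2)\<^sup>2) - Jn (Suc N) x) (at x)"
proof -
  have "((\<lambda>x. bser N ((x / 2)\<^sup>2)) has_real_derivative - bser (Suc N) ((x / 2)\<^sup>2) * (x / 2)) (at x)"
    by (rule DERIV_chain2[where f = "bser N" and g = "\<lambda>x. (x / 2)\<^sup>2", OF bser_deriv])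
      (auto intro!: derivative_eq_intros)
  moreover have "((\<lambda>x. (x / 2) ^ N) has_real_derivative real N * (x / 2) ^ (N - 1) / 2) (at x)"
    by (auto intro!: derivative_eq_intros)
  ultimately show ?thesis
    unfolding Jn_def[abs_def] by (auto intro!: derivative_eq_intros simp: Jn_def algebra_simps)
qed

lemma Jn_cont: "continuous_on S (Jn N)"
  by (meson DERIV_isCont Jn_deriv_at_all continuous_at_imp_continuous_on)

lemma Jn_deriv: "x > 0 \<Longrightarrow> (Jn N has_real_derivative real N / x * Jn N x - Jn (Suc N) x) (at x)"
proof -
  assume x: "x > 0"
  have "real N * (x / 2) ^ (N - 1) / 2 * bser N ((x / 2)\<^sup>2) = real N / x * Jn N x"
    using x by (cases N) (auto simp: Jn_def)
  thus ?thesis using Jn_deriv_at_all[of N x] by simp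
qed

lemma Jn_Suc_deriv:
  assumes x: "x > 0"
  shows "(Jn (Suc N) has_real_derivative Jn N x - real (Suc N) / x * Jn (Suc N) x) (at x)"
proof -
  have "Jn (Suc (Suc N)) x = (x / 2) ^ N * ((x / 2)\<^sup>2 * bser (Suc (Suc N)) ((x / 2)\<^sup>2))"
    by (simp add: Jn_def power2_eq_square)
  also have "\<dots> = 2 * real (Suc N) / x * Jn (Suc N) x - Jn N x"
    unfolding bser_rec using x by (simp add: Jn_def field_simps)
  finally have "real (Suc N) / x * Jn (Suc N) x - Jn (Suc (Suc N)) x = Jn N x - real (Suc N) / x * Jn (Suc N) x"
    by simp
  with Jn_deriv[OF x, of "Suc N"] show ?thesis by (simp only:)
qed

text \<open>Multiplication by sqrt s removes the first-order term of Bessel's equation and brings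
  J_N into the same form as the scattered coefficients; \<open>JU1\<close> is the
  derivative.\<close>

definition JU :: "nat \<Rightarrow> real \<Rightarrow> real" where
  "JU N s = sqrt s * Jn N s"

definition JU1 :: "nat \<Rightarrow> real \<Rightarrow> real" where
  "JU1 N s = sqrt s * ((real N + 1 / 2) / s * Jn N s - Jn (Suc N) s)"

lemma JU_osc: "osc_all ((real N)\<^sup>2 - 1 / 4) (JU N) (JU1 N)"
  unfolding osc_all_def
proof (intro allI impI conjI)
  fix s :: real assume s: "s > 0"
  have sq: "(sqrt has_real_derivative sqrt s / (2 * s)) (at s)"
    using s by (auto intro!: derivative_eq_intros simp: field_simps)
  show "(JU N has_real_derivative JU1 N s) (at s)"
  proof -
    have "(JU N has_real_derivative sqrt s / (2 * s) * Jn N s + (real N / s * Jn N s - Jn (Suc N) s) * sqrt s) (at s)"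
      unfolding JU_def[abs_def] by (intro DERIV_mult sq Jn_deriv s)
    moreover have "sqrt s / (2 * s) * Jn N s + (real N / s * Jn N s - Jn (Suc N) s) * sqrt s = JU1 N s"
    proof -
      have "r / (2 * s) * J + (n / s * J - K) * r = r * ((n + 1 / 2) / s * J - K)" for r J K n
        by (simp add: add_divide_distrib algebra_simps)
      thus ?thesis unfolding JU1_def .
    qed
    ultimately show ?thesis by simp
  qed
  show "(JU1 N has_real_derivative - qpot ((real N)\<^sup>2 - 1 / 4) s * JU N s) (at s)"
  proof -
    \<comment> \<open>In terms of 1/s the cancellation becomes a polynomial identity.\<close>
    define z where "z = inverse s"
    have alg: "r * z / 2 * ((n + 1 / 2) * z * J - K) + (- (n + 1 / 2) * z\<^sup>2 * J + (n * z * J - K) * ((n + 1 / 2) * z)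
          - (J - (n + 1) * z * K)) * r = - (1 - (n\<^sup>2 - 1 / 4) * z\<^sup>2) * (r * J)" for r z n J K :: real
      by (simp add: algebra_simps power2_eq_square)
    have sq': "(sqrt has_real_derivative sqrt s * z / 2) (at s)"
      using sq by (simp add: z_def field_simps)
    have inv: "((\<lambda>s. (real N + 1 / 2) / s) has_real_derivative - (real N + 1 / 2) * z\<^sup>2) (at s)"
      using s by (auto intro!: derivative_eq_intros simp: power2_eq_square z_def field_simps)
    have J: "(Jn N has_real_derivative real N * z * Jn N s - Jn (Suc N) s) (at s)"
      using Jn_deriv[OF s, of N] by (simp only: z_def divide_inverse)
    have K: "(Jn (Suc N) has_real_derivative Jn N s - (real N + 1) * z * Jn (Suc N) s) (at s)"
      using Jn_Suc_deriv[OF s, of N] by (simp only: z_def divide_inverse of_nat_Suc add.commute)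
    have h: "(real N + 1 / 2) / s = (real N + 1 / 2) * z" by (simp only: z_def divide_inverse)
    have q: "qpot ((real N)\<^sup>2 - 1 / 4) s = 1 - ((real N)\<^sup>2 - 1 / 4) * z\<^sup>2"
      by (simp only: qpot_def z_def divide_inverse power_inverse)
    show ?thesis
      unfolding JU1_def[abs_def] JU_def q
      using DERIV_mult[OF sq' DERIV_diff[OF DERIV_mult[OF inv J] K]] unfolding h alg by simp
  qed
qed

section \<open>Sign, critical points and numerical bounds of Bessel functions\<close>

lemma Jn_small_pos: "\<exists>\<eta>>0. \<forall>s. 0 < s \<and> s < \<eta> \<longrightarrow> Jn N s > 0"
proof -
  have "bser N 0 = bcoeff N 0" unfolding bser_def using powser_zero[of "bcoeff N"] by simp
  hence "bser N 0 > 0" by (simp add: bcoeff_def)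
  moreover have "isCont (\<lambda>s. bser N ((s / 2)\<^sup>2)) 0"
    by (intro isCont_o2[where g = "bser N" and f = "\<lambda>s. (s / 2)\<^sup>2"] DERIV_isCont[OF bser_deriv]) auto
  ultimately have "\<forall>\<^sub>F s in at 0. bser N ((s / 2)\<^sup>2) > 0"
    unfolding isCont_def by (intro order_tendstoD(1)[of _ "bser N 0"]) auto
  then obtain \<eta> where "\<eta> > 0" "\<And>s. s \<noteq> 0 \<Longrightarrow> \<bar>s\<bar> < \<eta> \<Longrightarrow> bser N ((s / 2)\<^sup>2) > 0"
    unfolding eventually_at by (auto simp: dist_real_def)
  thus ?thesis by (intro exI[of _ \<eta>]) (auto simp: Jn_def)
qed

text \<open>\<open>B\<close> is the product of J and s J'. Its derivative ((s J')^2 + (N^2 - s^2)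
  J^2) / s is nonnegative up to N and \<open>B 0 = 0\<close>, so J^2 increases on this range and J
  keeps the positive sign it has near 0.\<close>

lemma Jn_mono_facts:
  assumes N: "N \<ge> 1" and s: "0 < s" "s \<le> real N"
  shows "Jn N s > 0" "real N * Jn N s - s * Jn (Suc N) s \<ge> 0"
proof -
  define B where "B s = Jn N s * (real N * Jn N s - s * Jn (Suc N) s)" for s
  have B0: "B 0 = 0" using N by (simp add: B_def Jn_def)
  have Bd: "(B has_real_derivative (real N * Jn N t - t * Jn (Suc N) t)\<^sup>2 / t + ((real N)\<^sup>2 - t\<^sup>2) / t * (Jn N t)\<^sup>2) (at t)" if t: "t > 0" for t
  proof -
    let ?J = "Jn N t" and ?K = "Jn (Suc N) t"
    let ?J' = "real N / t * ?J - ?K" and ?K' = "?J - real (Suc N) / t * ?K"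
    have "(B has_real_derivative ?J' * (real N * ?J - t * ?K) + (real N * ?J' - (1 * ?K + ?K' * t)) * ?J) (at t)"
      unfolding B_def[abs_def] by (intro DERIV_mult DERIV_diff DERIV_cmult DERIV_ident Jn_deriv Jn_Suc_deriv t)
    moreover have "?J' * (real N * ?J - t * ?K) + (real N * ?J' - (1 * ?K + ?K' * t)) * ?J
      = (real N * ?J - t * ?K)\<^sup>2 / t + ((real N)\<^sup>2 - t\<^sup>2) / t * ?J\<^sup>2"
      using t by (simp add: field_simps power2_eq_square)
    ultimately show ?thesis by simp
  qed
  have Bnn: "B t \<ge> 0" if t: "0 \<le> t" "t \<le> real N" for t
  proof -
    have "B 0 \<le> B t"
    proof (rule deriv_nonneg_mono[where h = B, OF _ t(1) Bd])
      show "continuous_on {0..t} B" unfolding B_def[abs_def] by (intro continuous_intros Jn_cont)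
      fix r assume r: "0 < r" "r < t"
      hence "r\<^sup>2 \<le> (real N)\<^sup>2" using t by (intro power_mono) auto
      thus "(real N * Jn N r - r * Jn (Suc N) r)\<^sup>2 / r + ((real N)\<^sup>2 - r\<^sup>2) / r * (Jn N r)\<^sup>2 \<ge> 0"
        using r by (intro add_nonneg_nonneg mult_nonneg_nonneg) auto
    qed auto
    thus ?thesis using B0 by simp
  qed
  have sqm: "(Jn N a)\<^sup>2 \<le> (Jn N b)\<^sup>2" if ab: "0 < a" "a \<le> b" "b \<le> real N" for a b
  proof (rule deriv_nonneg_mono[where h = "\<lambda>t. (Jn N t)\<^sup>2" and h' = "\<lambda>t. 2 * B t / t"])
    show "continuous_on {a..b} (\<lambda>t. (Jn N t)\<^sup>2)" by (intro continuous_intros Jn_cont)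
    fix t assume t: "a < t" "t < b"
    have "((\<lambda>t. (Jn N t)\<^sup>2) has_real_derivative 2 * Jn N t * (real N / t * Jn N t - Jn (Suc N) t)) (at t)"
      using t ab by (auto intro!: derivative_eq_intros Jn_deriv)
    moreover have "2 * Jn N t * (real N / t * Jn N t - Jn (Suc N) t) = 2 * B t / t"
      using t ab by (simp add: B_def field_simps)
    ultimately show "((\<lambda>t. (Jn N t)\<^sup>2) has_real_derivative 2 * B t / t) (at t)" by simp
    show "2 * B t / t \<ge> 0" using Bnn[of t] t ab by simp
  qed (rule ab)
  obtain \<eta> where \<eta>: "\<eta> > 0" "\<And>s. 0 < s \<Longrightarrow> s < \<eta> \<Longrightarrow> Jn N s > 0" using Jn_small_pos by blast
  have nz: "Jn N t \<noteq> 0" if t: "0 < t" "t \<le> real N" for t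
  proof -
    define a where "a = min t \<eta> / 2"
    have a: "0 < a" "a \<le> t" "a < \<eta>" using t \<eta> by (auto simp: a_def min_def)
    have "0 < (Jn N a)\<^sup>2" using \<eta>(2)[OF a(1,3)] by simp
    also have "\<dots> \<le> (Jn N t)\<^sup>2" by (rule sqm) (use a t in auto)
    finally show ?thesis by auto
  qed
  show pos: "Jn N s > 0"
  proof (rule ccontr)
    assume c: "\<not> Jn N s > 0"
    define a where "a = min s \<eta> / 2"
    have a: "0 < a" "a \<le> s" "a < \<eta>" using s \<eta> by (auto simp: a_def min_def)
    have "\<exists>x\<ge>a. x \<le> s \<and> Jn N x = 0"
      by (rule IVT2') (use a c \<eta>(2)[OF a(1,3)] Jn_cont in auto)
    thus False using nz a s by auto
  qed
  have "Jn N s * (real N * Jn N s - s * Jn (Suc N) s) \<ge> 0" using Bnn[of s] s by (simp add: B_def)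
  thus "real N * Jn N s - s * Jn (Suc N) s \<ge> 0" using pos by (simp add: zero_le_mult_iff)
qed

text \<open>Without a critical point on [n, 4n], U = sqrt s J_N would be increasing and concave
  there. Then U(2n) \<ge> n U'(2n), and as the potential is at least 3/4 on [2n, 4n], U' would drop
  by at least (3/2) n^2 U'(2n) and become nonpositive.\<close>

lemma JU_critical:
  assumes N: "N \<ge> 1"
  shows "\<exists>t. real N \<le> t \<and> t \<le> 4 * real N \<and> JU1 N t = 0"
proof (rule ccontr)
  assume none: "\<not> ?thesis"
  define n where "n = real N"
  have n: "n \<ge> 1" using N by (simp add: n_def)
  have d: "(JU N has_real_derivative JU1 N t) (at t)" "(JU1 N has_real_derivative - qpot (n\<^sup>2 - 1 / 4) t * JU N t) (at t)" if "t > 0" for t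
    using osc_all_deriv[OF JU_osc that, of N] by (simp_all add: n_def)
  have c: "continuous_on {a..b} (JU N)" "continuous_on {a..b} (JU1 N)" if "a > 0" for a b
    using that by (intro osc_all_cont[OF JU_osc]; auto)+
  have Un: "JU N n > 0" using Jn_mono_facts(1)[OF N, of n] n by (simp add: JU_def n_def)
  have "JU1 N n = sqrt n * ((n * Jn N n - n * Jn (Suc N) n) / n + Jn N n / (2 * n))"
    using n unfolding JU1_def n_def[symmetric] by (simp add: field_simps)
  moreover have "(n * Jn N n - n * Jn (Suc N) n) / n \<ge> 0" using Jn_mono_facts(2)[OF N, of n] n by (simp add: n_def)
  moreover have "Jn N n / (2 * n) > 0" using Jn_mono_facts(1)[OF N, of n] n by (simp add: n_def)
  ultimately have U1n: "JU1 N n > 0" using n by (simp add: add_nonneg_pos)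
  have pos: "JU1 N t > 0" if t: "n \<le> t" "t \<le> 4 * n" for t
  proof (rule ccontr)
    assume "\<not> JU1 N t > 0"
    hence "\<exists>x\<ge>n. x \<le> t \<and> JU1 N x = 0" by (intro IVT2' c) (use t n U1n in auto)
    thus False using none t by (auto simp: n_def)
  qed
  have mono: "JU N a \<le> JU N b" if "n \<le> a" "a \<le> b" "b \<le> 4 * n" for a b
    by (rule deriv_nonneg_mono[where h = "JU N" and h' = "JU1 N"]) (use that n c pos d in \<open>auto intro: less_imp_le\<close>)
  have q: "qpot (n\<^sup>2 - 1 / 4) t \<ge> 0" if "t \<ge> n" for t
  proof -
    have "n\<^sup>2 \<le> t\<^sup>2" using that n by (intro power_mono) auto
    hence "n\<^sup>2 - 1 / 4 \<le> t\<^sup>2" by linarith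
    thus ?thesis using that n by (simp add: qpot_def)
  qed
  have dec: "JU1 N b \<le> JU1 N a" if "n \<le> a" "a \<le> b" "b \<le> 4 * n" for a b
  proof -
    have "- JU1 N a \<le> - JU1 N b"
    proof (rule deriv_nonneg_mono[where h = "\<lambda>t. - JU1 N t" and h' = "\<lambda>t. qpot (n\<^sup>2 - 1 / 4) t * JU N t"])
      show "continuous_on {a..b} (\<lambda>t. - JU1 N t)" using that n by (intro continuous_intros c) auto
      fix t assume t: "a < t" "t < b"
      show "((\<lambda>t. - JU1 N t) has_real_derivative qpot (n\<^sup>2 - 1 / 4) t * JU N t) (at t)"
        using d(2)[of t] t that n by (auto intro!: derivative_eq_intros)
      show "qpot (n\<^sup>2 - 1 / 4) t * JU N t \<ge> 0"
        using q[of t] mono[of n t] Un t that by (intro mult_nonneg_nonneg) auto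
    qed (rule that)
    thus ?thesis by simp
  qed
  have A: "JU N (2 * n) \<ge> n * JU1 N (2 * n)"
  proof -
    have "JU N n - JU1 N (2 * n) * n \<le> JU N (2 * n) - JU1 N (2 * n) * (2 * n)"
    proof (rule deriv_nonneg_mono[where h = "\<lambda>t. JU N t - JU1 N (2 * n) * t" and h' = "\<lambda>t. JU1 N t - JU1 N (2 * n)"])
      show "continuous_on {n..2 * n} (\<lambda>t. JU N t - JU1 N (2 * n) * t)" using n by (intro continuous_intros c) auto
      fix t assume t: "n < t" "t < 2 * n"
      show "((\<lambda>t. JU N t - JU1 N (2 * n) * t) has_real_derivative JU1 N t - JU1 N (2 * n)) (at t)"
        using d(1)[of t] t n by (auto intro!: derivative_eq_intros)
      show "JU1 N t - JU1 N (2 * n) \<ge> 0" using dec[of t "2 * n"] t n by simp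
    qed (use n in simp)
    thus ?thesis using Un by (simp add: algebra_simps)
  qed
  have "JU1 N (4 * n) \<le> JU1 N (2 * n) - 2 * n * (3 / 4 * JU N (2 * n))"
  proof -
    have "- (JU1 N (2 * n) + 3 / 4 * JU N (2 * n) * (2 * n)) \<le> - (JU1 N (4 * n) + 3 / 4 * JU N (2 * n) * (4 * n))"
    proof (rule deriv_nonneg_mono[where h = "\<lambda>t. - (JU1 N t + 3 / 4 * JU N (2 * n) * t)"
          and h' = "\<lambda>t. qpot (n\<^sup>2 - 1 / 4) t * JU N t - 3 / 4 * JU N (2 * n)"])
      show "continuous_on {2 * n..4 * n} (\<lambda>t. - (JU1 N t + 3 / 4 * JU N (2 * n) * t))" using n by (intro continuous_intros c) auto
      fix t assume t: "2 * n < t" "t < 4 * n"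
      show "((\<lambda>t. - (JU1 N t + 3 / 4 * JU N (2 * n) * t)) has_real_derivative qpot (n\<^sup>2 - 1 / 4) t * JU N t - 3 / 4 * JU N (2 * n)) (at t)"
        using d(2)[of t] t n by (auto intro!: derivative_eq_intros)
      have "(2 * n)\<^sup>2 \<le> t\<^sup>2" using t n by (intro power_mono) auto
      hence "4 * n\<^sup>2 \<le> t\<^sup>2" by (simp add: power_mult_distrib)
      hence "3 / 4 \<le> qpot (n\<^sup>2 - 1 / 4) t" using t n by (simp add: qpot_def field_simps)
      hence "3 / 4 * JU N (2 * n) \<le> qpot (n\<^sup>2 - 1 / 4) t * JU N t"
        using mono[of "2 * n" t] mono[of n "2 * n"] Un t n by (intro mult_mono) auto
      thus "qpot (n\<^sup>2 - 1 / 4) t * JU N t - 3 / 4 * JU N (2 * n) \<ge> 0" by simp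
    qed (use n in simp)
    thus ?thesis by (simp add: algebra_simps)
  qed
  also have "\<dots> \<le> JU1 N (2 * n) - 2 * n * (3 / 4 * (n * JU1 N (2 * n)))"
    using A n by (intro diff_left_mono mult_left_mono) auto
  also have "\<dots> = JU1 N (2 * n) * (1 - 3 / 2 * (n * n))" by (simp add: algebra_simps)
  also have "\<dots> \<le> 0"
  proof -
    have "1 * 1 \<le> n * n" using n by (intro mult_mono) auto
    thus ?thesis using pos[of "2 * n"] n by (intro mult_nonneg_nonpos) auto
  qed
  finally show False using pos[of "4 * n"] n by simp
qed

text \<open>Starting from |J0| \<le> 1, alternate integration of (t J1)' = t J0 and J0' = -J1 yields
  the Taylor polynomials as upper and lower bounds in turn.\<close>

lemma J0_bounds:
  assumes s: "0 \<le> s"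
  shows "\<bar>Jn 0 s\<bar> \<le> 1" "\<bar>Jn 1 s\<bar> \<le> s / 2" "1 - s\<^sup>2 / 4 \<le> Jn 0 s"
    "s / 2 - s ^ 3 / 16 \<le> Jn 1 s" "Jn 0 s \<le> 1 - s\<^sup>2 / 4 + s ^ 4 / 64"
    "Jn 1 s \<le> s / 2 - s ^ 3 / 16 + s ^ 5 / 384" "1 - s\<^sup>2 / 4 + s ^ 4 / 64 - s ^ 6 / 2304 \<le> Jn 0 s"
proof -
  have J00: "Jn 0 0 = 1" "Jn 1 0 = 0" "Jn (Suc 0) 0 = 0"
    using powser_zero[of "bcoeff 0"] by (simp_all add: Jn_def bser_def bcoeff_def)
  have d0: "(Jn 0 has_real_derivative - Jn 1 t) (at t)" for t
    using Jn_deriv_at_all[of 0 t] by simp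
  have d1: "((\<lambda>t. t * Jn 1 t) has_real_derivative t * Jn 0 t) (at t)" if t: "t > 0" for t
  proof -
    have "((\<lambda>t. t * Jn 1 t) has_real_derivative 1 * Jn 1 t + (Jn 0 t - real (Suc 0) / t * Jn 1 t) * t) (at t)"
      using DERIV_mult[OF DERIV_ident Jn_Suc_deriv[OF t, of 0]] by simp
    moreover have "1 * Jn 1 t + (Jn 0 t - real (Suc 0) / t * Jn 1 t) * t = t * Jn 0 t"
      using t by (simp add: field_simps)
    ultimately show ?thesis by simp
  qed
  define F where "F t = t * Jn 1 t" for t
  have F: "F 0 = 0" "\<And>s. continuous_on {0..s} F" "\<And>t. t > 0 \<Longrightarrow> (F has_real_derivative t * Jn 0 t) (at t)"
    using d1 by (auto simp: F_def[abs_def] intro!: continuous_intros Jn_cont)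
  have c: "continuous_on {0..s} (Jn 0)" "continuous_on {0..s} (Jn 1)" for s by (rule Jn_cont)+
  have up: "A s \<le> B s"
    if "A 0 \<le> B (0::real)" "0 \<le> s" "continuous_on {0..s} A" "continuous_on {0..s} B"
      "\<And>t. t > 0 \<Longrightarrow> (A has_real_derivative A' t) (at t)" "\<And>t. t > 0 \<Longrightarrow> (B has_real_derivative B' t) (at t)"
      "\<And>t. t > 0 \<Longrightarrow> A' t \<le> B' t" for A B A' B' :: "real \<Rightarrow> real" and s
  proof -
    have "B 0 - A 0 \<le> B s - A s"
      by (rule deriv_nonneg_mono[where h = "\<lambda>s. B s - A s" and h' = "\<lambda>t. B' t - A' t"])
        (use that in \<open>auto intro!: continuous_intros DERIV_diff\<close>)
    thus ?thesis using that(1) by simp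
  qed
  \<comment> \<open>J0^2 + J1^2 equals 1 at 0 and has derivative -2 J1^2 / t.\<close>
  have sq: "(Jn 0 s)\<^sup>2 + (Jn 1 s)\<^sup>2 \<le> 1" if "s \<ge> 0" for s
  proof -
    have "- ((Jn 0 0)\<^sup>2 + (Jn 1 0)\<^sup>2) \<le> - ((Jn 0 s)\<^sup>2 + (Jn 1 s)\<^sup>2)"
    proof (rule deriv_nonneg_mono[where h = "\<lambda>s. - ((Jn 0 s)\<^sup>2 + (Jn 1 s)\<^sup>2)" and h' = "\<lambda>t. 2 * (Jn 1 t)\<^sup>2 / t"])
      show "continuous_on {0..s} (\<lambda>s. - ((Jn 0 s)\<^sup>2 + (Jn 1 s)\<^sup>2))" by (intro continuous_intros c)
      fix t assume t: "0 < t" "t < s"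
      have "((\<lambda>s. - (Jn 0 s * Jn 0 s + Jn 1 s * Jn 1 s)) has_real_derivative
        - ((- Jn 1 t * Jn 0 t + - Jn 1 t * Jn 0 t) + ((Jn 0 t - 1 / t * Jn 1 t) * Jn 1 t + (Jn 0 t - 1 / t * Jn 1 t) * Jn 1 t))) (at t)"
        using Jn_Suc_deriv[OF t(1), of 0] by (intro DERIV_minus DERIV_add DERIV_mult d0) simp_all
      moreover have "- ((- Jn 1 t * Jn 0 t + - Jn 1 t * Jn 0 t) + ((Jn 0 t - 1 / t * Jn 1 t) * Jn 1 t + (Jn 0 t - 1 / t * Jn 1 t) * Jn 1 t)) = 2 * (Jn 1 t)\<^sup>2 / t"
        using t by (simp add: field_simps power2_eq_square)
      ultimately show "((\<lambda>s. - ((Jn 0 s)\<^sup>2 + (Jn 1 s)\<^sup>2)) has_real_derivative 2 * (Jn 1 t)\<^sup>2 / t) (at t)"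
        by (simp add: power2_eq_square)
      show "2 * (Jn 1 t)\<^sup>2 / t \<ge> 0" using t by simp
    qed (rule that)
    thus ?thesis by (simp add: J00)
  qed
  have b0: "\<bar>Jn 0 s\<bar> \<le> 1" if "s \<ge> 0" for s
  proof -
    have "(Jn 0 s)\<^sup>2 \<le> 1" using sq[OF that] zero_le_power2[of "Jn 1 s"] by linarith
    thus ?thesis by (simp add: abs_square_le_1)
  qed
  have div: "Jn 1 s \<le> b" if "F s \<le> s * b" "s = 0 \<Longrightarrow> b \<ge> 0" "s \<ge> 0" for s b
    using that J00 by (cases "s = 0") (auto simp: F_def)
  have div': "b \<le> Jn 1 s" if "s * b \<le> F s" "s = 0 \<Longrightarrow> b \<le> 0" "s \<ge> 0" for s b
    using that J00 by (cases "s = 0") (auto simp: F_def)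
  have u1: "Jn 1 s \<le> s / 2" if "s \<ge> 0" for s
  proof (rule div[OF _ _ that])
    show "F s \<le> s * (s / 2)"
      by (rule up[where A = F and B = "\<lambda>s. s * (s / 2)" and A' = "\<lambda>t. t * Jn 0 t" and B' = "\<lambda>t. t * 1", OF _ that])
        (auto intro!: continuous_intros c derivative_eq_intros F(2,3) mult_left_mono simp: J00 F(1) dest: b0[THEN abs_le_D1, OF less_imp_le] simp del: One_nat_def)
  qed simp
  have l1': "- (s / 2) \<le> Jn 1 s" if "s \<ge> 0" for s
  proof (rule div'[OF _ _ that])
    have m: "- t \<le> t * Jn 0 t" if "t > 0" for t
      using mult_left_mono[of "-1" "Jn 0 t" t] b0[of t] that by (simp add: abs_le_iff)
    show "s * (- (s / 2)) \<le> F s"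
      by (rule up[where B = F and A = "\<lambda>s. s * (- (s / 2))" and B' = "\<lambda>t. t * Jn 0 t" and A' = "\<lambda>t. - t", OF _ that])
        (auto intro!: continuous_intros c derivative_eq_intros F(2,3) m simp: J00 F(1) simp del: One_nat_def)
  qed simp
  have u1h: "Jn 1 t * 2 \<le> t" if "t > 0" for t using u1[of t] that by simp
  have l0: "1 - s\<^sup>2 / 4 \<le> Jn 0 s" if "s \<ge> 0" for s
    by (rule up[where A = "\<lambda>s. 1 - s\<^sup>2 / 4" and B = "Jn 0" and A' = "\<lambda>t. - (t / 2)" and B' = "\<lambda>t. - Jn 1 t", OF _ that])
      (auto intro!: continuous_intros c derivative_eq_intros d0 simp: J00 F(1) u1h simp del: One_nat_def)
  have l1: "s / 2 - s ^ 3 / 16 \<le> Jn 1 s" if "s \<ge> 0" for s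
  proof (rule div'[OF _ _ that])
    have m: "t - t ^ 3 / 4 \<le> t * Jn 0 t" if "t > 0" for t
      using mult_left_mono[OF l0[of t], of t] that by (simp add: algebra_simps power2_eq_square power3_eq_cube)
    have "s\<^sup>2 / 2 - s ^ 4 / 16 \<le> F s"
      by (rule up[where B = F and A = "\<lambda>s. s\<^sup>2 / 2 - s ^ 4 / 16" and B' = "\<lambda>t. t * Jn 0 t" and A' = "\<lambda>t. t - t ^ 3 / 4", OF _ that])
        (auto intro!: continuous_intros c derivative_eq_intros F(2,3) m simp: F(1))
    thus "s * (s / 2 - s ^ 3 / 16) \<le> F s" by (simp add: algebra_simps eval_nat_numeral)
  qed simp
  have l1h: "- Jn 1 t \<le> t ^ 3 / 16 - t / 2" if "t > 0" for t using l1[of t] that by simp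
  have u0: "Jn 0 s \<le> 1 - s\<^sup>2 / 4 + s ^ 4 / 64" if "s \<ge> 0" for s
    by (rule up[where B = "\<lambda>s. 1 - s\<^sup>2 / 4 + s ^ 4 / 64" and A = "Jn 0" and B' = "\<lambda>t. - (t / 2 - t ^ 3 / 16)" and A' = "\<lambda>t. - Jn 1 t", OF _ that])
      (auto intro!: continuous_intros c derivative_eq_intros d0 simp: J00 F(1) l1h simp del: One_nat_def)
  have u1': "Jn 1 s \<le> s / 2 - s ^ 3 / 16 + s ^ 5 / 384" if "s \<ge> 0" for s
  proof (rule div[OF _ _ that])
    have m: "t * Jn 0 t \<le> t - t ^ 3 / 4 + t ^ 5 / 64" if "t > 0" for t
      using mult_left_mono[OF u0[of t], of t] that by (simp add: algebra_simps eval_nat_numeral)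
    have "F s \<le> s\<^sup>2 / 2 - s ^ 4 / 16 + s ^ 6 / 384"
      by (rule up[where A = F and B = "\<lambda>s. s\<^sup>2 / 2 - s ^ 4 / 16 + s ^ 6 / 384" and A' = "\<lambda>t. t * Jn 0 t" and B' = "\<lambda>t. t - t ^ 3 / 4 + t ^ 5 / 64", OF _ that])
        (auto intro!: continuous_intros c derivative_eq_intros F(2,3) m simp: F(1))
    thus "F s \<le> s * (s / 2 - s ^ 3 / 16 + s ^ 5 / 384)" by (simp add: algebra_simps eval_nat_numeral)
  qed simp
  have u1h': "t ^ 3 / 16 - t / 2 - t ^ 5 / 384 \<le> - Jn 1 t" if "t > 0" for t using u1'[of t] that by simp
  have l0': "1 - s\<^sup>2 / 4 + s ^ 4 / 64 - s ^ 6 / 2304 \<le> Jn 0 s" if "s \<ge> 0" for s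
    by (rule up[where A = "\<lambda>s. 1 - s\<^sup>2 / 4 + s ^ 4 / 64 - s ^ 6 / 2304" and B = "Jn 0" and A' = "\<lambda>t. - (t / 2 - t ^ 3 / 16 + t ^ 5 / 384)" and B' = "\<lambda>t. - Jn 1 t", OF _ that])
      (auto intro!: continuous_intros c derivative_eq_intros d0 simp: J00 F(1) u1h' simp del: One_nat_def)
  show "\<bar>Jn 0 s\<bar> \<le> 1" "\<bar>Jn 1 s\<bar> \<le> s / 2" "1 - s\<^sup>2 / 4 \<le> Jn 0 s"
    "s / 2 - s ^ 3 / 16 \<le> Jn 1 s" "Jn 0 s \<le> 1 - s\<^sup>2 / 4 + s ^ 4 / 64"
    "Jn 1 s \<le> s / 2 - s ^ 3 / 16 + s ^ 5 / 384" "1 - s\<^sup>2 / 4 + s ^ 4 / 64 - s ^ 6 / 2304 \<le> Jn 0 s"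
    using b0[OF s] u1[OF s] l1'[OF s] l0[OF s] l1[OF s] u0[OF s] u1'[OF s] l0'[OF s] by auto
qed

section \<open>Matching at the interface\<close>

text \<open>The wronskian r (G' j - j' G) is constant inside, and it has to be shown to vanish when
  only G is known to be bounded. The mean value theorem in the variable ln r, over an interval of
  length T, produces arbitrarily small radii with |r G'| \<le> 2 B / T.\<close>

lemma regular_inside_real:
  assumes e: "\<epsilon> > 0" and ka: "\<kappa> > 0" and c1: "continuous_on {0<..} G1"
    and d: "\<And>r. r > 0 \<Longrightarrow> (G has_real_derivative G1 r) (at r)"
    and d1: "\<And>r. 0 < r \<Longrightarrow> r < \<epsilon> \<Longrightarrow> (G1 has_real_derivative - G1 r / r - (\<kappa>\<^sup>2 - (real N)\<^sup>2 / r\<^sup>2) * G r) (at r)"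
    and B: "\<And>r. 0 < r \<Longrightarrow> r \<le> \<epsilon> \<Longrightarrow> \<bar>G r\<bar> \<le> B"
  shows "\<epsilon> * G1 \<epsilon> * Jn N (\<kappa> * \<epsilon>) = (real N * Jn N (\<kappa> * \<epsilon>) - \<kappa> * \<epsilon> * Jn (Suc N) (\<kappa> * \<epsilon>)) * G \<epsilon>"
proof -
  define j where "j r = Jn N (\<kappa> * r)" for r
  define m where "m r = real N * j r - \<kappa> * r * Jn (Suc N) (\<kappa> * r)" for r
  define D where "D r = r * G1 r * j r - m r * G r" for r
  have B0: "B \<ge> 0" using B[of \<epsilon>] e by auto
  have cj: "continuous_on S j" and cm: "continuous_on S m" for S
    unfolding m_def[abs_def] j_def[abs_def] by (intro continuous_intros continuous_on_compose2[OF Jn_cont[of UNIV]]; auto)+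
  have kd: "((\<lambda>r. \<kappa> * r) has_real_derivative \<kappa>) (at r)" for r
    by (auto intro!: derivative_eq_intros)
  have dj: "(j has_real_derivative m r / r) (at r)" if r: "r > 0" for r
  proof -
    have "(j has_real_derivative (real N / (\<kappa> * r) * Jn N (\<kappa> * r) - Jn (Suc N) (\<kappa> * r)) * \<kappa>) (at r)"
      unfolding j_def[abs_def] using ka r by (intro DERIV_chain2[OF Jn_deriv kd]) simp
    moreover have "(real N / (\<kappa> * r) * Jn N (\<kappa> * r) - Jn (Suc N) (\<kappa> * r)) * \<kappa> = m r / r"
      using ka r by (simp add: m_def j_def field_simps)
    ultimately show ?thesis by simp
  qed
  have dm: "(m has_real_derivative (real N)\<^sup>2 / r * j r - \<kappa>\<^sup>2 * r * j r) (at r)" if r: "r > 0" for r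
  proof -
    let ?K = "Jn (Suc N) (\<kappa> * r)"
    have dK: "((\<lambda>r. Jn (Suc N) (\<kappa> * r)) has_real_derivative (j r - real (Suc N) / (\<kappa> * r) * ?K) * \<kappa>) (at r)"
      unfolding j_def using ka r by (intro DERIV_chain2[OF Jn_Suc_deriv kd]) simp
    have "(m has_real_derivative real N * (m r / r) - (\<kappa> * ?K + (j r - real (Suc N) / (\<kappa> * r) * ?K) * \<kappa> * (\<kappa> * r))) (at r)"
      unfolding m_def[abs_def] by (intro DERIV_diff DERIV_cmult DERIV_mult dj r kd dK[unfolded mult.commute[of _ \<kappa>]] dK)
        (use dj[OF r] in \<open>simp add: m_def\<close>)
    moreover have "real N * (m r / r) - (\<kappa> * ?K + (j r - real (Suc N) / (\<kappa> * r) * ?K) * \<kappa> * (\<kappa> * r)) = (real N)\<^sup>2 / r * j r - \<kappa>\<^sup>2 * r * j r"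
      using ka r by (simp add: m_def field_simps power2_eq_square)
    ultimately show ?thesis by simp
  qed
  have dD: "(D has_real_derivative 0) (at r)" if r: "0 < r" "r < \<epsilon>" for r
  proof -
    have "(D has_real_derivative ((1 * G1 r + (- G1 r / r - (\<kappa>\<^sup>2 - (real N)\<^sup>2 / r\<^sup>2) * G r) * r) * j r + m r / r * (r * G1 r))
      - (((real N)\<^sup>2 / r * j r - \<kappa>\<^sup>2 * r * j r) * G r + G1 r * m r)) (at r)"
      unfolding D_def[abs_def] by (intro DERIV_diff DERIV_mult DERIV_ident dj dm d d1 r)
    moreover have "((1 * G1 r + (- G1 r / r - (\<kappa>\<^sup>2 - (real N)\<^sup>2 / r\<^sup>2) * G r) * r) * j r + m r / r * (r * G1 r))
      - (((real N)\<^sup>2 / r * j r - \<kappa>\<^sup>2 * r * j r) * G r + G1 r * m r) = 0"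
      using r by (simp add: field_simps power2_eq_square)
    ultimately show ?thesis by simp
  qed
  have cG: "continuous_on S G" if "S \<subseteq> {0<..}" for S
    using that d by (meson DERIV_isCont continuous_at_imp_continuous_on greaterThan_iff subsetD)
  have cD: "continuous_on S D" if "S \<subseteq> {0<..}" for S
    unfolding D_def[abs_def] using that by (intro continuous_intros cj cm cG continuous_on_subset[OF c1])
  have const: "D \<epsilon> = D r" if r: "0 < r" "r < \<epsilon>" for r
    by (rule DERIV_isconst_end[OF r(2)]) (use r in \<open>auto intro!: cD dD\<close>)
  have "\<bar>D \<epsilon>\<bar> \<le> \<eta> * (1 + B)" if \<eta>: "\<eta> > 0" for \<eta>
  proof -
    have "bounded (j ` {0..\<epsilon>})" by (intro compact_imp_bounded compact_continuous_image cj) auto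
    then obtain C where "\<forall>r\<in>{0..\<epsilon>}. \<bar>j r\<bar> \<le> C" and C0: "C > 0"
      unfolding bounded_pos by auto
    hence C: "\<And>r. 0 \<le> r \<Longrightarrow> r \<le> \<epsilon> \<Longrightarrow> \<bar>j r\<bar> \<le> C" "C > 0" by auto
    have "m 0 = 0" by (cases N) (auto simp: m_def j_def Jn_def)
    moreover have "isCont m 0" using cm[of UNIV] by (simp add: continuous_on_eq_continuous_at)
    ultimately obtain \<delta> where \<delta>: "\<delta> > 0" "\<And>r. \<bar>r\<bar> < \<delta> \<Longrightarrow> \<bar>m r\<bar> < \<eta>"
      using \<eta> unfolding continuous_at_eps_delta by (auto simp: dist_real_def)
    define b where "b = ln (min \<delta> \<epsilon> / 2)"
    \<comment> \<open>Chosen so that 2 B C / T \<le> \<eta>, where C bounds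
      \<open>j\<close>.\<close>
    define T where "T = 1 + 2 * B * C / \<eta>"
    have T: "T > 0" using C B0 \<eta> by (simp add: T_def add_pos_nonneg)
    have eb: "exp b < \<delta>" "exp b < \<epsilon>" using \<delta>(1) e by (auto simp: b_def)
    have "\<exists>z>b - T. z < b \<and> G (exp b) - G (exp (b - T)) = (b - (b - T)) * (exp z * G1 (exp z))"
    proof (rule MVT2[where f = "\<lambda>t. G (exp t)" and f' = "\<lambda>z. exp z * G1 (exp z)"])
      show "b - T < b" using T by simp
      fix t
      have "((\<lambda>t. G (exp t)) has_real_derivative G1 (exp t) * exp t) (at t)"
        by (rule DERIV_chain2[OF d DERIV_exp]) simp
      thus "((\<lambda>t. G (exp t)) has_real_derivative exp t * G1 (exp t)) (at t)" by (simp only: mult.commute)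
    qed
    then obtain z where z: "z < b" "G (exp b) - G (exp (b - T)) = T * (exp z * G1 (exp z))" by auto
    define r where "r = exp z"
    have r: "0 < r" "r < \<delta>" "r < \<epsilon>" using z(1) eb by (auto simp: r_def intro: order.strict_trans)
    have "\<bar>G (exp b)\<bar> \<le> B" "\<bar>G (exp (b - T))\<bar> \<le> B"
    proof -
      have "exp (b - T) < exp b" using T by simp
      hence "exp (b - T) \<le> \<epsilon>" using eb(2) by linarith
      thus "\<bar>G (exp b)\<bar> \<le> B" "\<bar>G (exp (b - T))\<bar> \<le> B" using eb(2) by (auto intro!: B)
    qed
    hence "\<bar>T * (r * G1 r)\<bar> \<le> 2 * B" using z(2) unfolding r_def by linarith
    hence 1: "T * \<bar>r * G1 r\<bar> \<le> 2 * B" using T by (simp add: abs_mult)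
    have "\<bar>r * G1 r * j r\<bar> \<le> \<eta>"
    proof -
      have "\<bar>r * G1 r\<bar> * \<bar>j r\<bar> \<le> \<bar>r * G1 r\<bar> * C" using C(1)[of r] r by (intro mult_left_mono) auto
      moreover have "T * (\<bar>r * G1 r\<bar> * C) \<le> 2 * B * C" using mult_right_mono[OF 1, of C] C by (simp add: algebra_simps)
      moreover have "2 * B * C \<le> T * \<eta>" using \<eta> by (simp add: T_def field_simps)
      ultimately have "\<bar>r * G1 r\<bar> * \<bar>j r\<bar> \<le> \<bar>r * G1 r\<bar> * C" "T * (\<bar>r * G1 r\<bar> * C) \<le> T * \<eta>" by linarith+
      hence "T * (\<bar>r * G1 r\<bar> * \<bar>j r\<bar>) \<le> T * \<eta>" using T by (meson mult_left_mono less_imp_le order_trans)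
      hence "\<bar>r * G1 r\<bar> * \<bar>j r\<bar> \<le> \<eta>" using T by (simp only: mult_le_cancel_left_pos)
      thus ?thesis by (simp only: abs_mult)
    qed
    moreover have "\<bar>m r * G r\<bar> \<le> \<eta> * B"
      unfolding abs_mult using \<delta>(2)[of r] B[of r] r \<eta> by (intro mult_mono) auto
    ultimately have "\<bar>D r\<bar> \<le> \<eta> + \<eta> * B" unfolding D_def by linarith
    thus ?thesis using const[of r] r by (simp add: algebra_simps)
  qed
  note le = this
  have "D \<epsilon> = 0"
  proof (rule ccontr)
    assume nz: "D \<epsilon> \<noteq> 0"
    have "\<bar>D \<epsilon>\<bar> \<le> \<bar>D \<epsilon>\<bar> / (2 * (1 + B)) * (1 + B)" using nz B0 by (intro le) simp
    also have "\<dots> = \<bar>D \<epsilon>\<bar> / 2" using B0 by (simp add: field_simps)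
    finally show False using nz by simp
  qed
  thus ?thesis by (simp add: D_def m_def j_def)
qed

lemma regular_inside:
  fixes w w1 :: "real \<Rightarrow> complex"
  assumes e: "\<epsilon> > 0" and ka: "\<kappa> > 0" and c1: "continuous_on {0<..} w1"
    and d: "\<And>r. r > 0 \<Longrightarrow> (w has_vector_derivative w1 r) (at r)"
    and d1: "\<And>r. 0 < r \<Longrightarrow> r < \<epsilon> \<Longrightarrow> (w1 has_vector_derivative - w1 r / of_real r - of_real (\<kappa>\<^sup>2 - (real N)\<^sup>2 / r\<^sup>2) * w r) (at r)"
    and B: "\<And>r. 0 < r \<Longrightarrow> r \<le> \<epsilon> \<Longrightarrow> cmod (w r) \<le> B"
  shows "of_real \<epsilon> * w1 \<epsilon> * of_real (Jn N (\<kappa> * \<epsilon>))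
    = of_real (real N * Jn N (\<kappa> * \<epsilon>) - \<kappa> * \<epsilon> * Jn (Suc N) (\<kappa> * \<epsilon>)) * w \<epsilon>"
proof -
  have R: "L \<circ> w1 = (\<lambda>r. L (w1 r))" for L :: "complex \<Rightarrow> real" by auto
  have *: "\<epsilon> * L (w1 \<epsilon>) * Jn N (\<kappa> * \<epsilon>) = (real N * Jn N (\<kappa> * \<epsilon>) - \<kappa> * \<epsilon> * Jn (Suc N) (\<kappa> * \<epsilon>)) * L (w \<epsilon>)"
    if L: "L = Re \<or> L = Im" for L
  proof (rule regular_inside_real[where G = "\<lambda>r. L (w r)" and ?G1.0 = "\<lambda>r. L (w1 r)" and B = B, OF e ka])
    have bl: "bounded_linear L" using L bounded_linear_Re bounded_linear_Im by auto
    show "continuous_on {0<..} (\<lambda>r. L (w1 r))"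
      by (rule bounded_linear.continuous_on[OF bl c1])
    show "((\<lambda>r. L (w r)) has_real_derivative L (w1 r)) (at r)" if "r > 0" for r
      unfolding has_real_derivative_iff_has_vector_derivative
      by (rule bounded_linear.has_vector_derivative[OF bl d[OF that]])
    show "((\<lambda>r. L (w1 r)) has_real_derivative - L (w1 r) / r - (\<kappa>\<^sup>2 - (real N)\<^sup>2 / r\<^sup>2) * L (w r)) (at r)" if "0 < r" "r < \<epsilon>" for r
    proof -
      have "L (- w1 r / of_real r - of_real (\<kappa>\<^sup>2 - (real N)\<^sup>2 / r\<^sup>2) * w r) = - L (w1 r) / r - (\<kappa>\<^sup>2 - (real N)\<^sup>2 / r\<^sup>2) * L (w r)"
        using L by (auto simp del: of_real_diff of_real_power of_real_divide)
      thus ?thesis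
        unfolding has_real_derivative_iff_has_vector_derivative
        using bounded_linear.has_vector_derivative[OF bl d1[OF that]] by simp
    qed
    show "\<bar>L (w r)\<bar> \<le> B" if "0 < r" "r \<le> \<epsilon>" for r
      using B[OF that] L abs_Re_le_cmod[of "w r"] abs_Im_le_cmod[of "w r"] by auto
  qed
  from *[of Re] *[of Im] show ?thesis
    by (intro complex_eqI) (simp_all del: of_real_diff of_real_mult)
qed

text \<open>Rescaling to s = \<kappa> r normalises the wave number to 1: every frequency then gives
  the same equation, and only the starting point \<epsilon> \<kappa> moves.\<close>

lemma scaled_mode:
  fixes w w1 :: "real \<Rightarrow> complex"
  assumes ka: "\<kappa> > 0" and r: "r > 0"
    and d: "(w has_vector_derivative w1 r) (at r)"
    and d1: "(w1 has_vector_derivative - w1 r / of_real r - of_real (\<kappa>\<^sup>2 - \<nu>\<^sup>2 / r\<^sup>2) * w r) (at r)"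
  defines "F \<equiv> \<lambda>s. of_real (sqrt s) * w (s / \<kappa>)"
    and "F1 \<equiv> \<lambda>s. of_real (1 / (2 * sqrt s)) * w (s / \<kappa>) + of_real (sqrt s / \<kappa>) * w1 (s / \<kappa>)"
  shows "(F has_vector_derivative F1 (\<kappa> * r)) (at (\<kappa> * r))"
    "(F1 has_vector_derivative - of_real (qpot (\<nu>\<^sup>2 - 1 / 4) (\<kappa> * r)) * F (\<kappa> * r)) (at (\<kappa> * r))"
proof -
  define s where "s = \<kappa> * r"
  have s: "s > 0" "s / \<kappa> = r" using ka r by (auto simp: s_def)
  have sd: "((\<lambda>s. s / \<kappa>) has_real_derivative 1 / \<kappa>) (at s)" using ka by (auto intro!: derivative_eq_intros)
  have w: "((\<lambda>s. w (s / \<kappa>)) has_vector_derivative of_real (1 / \<kappa>) * w1 r) (at s)"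
    using vector_diff_chain_at[OF sd[unfolded has_real_derivative_iff_has_vector_derivative], of w "w1 r"] d
    by (simp add: o_def s scaleR_conv_of_real)
  have w1: "((\<lambda>s. w1 (s / \<kappa>)) has_vector_derivative of_real (1 / \<kappa>) * (- w1 r / of_real r - of_real (\<kappa>\<^sup>2 - \<nu>\<^sup>2 / r\<^sup>2) * w r)) (at s)"
    using vector_diff_chain_at[OF sd[unfolded has_real_derivative_iff_has_vector_derivative], of w1 "- w1 r / of_real r - of_real (\<kappa>\<^sup>2 - \<nu>\<^sup>2 / r\<^sup>2) * w r"] d1
    by (simp add: o_def s scaleR_conv_of_real)
  have e: "((\<lambda>s. of_real (h s) :: complex) has_vector_derivative of_real h') (at s)" if "(h has_real_derivative h') (at s)" for h h'
    using that by (intro has_vector_derivative_of_real) (simp add: has_real_derivative_iff_has_vector_derivative)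
  have sq: "(sqrt has_real_derivative 1 / (2 * sqrt s)) (at s)"
    using s by (auto intro!: derivative_eq_intros simp: field_simps)
  have sq1: "((\<lambda>s. sqrt s / \<kappa>) has_real_derivative 1 / (2 * sqrt s) / \<kappa>) (at s)"
    using DERIV_cdivide[OF sq] .
  have sq2: "((\<lambda>s. 1 / (2 * sqrt s)) has_real_derivative - 1 / (4 * s * sqrt s)) (at s)"
    using s by (auto intro!: derivative_eq_intros simp: field_simps)
  have "(F has_vector_derivative of_real (sqrt s) * (of_real (1 / \<kappa>) * w1 r) + of_real (1 / (2 * sqrt s)) * w r) (at s)"
    unfolding F_def using has_vector_derivative_mult[OF e[OF sq] w] by (simp only: s)
  thus "(F has_vector_derivative F1 (\<kappa> * r)) (at (\<kappa> * r))"
    unfolding F1_def s_def[symmetric] s(2) by (simp add: algebra_simps)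
  have "(F1 has_vector_derivative (of_real (1 / (2 * sqrt s)) * (of_real (1 / \<kappa>) * w1 r) + of_real (- 1 / (4 * s * sqrt s)) * w r)
    + (of_real (sqrt s / \<kappa>) * (of_real (1 / \<kappa>) * (- w1 r / of_real r - of_real (\<kappa>\<^sup>2 - \<nu>\<^sup>2 / r\<^sup>2) * w r)) + of_real (1 / (2 * sqrt s) / \<kappa>) * w1 r)) (at s)"
    unfolding F1_def using has_vector_derivative_add[OF has_vector_derivative_mult[OF e[OF sq2] w] has_vector_derivative_mult[OF e[OF sq1] w1]]
    by (simp only: s)
  moreover have "(of_real (1 / (2 * sqrt s)) * (of_real (1 / \<kappa>) * w1 r) + of_real (- 1 / (4 * s * sqrt s)) * w r)
    + (of_real (sqrt s / \<kappa>) * (of_real (1 / \<kappa>) * (- w1 r / of_real r - of_real (\<kappa>\<^sup>2 - \<nu>\<^sup>2 / r\<^sup>2) * w r)) + of_real (1 / (2 * sqrt s) / \<kappa>) * w1 r)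
    = - of_real (qpot (\<nu>\<^sup>2 - 1 / 4) s) * F s"
  proof -
    define h where "h = sqrt s"
    have h: "h > 0" "s = h * h" "r = h * h / \<kappa>" using s ka by (auto simp: h_def)
    have *: "1 / (2 * h) * (1 / \<kappa>) - h / \<kappa> * (1 / \<kappa>) / r + 1 / (2 * h) / \<kappa> = 0"
      unfolding h(3) using h(1) ka by (simp add: field_simps)
    have **: "- 1 / (4 * s * h) - h / \<kappa> * (1 / \<kappa>) * (\<kappa>\<^sup>2 - \<nu>\<^sup>2 / r\<^sup>2) = - qpot (\<nu>\<^sup>2 - 1 / 4) s * h"
      unfolding h(3) h(2) qpot_def using h(1) ka by (simp add: field_simps power2_eq_square)
    have "of_real (1 / (2 * h)) * (of_real (1 / \<kappa>) * w1 r) + of_real (- 1 / (4 * s * h)) * w r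
      + (of_real (h / \<kappa>) * (of_real (1 / \<kappa>) * (- w1 r / of_real r - of_real (\<kappa>\<^sup>2 - \<nu>\<^sup>2 / r\<^sup>2) * w r)) + of_real (1 / (2 * h) / \<kappa>) * w1 r)
      = of_real (1 / (2 * h) * (1 / \<kappa>) - h / \<kappa> * (1 / \<kappa>) / r + 1 / (2 * h) / \<kappa>) * w1 r
        + of_real (- 1 / (4 * s * h) - h / \<kappa> * (1 / \<kappa>) * (\<kappa>\<^sup>2 - \<nu>\<^sup>2 / r\<^sup>2)) * w r"
    proof -
      have "of_real A * (of_real K * p) + of_real C * q + (of_real H * (of_real K * (- p / of_real r - of_real Q * q)) + of_real E * p)
        = of_real (A * K - H * K / r + E) * p + of_real (C - H * K * Q) * q" for A K C H Q E and p q :: complex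
        by (simp add: algebra_simps)
      thus ?thesis .
    qed
    thus ?thesis unfolding * ** by (simp add: F_def s h_def)
  qed
  ultimately show "(F1 has_vector_derivative - of_real (qpot (\<nu>\<^sup>2 - 1 / 4) (\<kappa> * r)) * F (\<kappa> * r)) (at (\<kappa> * r))"
    by (simp only: s_def)
qed

lemma bessel_J_Jn:
  obtains s :: real where "\<bar>s\<bar> = 1" "\<And>x. x > 0 \<Longrightarrow> bessel_J n x = s * Jn (nat \<bar>n\<bar>) x"
proof (cases "n \<ge> 0")
  case True
  thus thesis using bessel_J_nat[of _ "nat \<bar>n\<bar>"] by (intro that[of 1]) auto
next
  case False
  hence "n = - int (nat \<bar>n\<bar>)" by simp
  thus thesis using bessel_J_neg[of _ "nat \<bar>n\<bar>"]
    by (intro that[of "(-1) ^ nat \<bar>n\<bar>"]) (simp add: power_abs, metis)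
qed

text \<open>The wronskian of \<open>Re F\<close> and \<open>Im F\<close> is constant, which bounds \<open>F\<close> a priori.\<close>

lemma outgoing_pairI:
  fixes F F1 :: "real \<Rightarrow> complex"
  assumes x: "x > 0" and cF: "continuous_on {x..} F" "continuous_on {x..} F1"
    and dF: "\<And>s. s > x \<Longrightarrow> (F has_vector_derivative F1 s) (at s)"
    and dF1: "\<And>s. s > x \<Longrightarrow> (F1 has_vector_derivative - of_real (qpot \<mu> s) * F s) (at s)"
    and rad: "((\<lambda>s. F1 s - \<i> * F s - F s / of_real (2 * s)) \<longlongrightarrow> 0) at_top"
  shows "outgoing_pair \<mu> x (\<lambda>s. Re (F s)) (\<lambda>s. Re (F1 s)) (\<lambda>s. Im (F s)) (\<lambda>s. Im (F1 s))"
proof -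
  define e where "e s = F1 s - \<i> * F s - F s / of_real (2 * s)" for s
  have oR: "osc \<mu> x (\<lambda>s. Re (F s)) (\<lambda>s. Re (F1 s))"
    unfolding osc_def has_real_derivative_iff_has_vector_derivative
    using bounded_linear.has_vector_derivative[OF bounded_linear_Re dF] bounded_linear.has_vector_derivative[OF bounded_linear_Re dF1]
    by (auto intro!: continuous_intros cF simp: Re_divide)
  have oI: "osc \<mu> x (\<lambda>s. Im (F s)) (\<lambda>s. Im (F1 s))"
    unfolding osc_def has_real_derivative_iff_has_vector_derivative
    using bounded_linear.has_vector_derivative[OF bounded_linear_Im dF] bounded_linear.has_vector_derivative[OF bounded_linear_Im dF1]
    by (auto intro!: continuous_intros cF)
  define c where "c = Re (F x) * Im (F1 x) - Im (F x) * Re (F1 x)"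
  have c: "Im (cnj (F s) * F1 s) = c" if "s \<ge> x" for s
    using osc_wronskian[OF oR oI that] by (simp add: c_def)
  have "\<forall>\<^sub>F s in at_top. cmod (e s) < 1"
    using tendstoD[OF rad, of 1] by (simp add: e_def dist_norm)
  hence bd: "\<forall>\<^sub>F s in at_top. norm (F s) \<le> \<bar>c\<bar> + 1"
    using eventually_ge_at_top[of x]
  proof eventually_elim
    case (elim s)
    have sp: "s > 0" using elim x by simp
    \<comment> \<open>A real multiple of F contributes nothing to Im (cnj F F1), so c differs from
      |F|^2 by at most |F| |e|; this bounds F before the term F / (2 s) is known to decay.\<close>
    have "F1 s = e s + \<i> * F s + of_real (1 / (2 * s)) * F s" by (simp add: e_def)
    hence "cnj (F s) * F1 s = cnj (F s) * e s + of_real ((cmod (F s))\<^sup>2) * (\<i> + of_real (1 / (2 * s)))"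
      by (simp only: complex_norm_square) (simp add: algebra_simps)
    hence "c = Im (cnj (F s) * e s) + (cmod (F s))\<^sup>2" using c[OF elim(2)] by simp
    moreover have "\<bar>Im (cnj (F s) * e s)\<bar> \<le> cmod (F s) * cmod (e s)"
      using abs_Im_le_cmod[of "cnj (F s) * e s"] by (simp add: norm_mult)
    moreover have "cmod (F s) * cmod (e s) \<le> cmod (F s)" using elim(1) by (simp add: mult_left_le)
    ultimately have le: "(cmod (F s))\<^sup>2 \<le> \<bar>c\<bar> + cmod (F s)" by linarith
    show ?case
    proof (rule ccontr)
      assume "\<not> cmod (F s) \<le> \<bar>c\<bar> + 1"
      hence g: "cmod (F s) - 1 > \<bar>c\<bar>" by simp
      hence "cmod (F s) * (cmod (F s) - 1) \<ge> 1 * (cmod (F s) - 1)" by (intro mult_right_mono) auto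
      thus False using le g by (simp add: power2_eq_square algebra_simps)
    qed
  qed
  have "((\<lambda>s. of_real (1 / (2 * s)) * F s) \<longlongrightarrow> 0) at_top"
  proof (rule Lim_null_comparison)
    show "\<forall>\<^sub>F s in at_top. norm (of_real (1 / (2 * s)) * F s) \<le> 1 / (2 * s) * (\<bar>c\<bar> + 1)"
      using bd eventually_gt_at_top[of 0]
    proof eventually_elim
      case (elim s)
      have "norm (of_real (1 / (2 * s)) * F s) = 1 / (2 * s) * norm (F s)"
        using elim(2) unfolding norm_mult norm_of_real by simp
      thus ?case using elim by (simp only:) (intro mult_left_mono, auto)
    qed
    show "((\<lambda>s. 1 / (2 * s) * (\<bar>c\<bar> + 1)) \<longlongrightarrow> 0) at_top"
      by (intro tendsto_mult_left_zero real_tendsto_divide_at_top tendsto_const filterlim_tendsto_pos_mult_at_top[OF tendsto_const] filterlim_ident) auto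
  qed
  from tendsto_add[OF rad this] have lim: "((\<lambda>s. F1 s - \<i> * F s) \<longlongrightarrow> 0) at_top" by simp
  show ?thesis
  proof
    show "((\<lambda>s. Re (F1 s) + Im (F s)) \<longlongrightarrow> 0) at_top" "((\<lambda>s. Im (F1 s) - Re (F s)) \<longlongrightarrow> 0) at_top"
      using tendsto_Re[OF lim] tendsto_Im[OF lim] by simp_all
  qed (use x oR oI in auto)
qed

text \<open>Condenses the boundary value problem to one mode: an outgoing solution outside, an
  amplitude \<open>b\<close> that is a_n up to the sign in J_(-n) = (-1)^n J_n, and one matching
  equation in which the interior enters at the argument \<kappa> and the exterior at \<epsilon>
  \<kappa>.\<close>

lemma scattering_mode:
  fixes n :: int
  assumes e: "\<epsilon> > 0" and q0: "q\<^sub>0 > 0" and q: "q > 0" "sqrt (q / q\<^sub>0) = 1 / \<epsilon>" and \<omega>: "\<omega> > 0"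
    and inc: "incident_field \<omega> q\<^sub>0 a ui" and sc: "scattering_solution \<epsilon> \<omega> q q\<^sub>0 ui u"
  defines "\<kappa> \<equiv> sqrt q\<^sub>0 * \<omega>" and "N \<equiv> nat \<bar>n\<bar>"
  obtains f f1 g g1 b where
    "outgoing_pair ((real N)\<^sup>2 - 1 / 4) (\<epsilon> * \<kappa>) f f1 g g1" "cmod b = cmod (a n)"
    "\<And>r. r \<ge> \<epsilon> \<Longrightarrow> circle_coeff (\<lambda>z. u z - ui z) r n = Complex (f (\<kappa> * r)) (g (\<kappa> * r)) / of_real (sqrt (\<kappa> * r))"
    "of_real (\<epsilon> * \<kappa>) * (Complex (f1 (\<epsilon> * \<kappa>)) (g1 (\<epsilon> * \<kappa>)) + b * of_real (JU1 N (\<epsilon> * \<kappa>))) * of_real (JU N \<kappa>)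
      = of_real (\<kappa> * JU1 N \<kappa>) * (Complex (f (\<epsilon> * \<kappa>)) (g (\<epsilon> * \<kappa>)) + b * of_real (JU N (\<epsilon> * \<kappa>)))"
proof -
  have ka: "\<kappa> > 0" using q0 \<omega> by (simp add: \<kappa>_def)
  define x where "x = \<epsilon> * \<kappa>"
  have x: "x > 0" using e ka by (simp add: x_def)
  define w where "w r = circle_coeff u r n" for r
  have ka2: "\<omega>\<^sup>2 * q\<^sub>0 = \<kappa>\<^sup>2" using q0 by (simp add: \<kappa>_def power_mult_distrib)
  have "q / q\<^sub>0 = (1 / \<epsilon>)\<^sup>2" using q q0 by (metis divide_nonneg_pos less_imp_le real_sqrt_pow2)
  hence "q = q\<^sub>0 / \<epsilon>\<^sup>2" using q0 by (simp add: field_simps)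
  \<comment> \<open>The contrast 1/\<epsilon> makes the interior wave number \<kappa> / \<epsilon>,
    so that at r = \<epsilon> the interior argument is \<kappa> itself.\<close>
  hence in2: "\<omega>\<^sup>2 * q = (\<kappa> / \<epsilon>)\<^sup>2" using ka2 by (simp add: power_divide)
  have cu: "continuous_on UNIV u" and cui: "continuous_on UNIV ui"
    using inc sc by (auto simp: incident_field_def scattering_solution_def helmholtz_solution_def)
  have "(\<lambda>z. \<omega>\<^sup>2 * q_eps \<epsilon> q q\<^sub>0 z) = (\<lambda>z. if cmod z < \<epsilon> then (\<kappa> / \<epsilon>)\<^sup>2 else \<kappa>\<^sup>2)"
    using in2 ka2 by (auto simp: q_eps_def)
  hence hs: "helmholtz_solution (\<lambda>z. if cmod z < \<epsilon> then (\<kappa> / \<epsilon>)\<^sup>2 else \<kappa>\<^sup>2) u"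
    and out: "outgoing \<epsilon> \<kappa> (\<lambda>z. u z - ui z)"
    using sc by (auto simp: scattering_solution_def \<kappa>_def mult.commute)
  obtain w1 where w1: "continuous_on {0<..} w1" "\<And>r. r > 0 \<Longrightarrow> (w has_vector_derivative w1 r) (at r)"
    "\<And>r. r > 0 \<Longrightarrow> r \<noteq> \<epsilon> \<Longrightarrow> (w1 has_vector_derivative
      - w1 r / of_real r - of_real ((if r < \<epsilon> then (\<kappa> / \<epsilon>)\<^sup>2 else \<kappa>\<^sup>2) - (of_int n)\<^sup>2 / r\<^sup>2) * w r) (at r)"
    unfolding w_def by (rule helmholtz_coeff_ode[OF hs e]) blast
  have N2: "(of_int n)\<^sup>2 = (real N)\<^sup>2" by (simp add: N_def)
  have cw: "continuous_on S w" for S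
    unfolding w_def by (rule continuous_on_subset[OF continuous_on_circle_coeff[OF cu]]) simp
  have "bounded (w ` {0..\<epsilon>})" by (intro compact_imp_bounded compact_continuous_image cw) auto
  then obtain B where B: "\<And>r. 0 < r \<Longrightarrow> r \<le> \<epsilon> \<Longrightarrow> cmod (w r) \<le> B"
    unfolding bounded_iff by force
  have "of_real \<epsilon> * w1 \<epsilon> * of_real (Jn N (\<kappa> / \<epsilon> * \<epsilon>))
    = of_real (real N * Jn N (\<kappa> / \<epsilon> * \<epsilon>) - \<kappa> / \<epsilon> * \<epsilon> * Jn (Suc N) (\<kappa> / \<epsilon> * \<epsilon>)) * w \<epsilon>"
  proof (rule regular_inside[OF e _ w1(1,2)])
    show "\<kappa> / \<epsilon> > 0" using ka e by simp
    show "cmod (w r) \<le> B" if "0 < r" "r \<le> \<epsilon>" for r using B that .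
    show "(w1 has_vector_derivative - w1 r / of_real r - of_real ((\<kappa> / \<epsilon>)\<^sup>2 - (real N)\<^sup>2 / r\<^sup>2) * w r) (at r)" if "0 < r" "r < \<epsilon>" for r
      using w1(3)[of r] that unfolding N2 by simp
  qed
  hence inner: "of_real \<epsilon> * w1 \<epsilon> * of_real (Jn N \<kappa>) = of_real (real N * Jn N \<kappa> - \<kappa> * Jn (Suc N) \<kappa>) * w \<epsilon>"
    using e by (simp only: nonzero_eq_divide_eq times_divide_eq_left mult.commute[of _ \<epsilon>] nonzero_mult_div_cancel_left) simp
  obtain t :: real where t: "\<bar>t\<bar> = 1" "\<And>x. x > 0 \<Longrightarrow> bessel_J n x = t * Jn N x"
    using bessel_J_Jn[of n] unfolding N_def by blast
  define b where "b = a n * of_real t"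
  have bn: "cmod b = cmod (a n)" using t(1) by (simp add: b_def norm_mult)
  have ui: "circle_coeff ui r n = b * of_real (Jn N (\<kappa> * r))" if r: "r > 0" for r
  proof -
    have "circle_coeff ui r n = a n * of_real (bessel_J n (\<kappa> * r))"
      by (rule circle_coeff_has_sum[where c = "\<lambda>n. a n * of_real (bessel_J n (\<kappa> * r))"])
        (use inc r in \<open>auto simp: incident_field_def \<kappa>_def\<close>)
    thus ?thesis using t(2)[of "\<kappa> * r"] ka r by (simp add: b_def)
  qed
  have diff: "circle_coeff (\<lambda>z. u z - ui z) r n = w r - circle_coeff ui r n" for r
  proof -
    have "(\<lambda>\<theta>. h (rcis r \<theta>) * cis (- of_int n * \<theta>)) integrable_on {0..2 * pi}" if "continuous_on UNIV h" for h
      unfolding rcis_def by (intro integrable_continuous_interval continuous_intros continuous_on_compose2[OF that]) auto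
    from integral_diff[OF this[OF cu] this[OF cui]] show ?thesis
      unfolding w_def circle_coeff_def left_diff_distrib by (simp only: right_diff_distrib)
  qed
  define W where "W s = of_real (sqrt s) * w (s / \<kappa>)" for s
  define W1 where "W1 s = of_real (1 / (2 * sqrt s)) * w (s / \<kappa>) + of_real (sqrt s / \<kappa>) * w1 (s / \<kappa>)" for s
  have dW: "(W has_vector_derivative W1 s) (at s)"
      "(W1 has_vector_derivative - of_real (qpot ((real N)\<^sup>2 - 1 / 4) s) * W s) (at s)" if s: "s > x" for s
  proof -
    have r: "s / \<kappa> > 0" "s / \<kappa> > \<epsilon>" "\<kappa> * (s / \<kappa>) = s" using s ka x by (auto simp: x_def field_simps)
    have "(w1 has_vector_derivative - w1 (s / \<kappa>) / of_real (s / \<kappa>) - of_real (\<kappa>\<^sup>2 - (real N)\<^sup>2 / (s / \<kappa>)\<^sup>2) * w (s / \<kappa>)) (at (s / \<kappa>))"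
      using w1(3)[OF r(1)] r(2) unfolding N2 by simp
    from scaled_mode[OF ka r(1) w1(2)[OF r(1)] this] show "(W has_vector_derivative W1 s) (at s)"
      "(W1 has_vector_derivative - of_real (qpot ((real N)\<^sup>2 - 1 / 4) s) * W s) (at s)"
      unfolding r(3) W_def[abs_def] W1_def[abs_def] by simp_all
  qed
  have cW: "continuous_on {x..} W" "continuous_on {x..} W1"
    unfolding W_def[abs_def] W1_def[abs_def] using x ka
    by (auto intro!: continuous_intros continuous_on_compose2[OF cw[of UNIV]] continuous_on_compose2[OF w1(1)])
  define F where "F s = W s - b * of_real (JU N s)" for s
  define F1 where "F1 s = W1 s - b * of_real (JU1 N s)" for s
  have Jd: "((\<lambda>s. of_real (JU N s) :: complex) has_vector_derivative of_real (JU1 N s)) (at s)"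
      "((\<lambda>s. of_real (JU1 N s) :: complex) has_vector_derivative of_real (- qpot ((real N)\<^sup>2 - 1 / 4) s * JU N s)) (at s)" if "s > 0" for s
  proof -
    have "osc_all ((real N)\<^sup>2 - 1 / 4) (JU N) (JU1 N)" by (rule JU_osc)
    hence "(JU N has_real_derivative JU1 N s) (at s)" "(JU1 N has_real_derivative - qpot ((real N)\<^sup>2 - 1 / 4) s * JU N s) (at s)"
      using that unfolding osc_all_def by blast+
    thus "((\<lambda>s. of_real (JU N s) :: complex) has_vector_derivative of_real (JU1 N s)) (at s)"
      "((\<lambda>s. of_real (JU1 N s) :: complex) has_vector_derivative of_real (- qpot ((real N)\<^sup>2 - 1 / 4) s * JU N s)) (at s)"
      by (simp_all only: has_vector_derivative_complex_of_real)
  qed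
  have Jc: "continuous_on {x..} (JU N)" "continuous_on {x..} (JU1 N)"
    using x by (auto intro!: osc_all_cont[OF JU_osc])
  have F: "circle_coeff (\<lambda>z. u z - ui z) r n = F (\<kappa> * r) / of_real (sqrt (\<kappa> * r))" if r: "r > 0" for r
  proof -
    have "F (\<kappa> * r) = of_real (sqrt (\<kappa> * r)) * (w r - b * of_real (Jn N (\<kappa> * r)))"
      using ka by (simp add: F_def W_def JU_def algebra_simps)
    thus ?thesis using r ka by (simp add: diff ui)
  qed
  have op: "outgoing_pair ((real N)\<^sup>2 - 1 / 4) x (\<lambda>s. Re (F s)) (\<lambda>s. Re (F1 s)) (\<lambda>s. Im (F s)) (\<lambda>s. Im (F1 s))"
  proof (rule outgoing_pairI[OF x])
    show "continuous_on {x..} F" "continuous_on {x..} F1"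
      unfolding F_def[abs_def] F1_def[abs_def] by (intro continuous_intros cW Jc)+
    show "(F has_vector_derivative F1 s) (at s)" if "s > x" for s
      unfolding F_def[abs_def] F1_def by (rule has_vector_derivative_diff[OF dW(1)[OF that] has_vector_derivative_mult_right[OF Jd(1)]]) (use x that in simp)
    show "(F1 has_vector_derivative - of_real (qpot ((real N)\<^sup>2 - 1 / 4) s) * F s) (at s)" if "s > x" for s
    proof -
      have "(F1 has_vector_derivative - of_real (qpot ((real N)\<^sup>2 - 1 / 4) s) * W s - b * of_real (- qpot ((real N)\<^sup>2 - 1 / 4) s * JU N s)) (at s)"
        unfolding F1_def[abs_def] by (rule has_vector_derivative_diff[OF dW(2)[OF that] has_vector_derivative_mult_right[OF Jd(2)]]) (use x that in simp)
      thus ?thesis by (simp add: F_def algebra_simps)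
    qed
    define v1 where "v1 r = w1 r - b * of_real (\<kappa> * (real N / (\<kappa> * r) * Jn N (\<kappa> * r) - Jn (Suc N) (\<kappa> * r)))" for r
    have vd: "((\<lambda>r. circle_coeff (\<lambda>z. u z - ui z) r n) has_vector_derivative v1 r) (at r)" if r: "r > \<epsilon>" for r
    proof -
      have r0: "r > 0" using r e by simp
      have "((\<lambda>r. Jn N (\<kappa> * r)) has_real_derivative \<kappa> * (real N / (\<kappa> * r) * Jn N (\<kappa> * r) - Jn (Suc N) (\<kappa> * r))) (at r)"
        unfolding mult.commute[of \<kappa> "real N / (\<kappa> * r) * Jn N (\<kappa> * r) - Jn (Suc N) (\<kappa> * r)"]
        using ka r0 by (intro DERIV_chain2[OF Jn_deriv]) (auto intro!: derivative_eq_intros)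
      hence "((\<lambda>r. w r - b * of_real (Jn N (\<kappa> * r))) has_vector_derivative v1 r) (at r)"
        unfolding v1_def
        by (intro has_vector_derivative_diff w1(2) r0 has_vector_derivative_mult_right has_vector_derivative_complex_of_real)
          (simp add: has_real_derivative_iff_has_vector_derivative)
      thus ?thesis
        by (rule has_vector_derivative_transform_within_open[where S = "{0<..}"]) (use r0 in \<open>auto simp: diff ui\<close>)
    qed
    have "((\<lambda>r. of_real (sqrt r) * (v1 r - \<i> * of_real \<kappa> * circle_coeff (\<lambda>z. u z - ui z) r n)) \<longlongrightarrow> 0) at_top"
      by (rule coeff_radiation[OF _ out vd]) (intro continuous_intros cu cui)
    moreover have "LIM s at_top. s / \<kappa> :> at_top"
      using ka by (intro filterlim_at_top_mult_tendsto_pos[OF tendsto_const, of "1 / \<kappa>", simplified] filterlim_ident) auto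
    ultimately have "((\<lambda>s. of_real (sqrt (s / \<kappa>)) * (v1 (s / \<kappa>) - \<i> * of_real \<kappa> * circle_coeff (\<lambda>z. u z - ui z) (s / \<kappa>) n)) \<longlongrightarrow> 0) at_top"
      by (rule filterlim_compose)
    from tendsto_mult_right_zero[OF this, of "of_real (1 / sqrt \<kappa>)"]
    have lim: "((\<lambda>s. of_real (1 / sqrt \<kappa>) * (of_real (sqrt (s / \<kappa>)) * (v1 (s / \<kappa>) - \<i> * of_real \<kappa> * circle_coeff (\<lambda>z. u z - ui z) (s / \<kappa>) n))) \<longlongrightarrow> 0) at_top" .
    \<comment> \<open>Differentiating the factor sqrt s produces the term F / (2 s), by which the
      radiation expression for F differs from the one for the coefficient.\<close>
    have ev: "\<forall>\<^sub>F s in at_top. of_real (1 / sqrt \<kappa>) * (of_real (sqrt (s / \<kappa>)) * (v1 (s / \<kappa>) - \<i> * of_real \<kappa> * circle_coeff (\<lambda>z. u z - ui z) (s / \<kappa>) n))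
        = F1 s - \<i> * F s - F s / of_real (2 * s)"
      using eventually_gt_at_top[of 0]
    proof eventually_elim
      case (elim s)
      define h where "h = sqrt s"
      have h: "h > 0" "s = h * h" using elim by (auto simp: h_def)
      let ?J = "Jn N s" and ?K = "Jn (Suc N) s"
      have k: "1 / sqrt \<kappa> * sqrt (s / \<kappa>) = h / \<kappa>" using ka by (simp add: h_def real_sqrt_divide)
      have cs: "circle_coeff (\<lambda>z. u z - ui z) (s / \<kappa>) n = w (s / \<kappa>) - b * of_real ?J"
        using elim ka by (simp add: diff ui)
      have v: "v1 (s / \<kappa>) = w1 (s / \<kappa>) - b * of_real (\<kappa> * (real N / s * ?J - ?K))"
        using ka by (simp add: v1_def)
      have Fs: "F s = of_real h * (w (s / \<kappa>) - b * of_real ?J)"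
        by (simp add: F_def W_def JU_def h_def algebra_simps)
      have F1s: "F1 s = of_real (1 / (2 * h)) * w (s / \<kappa>) + of_real (h / \<kappa>) * w1 (s / \<kappa>) - b * of_real (h * ((real N + 1 / 2) / s * ?J - ?K))"
        by (simp add: F1_def W1_def JU1_def h_def)
      have a1: "h / \<kappa> * (\<kappa> * (real N / s * ?J - ?K)) = h * ((real N + 1 / 2) / s * ?J - ?K) - 1 / (2 * h) * ?J"
        unfolding h(2) using ka h(1) by (simp add: field_simps)
      have a2: "h / \<kappa> * \<kappa> = h" using ka by simp
      have a3: "F s / of_real (2 * s) = of_real (1 / (2 * h)) * (w (s / \<kappa>) - b * of_real ?J)"
        unfolding Fs unfolding h(2) using h(1) by (simp add: field_simps)
      have "of_real (1 / sqrt \<kappa>) * (of_real (sqrt (s / \<kappa>)) * (v1 (s / \<kappa>) - \<i> * of_real \<kappa> * circle_coeff (\<lambda>z. u z - ui z) (s / \<kappa>) n))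
        = of_real (1 / sqrt \<kappa> * sqrt (s / \<kappa>)) * (v1 (s / \<kappa>) - \<i> * of_real \<kappa> * circle_coeff (\<lambda>z. u z - ui z) (s / \<kappa>) n)"
        by (simp only: of_real_mult mult.assoc)
      also have "\<dots> = of_real (h / \<kappa>) * w1 (s / \<kappa>) - b * of_real (h / \<kappa> * (\<kappa> * (real N / s * ?J - ?K))) - \<i> * (of_real (h / \<kappa> * \<kappa>) * (w (s / \<kappa>) - b * of_real ?J))"
        unfolding k cs v by (simp only: of_real_mult) (simp only: ring_distribs mult_ac)
      also have "\<dots> = F1 s - \<i> * F s - F s / of_real (2 * s)"
        unfolding a1 a2 a3 unfolding F1s Fs of_real_diff of_real_mult[of "1 / (2 * h)"] by (simp add: ring_distribs)
      finally show ?case .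
    qed
    show "((\<lambda>s. F1 s - \<i> * F s - F s / of_real (2 * s)) \<longlongrightarrow> 0) at_top"
      using lim by (rule Lim_transform_eventually) (rule ev)
  qed
  have tot: "Complex (Re (F x)) (Im (F x)) + b * of_real (JU N x) = W x" "Complex (Re (F1 x)) (Im (F1 x)) + b * of_real (JU1 N x) = W1 x"
    by (simp_all add: F_def F1_def complex_eq_iff)
  have xk: "x / \<kappa> = \<epsilon>" using ka by (simp add: x_def)
  have "of_real x * W1 x * of_real (JU N \<kappa>) = of_real (\<kappa> * JU1 N \<kappa>) * W x"
  proof -
    define h where "h = sqrt x"
    have h: "h > 0" "x = h * h" using x by (auto simp: h_def)
    have 1: "of_real x * W1 x = of_real h * (w \<epsilon> / 2 + of_real \<epsilon> * w1 \<epsilon>)"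
    proof -
      have "x * (1 / (2 * h)) = h * (1 / 2)" using h by (simp add: field_simps)
      moreover have "x * (h / \<kappa>) = h * \<epsilon>" unfolding xk[symmetric] by simp
      ultimately have "of_real (x * (1 / (2 * h))) * w \<epsilon> + of_real (x * (h / \<kappa>)) * w1 \<epsilon> = of_real (h * (1 / 2)) * w \<epsilon> + of_real (h * \<epsilon>) * w1 \<epsilon>"
        by (simp only:)
      thus ?thesis by (simp only: W1_def h_def[symmetric] xk of_real_mult) (simp add: algebra_simps)
    qed
    have 2: "\<kappa> * JU1 N \<kappa> = sqrt \<kappa> * (Jn N \<kappa> / 2 + (real N * Jn N \<kappa> - \<kappa> * Jn (Suc N) \<kappa>))"
      using ka by (simp add: JU1_def field_simps)
    have "of_real x * W1 x * of_real (JU N \<kappa>) = of_real (h * sqrt \<kappa>) * (w \<epsilon> * of_real (Jn N \<kappa>) / 2 + of_real \<epsilon> * w1 \<epsilon> * of_real (Jn N \<kappa>))"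
      unfolding 1 JU_def by (simp add: algebra_simps)
    also have "\<dots> = of_real (\<kappa> * JU1 N \<kappa>) * W x"
      unfolding inner 2 W_def xk h_def by (simp add: algebra_simps)
    finally show ?thesis .
  qed
  with that[OF op[unfolded x_def] bn] show thesis
    unfolding tot[symmetric] unfolding x_def using F e by (simp add: complex_eq_iff)
qed

section \<open>Modes of positive order\<close>

text \<open>The outgoing solution is quantified existentially, so the set depends on \<mu>, U,
  \<epsilon> and \<delta> but not on the incident field; c > 0 excludes the zero solution, for which
  k has no meaning. The -1 / 2 compensates the factor sqrt s in U and leaves \<kappa> J' /
  J.\<close>

definition resonant :: "real \<Rightarrow> (real \<Rightarrow> real) \<Rightarrow> (real \<Rightarrow> real) \<Rightarrow> real \<Rightarrow> real \<Rightarrow> real set" where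
  "resonant \<mu> U U1 \<epsilon> \<delta> = {\<kappa>. U \<kappa> \<noteq> 0 \<and> (\<exists>f f1 g g1. outgoing_pair \<mu> (\<epsilon> * \<kappa>) f f1 g g1 \<and>
    outgoing_pair.c (\<epsilon> * \<kappa>) f f1 g g1 > 0 \<and>
    \<bar>outgoing_pair.k f f1 g g1 (\<epsilon> * \<kappa>) + \<kappa> * U1 \<kappa> / U \<kappa> - 1 / 2\<bar> \<le> \<delta>)}"

lemma (in outgoing_pair) p_pos_of_c: "c > 0 \<Longrightarrow> s \<ge> x0 \<Longrightarrow> p s > 0"
  using wr[of s] by (auto simp: p_def sum_power2_gt_zero_iff)

text \<open>Uniqueness of k lets two resonant frequencies share one outgoing solution, so
  \<open>bad_pair_dist\<close> bounds their distance. Zeros of U occur only beyond t0, where the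
  bound on the potential keeps them more than 1 apart.\<close>

lemma resonant_cover:
  assumes U: "osc_all \<mu> U U1" and e: "0 < \<epsilon>" and lo: "lo > 0" and \<delta>: "\<delta> \<ge> 0"
    and k: "\<And>x f f1 g g1 t. outgoing_pair \<mu> x f f1 g g1 \<Longrightarrow> outgoing_pair.c x f f1 g g1 > 0 \<Longrightarrow>
      \<epsilon> * lo \<le> x \<Longrightarrow> x \<le> t \<Longrightarrow> t \<le> \<epsilon> * hi \<Longrightarrow> 0 \<le> outgoing_pair.k f f1 g g1 t \<and> outgoing_pair.k f f1 g g1 t \<le> kb"
    and q: "\<And>t. t \<ge> t0 \<Longrightarrow> \<bar>qpot \<mu> t\<bar> \<le> 5 / 4" and nz: "0 < t0" "\<And>t. 0 < t \<Longrightarrow> t \<le> t0 \<Longrightarrow> U t \<noteq> 0"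
    and kb: "0 \<le> kb" and \<theta>: "2 * kb * \<delta> \<le> \<theta> * lo\<^sup>2" "\<theta> \<ge> 0" "\<rho> = 1 - \<epsilon>\<^sup>2 - \<theta>" "\<rho> > 0"
    and B: "lo \<le> hi \<Longrightarrow> 4 * \<delta> / \<rho> * (1 / lo + ln (hi / lo)) \<le> B"
  shows "\<exists>I\<in>sets borel. resonant \<mu> U U1 \<epsilon> \<delta> \<inter> {lo..hi} \<subseteq> I \<and> I \<subseteq> {0<..} \<and> emeasure lborel I \<le> ennreal B"
proof (rule cover_cells[where d = "2 * \<delta> / \<rho>" and Z = "\<lambda>z. U z = 0" and lo = lo and hi = hi])
  show "False" if "lo \<le> z1" "z1 < z2" "z2 - z1 \<le> 1" "U z1 = 0" "U z2 = 0" for z1 z2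
  proof (rule zero_spacing[OF U _ that(2,4,5,3)])
    have z: "z1 > t0" using nz(2)[of z1] that lo by fastforce
    show "0 < t0" "t0 \<le> z1" "U t0 \<noteq> 0" "0 < z1" using nz z by auto
    show "\<bar>qpot \<mu> t\<bar> \<le> 5 / 4" if "z1 \<le> t" for t using q[of t] that z by simp
  qed
  fix s t
  assume s: "s \<in> resonant \<mu> U U1 \<epsilon> \<delta> \<inter> {lo..hi}" and t: "t \<in> resonant \<mu> U U1 \<epsilon> \<delta> \<inter> {lo..hi}"
    and st: "s < t" and nz: "\<And>z. s \<le> z \<Longrightarrow> z \<le> t \<Longrightarrow> U z \<noteq> 0"
  obtain f f1 g g1 where o1: "outgoing_pair \<mu> (\<epsilon> * s) f f1 g g1" and c1: "outgoing_pair.c (\<epsilon> * s) f f1 g g1 > 0"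
    and k1: "\<bar>outgoing_pair.k f f1 g g1 (\<epsilon> * s) + s * U1 s / U s - 1 / 2\<bar> \<le> \<delta>"
    using s unfolding resonant_def by blast
  obtain F F1 G G1 where o2: "outgoing_pair \<mu> (\<epsilon> * t) F F1 G G1" and c2: "outgoing_pair.c (\<epsilon> * t) F F1 G G1 > 0"
    and k2: "\<bar>outgoing_pair.k F F1 G G1 (\<epsilon> * t) + t * U1 t / U t - 1 / 2\<bar> \<le> \<delta>"
    using t unfolding resonant_def by blast
  have le: "\<epsilon> * s \<le> \<epsilon> * t" using e st by simp
  have pp: "outgoing_pair.p f g r > 0" if "r \<ge> \<epsilon> * s" for r
    by (rule outgoing_pair.p_pos_of_c[OF o1 c1 that])
  have "outgoing_pair.k f f1 g g1 (\<epsilon> * t) = outgoing_pair.k F F1 G G1 (\<epsilon> * t)"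
    by (rule outgoing_pair_unique_k[OF outgoing_pair_restrict(1)[OF o1 le] o2 pp[OF le] outgoing_pair.p_pos_of_c[OF o2 c2 order_refl]])
  hence k2': "\<bar>outgoing_pair.k f f1 g g1 (\<epsilon> * t) + t * U1 t / U t - 1 / 2\<bar> \<le> \<delta>" using k2 by simp
  have s0: "0 < s" "lo\<^sup>2 \<le> s\<^sup>2" using s lo by (auto intro: power_mono)
  show "s * (t - s) \<le> 2 * \<delta> / \<rho>"
  proof (rule bad_pair_dist[OF U o1 e s0(1) st nz pp _ k1 k2' _ \<theta>(3,4), where kb = kb])
    show "0 \<le> outgoing_pair.k f f1 g g1 r \<and> outgoing_pair.k f f1 g g1 r \<le> kb" if "\<epsilon> * s \<le> r" "r \<le> \<epsilon> * t" for r
    proof (rule k[OF o1 c1 _ that(1)])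
      show "\<epsilon> * lo \<le> \<epsilon> * s" using e s by simp
      have "\<epsilon> * t \<le> \<epsilon> * hi" using e t by simp
      thus "r \<le> \<epsilon> * hi" using that(2) by linarith
    qed
    show "2 * kb * \<delta> \<le> \<theta> * s\<^sup>2" using \<theta>(1) mult_left_mono[OF s0(2) \<theta>(2)] by linarith
  qed
next
  show "0 \<le> 2 * \<delta> / \<rho>" using \<delta> \<theta>(4) by simp
  show "2 * (2 * \<delta> / \<rho>) * (1 / lo + ln (hi / lo)) \<le> B" if "lo \<le> hi"
    using B[OF that] by (simp add: mult.assoc)
  show "U s \<noteq> 0" if "s \<in> resonant \<mu> U U1 \<epsilon> \<delta> \<inter> {lo..hi}" for s
    using that unfolding resonant_def by blast
qed (use lo in auto)

text \<open>The square of exp (3/2) is e^3 \<le> 27 < 36, while 1/\<epsilon> > 7 > 6.\<close>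

lemma ln_inverse_ge:
  fixes \<epsilon> :: real
  assumes "0 < \<epsilon>" "\<epsilon> < 1 / 7"
  shows "\<bar>ln \<epsilon>\<bar> = - ln \<epsilon>" "- ln \<epsilon> \<ge> 3 / 2" "exp (- \<bar>ln \<epsilon>\<bar>) = \<epsilon>"
proof -
  have "(exp (3 / 2 :: real))\<^sup>2 = exp 1 ^ 3" 
  proof -
    have "exp (3 / 2 + 3 / 2 :: real) = exp (1 + 1 + 1)" by simp
    thus ?thesis by (simp only: power2_eq_square power3_eq_cube exp_add)
  qed
  also have "\<dots> \<le> 3 ^ 3" by (intro power_mono exp_le) auto
  also have "\<dots> \<le> (6 :: real)\<^sup>2" by simp
  finally have "exp (3 / 2 :: real) \<le> 6" by (rule power2_le_imp_le) simp
  also have "6 \<le> 1 / \<epsilon>" using assms by (simp add: field_simps)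
  finally have "exp (3 / 2) \<le> 1 / \<epsilon>" .
  moreover have "1 / \<epsilon> > 0" using assms by simp
  ultimately have "3 / 2 \<le> ln (1 / \<epsilon>)" by (simp only: ln_ge_iff)
  moreover have "ln (1 / \<epsilon>) = - ln \<epsilon>" using assms by (subst ln_div) auto
  ultimately have ge: "- ln \<epsilon> \<ge> 3 / 2" by (simp only:)
  thus "- ln \<epsilon> \<ge> 3 / 2" .
  from ge have ab: "\<bar>ln \<epsilon>\<bar> = - ln \<epsilon>" by linarith
  thus "\<bar>ln \<epsilon>\<bar> = - ln \<epsilon>" .
  show "exp (- \<bar>ln \<epsilon>\<bar>) = \<epsilon>" unfolding ab using assms by simp
qed

lemma resonant_cover_pos:
  assumes e: "0 < \<epsilon>" "\<epsilon> < 1 / 7" and N: "N \<ge> 1" and Z: "Z \<ge> 18 * (1 + real N)\<^sup>2"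
  shows "\<exists>I\<in>sets borel. resonant ((real N)\<^sup>2 - 1 / 4) (JU N) (JU1 N) \<epsilon> (2 * real N / (Z - 1)) \<inter> {real N..real N / \<epsilon>} \<subseteq> I \<and> I \<subseteq> {0<..} \<and>
    emeasure lborel I \<le> ennreal (18 * real N * \<bar>ln \<epsilon>\<bar> / Z)"
proof -
  define n where "n = real N"
  have n: "n \<ge> 1" using N by (simp add: n_def)
  have "4 * n \<le> (1 + n)\<^sup>2" using zero_le_power2[of "n - 1"] by (simp add: power2_eq_square algebra_simps)
  hence Zn: "Z \<ge> 72 * n" using Z by (simp add: n_def)
  have e2: "\<epsilon>\<^sup>2 \<le> 1 / 49" using power_mono[of \<epsilon> "1 / 7" 2] e by (simp add: power_divide)
  \<comment> \<open>This makes (1 - 1/Z) \<delta> = 2 n / Z, the form in which the bound on the mode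
    uses it.\<close>
  define \<delta> where "\<delta> = 2 * n / (Z - 1)"
  have Z1: "Z - 1 \<ge> 71 * n" using Zn n by linarith
  have dz: "\<delta> \<ge> 0" "\<delta> * (Z - 1) = 2 * n" using n Z1 by (auto simp: \<delta>_def)
  show ?thesis unfolding n_def[symmetric] \<delta>_def[symmetric]
  proof (rule resonant_cover[where kb = "2 * n" and \<theta> = "8 / 71" and \<rho> = "1 - \<epsilon>\<^sup>2 - 8 / 71" and ?t0.0 = n])
    show "osc_all (n\<^sup>2 - 1 / 4) (JU N) (JU1 N)" unfolding n_def by (rule JU_osc)
    show "JU N t \<noteq> 0" if "0 < t" "t \<le> n" for t using Jn_mono_facts(1)[OF N, of t] that by (simp add: JU_def n_def)
    show "\<bar>qpot (n\<^sup>2 - 1 / 4) t\<bar> \<le> 5 / 4" if "t \<ge> n" for t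
    proof -
      have "n\<^sup>2 \<le> t\<^sup>2" "1 \<le> n\<^sup>2" using that n by (auto intro: power_mono)
      hence "(n\<^sup>2 - 1 / 4) / t\<^sup>2 \<le> 1" "0 \<le> (n\<^sup>2 - 1 / 4) / t\<^sup>2" by (simp_all add: divide_le_eq_1)
      thus ?thesis unfolding qpot_def by linarith
    qed
    \<comment> \<open>The origin of \<theta> = 8/71: the denominator satisfies Z - 1 \<ge> 71 n
      \<ge> 71.\<close>
    have "2 * (2 * n) * \<delta> = 8 * n\<^sup>2 / (Z - 1)" by (simp add: \<delta>_def power2_eq_square)
    also have "\<dots> \<le> 8 * n\<^sup>2 / 71" using Z1 n by (intro divide_left_mono mult_pos_pos) auto
    finally show "2 * (2 * n) * \<delta> \<le> 8 / 71 * n\<^sup>2" by simp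
    fix x f f1 g g1 t
    assume op: "outgoing_pair (n\<^sup>2 - 1 / 4) x f f1 g g1" and c: "outgoing_pair.c x f f1 g g1 > 0" and t: "x \<le> t" "t \<le> \<epsilon> * (n / \<epsilon>)"
    interpret outgoing_pos "n\<^sup>2 - 1 / 4" x f f1 g g1
      by (intro outgoing_pos.intro op outgoing_pos_axioms.intro c) (use n one_le_power[of n 2] in linarith)
    have "t > 0" "t \<le> n" using t x0 e by auto
    hence "t\<^sup>2 \<le> n\<^sup>2" by (intro power_mono) auto
    moreover have "2 * n\<^sup>2 \<le> (3 / 2 * n)\<^sup>2" by (simp add: power_mult_distrib power_divide)
    ultimately have "t\<^sup>2 + (n\<^sup>2 - 1 / 4) \<le> (3 / 2 * n)\<^sup>2" by linarith
    hence "sqrt (t\<^sup>2 + (n\<^sup>2 - 1 / 4)) \<le> 3 / 2 * n" using n by (intro real_le_lsqrt) auto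
    thus "0 \<le> k t \<and> k t \<le> 2 * n" using k_ge_half[OF t(1)] k_le[OF t(1)] n by linarith
  next
    define L where "L = \<bar>ln \<epsilon>\<bar>"
    define \<rho> where "\<rho> = 1 - \<epsilon>\<^sup>2 - 8 / 71"
    have L: "L \<ge> 3 / 2" and Ln: "ln (n / \<epsilon> / n) = L" using ln_inverse_ge[OF e] n e by (simp_all add: L_def ln_div)
    have \<rho>: "\<rho> \<ge> 13 / 15" using e2 by (simp add: \<rho>_def)
    have "1 / n \<le> 1" using n by simp
    hence "1 / n + L \<le> 5 / 3 * L" "0 \<le> 1 / n + L" using L n by (linarith, simp)
    \<comment> \<open>4 * (15/13) * (5/3) is below 8. Passing from Z - 1 to Z costs a factor 9/8,
      and with \<delta> = 2 n / (Z - 1) the constant becomes 8 * 2 * 9/8 = 18.\<close>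
    hence "4 * \<delta> / \<rho> * (1 / n + L) \<le> 4 * \<delta> / (13 / 15) * (5 / 3 * L)"
      using \<rho> dz by (intro mult_mono divide_left_mono) auto
    also have "\<dots> \<le> 8 * \<delta> * L" using dz L by (simp add: field_simps) 
    also have "8 * \<delta> * L \<le> 18 * n * L / Z"
    proof -
      have "Z \<ge> 72" using Z1 n by linarith
      hence "Z \<le> 9 / 8 * (Z - 1)" by simp
      hence "\<delta> * Z \<le> \<delta> * (9 / 8 * (Z - 1))" using dz by (intro mult_left_mono)
      hence "\<delta> * Z \<le> 9 / 4 * n" using dz by (simp add: algebra_simps)
      hence "\<delta> \<le> 9 / 4 * n / Z" using Zn n by (subst pos_le_divide_eq) auto
      hence "8 * \<delta> * L \<le> 8 * (9 / 4 * n / Z) * L" using L dz Zn n by (intro mult_mono) auto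
      thus ?thesis by (simp add: algebra_simps)
    qed
    finally show "4 * \<delta> / (1 - \<epsilon>\<^sup>2 - 8 / 71) * (1 / n + ln (n / \<epsilon> / n)) \<le> 18 * n * \<bar>ln \<epsilon>\<bar> / Z"
      unfolding Ln \<rho>_def[symmetric] L_def .
  qed (use n e e2 dz in auto)
qed

lemma JU_nontrivial:
  assumes \<kappa>: "\<kappa> > 0"
  shows "JU N \<kappa> \<noteq> 0 \<or> JU1 N \<kappa> \<noteq> 0"
proof (rule ccontr)
  assume z: "\<not> ?thesis"
  obtain \<eta> where \<eta>: "\<eta> > 0" "\<And>s. 0 < s \<Longrightarrow> s < \<eta> \<Longrightarrow> Jn N s > 0" using Jn_small_pos[of N] by blast
  define s where "s = min \<kappa> \<eta> / 2"
  have s: "0 < s" "s \<le> \<kappa>" "s < \<eta>" using \<kappa> \<eta> by (auto simp: s_def min_def)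
  have "JU N s = 0" using osc_all_vanish[OF JU_osc \<kappa>, of N s] z s by auto
  thus False using \<eta>(2)[OF s(1,3)] s by (simp add: JU_def)
qed

text \<open>If \<epsilon> \<kappa> \<ge> n, the energy inequality alone bounds p. Otherwise p
  decreases and its value at the interface suffices: either the incident term at y = \<epsilon>
  \<kappa> already bounds it, or the total field is at least (1 - 1/Z) sqrt p, and the lower bound
  \<delta> for |\<sigma>| closes the estimate with y the critical point of sqrt s J_N.\<close>

lemma mode_bound_pos:
  fixes x \<kappa> :: real
  assumes e: "0 < \<epsilon>" "\<epsilon> < 1 / 7" and N: "N \<ge> 1" and Z: "Z \<ge> 18 * (1 + real N)\<^sup>2" and \<kappa>: "\<kappa> > 0"
    and op: "outgoing_pair ((real N)\<^sup>2 - 1 / 4) (\<epsilon> * \<kappa>) f f1 g g1"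
    and match: "of_real (\<epsilon> * \<kappa>) * (Complex (f1 (\<epsilon> * \<kappa>)) (g1 (\<epsilon> * \<kappa>)) + b * of_real (JU1 N (\<epsilon> * \<kappa>))) * of_real (JU N \<kappa>)
      = of_real (\<kappa> * JU1 N \<kappa>) * (Complex (f (\<epsilon> * \<kappa>)) (g (\<epsilon> * \<kappa>)) + b * of_real (JU N (\<epsilon> * \<kappa>)))"
    and nres: "\<kappa> \<notin> resonant ((real N)\<^sup>2 - 1 / 4) (JU N) (JU1 N) \<epsilon> (2 * real N / (Z - 1)) \<inter> {real N..real N / \<epsilon>}"
  shows "\<exists>y>0. \<forall>s\<ge>\<epsilon> * \<kappa>. (f s)\<^sup>2 + (g s)\<^sup>2 \<le> \<epsilon> * \<kappa> * (Z * cmod b * Jn N y)\<^sup>2"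
proof -
  define n where "n = real N"
  define x where "x = \<epsilon> * \<kappa>"
  have n: "n \<ge> 1" using N by (simp add: n_def)
  have x: "x > 0" using e \<kappa> by (simp add: x_def)
  have mu: "n\<^sup>2 - 1 / 4 \<ge> 0" using one_le_power[of n 2] n by linarith
  have "4 * n \<le> (1 + n)\<^sup>2" using zero_le_power2[of "n - 1"] by (simp add: power2_eq_square algebra_simps)
  hence Zn: "Z \<ge> 72 * n" using Z by (simp add: n_def)
  interpret outgoing_pair "n\<^sup>2 - 1 / 4" x f f1 g g1 using op by (simp add: n_def x_def)
  note match' = match[folded x_def]
  show ?thesis unfolding x_def[symmetric] p_def[symmetric]
  proof (cases "c = 0")
    case True
    thus "\<exists>y>0. \<forall>s\<ge>x. p s \<le> x * (Z * cmod b * Jn N y)\<^sup>2"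
      using c_zero x by (intro exI[of _ 1]) (auto simp: p_def)
  next
    case False
    hence c: "c > 0" using c_nonneg by simp
    interpret outgoing_pos "n\<^sup>2 - 1 / 4" x f f1 g g1 by unfold_locales (use c mu in auto)
    have U: "osc_all (n\<^sup>2 - 1 / 4) (JU N) (JU1 N)" unfolding n_def by (rule JU_osc)
    note nt = JU_nontrivial[OF \<kappa>, of N]
    obtain t where t: "n \<le> t" "t \<le> 4 * n" "JU1 N t = 0" using JU_critical[OF N] by (auto simp: n_def)
    have t0: "t > 0" "n\<^sup>2 - 1 / 4 < t\<^sup>2" using t n power_mono[of n t 2] by (auto intro: order.strict_trans2[of _ "n\<^sup>2"])
    \<comment> \<open>Since t \<le> 4 n, this dominates (sqrt t J_N(t))^2.\<close>
    define Q where "Q = 4 * n * (Jn N t)\<^sup>2"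
    have Q0: "Q \<ge> 0" using n by (simp add: Q_def)
    have UQ: "(JU N t)\<^sup>2 \<le> Q" using t t0 by (auto simp: JU_def Q_def power_mult_distrib intro!: mult_right_mono)
    define \<Gamma> where "\<Gamma> = cmod (\<gamma> (JU N) (JU1 N))"
    have G0: "\<Gamma> \<ge> 0" by (simp add: \<Gamma>_def)
    have "\<Gamma>\<^sup>2 \<le> c * (JU N t)\<^sup>2"
      unfolding \<Gamma>_def by (rule energy_limit_le_critical[OF U c mu t0 t(3)])
    also have "\<dots> \<le> c * Q" using UQ c by (intro mult_left_mono) auto
    finally have G2: "\<Gamma>\<^sup>2 \<le> c * Q" .
    have cG: "c \<le> cmod b * \<Gamma>" unfolding \<Gamma>_def by (rule incident_energy_bound[OF nt match' \<kappa>])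
    \<comment> \<open>The unknown c is eliminated: \<Gamma>^2 \<le> c Q and c \<le> |b| \<Gamma>
      bound \<Gamma> by |b| Q and c by |b|^2 Q.\<close>
    have "\<Gamma> * \<Gamma> \<le> \<Gamma> * (cmod b * Q)"
      using G2 mult_right_mono[OF cG Q0] by (simp add: power2_eq_square algebra_simps)
    moreover have "\<Gamma> > 0" using cG c G0 by (cases "\<Gamma> = 0") auto
    ultimately have GQ: "\<Gamma> \<le> cmod b * Q" by simp
    have cQ: "c \<le> (cmod b)\<^sup>2 * Q"
      using cG mult_left_mono[OF GQ, of "cmod b"] by (simp add: power2_eq_square algebra_simps)
    show "\<exists>y>0. \<forall>s\<ge>x. p s \<le> x * (Z * cmod b * Jn N y)\<^sup>2"
    proof (cases "x \<ge> n")
      case True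
      have "p s \<le> x * (Z * cmod b * Jn N t)\<^sup>2" if s: "s \<ge> x" for s
      proof -
        have "n\<^sup>2 \<le> s\<^sup>2" using s True n by (intro power_mono) auto
        moreover have "qpot (n\<^sup>2 - 1 / 4) s = 1 - (n\<^sup>2 - 1 / 4) / s\<^sup>2" by (simp add: qpot_def)
        moreover have "(n\<^sup>2 - 1 / 4) / s\<^sup>2 \<le> (n\<^sup>2 - 1 / 4) / n\<^sup>2"
          using calculation(1) mu n by (intro divide_left_mono mult_pos_pos) (auto intro!: zero_less_power order.strict_trans2[OF _ s] x)
        moreover have "(n\<^sup>2 - 1 / 4) / n\<^sup>2 = 1 - 1 / (4 * n\<^sup>2)" using n by (simp add: field_simps)
        ultimately have "1 / (4 * n\<^sup>2) \<le> qpot (n\<^sup>2 - 1 / 4) s" by linarith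
        hence "1 / (4 * n\<^sup>2) * p s \<le> qpot (n\<^sup>2 - 1 / 4) s * p s" using p_pos[OF s] by (intro mult_right_mono) auto
        also have "\<dots> \<le> 2 * c" using F_le[OF mu s] zero_le_power2[of "f1 s"] zero_le_power2[of "g1 s"] by linarith
        finally have "p s \<le> 8 * n\<^sup>2 * c" using n by (simp add: field_simps)
        also have "\<dots> \<le> 8 * n\<^sup>2 * ((cmod b)\<^sup>2 * Q)" using cQ by (intro mult_left_mono) auto
        also have "\<dots> = n * (32 * n\<^sup>2) * ((cmod b)\<^sup>2 * (Jn N t)\<^sup>2)" by (simp add: Q_def power2_eq_square)
        also have "\<dots> \<le> x * Z\<^sup>2 * ((cmod b)\<^sup>2 * (Jn N t)\<^sup>2)"
        proof (intro mult_right_mono mult_mono True)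
          have "(72 * n)\<^sup>2 \<le> Z\<^sup>2" using Zn n by (intro power_mono) auto
          hence "5184 * n\<^sup>2 \<le> Z\<^sup>2" by (simp add: power_mult_distrib)
          thus "32 * n\<^sup>2 \<le> Z\<^sup>2" using zero_le_power2[of n] by linarith
        qed (use x in auto)
        finally show ?thesis by (simp add: power_mult_distrib algebra_simps)
      qed
      with t0(1) show ?thesis by (intro exI[of _ t] conjI allI impI)
    next
      case False
      have red: ?thesis if "y > 0" "p x \<le> x * (Z * cmod b * Jn N y)\<^sup>2" for y
      proof (intro exI[of _ y] conjI allI impI that(1))
        fix s assume "s \<ge> x"
        from order_trans[OF p_antimono[OF order_refl this] that(2)] show "p s \<le> x * (Z * cmod b * Jn N y)\<^sup>2" .
      qed
      define w where "w = cmod (Complex (f x) (g x) + b * of_real (JU N x))"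
      have px: "p x > 0" by (rule p_pos) simp
      have pc: "sqrt (p x) = cmod (Complex (f x) (g x))" by (simp add: p_def cmod_def)
      have wl: "sqrt (p x) \<le> w + cmod b * \<bar>JU N x\<bar>"
        unfolding pc w_def using norm_triangle_ineq4[of "Complex (f x) (g x) + b * of_real (JU N x)" "b * of_real (JU N x)"]
        by (simp add: norm_mult)
      show ?thesis
      proof (cases "p x \<le> x * (Z * cmod b * Jn N x)\<^sup>2")
        case True
        from red[OF x this] show ?thesis .
      next
        case False
        have Z1: "Z > 1" using Zn n by linarith
        have "x * (Z * cmod b * Jn N x)\<^sup>2 = (Z * (cmod b * \<bar>JU N x\<bar>))\<^sup>2"
          using x by (simp add: JU_def power_mult_distrib abs_mult)
        hence "(Z * (cmod b * \<bar>JU N x\<bar>))\<^sup>2 < (sqrt (p x))\<^sup>2" using False px by simp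
        hence Zl: "Z * (cmod b * \<bar>JU N x\<bar>) < sqrt (p x)" by (rule power_less_imp_less_base) (use px in simp)
        hence "cmod b * \<bar>JU N x\<bar> \<le> sqrt (p x) / Z" using Z1 by (simp add: field_simps)
        moreover have "sqrt (p x) * (1 - 1 / Z) = sqrt (p x) - sqrt (p x) / Z" by (simp add: right_diff_distrib)
        ultimately have w: "w \<ge> sqrt (p x) * (1 - 1 / Z)" using wl by linarith
        hence wpos: "w > 0" using px Z1 by (intro order.strict_trans2[OF _ w] mult_pos_pos) auto
        have Uk: "JU N \<kappa> \<noteq> 0"
        proof
          assume z: "JU N \<kappa> = 0"
          hence "of_real (\<kappa> * JU1 N \<kappa>) * (Complex (f x) (g x) + b * of_real (JU N x)) = 0" using match' by simp
          hence "Complex (f x) (g x) + b * of_real (JU N x) = 0" using nt z \<kappa> by simp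
          thus False using wpos by (simp add: w_def)
        qed
        define \<delta> where "\<delta> = 2 * n / (Z - 1)"
        have \<delta>: "\<delta> > 0" "\<delta> < 1 / 2" using Zn n by (auto simp: \<delta>_def field_simps)
        define \<sigma> where "\<sigma> = k x + \<kappa> * JU1 N \<kappa> / JU N \<kappa> - 1 / 2"
        have \<sigma>: "\<bar>\<sigma>\<bar> \<ge> \<delta>"
        \<comment> \<open>No frequency below n is excluded: there J_N > 0 and J_N' \<ge> 0, so
          \<sigma> \<ge> k \<ge> 1/2 > \<delta>. Above n, the bound \<kappa> \<le> n / \<epsilon>
          holds because \<epsilon> \<kappa> < n.\<close>
        proof (cases "\<kappa> \<le> n")
          case True
          have J: "Jn N \<kappa> > 0" "n * Jn N \<kappa> - \<kappa> * Jn (Suc N) \<kappa> \<ge> 0"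
            using Jn_mono_facts[OF N \<kappa>] True by (simp_all add: n_def)
          have "\<kappa> * JU1 N \<kappa> / JU N \<kappa> = 1 / 2 + (n * Jn N \<kappa> - \<kappa> * Jn (Suc N) \<kappa>) / Jn N \<kappa>"
            using J(1) \<kappa> by (simp add: JU_def JU1_def n_def field_simps)
          moreover have "(n * Jn N \<kappa> - \<kappa> * Jn (Suc N) \<kappa>) / Jn N \<kappa> \<ge> 0" using J by simp
          ultimately show ?thesis using k_ge_half[of x] \<delta> by (simp add: \<sigma>_def)
        next
          case False
          have "\<kappa> \<le> n / \<epsilon>" using \<open>\<not> n \<le> x\<close> e by (simp add: x_def field_simps)
          hence "\<kappa> \<notin> resonant (n\<^sup>2 - 1 / 4) (JU N) (JU1 N) \<epsilon> \<delta>"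
            using nres False by (auto simp: n_def \<delta>_def)
          hence "\<not> \<bar>\<sigma>\<bar> \<le> \<delta>"
            unfolding resonant_def \<sigma>_def using Uk c outgoing_pair_axioms unfolding x_def by blast
          thus ?thesis by simp
        qed
        have "w * sqrt (p x) * \<bar>\<sigma>\<bar> \<le> x * cmod b * \<Gamma>"
          unfolding w_def \<sigma>_def \<Gamma>_def by (rule total_field_bound[OF Uk px match'])
        also have "\<dots> \<le> x * cmod b * (cmod b * Q)" using GQ x by (intro mult_left_mono) auto
        finally have 1: "w * sqrt (p x) * \<bar>\<sigma>\<bar> \<le> x * ((cmod b)\<^sup>2 * Q)" by (simp add: power2_eq_square algebra_simps)
        have "sqrt (p x) * (1 - 1 / Z) * sqrt (p x) * \<delta> \<le> w * sqrt (p x) * \<bar>\<sigma>\<bar>"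
          using w \<sigma> \<delta> wpos px by (intro mult_mono) auto
        moreover have "sqrt (p x) * (1 - 1 / Z) * sqrt (p x) * \<delta> = p x * (2 * n) / Z"
        proof -
          have "sqrt (p x) * (1 - 1 / Z) * sqrt (p x) * \<delta> = (sqrt (p x))\<^sup>2 * ((1 - 1 / Z) * \<delta>)"
            by (simp add: power2_eq_square algebra_simps)
          also have "(1 - 1 / Z) * \<delta> = 2 * n / Z" using Z1 by (simp add: \<delta>_def field_simps)
          finally show ?thesis using px by simp
        qed
        ultimately have "p x * (2 * n) / Z \<le> x * ((cmod b)\<^sup>2 * Q)" using 1 by linarith
        hence "p x * (2 * n) \<le> (2 * n) * (2 * Z * (x * ((cmod b)\<^sup>2 * (Jn N t)\<^sup>2)))" using Z1 by (simp add: Q_def field_simps)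
        hence "p x \<le> 2 * Z * (x * ((cmod b)\<^sup>2 * (Jn N t)\<^sup>2))" using n by (simp add: mult.commute)
        also have "\<dots> \<le> Z * Z * (x * ((cmod b)\<^sup>2 * (Jn N t)\<^sup>2))" using Zn n x by (intro mult_right_mono) auto
        finally have "p x \<le> x * (Z * cmod b * Jn N t)\<^sup>2" by (simp add: power_mult_distrib power2_eq_square algebra_simps)
        from red[OF t0(1) this] show ?thesis .
      qed
    qed
  qed
qed

section \<open>The radially symmetric mode\<close>

text \<open>For \<mu> = -1/4 the potential decreases to 1. Then U'^2 + q U^2 decreases while U^2 +
  U'^2 / q increases, and together they enclose the limiting energy between data at s = 1.\<close>

lemma osc_zero_energy:
  assumes U: "osc_all (- 1 / 4) U U1" and lim: "((\<lambda>s. (U s)\<^sup>2 + (U1 s)\<^sup>2) \<longlongrightarrow> M) at_top"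
  shows "(U 1)\<^sup>2 \<le> M" "M \<le> (U1 1)\<^sup>2 + 5 / 4 * (U 1)\<^sup>2"
proof -
  let ?q = "qpot (- 1 / 4)"
  have q: "?q s = 1 + 1 / (4 * s\<^sup>2)" for s by (simp add: qpot_def)
  have q1: "?q s \<ge> 1" for s unfolding q by simp
  have c: "continuous_on {1..} U" "continuous_on {1..} U1" by (auto intro!: osc_all_cont[OF U])
  have cq: "continuous_on {1..} ?q" unfolding qpot_def[abs_def] by (intro continuous_intros) auto
  have up: "(U1 s)\<^sup>2 + ?q s * (U s)\<^sup>2 \<le> (U1 1)\<^sup>2 + ?q 1 * (U 1)\<^sup>2" if "s \<ge> 1" for s
  proof -
    have "- ((U1 1)\<^sup>2 + ?q 1 * (U 1)\<^sup>2) \<le> - ((U1 s)\<^sup>2 + ?q s * (U s)\<^sup>2)"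
    proof (rule ray_mono[where x = 1 and h = "\<lambda>s. - ((U1 s)\<^sup>2 + ?q s * (U s)\<^sup>2)" and h' = "\<lambda>t. 1 / (2 * t ^ 3) * (U t)\<^sup>2"])
      show "continuous_on {1..} (\<lambda>s. - ((U1 s)\<^sup>2 + ?q s * (U s)\<^sup>2))" by (intro continuous_intros c cq)
      fix t :: real assume t: "t > 1"
      show "((\<lambda>s. - ((U1 s)\<^sup>2 + ?q s * (U s)\<^sup>2)) has_real_derivative 1 / (2 * t ^ 3) * (U t)\<^sup>2) (at t)"
        using t osc_all_deriv[OF U, of t]
        by (auto intro!: derivative_eq_intros simp: field_simps power2_eq_square power3_eq_cube)
      show "1 / (2 * t ^ 3) * (U t)\<^sup>2 \<ge> 0" using t by simp
    qed (use that in auto)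
    thus ?thesis by simp
  qed
  have dn: "(U 1)\<^sup>2 + (U1 1)\<^sup>2 / ?q 1 \<le> (U s)\<^sup>2 + (U1 s)\<^sup>2 / ?q s" if "s \<ge> 1" for s
  proof (rule ray_mono[where x = 1 and h = "\<lambda>s. (U s)\<^sup>2 + (U1 s)\<^sup>2 / ?q s" and h' = "\<lambda>t. 1 / (2 * t ^ 3) * (U1 t)\<^sup>2 / (?q t)\<^sup>2"])
    have nz: "?q s \<noteq> 0" for s using q1[of s] by linarith
    show "continuous_on {1..} (\<lambda>s. (U s)\<^sup>2 + (U1 s)\<^sup>2 / ?q s)" by (intro continuous_intros c cq) (use nz in auto)
    fix t :: real assume t: "t > 1"
    show "((\<lambda>s. (U s)\<^sup>2 + (U1 s)\<^sup>2 / ?q s) has_real_derivative 1 / (2 * t ^ 3) * (U1 t)\<^sup>2 / (?q t)\<^sup>2) (at t)"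
      using t nz[of t] osc_all_deriv[OF U, of t]
      by (auto intro!: derivative_eq_intros simp: field_simps power2_eq_square)
    show "1 / (2 * t ^ 3) * (U1 t)\<^sup>2 / (?q t)\<^sup>2 \<ge> 0" using t by simp
  qed (use that in auto)
  have e1: "(U s)\<^sup>2 + (U1 s)\<^sup>2 \<le> (U1 1)\<^sup>2 + 5 / 4 * (U 1)\<^sup>2" if "s \<ge> 1" for s
  proof -
    have q11: "?q 1 = 5 / 4" by (simp add: qpot_def)
    have "(U1 s)\<^sup>2 + ?q s * (U s)\<^sup>2 \<le> (U1 1)\<^sup>2 + 5 / 4 * (U 1)\<^sup>2" by (rule up[OF that, unfolded q11])
    moreover have "1 * (U s)\<^sup>2 \<le> ?q s * (U s)\<^sup>2" by (rule mult_right_mono[OF q1]) simp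
    ultimately show ?thesis by linarith
  qed
  show "M \<le> (U1 1)\<^sup>2 + 5 / 4 * (U 1)\<^sup>2"
    by (rule tendsto_upperbound[OF lim eventually_mono[OF eventually_ge_at_top[of 1] e1]]) auto
  have e2: "(U 1)\<^sup>2 \<le> (U s)\<^sup>2 + (U1 s)\<^sup>2" if "s \<ge> 1" for s
  proof -
    have "0 \<le> (U1 1)\<^sup>2 / ?q 1" using q1[of 1] by simp
    moreover have "(U1 s)\<^sup>2 / ?q s \<le> (U1 s)\<^sup>2 / 1" using q1[of s] by (intro divide_left_mono) auto
    ultimately show ?thesis using dn[OF that] by linarith
  qed
  show "(U 1)\<^sup>2 \<le> M"
    by (rule tendsto_lowerbound[OF lim eventually_mono[OF eventually_ge_at_top[of 1] e2]]) auto
qed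

text \<open>The last two bounds compare 1 / U^2 with 1 / s for U = sqrt s J_0; once integrated, they
  produce the logarithm.\<close>

lemma J0_facts:
  assumes s: "0 < s" "s \<le> 1"
  shows "Jn 0 s \<ge> 3 / 4" "Jn 0 s \<le> 1" "0 \<le> s * Jn 1 s / Jn 0 s" "s * Jn 1 s / Jn 0 s \<le> s\<^sup>2 / 2 / (1 - s\<^sup>2 / 4)"
    "JU 0 s > 0" "(JU 0 s)\<^sup>2 = s * (Jn 0 s)\<^sup>2" "s * JU1 0 s / JU 0 s = 1 / 2 - s * Jn 1 s / Jn 0 s"
    "1 / s \<le> 1 / (JU 0 s)\<^sup>2" "1 / (JU 0 s)\<^sup>2 \<le> 1 / s + 4 / 5 * s"
proof -
  have s2: "s\<^sup>2 \<le> 1" using power_mono[of s 1 2] s by simp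
  note b = J0_bounds[of s]
  show j: "Jn 0 s \<ge> 3 / 4" "Jn 0 s \<le> 1" using b(1,3) s s2 by auto
  have "s ^ 3 \<le> s" using mult_left_mono[OF s2, of s] s by (simp add: power2_eq_square power3_eq_cube)
  hence j1: "Jn 1 s \<ge> 0" "Jn 1 s \<le> s / 2" using b(2,4) s by auto
  show "0 \<le> s * Jn 1 s / Jn 0 s" using j1 j s by simp
  show "s * Jn 1 s / Jn 0 s \<le> s\<^sup>2 / 2 / (1 - s\<^sup>2 / 4)"
    using j1 s s2 b(3) by (intro frac_le) (auto simp: power2_eq_square intro!: mult_left_mono)
  show "JU 0 s > 0" using s j by (simp add: JU_def)
  show sq: "(JU 0 s)\<^sup>2 = s * (Jn 0 s)\<^sup>2" using s by (simp add: JU_def power_mult_distrib)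
  have "r * ((1 / 2) / s * J - K) * s / (r * J) = 1 / 2 - s * K / J" if "r > 0" "J > 0" for r J K
    using that s by (simp add: field_simps)
  from this[of "sqrt s" "Jn 0 s" "Jn 1 s"] show "s * JU1 0 s / JU 0 s = 1 / 2 - s * Jn 1 s / Jn 0 s"
    using s j by (simp add: JU_def JU1_def mult.commute)
  have "0 < (Jn 0 s)\<^sup>2" "(Jn 0 s)\<^sup>2 \<le> 1" using j power_mono[of "Jn 0 s" 1 2] by auto
  thus "1 / s \<le> 1 / (JU 0 s)\<^sup>2" unfolding sq using s by (intro divide_left_mono) (auto simp: mult_left_le)
  have q: "1 \<le> (1 + 4 / 5 * t) * (1 - t / 4)\<^sup>2" if "0 \<le> t" "t \<le> 1" for t :: real
  proof -
    have "(1 + 4 / 5 * t) * (1 - t / 4)\<^sup>2 - 1 = t / 80 * (24 - 27 * t + 4 * t\<^sup>2)" by (simp add: power2_eq_square algebra_simps)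
    moreover have "24 - 27 * t + 4 * t\<^sup>2 \<ge> 0"
    proof -
      have "24 - 27 * t + 4 * t\<^sup>2 = (1 - t) * (23 - 4 * t) + 1" by (simp add: power2_eq_square algebra_simps)
      moreover have "(1 - t) * (23 - 4 * t) \<ge> 0" using that by (intro mult_nonneg_nonneg) auto
      ultimately show ?thesis by linarith
    qed
    ultimately show ?thesis using that by (smt (verit) divide_nonneg_nonneg mult_nonneg_nonneg)
  qed
  have "(1 - s\<^sup>2 / 4)\<^sup>2 \<le> (Jn 0 s)\<^sup>2" using b(3) s s2 by (intro power_mono) auto
  hence "(1 + 4 / 5 * s\<^sup>2) * (1 - s\<^sup>2 / 4)\<^sup>2 \<le> (1 + 4 / 5 * s\<^sup>2) * (Jn 0 s)\<^sup>2" by (intro mult_left_mono) auto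
  with q[of "s\<^sup>2"] s2 have "1 \<le> (1 + 4 / 5 * s\<^sup>2) * (Jn 0 s)\<^sup>2" by simp
  hence "s \<le> s * ((1 + 4 / 5 * s\<^sup>2) * (Jn 0 s)\<^sup>2)" using mult_left_mono[of 1 "(1 + 4 / 5 * s\<^sup>2) * (Jn 0 s)\<^sup>2" s] s by simp
  hence "1 \<le> (1 / s + 4 / 5 * s) * (s * (Jn 0 s)\<^sup>2)" using s by (simp add: field_simps power2_eq_square)
  thus "1 / (JU 0 s)\<^sup>2 \<le> 1 / s + 4 / 5 * s" unfolding sq
    using s \<open>0 < (Jn 0 s)\<^sup>2\<close> by (subst pos_divide_le_eq) auto
qed

locale outgoing_zero = outgoing_pair "- 1 / 4" x f f1 g g1 for x f f1 g g1 +
  assumes cpos: "c > 0"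
begin

lemma U: "osc_all (- 1 / 4) (JU 0) (JU1 0)"
  using JU_osc[of 0] by simp

abbreviation "R \<equiv> gr (JU 0) (JU1 0)"
abbreviation "I \<equiv> gi (JU 0) (JU1 0)"

text \<open>The limiting energy of sqrt s J_0 is |\<gamma>|^2 / c. The Taylor bounds at s = 1 place
  it between explicit numbers, so |\<gamma>|^2 and c are interchangeable up to constants.\<close>

lemma gamma_c: "9 / 16 * c \<le> R\<^sup>2 + I\<^sup>2" "R\<^sup>2 + I\<^sup>2 \<le> 3 / 4 * c" "R\<^sup>2 + I\<^sup>2 > 0"
proof -
  note b = J0_bounds[of 1]
  have J: "3 / 4 \<le> Jn 0 1" "Jn 0 1 \<le> 49 / 64" "7 / 16 \<le> Jn 1 1" "Jn 1 1 \<le> 1 / 2" using b by (simp_all add: abs_le_iff)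
  have "JU 0 1 = Jn 0 1" "JU1 0 1 = Jn 0 1 / 2 - Jn 1 1" by (simp_all add: JU_def JU1_def)
  hence u: "3 / 4 \<le> JU 0 1" "JU 0 1 \<le> 49 / 64" "\<bar>JU1 0 1\<bar> \<le> 1 / 8" using J by auto
  have u2: "(3 / 4)\<^sup>2 \<le> (JU 0 1)\<^sup>2" "(JU 0 1)\<^sup>2 \<le> (49 / 64)\<^sup>2" "\<bar>JU1 0 1\<bar>\<^sup>2 \<le> (1 / 8)\<^sup>2"
    using u by (intro power_mono; auto)+
  note M = osc_zero_energy[OF U real_energy_lim[OF U cpos]]
  have "(3 / 4)\<^sup>2 = (9 / 16 :: real)" "(49 / 64)\<^sup>2 = (2401 / 4096 :: real)" "(1 / 8)\<^sup>2 = (1 / 64 :: real)"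
    by (simp_all add: power_divide)
  hence "9 / 16 \<le> (R\<^sup>2 + I\<^sup>2) / c" "(R\<^sup>2 + I\<^sup>2) / c \<le> 3 / 4"
    using M u2 unfolding power2_abs by linarith+
  thus a: "9 / 16 * c \<le> R\<^sup>2 + I\<^sup>2" "R\<^sup>2 + I\<^sup>2 \<le> 3 / 4 * c" using cpos by (simp_all add: field_simps)
  thus "R\<^sup>2 + I\<^sup>2 > 0" using cpos by linarith
qed

text \<open>h + \<i> e = u / (\<gamma> U). By reduction of order its derivative is 1 / U^2, which is
  real, so e is constant and h grows like ln s.\<close>

definition h where "h s = (f s * R + g s * I) / (JU 0 s * (R\<^sup>2 + I\<^sup>2))"
definition e where "e s = (g s * R - f s * I) / (JU 0 s * (R\<^sup>2 + I\<^sup>2))"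

lemma rep:
  assumes "x \<le> s" "s \<le> 1"
  shows "f s * R + g s * I = JU 0 s * (R\<^sup>2 + I\<^sup>2) * h s" "g s * R - f s * I = JU 0 s * (R\<^sup>2 + I\<^sup>2) * e s"
    "p s = (JU 0 s)\<^sup>2 * (R\<^sup>2 + I\<^sup>2) * ((h s)\<^sup>2 + (e s)\<^sup>2)"
proof -
  have s: "0 < s" using assms x0 by simp
  have u: "JU 0 s > 0" by (rule J0_facts(5)[OF s assms(2)])
  show a: "f s * R + g s * I = JU 0 s * (R\<^sup>2 + I\<^sup>2) * h s" "g s * R - f s * I = JU 0 s * (R\<^sup>2 + I\<^sup>2) * e s"
    using u gamma_c(3) by (simp_all add: h_def e_def)
  have "p s * (R\<^sup>2 + I\<^sup>2) = (f s * R + g s * I)\<^sup>2 + (g s * R - f s * I)\<^sup>2"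
    by (simp add: p_def power2_eq_square algebra_simps)
  also have "\<dots> = ((JU 0 s)\<^sup>2 * (R\<^sup>2 + I\<^sup>2) * ((h s)\<^sup>2 + (e s)\<^sup>2)) * (R\<^sup>2 + I\<^sup>2)"
    unfolding a by (simp add: power2_eq_square algebra_simps)
  finally have "p s * (R\<^sup>2 + I\<^sup>2) = \<dots>" .
  moreover have "R\<^sup>2 + I\<^sup>2 \<noteq> 0" using gamma_c(3) by linarith
  ultimately show "p s = (JU 0 s)\<^sup>2 * (R\<^sup>2 + I\<^sup>2) * ((h s)\<^sup>2 + (e s)\<^sup>2)" using mult_right_cancel by blast
qed

lemma he_deriv:
  assumes "x < t" "t \<le> 1"
  shows "(h has_real_derivative 1 / (JU 0 t)\<^sup>2) (at t)" "(e has_real_derivative 0) (at t)"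
proof -
  have t: "0 < t" using assms x0 by simp
  have u: "JU 0 t > 0" by (rule J0_facts(5)[OF t assms(2)])
  note d = deriv(1,3)[OF assms(1)] osc_all_deriv(1)[OF U t]
  have gg: "f1 t * JU 0 t - JU1 0 t * f t = R" "g1 t * JU 0 t - JU1 0 t * g t = I"
    using gr_gi[OF U, of t] assms by auto
  have n: "JU 0 t * (R\<^sup>2 + I\<^sup>2) \<noteq> 0" using mult_pos_pos[OF u gamma_c(3)] by linarith
  have "(h has_real_derivative ((f1 t * R + g1 t * I) * (JU 0 t * (R\<^sup>2 + I\<^sup>2)) - (f t * R + g t * I) * (JU1 0 t * (R\<^sup>2 + I\<^sup>2)))
    / (JU 0 t * (R\<^sup>2 + I\<^sup>2) * (JU 0 t * (R\<^sup>2 + I\<^sup>2)))) (at t)"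
    unfolding h_def[abs_def] by (intro DERIV_divide DERIV_add DERIV_cmult_right d n)
  moreover have "((f1 t * R + g1 t * I) * (JU 0 t * (R\<^sup>2 + I\<^sup>2)) - (f t * R + g t * I) * (JU1 0 t * (R\<^sup>2 + I\<^sup>2)))
    = ((f1 t * JU 0 t - JU1 0 t * f t) * R + (g1 t * JU 0 t - JU1 0 t * g t) * I) * (R\<^sup>2 + I\<^sup>2)"
    by (simp add: algebra_simps)
  moreover have "\<dots> = (R\<^sup>2 + I\<^sup>2)\<^sup>2" unfolding gg by (simp add: power2_eq_square)
  moreover have "G\<^sup>2 / (w * G * (w * G)) = 1 / w\<^sup>2" if "G > 0" for G w :: real
    using that by (simp add: power2_eq_square)
  note this[OF gamma_c(3), of "JU 0 t"]
  ultimately show "(h has_real_derivative 1 / (JU 0 t)\<^sup>2) (at t)" by (simp only:)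
  have "(e has_real_derivative ((g1 t * R - f1 t * I) * (JU 0 t * (R\<^sup>2 + I\<^sup>2)) - (g t * R - f t * I) * (JU1 0 t * (R\<^sup>2 + I\<^sup>2)))
    / (JU 0 t * (R\<^sup>2 + I\<^sup>2) * (JU 0 t * (R\<^sup>2 + I\<^sup>2)))) (at t)"
    unfolding e_def[abs_def] by (intro DERIV_divide DERIV_diff DERIV_cmult_right d n)
  moreover have "((g1 t * R - f1 t * I) * (JU 0 t * (R\<^sup>2 + I\<^sup>2)) - (g t * R - f t * I) * (JU1 0 t * (R\<^sup>2 + I\<^sup>2)))
    = ((g1 t * JU 0 t - JU1 0 t * g t) * R - (f1 t * JU 0 t - JU1 0 t * f t) * I) * (R\<^sup>2 + I\<^sup>2)"
    by (simp add: algebra_simps)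
  moreover have "\<dots> = 0" unfolding gg by simp
  ultimately show "(e has_real_derivative 0) (at t)" by (simp only: div_0)
qed

lemma he_cont: "S \<subseteq> {x..1} \<Longrightarrow> continuous_on S h" "S \<subseteq> {x..1} \<Longrightarrow> continuous_on S e"
proof -
  assume S: "S \<subseteq> {x..1}"
  have "\<forall>s\<in>S. JU 0 s * (R\<^sup>2 + I\<^sup>2) \<noteq> 0"
  proof
    fix s assume "s \<in> S"
    hence "0 < s" "s \<le> 1" using S x0 by force+
    from mult_pos_pos[OF J0_facts(5)[OF this] gamma_c(3)] show "JU 0 s * (R\<^sup>2 + I\<^sup>2) \<noteq> 0" by linarith
  qed
  moreover have "continuous_on S (JU 0)" by (rule osc_all_cont[OF U]) (use S x0 in force)
  moreover have "S \<subseteq> {x..}" using S by auto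
  ultimately show "continuous_on S h" "continuous_on S e"
    unfolding h_def[abs_def] e_def[abs_def] by (intro continuous_intros; simp)+
qed

text \<open>16/9 bounds |h 1| and |e 1| because p 1 \<le> c, U(1)^2 \<ge> 9/16 and |\<gamma>|^2
  \<ge> 9/16 c. Integrating 1/s \<le> h' \<le> 1/s + 4/5 s up to 1 costs at most another 2/5 on one
  side, and 16/9 + 2/5 < 11/5.\<close>

lemma he_bounds:
  assumes s: "x \<le> s" "s \<le> 1"
  shows "h s \<le> ln s + 16 / 9" "ln s - 11 / 5 \<le> h s" "\<bar>e s\<bar> \<le> 16 / 9"
proof -
  have s0: "s > 0" using s x0 by simp
  have "p 1 \<le> c" by (rule p_le_c) (use s in auto)
  moreover have "p 1 = (JU 0 1)\<^sup>2 * (R\<^sup>2 + I\<^sup>2) * ((h 1)\<^sup>2 + (e 1)\<^sup>2)" by (rule rep(3)) (use s in auto)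
  moreover have "(JU 0 1)\<^sup>2 \<ge> (3 / 4)\<^sup>2" using J0_facts(1)[of 1] by (intro power_mono) (auto simp: JU_def)
  hence "(3 / 4)\<^sup>2 * (9 / 16 * c) * ((h 1)\<^sup>2 + (e 1)\<^sup>2) \<le> (JU 0 1)\<^sup>2 * (R\<^sup>2 + I\<^sup>2) * ((h 1)\<^sup>2 + (e 1)\<^sup>2)"
    using gamma_c(1) cpos by (intro mult_right_mono mult_mono) auto
  ultimately have "(3 / 4)\<^sup>2 * (9 / 16 * c) * ((h 1)\<^sup>2 + (e 1)\<^sup>2) \<le> c" by linarith
  hence "(81 / 256 * ((h 1)\<^sup>2 + (e 1)\<^sup>2)) * c \<le> 1 * c" by (simp only: power2_eq_square) (simp add: algebra_simps)
  hence "(h 1)\<^sup>2 + (e 1)\<^sup>2 \<le> (16 / 9)\<^sup>2" using cpos by (simp add: power_divide)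
  hence "(h 1)\<^sup>2 \<le> (16 / 9)\<^sup>2" "(e 1)\<^sup>2 \<le> (16 / 9)\<^sup>2" using zero_le_power2[of "h 1"] zero_le_power2[of "e 1"] by linarith+
  hence 1: "\<bar>h 1\<bar> \<le> 16 / 9" "\<bar>e 1\<bar> \<le> 16 / 9" 
    by (simp_all only: abs_le_square_iff[symmetric] abs_numeral abs_divide)
  have lnc: "continuous_on {s..1} ln" using s0 by (intro continuous_intros) auto
  have hc: "continuous_on {s..1} h" "continuous_on {s..1} e" using s by (auto intro: he_cont)
  have "h s - ln s \<le> h 1 - ln 1"
    by (rule deriv_nonneg_mono[where h = "\<lambda>s. h s - ln s" and h' = "\<lambda>t. 1 / (JU 0 t)\<^sup>2 - 1 / t"])
      (use s s0 J0_facts(8) in \<open>auto intro!: continuous_on_diff hc lnc DERIV_diff he_deriv DERIV_ln_divide\<close>)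
  thus "h s \<le> ln s + 16 / 9" using 1 by simp
  have "ln s + 2 / 5 * s\<^sup>2 - h s \<le> ln 1 + 2 / 5 * 1\<^sup>2 - h 1"
  proof (rule deriv_nonneg_mono[where h = "\<lambda>s. ln s + 2 / 5 * s\<^sup>2 - h s" and h' = "\<lambda>t. 1 / t + 4 / 5 * t - 1 / (JU 0 t)\<^sup>2"])
    show "continuous_on {s..1} (\<lambda>s. ln s + 2 / 5 * s\<^sup>2 - h s)" by (intro continuous_intros hc lnc)
    fix t assume t: "s < t" "t < 1"
    have "((\<lambda>s. 2 / 5 * s\<^sup>2) has_real_derivative 4 / 5 * t) (at t)" by (auto intro!: derivative_eq_intros)
    thus "((\<lambda>s. ln s + 2 / 5 * s\<^sup>2 - h s) has_real_derivative 1 / t + 4 / 5 * t - 1 / (JU 0 t)\<^sup>2) (at t)"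
      using t s s0 by (intro DERIV_diff DERIV_add DERIV_ln_divide he_deriv) auto
    show "0 \<le> 1 / t + 4 / 5 * t - 1 / (JU 0 t)\<^sup>2" using J0_facts(9)[of t] t s0 by simp
  qed (rule s)
  hence "ln s + 2 / 5 * s\<^sup>2 - h s \<le> 2 / 5 - h 1" by simp
  moreover have "0 \<le> 2 / 5 * s\<^sup>2" by simp
  moreover have "- (16 / 9) \<le> h 1" using 1 by (simp add: abs_le_iff)
  ultimately show "ln s - 11 / 5 \<le> h s" by linarith
  have "e s = e 1"
  proof (cases "s = 1")
    case False
    thus ?thesis using s hc(2) by (intro DERIV_isconst_end[symmetric]) (auto intro!: he_deriv)
  qed simp
  thus "\<bar>e s\<bar> \<le> 16 / 9" using 1 by simp
qed

text \<open>The logarithmic derivative of v = \<gamma> J_0 (h + \<i> e) is a sum of two terms; with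
  h' = 1 / (s J_0^2), the second contributes roughly 1 / |ln s|.\<close>

lemma k_rep:
  assumes s: "x \<le> s" "s \<le> 1"
  shows "k s = s * Jn 1 s / Jn 0 s - h s / ((Jn 0 s)\<^sup>2 * ((h s)\<^sup>2 + (e s)\<^sup>2))"
proof -
  have s0: "s > 0" using s x0 by simp
  note J = J0_facts[OF s0 s(2)]
  have u: "JU 0 s > 0" and ps: "p s > 0" using J(5) p_pos_of_c[OF cpos s(1)] by auto
  define G where "G = R\<^sup>2 + I\<^sup>2"
  define H where "H = (h s)\<^sup>2 + (e s)\<^sup>2"
  have G: "G > 0" using gamma_c(3) by (simp add: G_def)
  have pr: "p s = (JU 0 s)\<^sup>2 * G * H" using rep(3)[OF s] by (simp add: G_def H_def)
  have H: "H \<noteq> 0" using ps pr by auto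
  have gg: "f1 s * JU 0 s - JU1 0 s * f s = R" "g1 s * JU 0 s - JU1 0 s * g s = I" using gr_gi[OF U s(1)] .
  have "(f s * f1 s + g s * g1 s) * JU 0 s = f s * (f1 s * JU 0 s - JU1 0 s * f s) + g s * (g1 s * JU 0 s - JU1 0 s * g s) + JU1 0 s * p s"
    by (simp add: p_def power2_eq_square algebra_simps)
  also have "\<dots> = JU 0 s * G * h s + JU1 0 s * p s" unfolding gg using rep(1)[OF s] by (simp add: G_def)
  finally have "f s * f1 s + g s * g1 s = G * h s + JU1 0 s / JU 0 s * p s" using u by (simp add: field_simps)
  hence "k s = 1 / 2 - s * JU1 0 s / JU 0 s - s * (G * h s) / p s"
    using ps by (simp add: k_def p1_def add_divide_distrib algebra_simps)
  also have "s * (G * h s) / p s = h s / ((Jn 0 s)\<^sup>2 * H)"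
    unfolding pr J(6) using G H s0 J(1) by (simp add: field_simps)
  finally show ?thesis unfolding J(7) H_def by simp
qed

end

section \<open>Numerical estimates in the resonance window of the radially symmetric mode\<close>

lemma le_tenth:
  assumes "0 < s" "ln s \<le> - (9 :: real)"
  shows "s \<le> 1 / 10"
proof -
  have "10 \<le> exp (9 :: real)" using exp_ge_add_one_self[of "9 :: real"] by simp
  also have "\<dots> \<le> exp (- ln s)" using assms by (subst exp_le_cancel_iff) linarith
  also have "\<dots> = 1 / s" using assms by (simp add: exp_minus divide_inverse)
  finally show ?thesis using assms by (simp add: field_simps)
qed

text \<open>The threshold gives -h \<ge> 39/4 - 16/9 = 287/36, so the two terms of
  \<open>k_rep\<close> are at most 2/399 and 13/100.\<close>

lemma (in outgoing_zero) k_small: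
  assumes s: "x \<le> s" "ln s \<le> - 39 / 4"
  shows "0 \<le> k s" "k s \<le> 7 / 50"
proof -
  have s0: "s > 0" using s x0 by simp
  have s10: "s \<le> 1 / 10" by (rule le_tenth) (use s s0 in auto)
  hence s1: "s \<le> 1" by simp
  note J = J0_facts[OF s0 s1]
  have s2: "s\<^sup>2 \<le> 1 / 100" using power_mono[OF s10, of 2] s0 by (simp add: power_divide)
  have "s\<^sup>2 / 2 / (1 - s\<^sup>2 / 4) \<le> (1 / 100) / 2 / (1 - (1 / 100) / 4)" using s2 by (intro frac_le) auto
  also have "\<dots> = 2 / 399" by simp
  finally have J4: "s\<^sup>2 / 2 / (1 - s\<^sup>2 / 4) \<le> 2 / 399" .
  hence a: "0 \<le> s * Jn 1 s / Jn 0 s" "s * Jn 1 s / Jn 0 s \<le> 2 / 399" using J(3) order_trans[OF J(4) J4] by auto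
  have H: "- h s \<ge> 287 / 36" using he_bounds(1)[OF s(1) s1] s(2) by simp
  have "99 / 100 \<le> Jn 0 s" using J0_bounds(3)[of s] s0 s2 by simp
  hence J2: "(99 / 100)\<^sup>2 \<le> (Jn 0 s)\<^sup>2" by (intro power_mono) auto
  have "(287 / 36 * (- h s)) \<le> (h s)\<^sup>2 + (e s)\<^sup>2"
  proof -
    have "287 / 36 * (- h s) \<le> (- h s) * (- h s)" using H by (intro mult_right_mono) auto
    moreover have "(- h s) * (- h s) = (h s)\<^sup>2" by (simp add: power2_eq_square)
    ultimately show ?thesis using zero_le_power2[of "e s"] by linarith
  qed
  hence le: "(99 / 100)\<^sup>2 * (287 / 36 * (- h s)) \<le> (Jn 0 s)\<^sup>2 * ((h s)\<^sup>2 + (e s)\<^sup>2)"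
    using J2 H by (intro mult_mono) auto
  hence "(- h s) / ((Jn 0 s)\<^sup>2 * ((h s)\<^sup>2 + (e s)\<^sup>2)) \<le> (- h s) / ((99 / 100)\<^sup>2 * (287 / 36 * (- h s)))"
  proof (rule divide_left_mono)
    have "0 < - h s" using H by linarith
    hence pos: "0 < (99 / 100)\<^sup>2 * (287 / 36 * (- h s))" by (intro mult_pos_pos) auto
    have "0 < (Jn 0 s)\<^sup>2 * ((h s)\<^sup>2 + (e s)\<^sup>2)" by (rule order.strict_trans2[OF pos le])
    thus "0 < (Jn 0 s)\<^sup>2 * ((h s)\<^sup>2 + (e s)\<^sup>2) * ((99 / 100)\<^sup>2 * (287 / 36 * (- h s)))"
      using pos by (rule mult_pos_pos)
  qed (use H in auto)
  also have "\<dots> = 1 / ((99 / 100)\<^sup>2 * (287 / 36))" using H by simp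
  also have "\<dots> \<le> 13 / 100" by (simp add: power2_eq_square)
  finally have b: "- h s / ((Jn 0 s)\<^sup>2 * ((h s)\<^sup>2 + (e s)\<^sup>2)) \<le> 13 / 100" by simp
  have "0 \<le> - h s / ((Jn 0 s)\<^sup>2 * ((h s)\<^sup>2 + (e s)\<^sup>2))" using H by (intro divide_nonneg_nonneg) auto
  with a b show "0 \<le> k s" "k s \<le> 7 / 50" unfolding k_rep[OF s(1) s1] by (simp_all only: minus_divide_left[symmetric])
qed

text \<open>A nonempty window already forces \<epsilon> to be tiny: eliminating \<kappa> gives y^4
  \<ge> 18432. The bound on ln \<kappa> serves to keep ln (\<epsilon> \<kappa>) below -39/4; it uses
  192 = 8 * 24 and the tangent of ln (y / 4) at y = 4.\<close>

lemma zero_zone: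
  fixes y E \<kappa> :: real
  assumes y: "y > 0" and E: "E \<ge> 1" and \<kappa>: "\<kappa> > 0" "1 \<le> 2 * y * \<kappa>\<^sup>2" "\<kappa> \<le> y * sqrt y / (192 * E\<^sup>2)"
  shows "y \<ge> 58 / 5" "ln \<kappa> \<le> 3 / 8 * y - 7 / 2"
proof -
  have E2: "E\<^sup>2 \<ge> 1" using one_le_power[OF E] .
  have kle: "\<kappa> \<le> y * sqrt y / 192"
  proof -
    have "y * sqrt y / (192 * E\<^sup>2) \<le> y * sqrt y / 192" using y E2 by (intro divide_left_mono) auto
    thus ?thesis using \<kappa> by linarith
  qed
  have "\<kappa>\<^sup>2 \<le> (y * sqrt y / 192)\<^sup>2" using kle \<kappa> by (intro power_mono) auto
  also have "\<dots> = y ^ 3 / 36864" using y by (simp add: power_divide power_mult_distrib power2_eq_square power3_eq_cube)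
  finally have "1 \<le> 2 * y * (y ^ 3 / 36864)" using \<kappa>(2) y mult_left_mono[of "\<kappa>\<^sup>2" "y ^ 3 / 36864" "2 * y"] by linarith
  hence y4: "18432 \<le> y ^ 4" by (simp add: power3_eq_cube power4_eq_xxxx)
  show "y \<ge> 58 / 5"
  proof (rule ccontr)
    assume "\<not> y \<ge> 58 / 5"
    hence "y ^ 4 \<le> (58 / 5) ^ 4" using y by (intro power_mono) auto
    thus False using y4 by (simp add: power_divide)
  qed
  have "exp (2 :: real) = exp 1 * exp 1" by (simp add: exp_add[symmetric])
  also have "\<dots> \<le> 3 * 3" by (intro mult_mono exp_le) auto
  finally have "exp (2 :: real) \<le> 24" by simp
  hence e24: "2 \<le> ln (24 :: real)" by (subst ln_ge_iff) auto
  have "ln \<kappa> \<le> ln ((y / 4) * sqrt (y / 4) / 24)"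
    using kle \<kappa> y by (subst ln_le_cancel_iff) (auto simp: real_sqrt_divide)
  also have "\<dots> = ln (y / 4) + ln (sqrt (y / 4)) - ln 24" using y by (simp only: ln_div ln_mult) (simp add: ln_div ln_mult)
  also have "ln (sqrt (y / 4)) = ln (y / 4) / 2" using y by (intro ln_sqrt) auto
  finally have "ln \<kappa> \<le> 3 / 2 * ln (y / 4) - 2" using e24 by linarith
  moreover have "ln (y / 4) \<le> y / 4 - 1" using y by (intro ln_le_minus_one) auto
  ultimately show "ln \<kappa> \<le> 3 / 8 * y - 7 / 2" by linarith
qed

lemma resonant_cover_zero:
  assumes e: "0 < \<epsilon>" "\<epsilon> < 1 / 7" and E: "E \<ge> 1"
  defines "y \<equiv> \<bar>ln \<epsilon>\<bar> + 1"
  shows "\<exists>I\<in>sets borel. resonant (- 1 / 4) (JU 0) (JU1 0) \<epsilon> (11 / (20 * y * E)) \<inter> {1 / sqrt (2 * y)..y * sqrt y / (192 * E\<^sup>2)} \<subseteq> I \<and> I \<subseteq> {0<..} \<and>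
    emeasure lborel I \<le> ennreal (ln \<bar>ln \<epsilon>\<bar> / E)"
proof (cases "1 / sqrt (2 * y) \<le> y * sqrt y / (192 * E\<^sup>2)")
  \<comment> \<open>With an empty window nothing is excluded; otherwise \<open>zero_zone\<close>
    makes y large enough for all numerical estimates.\<close>
  case False
  thus ?thesis by (intro bexI[of _ "{}"]) auto
next
  case True
  define L where "L = \<bar>ln \<epsilon>\<bar>"
  have lne: "ln \<epsilon> = - L" and L: "L \<ge> 3 / 2" and yL: "y = L + 1" using ln_inverse_ge[OF e] by (simp_all add: L_def y_def)
  have y: "y > 0" using L yL by simp
  define lo where "lo = 1 / sqrt (2 * y)"
  define hi where "hi = y * sqrt y / (192 * E\<^sup>2)"
  have lo: "lo > 0" "2 * y * lo\<^sup>2 = 1" using y by (simp_all add: lo_def power_divide)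
  have lohi: "lo \<le> hi" using True by (simp add: lo_def hi_def)
  have hi: "hi > 0" using lohi lo by simp
  have E2: "E\<^sup>2 \<ge> 1" using one_le_power[OF E] .
  have y11: "y \<ge> 58 / 5" using zero_zone(1)[OF y E lo(1)] lo(2) lohi by (simp add: hi_def)
  have lnhi: "ln hi \<le> 3 / 8 * y - 7 / 2"
  proof (rule zero_zone(2)[OF y E hi])
    have "lo\<^sup>2 \<le> hi\<^sup>2" using lohi lo by (intro power_mono) auto
    thus "1 \<le> 2 * y * hi\<^sup>2" using lo(2) mult_left_mono[of "lo\<^sup>2" "hi\<^sup>2" "2 * y"] y by simp
  qed (simp add: hi_def)
  define \<delta> where "\<delta> = 11 / (20 * y * E)"
  have \<delta>: "\<delta> > 0" using y E by (simp add: \<delta>_def)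
  have e2: "\<epsilon>\<^sup>2 \<le> 1 / 49" using power_mono[of \<epsilon> "1 / 7" 2] e by (simp add: power_divide)
  show ?thesis unfolding lo_def[symmetric] hi_def[symmetric] \<delta>_def[symmetric]
  proof (rule resonant_cover[where kb = "7 / 50" and \<theta> = "77 / 250" and \<rho> = "1 - \<epsilon>\<^sup>2 - 77 / 250" and ?t0.0 = 1])
    show "osc_all (- 1 / 4) (JU 0) (JU1 0)" using JU_osc[of 0] by simp
    show "JU 0 t \<noteq> 0" if "0 < t" "t \<le> 1" for t using J0_facts(5)[OF that] by simp
    show "\<bar>qpot (- 1 / 4) t\<bar> \<le> 5 / 4" if "t \<ge> 1" for t
    proof -
      have "1 \<le> t\<^sup>2" using that by simp
      hence "1 / (4 * t\<^sup>2) \<le> 1 / (4 * 1)" by (intro frac_le) auto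
      moreover have "0 \<le> 1 / (4 * t\<^sup>2)" by simp
      moreover have "qpot (- 1 / 4) t = 1 + 1 / (4 * t\<^sup>2)" by (simp add: qpot_def)
      ultimately show ?thesis by linarith
    qed
    have "lo\<^sup>2 = 1 / (2 * y)" using lo(2) y by (simp add: field_simps)
    \<comment> \<open>The origin of \<theta> = 77/250: \<open>lo\<close> satisfies 2 y lo^2 = 1, so
      \<theta> lo^2 scales like 2 kb \<delta> in y.\<close>
    moreover have "2 * (7 / 50) * \<delta> = 77 / 250 * (1 / (2 * y)) * (1 / E)" by (simp add: \<delta>_def)
    moreover have "77 / 250 * (1 / (2 * y)) * (1 / E) \<le> 77 / 250 * (1 / (2 * y)) * 1" using E y by (intro mult_left_mono) auto
    ultimately show "2 * (7 / 50) * \<delta> \<le> 77 / 250 * lo\<^sup>2" by linarith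
    fix x f f1 g g1 t
    assume op: "outgoing_pair (- 1 / 4) x f f1 g g1" and c: "outgoing_pair.c x f f1 g g1 > 0" and t: "x \<le> t" "t \<le> \<epsilon> * hi"
    interpret outgoing_zero x f f1 g g1
      by (intro outgoing_zero.intro op outgoing_zero_axioms.intro c)
    have "ln t \<le> ln (\<epsilon> * hi)" using t x0 e hi by (subst ln_le_cancel_iff) auto
    also have "\<dots> = ln \<epsilon> + ln hi" using e hi by (simp add: ln_mult)
    also have "\<dots> \<le> - 39 / 4" using lnhi lne yL y11 by linarith
    finally show "0 \<le> k t \<and> k t \<le> 7 / 50" using k_small[OF t(1)] by simp
  next
    define \<rho> where "\<rho> = 1 - \<epsilon>\<^sup>2 - 77 / 250"
    have \<rho>: "\<rho> \<ge> 67 / 100" using e2 by (simp add: \<rho>_def)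
    have "sqrt (2 * y) \<le> 52 / 125 * y"
    proof (rule real_le_lsqrt)
      have "2 * y \<le> (2704 / 15625 * (58 / 5)) * y" using y by (intro mult_right_mono) auto
      also have "\<dots> \<le> (2704 / 15625 * y) * y" using y y11 by (intro mult_right_mono mult_left_mono) auto
      finally show "2 * y \<le> (52 / 125 * y)\<^sup>2" by (simp add: power2_eq_square)
    qed (use y in auto)
    hence 1: "1 / lo \<le> 52 / 125 * y" by (simp add: lo_def)
    have "hi / lo = sqrt 2 * (sqrt y)\<^sup>2 * y / (192 * E\<^sup>2)" by (simp add: hi_def lo_def real_sqrt_mult power2_eq_square)
    hence "hi / lo = sqrt 2 * y\<^sup>2 / (192 * E\<^sup>2)" using y by (simp add: power2_eq_square)
    also have "\<dots> \<le> sqrt 2 * y\<^sup>2 / 192" using y E2 by (intro divide_left_mono) auto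
    also have "\<dots> \<le> (43 / 500 * y)\<^sup>2"
    proof -
      have "sqrt 2 \<le> 1415 / 1000" by (intro real_le_lsqrt) (auto simp: power2_eq_square)
      hence "sqrt 2 * y\<^sup>2 \<le> 1415 / 1000 * y\<^sup>2" by (intro mult_right_mono) auto
      moreover have "(43 / 500 * y)\<^sup>2 = 1849 / 250000 * y\<^sup>2" by (simp add: power_mult_distrib power_divide)
      ultimately show ?thesis using zero_le_power2[of y] by linarith
    qed
    finally have "ln (hi / lo) \<le> ln ((43 / 500 * y)\<^sup>2)" using hi lo y by (subst ln_le_cancel_iff) auto
    also have "\<dots> = 2 * ln (43 / 500 * y)" using y by (subst ln_realpow) auto
    also have "\<dots> \<le> 2 * (43 / 500 * y - 1)" using y by (intro mult_left_mono ln_le_minus_one) auto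
    finally have "1 / lo + ln (hi / lo) \<le> 52 / 125 * y + 2 * (43 / 500 * y - 1)" by (rule add_mono[OF 1])
    also have "\<dots> \<le> 147 / 250 * y" by simp
    finally have "1 / lo + ln (hi / lo) \<le> 147 / 250 * y" .
    moreover have "0 \<le> 1 / lo + ln (hi / lo)" using lo lohi by (intro add_nonneg_nonneg) auto
    ultimately have "4 * \<delta> / \<rho> * (1 / lo + ln (hi / lo)) \<le> 4 * \<delta> / (67 / 100) * (147 / 250 * y)"
      using \<rho> \<delta> by (intro mult_mono divide_left_mono) auto
    \<comment> \<open>The factor y cancels against the one in \<delta>. The constant left is below
      2, and 2 \<le> ln |ln \<epsilon>| because |ln \<epsilon>| = y - 1 > 9 \<ge> exp 2.\<close>
    also have "\<dots> = 4 * 11 / 20 / (67 / 100) * (147 / 250) / E" using y E by (simp add: \<delta>_def field_simps)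
    also have "\<dots> \<le> 2 / E" using E by (intro divide_right_mono) auto
    also have "\<dots> \<le> ln L / E"
    proof -
      have "exp (2 :: real) = exp 1 * exp 1" by (simp add: exp_add[symmetric])
      also have "\<dots> \<le> 3 * 3" by (intro mult_mono exp_le) auto
      finally have "exp 2 \<le> L" using y11 yL by simp
      hence "2 \<le> ln L" using L by (subst ln_ge_iff) auto
      thus ?thesis using E by (intro divide_right_mono) auto
    qed
    finally show "4 * \<delta> / (1 - \<epsilon>\<^sup>2 - 77 / 250) * (1 / lo + ln (hi / lo)) \<le> ln \<bar>ln \<epsilon>\<bar> / E"
      unfolding \<rho>_def[symmetric] L_def .
    show "0 < 1 - \<epsilon>\<^sup>2 - 77 / 250" using e2 by simp
  qed (use e lo \<delta> in auto)
qed

text \<open>As p \<le> c everywhere, only c has to be bounded. At high frequencies flux conservation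
  gives c \<le> 3/4 |b|^2, and 192 is 144 divided by 3/4. Frequencies with 2 y \<kappa>^2 \<le> 1
  are too low to resonate. In between, the exclusion of resonances is combined with the logarithmic
  size of u at the interface.\<close>

lemma mode_bound_zero:
  fixes \<kappa> :: real
  assumes e: "0 < \<epsilon>" "\<epsilon> < 1 / 7" and E: "E \<ge> 1" and \<kappa>: "\<kappa> > 0"
    and op: "outgoing_pair (- 1 / 4) (\<epsilon> * \<kappa>) f f1 g g1"
    and match: "of_real (\<epsilon> * \<kappa>) * (Complex (f1 (\<epsilon> * \<kappa>)) (g1 (\<epsilon> * \<kappa>)) + b * of_real (JU1 0 (\<epsilon> * \<kappa>))) * of_real (JU 0 \<kappa>)
      = of_real (\<kappa> * JU1 0 \<kappa>) * (Complex (f (\<epsilon> * \<kappa>)) (g (\<epsilon> * \<kappa>)) + b * of_real (JU 0 (\<epsilon> * \<kappa>)))"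
  defines "y \<equiv> \<bar>ln \<epsilon>\<bar> + 1"
  assumes nres: "\<kappa> \<notin> resonant (- 1 / 4) (JU 0) (JU1 0) \<epsilon> (11 / (20 * y * E)) \<inter> {1 / sqrt (2 * y)..y * sqrt y / (192 * E\<^sup>2)}"
    and s: "s \<ge> \<epsilon> * \<kappa>"
  shows "(f s)\<^sup>2 + (g s)\<^sup>2 \<le> 144 * \<kappa> * (cmod b)\<^sup>2 * E\<^sup>2 / (y * sqrt y)"
proof -
  define x where "x = \<epsilon> * \<kappa>"
  have x: "x > 0" "x \<le> \<kappa>" using e \<kappa> by (auto simp: x_def)
  have lne: "ln \<epsilon> = 1 - y" and y: "y \<ge> 5 / 2" using ln_inverse_ge[OF e] by (simp_all add: y_def)
  define h0 where "h0 = sqrt y"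
  have h0: "h0 > 0" "h0\<^sup>2 = y" using y by (simp_all add: h0_def)
  have E2: "E\<^sup>2 \<ge> 1" using one_le_power[OF E] .
  interpret outgoing_pair "- 1 / 4" x f f1 g g1 using op by (simp add: x_def)
  note match' = match[folded x_def]
  have "c \<le> 144 * \<kappa> * (cmod b)\<^sup>2 * E\<^sup>2 / (y * h0)"
  proof (cases "c = 0")
    case True
    thus ?thesis using \<kappa> y h0 by simp
  next
    case False
    hence c: "c > 0" using c_nonneg by simp
    interpret outgoing_zero x f f1 g g1 by unfold_locales (rule c)
    define \<Gamma> where "\<Gamma> = cmod (\<gamma> (JU 0) (JU1 0))"
    have G2: "\<Gamma>\<^sup>2 = R\<^sup>2 + I\<^sup>2" by (simp add: \<Gamma>_def \<gamma>_def cmod_power2)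
    have G: "\<Gamma> > 0" using gamma_c(3) unfolding G2[symmetric] by (auto simp: \<Gamma>_def)
    have cG2: "c \<le> 16 / 9 * \<Gamma>\<^sup>2" using gamma_c(1) unfolding G2 by simp
    have cG: "c \<le> cmod b * \<Gamma>" unfolding \<Gamma>_def
      by (rule incident_energy_bound[OF JU_nontrivial[OF \<kappa>] match' \<kappa>])
    define w where "w = Complex (f x) (g x) + b * of_real (JU 0 x)"
    have pc: "sqrt (p x) = cmod (Complex (f x) (g x))" by (simp add: p_def cmod_def)
    have px: "p x > 0" by (rule p_pos_of_c[OF c]) simp
    show ?thesis
    proof (cases "\<kappa> \<ge> y * h0 / (192 * E\<^sup>2)")
      case True
      have "c * c \<le> (cmod b)\<^sup>2 * \<Gamma>\<^sup>2"
        using mult_mono[OF cG cG] c G by (simp add: power2_eq_square algebra_simps)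
      also have "\<dots> \<le> (cmod b)\<^sup>2 * (3 / 4 * c)" using gamma_c(2) unfolding G2 by (intro mult_left_mono) auto
      finally have "c * c \<le> (3 / 4 * (cmod b)\<^sup>2) * c" by simp
      hence "c \<le> 144 * (cmod b)\<^sup>2 * E\<^sup>2 / (y * h0) * (y * h0 / (192 * E\<^sup>2))" using c y h0 E by (simp add: field_simps)
      also have "\<dots> \<le> 144 * (cmod b)\<^sup>2 * E\<^sup>2 / (y * h0) * \<kappa>" using True y h0 by (intro mult_left_mono) auto
      also have "\<dots> = 144 * \<kappa> * (cmod b)\<^sup>2 * E\<^sup>2 / (y * h0)" by simp
      finally show ?thesis .
    next
      case small: False
      \<comment> \<open>144 = 81 * 16/9, where 16/9 comes from c \<le> 16/9 |\<gamma>|^2.\<close>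
      have Gle: ?thesis if G': "\<Gamma>\<^sup>2 \<le> 81 * \<kappa> * (cmod b)\<^sup>2 * E\<^sup>2 / (y * h0)"
      proof -
        have "c \<le> 16 / 9 * (81 * \<kappa> * (cmod b)\<^sup>2 * E\<^sup>2 / (y * h0))" using cG2 G' by linarith
        also have "\<dots> = 144 * \<kappa> * (cmod b)\<^sup>2 * E\<^sup>2 / (y * h0)" by simp
        finally show ?thesis .
      qed
      show ?thesis
      proof (cases "2 * y * \<kappa>\<^sup>2 \<le> 1")
        case True
        have "5 * \<kappa>\<^sup>2 \<le> 2 * y * \<kappa>\<^sup>2" using y by (intro mult_right_mono) auto
        hence k5: "\<kappa>\<^sup>2 \<le> 1 / 5" using True by linarith
        hence "\<kappa>\<^sup>2 \<le> (9 / 20)\<^sup>2" by (simp add: power_divide)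
        hence k45: "\<kappa> \<le> 9 / 20" by (rule power2_le_imp_le) simp
        have k1: "\<kappa> \<le> 1" "x \<le> 1" using k45 x by auto
        note Jx = J0_facts[OF x(1) k1(2)]
        note Jk = J0_facts[OF \<kappa> k1(1)]
        define a where "a s = s * Jn 1 s / Jn 0 s" for s
        have ab: "0 \<le> a s" "a s \<le> 10 / 19 * \<kappa>\<^sup>2" if "0 < s" "s \<le> \<kappa>" for s
        proof -
          have s1: "s \<le> 1" using that k1 by simp
          have s2: "s\<^sup>2 \<le> \<kappa>\<^sup>2" using that by (intro power_mono) auto
          show "0 \<le> a s" unfolding a_def by (rule J0_facts(3)[OF that(1) s1])
          have "a s \<le> s\<^sup>2 / 2 / (1 - s\<^sup>2 / 4)" unfolding a_def by (rule J0_facts(4)[OF that(1) s1])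
          also have "\<dots> \<le> \<kappa>\<^sup>2 / 2 / (19 / 20)" using s2 k5 by (intro frac_le) auto
          finally show "a s \<le> 10 / 19 * \<kappa>\<^sup>2" by simp
        qed
        \<comment> \<open>The mismatch between the logarithmic derivatives of J_0 at x and at
          \<kappa>. It is O(\<kappa>^2), and by the matching condition x \<gamma> is z U w.\<close>
        define z where "z = a x - a \<kappa>"
        have zb: "\<bar>z\<bar> \<le> 10 / 19 * \<kappa>\<^sup>2" using ab[OF x] ab[OF \<kappa> order_refl] unfolding z_def by (intro abs_leI) linarith+
        have Mk: "\<kappa> * JU1 0 \<kappa> = (1 / 2 - a \<kappa>) * JU 0 \<kappa>" "x * JU1 0 x = (1 / 2 - a x) * JU 0 x"
          using Jk(5,7) Jx(5,7) by (simp_all add: a_def field_simps)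
        define U where "U = JU 0 x"
        have Up: "U > 0" "U\<^sup>2 \<le> x"
          using Jx(1,2,5,6) x power_mono[of "Jn 0 x" 1 2] by (auto simp: U_def mult_left_le)
        define u1c where "u1c = Complex (f1 x) (g1 x)"
        have gm: "u1c * of_real U - of_real (JU1 0 x) * Complex (f x) (g x) = \<gamma> (JU 0) (JU1 0)"
          using gr_gi[OF U, of x] by (simp add: u1c_def U_def \<gamma>_def complex_eq_iff)
        have "of_real x * (u1c + b * of_real (JU1 0 x)) * of_real (JU 0 \<kappa>) = of_real (1 / 2 - a \<kappa>) * w * of_real (JU 0 \<kappa>)"
          using match' unfolding Mk w_def u1c_def by (simp add: algebra_simps)
        hence m: "of_real x * (u1c + b * of_real (JU1 0 x)) = of_real (1 / 2 - a \<kappa>) * w" using Jk(5) by simp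
        have "of_real x * \<gamma> (JU 0) (JU1 0) = of_real x * (u1c + b * of_real (JU1 0 x)) * of_real U - of_real (x * JU1 0 x) * w"
          unfolding gm[symmetric] w_def U_def by (simp add: algebra_simps)
        also have "\<dots> = of_real (z * U) * w"
          unfolding m Mk U_def[symmetric] z_def by (simp add: algebra_simps)
        finally have "cmod (of_real x * \<gamma> (JU 0) (JU1 0)) = cmod (of_real (z * U) * w)" by (rule arg_cong)
        hence xG: "x * \<Gamma> = \<bar>z\<bar> * U * cmod w" using x Up by (simp add: norm_mult \<Gamma>_def abs_mult)
        have "sqrt (p x) = sqrt ((U * \<Gamma>)\<^sup>2 * ((h x)\<^sup>2 + (e x)\<^sup>2))"
          using rep(3)[of x] k1 by (simp add: U_def G2 power_mult_distrib)
        also have "\<dots> \<le> U * \<Gamma> * (\<bar>h x\<bar> + \<bar>e x\<bar>)"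
          using sqrt_sum_squares_le_sum_abs[of "h x" "e x"] Up G by (simp add: real_sqrt_mult)
        finally have "cmod w \<le> U * \<Gamma> * (\<bar>h x\<bar> + \<bar>e x\<bar>) + cmod b * U"
          using norm_triangle_ineq[of "Complex (f x) (g x)" "b * of_real U"] Up pc by (simp add: w_def U_def norm_mult)
        hence "x * \<Gamma> \<le> \<bar>z\<bar> * U * (U * \<Gamma> * (\<bar>h x\<bar> + \<bar>e x\<bar>) + cmod b * U)"
          unfolding xG using Up by (intro mult_left_mono) auto
        also have "\<dots> = U\<^sup>2 * (\<bar>z\<bar> * (\<Gamma> * (\<bar>h x\<bar> + \<bar>e x\<bar>) + cmod b))" by (simp add: power2_eq_square algebra_simps)
        also have "\<dots> \<le> x * (\<bar>z\<bar> * (\<Gamma> * (\<bar>h x\<bar> + \<bar>e x\<bar>) + cmod b))"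
          using Up G by (intro mult_right_mono) auto
        finally have G1: "\<Gamma> \<le> \<bar>z\<bar> * (\<Gamma> * (\<bar>h x\<bar> + \<bar>e x\<bar>) + cmod b)" using x by simp
        have "- ln \<kappa> \<le> 1 / \<kappa> - 1" using ln_le_minus_one[of "1 / \<kappa>"] \<kappa> by (simp add: ln_div)
        moreover have "ln x = 1 - y + ln \<kappa>" using e \<kappa> lne by (simp add: x_def ln_mult)
        moreover have "ln x \<le> 0" using k1 x by simp
        ultimately have "\<bar>h x\<bar> + \<bar>e x\<bar> \<le> y + 2 + 1 / \<kappa>"
          using he_bounds[of x] k1 by (auto simp: abs_le_iff abs_real_def)
        hence "\<Gamma> * (\<bar>h x\<bar> + \<bar>e x\<bar>) + cmod b \<le> \<Gamma> * (y + 2 + 1 / \<kappa>) + cmod b" using G by (intro add_right_mono mult_left_mono) auto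
        hence "\<bar>z\<bar> * (\<Gamma> * (\<bar>h x\<bar> + \<bar>e x\<bar>) + cmod b) \<le> 10 / 19 * \<kappa>\<^sup>2 * (\<Gamma> * (y + 2 + 1 / \<kappa>) + cmod b)"
          using zb G by (intro mult_mono) auto
        with G1 have "\<Gamma> \<le> 10 / 19 * \<kappa>\<^sup>2 * (\<Gamma> * (y + 2 + 1 / \<kappa>) + cmod b)" by linarith
        also have "\<dots> = \<Gamma> * (10 / 19 * (y * \<kappa>\<^sup>2 + 2 * \<kappa>\<^sup>2 + \<kappa>)) + 10 / 19 * (\<kappa>\<^sup>2 * cmod b)"
          using \<kappa> by (simp add: field_simps power2_eq_square)
        \<comment> \<open>y \<kappa>^2 \<le> 1/2, 2 \<kappa>^2 \<le> 2/5 and \<kappa> \<le> 9/20 add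
          up to 27/20; since (10/19) (27/20) < 1, the term with \<Gamma> can be absorbed on the
          left.\<close>
        also have "\<dots> \<le> \<Gamma> * (10 / 19 * (27 / 20)) + 10 / 19 * (\<kappa>\<^sup>2 * cmod b)"
          using G True k5 k45 by (intro add_right_mono mult_left_mono) auto
        finally have "\<Gamma> \<le> \<Gamma> * (10 / 19 * (27 / 20)) + 10 / 19 * (\<kappa>\<^sup>2 * cmod b)" .
        moreover have "0 \<le> \<kappa>\<^sup>2 * cmod b" by simp
        ultimately have "\<Gamma> \<le> 2 * (\<kappa>\<^sup>2 * cmod b)" by linarith
        hence "\<Gamma>\<^sup>2 \<le> (2 * (\<kappa>\<^sup>2 * cmod b))\<^sup>2" using G by (intro power_mono) auto
        also have "\<dots> = 4 * \<kappa> * (\<kappa> ^ 3) * (cmod b)\<^sup>2" by (simp add: power2_eq_square power3_eq_cube)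
        finally have G4: "\<Gamma>\<^sup>2 \<le> 4 * \<kappa> * (\<kappa> ^ 3) * (cmod b)\<^sup>2" .
        have "2 * (\<kappa>\<^sup>2 * y) \<le> 1" using True by (simp add: mult_ac)
        moreover have "0 \<le> \<kappa>\<^sup>2 * y" using y by simp
        ultimately have "\<kappa>\<^sup>2 * y \<le> 1" by linarith
        hence "(\<kappa> * h0)\<^sup>2 \<le> 1\<^sup>2" unfolding power_mult_distrib h0(2) by simp
        hence "\<kappa> * h0 \<le> 1" by (rule power2_le_imp_le) simp
        moreover have "0 \<le> \<kappa> * h0" using \<kappa> h0 by simp
        ultimately have "(\<kappa> * h0) ^ 3 \<le> 1" by (rule power_le_one[rotated])
        moreover have "(\<kappa> * h0) ^ 3 = \<kappa> ^ 3 * (y * h0)"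
          unfolding h0(2)[symmetric] by (simp add: power2_eq_square power3_eq_cube mult_ac)
        ultimately have "\<kappa> ^ 3 * (y * h0) \<le> 1" by simp
        hence k3: "\<kappa> ^ 3 \<le> 1 / (y * h0)" using y h0 by (simp add: pos_le_divide_eq)
        have "4 * \<kappa> * (\<kappa> ^ 3) * (cmod b)\<^sup>2 \<le> 81 * \<kappa> * (1 / (y * h0)) * (cmod b)\<^sup>2"
          using k3 \<kappa> by (intro mult_right_mono mult_mono) auto
        also have "\<dots> \<le> 81 * \<kappa> * (1 / (y * h0)) * (cmod b)\<^sup>2 * E\<^sup>2"
          using E2 \<kappa> y h0 mult_left_mono[OF E2, of "81 * \<kappa> * (1 / (y * h0)) * (cmod b)\<^sup>2"] by simp
        finally show ?thesis using G4 by (intro Gle) (simp add: algebra_simps)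
      next
        case False
        have ky: "1 \<le> 2 * y * \<kappa>\<^sup>2" using False by simp
        have km: "\<kappa> \<le> y * sqrt y / (192 * E\<^sup>2)" using small by (simp add: h0_def)
        have y0: "y > 0" using y by simp
        note zz = zero_zone[OF y0 E \<kappa> ky km]
        have lnx: "ln x \<le> - (5 / 8 * y) - 5 / 2" using e \<kappa> lne zz(2) by (simp add: x_def ln_mult)
        have x10: "x \<le> 1 / 10" by (rule le_tenth[OF x(1)]) (use lnx zz(1) in simp)
        have x1: "x \<le> 1" using x10 by simp
        note Jx = J0_facts[OF x(1) x1]
        define U where "U = JU 0 x"
        have Up: "U > 0" "U\<^sup>2 = x * (Jn 0 x)\<^sup>2" using Jx(5,6) by (simp_all add: U_def)
        \<comment> \<open>The logarithmic size of u relative to \<gamma> U at the interface. A bound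
          on sqrt (p x) becomes a bound on \<gamma> that is smaller by a factor of order y.\<close>
        define H where "H = - h x"
        have H: "H \<ge> 5 / 8 * y" using he_bounds(1)[of x] x1 lnx by (simp add: H_def)
        have Hp: "H > 0" using H y by simp
        have "(U * \<Gamma> * H)\<^sup>2 \<le> p x"
          using rep(3)[of x] x1 by (simp add: U_def G2 power_mult_distrib H_def mult_left_mono)
        hence Pl: "U * \<Gamma> * H \<le> sqrt (p x)" by (rule real_le_rsqrt)
        have "x\<^sup>2 \<le> 1 / 100" using power_mono[OF x10, of 2] x by (simp add: power_divide)
        hence "199 / 200 \<le> Jn 0 x" using J0_bounds(3)[of x] x by simp
        from power_mono[OF this, of 2] have J99: "99 / 100 \<le> (Jn 0 x)\<^sup>2" by (simp add: power_divide)
        define \<delta> where "\<delta> = 11 / (20 * y * E)"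
        have \<delta>: "\<delta> > 0" using y E by (simp add: \<delta>_def)
        \<comment> \<open>The constant 11/20 in \<delta> is large enough here: (99/100) (11/20)
          (5/8) = 1089/3200 > 1/3.\<close>
        have dH: "1 / ((Jn 0 x)\<^sup>2 * \<delta> * H) \<le> 3 * E"
        proof -
          have "99 / 100 * \<delta> * (5 / 8 * y) \<le> (Jn 0 x)\<^sup>2 * \<delta> * H" using J99 H \<delta> y by (intro mult_mono) auto
          moreover have "99 / 100 * \<delta> * (5 / 8 * y) = 1089 / 3200 / E" using y E by (simp add: \<delta>_def field_simps)
          moreover have "1 / (3 * E) \<le> 1089 / 3200 / E" using E by (simp add: field_simps)
          ultimately have "1 / (3 * E) \<le> (Jn 0 x)\<^sup>2 * \<delta> * H" by linarith
          moreover have "0 < 1 / (3 * E)" using E by simp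
          moreover have "1 / D \<le> 3 * E" if "1 / (3 * E) \<le> D" "D > 0" for D :: real
            using that E by (simp add: field_simps)
          ultimately show ?thesis by (meson order.strict_trans2)
        qed
        have wl: "sqrt (p x) \<le> cmod w + cmod b * U"
          unfolding pc w_def using norm_triangle_ineq4[of "Complex (f x) (g x) + b * of_real (JU 0 x)" "b * of_real (JU 0 x)"] Up
          by (simp add: norm_mult U_def)
        have "\<Gamma> * H \<le> 4 * E * cmod b"
        proof (cases "sqrt (p x) \<le> cmod b * U")
          case True
          hence "U * (\<Gamma> * H) \<le> U * cmod b" using Pl by (simp add: algebra_simps)
          hence "\<Gamma> * H \<le> cmod b" using Up by simp
          also have "\<dots> \<le> 4 * E * cmod b" using E mult_right_mono[of 1 "4 * E" "cmod b"] by simp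
          finally show ?thesis .
        next
          case False
          hence wp: "w \<noteq> 0" using wl by auto
          have Uk: "JU 0 \<kappa> \<noteq> 0"
          proof
            assume "JU 0 \<kappa> = 0"
            thus False using match' wp JU_nontrivial[OF \<kappa>, of 0] \<kappa> by (simp add: w_def)
          qed
          define \<sigma> where "\<sigma> = k x + \<kappa> * JU1 0 \<kappa> / JU 0 \<kappa> - 1 / 2"
          have "1 / sqrt (2 * y) \<le> \<kappa>"
          proof -
            have "1 \<le> (sqrt (2 * y) * \<kappa>)\<^sup>2" using ky y by (simp add: power_mult_distrib)
            hence "1 \<le> sqrt (2 * y) * \<kappa>" using \<kappa> y by (intro power2_le_imp_le[of 1]) auto
            thus ?thesis using y by (simp add: field_simps)
          qed
          hence "\<kappa> \<notin> resonant (- 1 / 4) (JU 0) (JU1 0) \<epsilon> \<delta>" using nres km by (auto simp: \<delta>_def)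
          hence "\<not> \<bar>\<sigma>\<bar> \<le> \<delta>"
            unfolding resonant_def \<sigma>_def using Uk c outgoing_pair_axioms unfolding x_def by blast
          hence \<sigma>: "\<delta> \<le> \<bar>\<sigma>\<bar>" by simp
          define q where "q = sqrt (p x)"
          have q: "q > 0" "cmod b * U < q" using px False by (auto simp: q_def)
          have "cmod w * q * \<bar>\<sigma>\<bar> \<le> x * cmod b * \<Gamma>"
            unfolding w_def \<sigma>_def \<Gamma>_def q_def by (rule total_field_bound[OF Uk px match'])
          moreover have "(q - cmod b * U) * q * \<delta> \<le> cmod w * q * \<bar>\<sigma>\<bar>"
            using wl \<sigma> \<delta> q by (intro mult_mono) (auto simp: q_def)
          ultimately have "(q - cmod b * U) * q * \<delta> \<le> x * cmod b * \<Gamma>" by linarith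
          hence "(q - cmod b * U) * q * \<delta> * (U * H) \<le> x * cmod b * \<Gamma> * (U * H)" using Up Hp by (intro mult_right_mono) auto
          also have "\<dots> = x * cmod b * (U * \<Gamma> * H)" by simp
          also have "\<dots> \<le> x * cmod b * q" using Pl x by (intro mult_left_mono) (auto simp: q_def)
          finally have "((q - cmod b * U) * (\<delta> * U * H)) * q \<le> (x * cmod b) * q" by (simp add: algebra_simps)
          hence "(q - cmod b * U) * (\<delta> * U * H) \<le> x * cmod b" using q by simp
          hence "(q - cmod b * U) \<le> x * cmod b / (\<delta> * U * H)" using \<delta> Up Hp by (simp add: pos_le_divide_eq)
          also have "\<dots> = U * (cmod b * (x / U\<^sup>2 / (\<delta> * H)))" using Up(1) by (simp add: power2_eq_square mult_ac)
          also have "x / U\<^sup>2 / (\<delta> * H) = 1 / ((Jn 0 x)\<^sup>2 * \<delta> * H)" unfolding Up(2) using x by simp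
          also have "U * (cmod b * (1 / ((Jn 0 x)\<^sup>2 * \<delta> * H))) \<le> U * (cmod b * (3 * E))"
            using dH Up by (intro mult_left_mono) auto
          finally have "U * (\<Gamma> * H) \<le> U * (cmod b + cmod b * (3 * E))" using Pl by (simp add: q_def algebra_simps)
          hence "\<Gamma> * H \<le> cmod b + cmod b * (3 * E)" using Up by simp
          also have "\<dots> \<le> 4 * E * cmod b" using E mult_right_mono[OF E, of "cmod b"] by (simp add: algebra_simps)
          finally show ?thesis .
        qed
        moreover have "\<Gamma> * (5 / 8 * y) \<le> \<Gamma> * H" using H G by (intro mult_left_mono) auto
        ultimately have "\<Gamma> * y \<le> 32 / 5 * E * cmod b" by linarith
        hence "(\<Gamma> * y)\<^sup>2 \<le> (32 / 5 * E * cmod b)\<^sup>2" using G y by (intro power_mono) auto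
        moreover have "(\<Gamma> * y)\<^sup>2 = \<Gamma>\<^sup>2 * (y * y)" by (simp add: power2_eq_square mult_ac)
        moreover have "(32 / 5 * E * cmod b)\<^sup>2 = 1024 / 25 * (E\<^sup>2 * (cmod b)\<^sup>2)" by (simp add: power_mult_distrib power_divide)
        ultimately have 1: "\<Gamma>\<^sup>2 * (y * y) \<le> 1024 / 25 * (E\<^sup>2 * (cmod b)\<^sup>2)" by (simp only:)
        have "(3 / 5)\<^sup>2 \<le> (\<kappa> * h0)\<^sup>2"
        proof -
          have "1 \<le> 2 * (\<kappa>\<^sup>2 * y)" using ky by (simp only: mult_ac)
          moreover have "(3 / 5)\<^sup>2 = (9 / 25 :: real)" by (simp add: power_divide)
          ultimately show ?thesis unfolding power_mult_distrib h0(2) by linarith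
        qed
        \<comment> \<open>The missing half power of y is supplied by the lower end of the window,
          where \<kappa>^2 y \<ge> 1/2 > 9/25.\<close>
        hence kh: "3 / 5 \<le> \<kappa> * h0" using \<kappa> h0 by (intro power2_le_imp_le[of "3 / 5"]) auto
        have "1024 / 25 * (E\<^sup>2 * (cmod b)\<^sup>2) \<le> 81 * (\<kappa> * h0) * (E\<^sup>2 * (cmod b)\<^sup>2)"
          using kh by (intro mult_right_mono) auto
        with 1 have "\<Gamma>\<^sup>2 * (y * y) \<le> 81 * (\<kappa> * h0) * (E\<^sup>2 * (cmod b)\<^sup>2)" by (rule order_trans)
        moreover have "\<Gamma>\<^sup>2 * (y * y) = (\<Gamma>\<^sup>2 * (y * h0)) * h0" using h0(2) by (simp add: power2_eq_square)
        moreover have "81 * (\<kappa> * h0) * (E\<^sup>2 * (cmod b)\<^sup>2) = (81 * \<kappa> * (cmod b)\<^sup>2 * E\<^sup>2) * h0" by (simp only: mult_ac)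
        ultimately have "(\<Gamma>\<^sup>2 * (y * h0)) * h0 \<le> (81 * \<kappa> * (cmod b)\<^sup>2 * E\<^sup>2) * h0" by (simp only:)
        hence "\<Gamma>\<^sup>2 * (y * h0) \<le> 81 * \<kappa> * (cmod b)\<^sup>2 * E\<^sup>2" using h0(1) by simp
        thus ?thesis using y h0 by (intro Gle) (simp add: pos_le_divide_eq)
      qed
    qed
  qed
  moreover have "p s \<le> c" using s by (intro p_le_c) (auto simp: x_def)
  ultimately show ?thesis by (simp add: p_def h0_def)
qed

section \<open>Summation over the modes\<close>

lemma ennreal_sqrt_le:
  assumes C: "C > 0" and le: "x \<le> ennreal (C\<^sup>2) * y"
  shows "ennreal_sqrt x \<le> ennreal C * ennreal_sqrt y"
proof (cases "y = \<infinity>")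
  case True
  thus ?thesis using C by (simp add: ennreal_sqrt_def ennreal_mult_top)
next
  case False
  then obtain r where r: "r \<ge> 0" "y = ennreal r" by (cases y) auto
  have le': "x \<le> ennreal (C\<^sup>2 * r)" using le r by (simp add: ennreal_mult)
  then obtain s where s: "s \<ge> 0" "x = ennreal s" by (cases x) (auto simp: top_unique)
  have "s \<le> C\<^sup>2 * r" using le' s r by (simp add: ennreal_le_iff)
  hence "sqrt s \<le> sqrt (C\<^sup>2 * r)" by simp
  also have "\<dots> = C * sqrt r" using C by (simp add: real_sqrt_mult)
  finally show ?thesis using r s C by (simp add: ennreal_sqrt_def ennreal_mult[symmetric] ennreal_leI)
qed

lemma ennreal_infsum_le_cmult:
  fixes f g :: "'a \<Rightarrow> ennreal"
  assumes "\<And>n. n \<in> A \<Longrightarrow> f n \<le> C * g n"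
  shows "infsum f A \<le> C * infsum g A"
proof -
  have "infsum f A = (SUP F\<in>{F. finite F \<and> F \<subseteq> A}. sum f F)" by (rule nonneg_infsum_complete) simp
  also have "\<dots> \<le> C * infsum g A"
  proof (rule SUP_least)
    fix F assume F: "F \<in> {F. finite F \<and> F \<subseteq> A}"
    have "sum f F \<le> (\<Sum>n\<in>F. C * g n)" using F assms by (intro sum_mono) auto
    also have "\<dots> = C * sum g F" by (simp add: sum_distrib_left)
    also have "sum g F \<le> (SUP F\<in>{F. finite F \<and> F \<subseteq> A}. sum g F)" by (rule SUP_upper[OF F])
    also have "(SUP F\<in>{F. finite F \<and> F \<subseteq> A}. sum g F) = infsum g A" by (rule nonneg_infsum_complete[symmetric]) simp
    finally show "sum f F \<le> C * infsum g A" by (simp add: mult_left_mono)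
  qed
  finally show ?thesis .
qed

text \<open>Mean value theorem for t powr (-\<alpha>). The left side dominates the cost of one
  order, the right side telescopes.\<close>

lemma powr_diff_ge:
  fixes n \<alpha> :: real
  assumes n: "n > 0" and \<alpha>: "\<alpha> > 0"
  shows "\<alpha> * (n + 1) powr (- \<alpha> - 1) \<le> n powr (- \<alpha>) - (n + 1) powr (- \<alpha>)"
proof -
  have "\<exists>z>n. z < n + 1 \<and> (n + 1) powr (- \<alpha>) - n powr (- \<alpha>) = (n + 1 - n) * (- \<alpha> * z powr (- \<alpha> - 1))"
    using n by (intro MVT2) (auto intro!: derivative_eq_intros)
  then obtain z where z: "z > n" "z < n + 1" "(n + 1) powr (- \<alpha>) - n powr (- \<alpha>) = - \<alpha> * z powr (- \<alpha> - 1)" by auto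
  have "(n + 1) powr (- \<alpha> - 1) \<le> z powr (- \<alpha> - 1)" using z n \<alpha> by (intro powr_mono2') auto
  hence "\<alpha> * (n + 1) powr (- \<alpha> - 1) \<le> \<alpha> * z powr (- \<alpha> - 1)" using \<alpha> by (intro mult_left_mono) auto
  thus ?thesis using z(3) by linarith
qed

text \<open>Ensures that (1 + n)^\<alpha> / \<alpha> is at least 1, however large \<alpha> is. With
  t = \<alpha> ln m / 2 and ln m \<ge> 1/2 it follows from \<alpha> \<le> 4 t \<le> (1 + t)^2 \<le>
  exp (2 t).\<close>

lemma weight_ge:
  fixes \<alpha> m :: real
  assumes \<alpha>: "\<alpha> > 0" and m: "m \<ge> 2"
  shows "\<alpha> \<le> m powr \<alpha>"
proof -
  have "(exp (1 / 2 :: real))\<^sup>2 = exp 1" by (simp add: power2_eq_square exp_add[symmetric])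
  also have "\<dots> \<le> 2\<^sup>2" using exp_le by simp
  finally have "exp (1 / 2 :: real) \<le> 2" by (rule power2_le_imp_le) simp
  also note m
  finally have l: "1 / 2 \<le> ln m" using m by (subst ln_ge_iff) auto
  define t where "t = \<alpha> * ln m / 2"
  have t: "t \<ge> \<alpha> / 4" using mult_left_mono[OF l, of \<alpha>] \<alpha> by (simp add: t_def)
  have "\<alpha> \<le> 4 * t" using t by simp
  also have "4 * t \<le> (1 + t)\<^sup>2" using zero_le_power2[of "t - 1"] by (simp add: power2_eq_square algebra_simps)
  also have "\<dots> \<le> (exp t)\<^sup>2" using t \<alpha> by (intro power_mono exp_ge_add_one_self) auto
  also have "(exp t)\<^sup>2 = exp (t + t)" by (simp only: power2_eq_square exp_add)
  also have "\<dots> = m powr \<alpha>" using m by (simp add: t_def powr_def)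
  finally show ?thesis .
qed

text \<open>With this \<open>Z\<close>, the measure bound for order N is \<epsilon>^\<beta> |ln
  \<epsilon>| times \<alpha> N (1 + N)^(-2 - \<alpha>), which is at most N^(-\<alpha>) - (N +
  1)^(-\<alpha>). These differences sum to 1, so no further constant appears.\<close>

lemma resonant_cover_all:
  fixes \<alpha> \<beta> :: real
  assumes e: "0 < \<epsilon>" "\<epsilon> < 1 / 7" and \<alpha>: "\<alpha> > 0" and \<beta>: "\<beta> > 0"
  defines "Z \<equiv> \<lambda>N. 18 / \<alpha> * (1 + real N) powr (2 + \<alpha>) * \<epsilon> powr (- \<beta>)"
  shows "\<And>N. N \<ge> 1 \<Longrightarrow> Z N \<ge> 18 * (1 + real N)\<^sup>2"
    and "\<exists>I\<in>sets borel. I \<subseteq> {0<..} \<and> emeasure lborel I \<le> ennreal (\<epsilon> powr \<beta> * \<bar>ln \<epsilon>\<bar>) \<and>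
      (\<forall>N\<ge>1. resonant ((real N)\<^sup>2 - 1 / 4) (JU N) (JU1 N) \<epsilon> (2 * real N / (Z N - 1)) \<inter> {real N..real N / \<epsilon>} \<subseteq> I)"
proof -
  have eb: "\<epsilon> powr (- \<beta>) \<ge> 1"
    using e \<beta> powr_mono2'[of "- \<beta>" \<epsilon> 1] by simp
  show Z: "Z N \<ge> 18 * (1 + real N)\<^sup>2" if "N \<ge> 1" for N
  proof -
    have "1 \<le> (1 + real N) powr \<alpha> / \<alpha>" using weight_ge[OF \<alpha>, of "1 + real N"] that \<alpha> by simp
    hence "18 * (1 + real N)\<^sup>2 * (1 * 1) \<le> 18 * (1 + real N)\<^sup>2 * ((1 + real N) powr \<alpha> / \<alpha> * \<epsilon> powr (- \<beta>))"
      using eb by (intro mult_left_mono mult_mono) auto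
    also have "\<dots> = Z N" by (simp add: Z_def powr_add powr_numeral)
    finally show ?thesis by simp
  qed
  define L where "L = \<bar>ln \<epsilon>\<bar>"
  \<comment> \<open>Index i stands for order N = i + 1, so the telescoping sum starts at A 0 =
    1.\<close>
  define A where "A i = (real (Suc i)) powr (- \<alpha>)" for i
  have L: "L \<ge> 0" by (simp add: L_def)
  have "\<forall>i. \<exists>I\<in>sets borel. resonant ((real (Suc i))\<^sup>2 - 1 / 4) (JU (Suc i)) (JU1 (Suc i)) \<epsilon> (2 * real (Suc i) / (Z (Suc i) - 1)) \<inter> {real (Suc i)..real (Suc i) / \<epsilon>} \<subseteq> I
      \<and> I \<subseteq> {0<..} \<and> emeasure lborel I \<le> ennreal (\<epsilon> powr \<beta> * L * (A i - A (Suc i)))"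
  proof
    fix i
    define n where "n = real (Suc i)"
    have n: "n \<ge> 1" by (simp add: n_def)
    have "18 * n * L / Z (Suc i) = n * \<epsilon> powr \<beta> * L * (\<alpha> * (n + 1) powr (- (2 + \<alpha>)))"
    proof -
      define P where "P = (1 + n) powr (2 + \<alpha>)"
      define Q where "Q = \<epsilon> powr \<beta>"
      have PQ: "P > 0" "Q > 0" using n e by (simp_all add: P_def Q_def)
      have P: "(n + 1) powr (- (2 + \<alpha>)) = 1 / P" unfolding P_def add.commute[of n 1] by (rule powr_minus_divide)
      have Q: "\<epsilon> powr (- \<beta>) = 1 / Q" unfolding Q_def by (rule powr_minus_divide)
      show ?thesis
        unfolding Z_def n_def[symmetric] P Q P_def[symmetric] Q_def[symmetric] using PQ \<alpha> by (simp add: field_simps)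
    qed
    also have "(n + 1) powr (- (2 + \<alpha>)) = (n + 1) powr (- \<alpha> - 1) / (n + 1)"
      using n by (simp add: powr_diff powr_minus powr_add field_simps powr_numeral power2_eq_square)
    also have "n * \<epsilon> powr \<beta> * L * (\<alpha> * ((n + 1) powr (- \<alpha> - 1) / (n + 1))) = \<epsilon> powr \<beta> * L * (n / (n + 1) * (\<alpha> * (n + 1) powr (- \<alpha> - 1)))"
      by simp
    also have "\<dots> \<le> \<epsilon> powr \<beta> * L * (1 * (n powr (- \<alpha>) - (n + 1) powr (- \<alpha>)))"
    proof (intro mult_left_mono mult_mono powr_diff_ge \<alpha>)
      show "0 \<le> \<alpha> * (n + 1) powr (- \<alpha> - 1)" using \<alpha> by simp
    qed (use n L in auto)
    also have "n powr (- \<alpha>) - (n + 1) powr (- \<alpha>) = A i - A (Suc i)" by (simp add: A_def n_def add.commute)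
    finally have le: "18 * real (Suc i) * \<bar>ln \<epsilon>\<bar> / Z (Suc i) \<le> \<epsilon> powr \<beta> * L * (A i - A (Suc i))"
      by (simp only: n_def L_def mult_1_left)
    obtain I where "I \<in> sets borel" "resonant ((real (Suc i))\<^sup>2 - 1 / 4) (JU (Suc i)) (JU1 (Suc i)) \<epsilon> (2 * real (Suc i) / (Z (Suc i) - 1)) \<inter> {real (Suc i)..real (Suc i) / \<epsilon>} \<subseteq> I"
      "I \<subseteq> {0<..}" "emeasure lborel I \<le> ennreal (18 * real (Suc i) * \<bar>ln \<epsilon>\<bar> / Z (Suc i))"
      using resonant_cover_pos[OF e _ Z, of "Suc i"] by auto
    thus "\<exists>I\<in>sets borel. resonant ((real (Suc i))\<^sup>2 - 1 / 4) (JU (Suc i)) (JU1 (Suc i)) \<epsilon> (2 * real (Suc i) / (Z (Suc i) - 1)) \<inter> {real (Suc i)..real (Suc i) / \<epsilon>} \<subseteq> I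
      \<and> I \<subseteq> {0<..} \<and> emeasure lborel I \<le> ennreal (\<epsilon> powr \<beta> * L * (A i - A (Suc i)))"
      using ennreal_leI[OF le] by (meson order_trans)
  qed
  then obtain I where I: "\<And>i. I i \<in> sets borel"
    "\<And>i. resonant ((real (Suc i))\<^sup>2 - 1 / 4) (JU (Suc i)) (JU1 (Suc i)) \<epsilon> (2 * real (Suc i) / (Z (Suc i) - 1)) \<inter> {real (Suc i)..real (Suc i) / \<epsilon>} \<subseteq> I i"
    "\<And>i. I i \<subseteq> {0<..}" "\<And>i. emeasure lborel (I i) \<le> ennreal (\<epsilon> powr \<beta> * L * (A i - A (Suc i)))"
    by metis
  have "A \<longlonglongrightarrow> 0"
    unfolding A_def using \<alpha> by (intro tendsto_neg_powr filterlim_compose[OF filterlim_real_sequentially filterlim_Suc]) auto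
  hence "(\<lambda>i. A i - A (Suc i)) sums (A 0 - 0)" by (rule telescope_sums')
  hence "(\<lambda>i. \<epsilon> powr \<beta> * L * (A i - A (Suc i))) sums (\<epsilon> powr \<beta> * L * (A 0 - 0))" by (rule sums_mult)
  moreover have "A 0 = 1" by (simp add: A_def)
  ultimately have sm: "(\<lambda>i. \<epsilon> powr \<beta> * L * (A i - A (Suc i))) sums (\<epsilon> powr \<beta> * L)" by simp
  have nn: "0 \<le> \<epsilon> powr \<beta> * L * (A i - A (Suc i))" for i
    using L \<alpha> by (auto intro!: mult_nonneg_nonneg powr_mono2' simp: A_def)
  have "emeasure lborel (\<Union>i. I i) \<le> (\<Sum>i. emeasure lborel (I i))"
    using I(1) by (intro emeasure_subadditive_countably) auto
  also have "\<dots> \<le> (\<Sum>i. ennreal (\<epsilon> powr \<beta> * L * (A i - A (Suc i))))" using I(4) by (intro suminf_le) auto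
  also have "\<dots> = ennreal (\<epsilon> powr \<beta> * L)" by (rule suminf_ennreal_eq[OF nn sm])
  finally have m: "emeasure lborel (\<Union>i. I i) \<le> ennreal (\<epsilon> powr \<beta> * \<bar>ln \<epsilon>\<bar>)" by (simp add: L_def)
  have "resonant ((real N)\<^sup>2 - 1 / 4) (JU N) (JU1 N) \<epsilon> (2 * real N / (Z N - 1)) \<inter> {real N..real N / \<epsilon>} \<subseteq> (\<Union>i. I i)" if "N \<ge> 1" for N
  proof (cases N)
    case 0
    thus ?thesis using that by simp
  next
    case (Suc i)
    thus ?thesis using I(2)[of i] by blast
  qed
  thus "\<exists>I\<in>sets borel. I \<subseteq> {0<..} \<and> emeasure lborel I \<le> ennreal (\<epsilon> powr \<beta> * \<bar>ln \<epsilon>\<bar>) \<and>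
      (\<forall>N\<ge>1. resonant ((real N)\<^sup>2 - 1 / 4) (JU N) (JU1 N) \<epsilon> (2 * real N / (Z N - 1)) \<inter> {real N..real N / \<epsilon>} \<subseteq> I)"
  proof (intro bexI[of _ "\<Union>i. I i"] conjI allI impI m)
    show "(\<Union>i. I i) \<subseteq> {0<..}" using I(3) by blast
    show "(\<Union>i. I i) \<in> sets borel" using I(1) by auto
  qed
qed

section \<open>Assembly of the two estimates\<close>

lemma lebesgue_of_borel:
  assumes "I \<in> sets borel"
  shows "I \<in> sets lebesgue" "emeasure lebesgue I = emeasure lborel I"
  using assms by (auto simp: sets_completionI_sets main_part_sets)

lemma mode_value:
  assumes "r > 0" "\<kappa> > 0"
  shows "(cmod (Complex a b / of_real (sqrt (\<kappa> * r))))\<^sup>2 = (a\<^sup>2 + b\<^sup>2) / (\<kappa> * r)"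
  using assms by (simp add: norm_divide power_divide cmod_power2)

theorem corollary6p4:
  fixes \<epsilon> :: real
  assumes "0 < \<epsilon>" and "\<epsilon> < 1 / 7"
  shows
    "(\<forall>\<alpha>>0. \<forall>\<beta>>0. \<exists>I\<^sub>1 \<in> sets lebesgue. I\<^sub>1 \<subseteq> {0<..} \<and>
        emeasure lebesgue I\<^sub>1 \<le> ennreal (\<epsilon> powr \<beta> * \<bar>ln \<epsilon>\<bar>) \<and>
        (\<forall>q>0. \<forall>q\<^sub>0>0. \<forall>a ui u.
          sqrt (q / q\<^sub>0) = 1 / \<epsilon> \<and> scattering_family \<epsilon> q q\<^sub>0 a ui u \<longrightarrow>
          (\<forall>R\<ge>\<epsilon>. \<forall>\<sigma>::real.
            (SUP \<omega>\<in>{\<omega>. 0 < \<omega> \<and> sqrt q\<^sub>0 * \<omega> \<in> {0<..} - I\<^sub>1}.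
                H_star_norm \<sigma> (\<lambda>z. u \<omega> z - ui \<omega> z) R)
            \<le> ennreal (18 / \<alpha> * sqrt (\<epsilon> powr (1 - 2 * \<beta>) / R)) * N_norm (\<sigma> + 2 + \<alpha>) a)))
     \<and>
     (\<forall>\<beta>>0. \<exists>I\<^sub>0 \<in> sets lebesgue. I\<^sub>0 \<subseteq> {0<..} \<and>
        emeasure lebesgue I\<^sub>0 \<le> ennreal (ln \<bar>ln \<epsilon>\<bar> / (\<bar>ln \<epsilon>\<bar> + 1) powr \<beta>) \<and>
        (\<forall>q>0. \<forall>q\<^sub>0>0. \<forall>a ui u.
          sqrt (q / q\<^sub>0) = 1 / \<epsilon> \<and> scattering_family \<epsilon> q q\<^sub>0 a ui u \<longrightarrow>
          (\<forall>R\<ge>\<epsilon>.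
            (SUP \<omega>\<in>{\<omega>. 0 < \<omega> \<and> sqrt q\<^sub>0 * \<omega> \<in> {0<..} - I\<^sub>0}.
                ennreal (cmod (of_real (1 / (2 * pi)) *
                  integral {0..2 * pi} (\<lambda>\<theta>. u \<omega> (rcis R \<theta>) - ui \<omega> (rcis R \<theta>)))))
            \<le> ennreal (12 * (cmod (a 0) / sqrt ((\<bar>ln \<epsilon>\<bar> + 1) powr (3 / 2 - 2 * \<beta>) * R))))))"
proof (intro conjI allI impI)
  fix \<alpha> \<beta> :: real assume \<alpha>: "\<alpha> > 0" and \<beta>: "\<beta> > 0"
  define Z where "Z N = 18 / \<alpha> * (1 + real N) powr (2 + \<alpha>) * \<epsilon> powr (- \<beta>)" for N
  note cov = resonant_cover_all[OF assms \<alpha> \<beta>, folded Z_def]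
  \<comment> \<open>The set is fixed before q, the incident field and u are introduced; it depends
    on \<epsilon>, \<alpha> and \<beta> only.\<close>
  obtain I where I: "I \<in> sets borel" "I \<subseteq> {0<..}" "emeasure lborel I \<le> ennreal (\<epsilon> powr \<beta> * \<bar>ln \<epsilon>\<bar>)"
    "\<And>N. N \<ge> 1 \<Longrightarrow> resonant ((real N)\<^sup>2 - 1 / 4) (JU N) (JU1 N) \<epsilon> (2 * real N / (Z N - 1)) \<inter> {real N..real N / \<epsilon>} \<subseteq> I"
    using cov(2) by blast
  show "\<exists>I\<^sub>1 \<in> sets lebesgue. I\<^sub>1 \<subseteq> {0<..} \<and>
        emeasure lebesgue I\<^sub>1 \<le> ennreal (\<epsilon> powr \<beta> * \<bar>ln \<epsilon>\<bar>) \<and>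
        (\<forall>q>0. \<forall>q\<^sub>0>0. \<forall>a ui u.
          sqrt (q / q\<^sub>0) = 1 / \<epsilon> \<and> scattering_family \<epsilon> q q\<^sub>0 a ui u \<longrightarrow>
          (\<forall>R\<ge>\<epsilon>. \<forall>\<sigma>::real.
            (SUP \<omega>\<in>{\<omega>. 0 < \<omega> \<and> sqrt q\<^sub>0 * \<omega> \<in> {0<..} - I\<^sub>1}.
                H_star_norm \<sigma> (\<lambda>z. u \<omega> z - ui \<omega> z) R)
            \<le> ennreal (18 / \<alpha> * sqrt (\<epsilon> powr (1 - 2 * \<beta>) / R)) * N_norm (\<sigma> + 2 + \<alpha>) a))"
  proof (intro bexI[of _ I] conjI allI impI SUP_least)
    fix q q\<^sub>0 :: real and a ui u and R \<sigma> \<omega> :: real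
    assume q: "q > 0" "q\<^sub>0 > 0" "sqrt (q / q\<^sub>0) = 1 / \<epsilon> \<and> scattering_family \<epsilon> q q\<^sub>0 a ui u"
      and R: "R \<ge> \<epsilon>" and "\<omega> \<in> {\<omega>. 0 < \<omega> \<and> sqrt q\<^sub>0 * \<omega> \<in> {0<..} - I}"
    hence \<omega>: "\<omega> > 0" and \<kappa>I: "sqrt q\<^sub>0 * \<omega> \<notin> I" and sq: "sqrt (q / q\<^sub>0) = 1 / \<epsilon>"
      and inc: "incident_field \<omega> q\<^sub>0 a (ui \<omega>)" and sc: "scattering_solution \<epsilon> \<omega> q q\<^sub>0 (ui \<omega>) (u \<omega>)"
      by (auto simp: scattering_family_def)
    define \<kappa> where "\<kappa> = sqrt q\<^sub>0 * \<omega>"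
    have \<kappa>: "\<kappa> > 0" using q \<omega> by (simp add: \<kappa>_def)
    have R0: "R > 0" using R assms by simp
    define C where "C = 18 / \<alpha> * sqrt (\<epsilon> powr (1 - 2 * \<beta>) / R)"
    have C: "C > 0" using \<alpha> R0 assms by (simp add: C_def)
    \<comment> \<open>The factor Z^2 carries the weight (1 + N)^(2 (2 + \<alpha>)), which raises the
      index from \<sigma> to \<sigma> + 2 + \<alpha>, and \<epsilon> * \<epsilon>^(-2 \<beta>) is
      the power in the constant.\<close>
    have C2: "\<epsilon> / R * (Z N)\<^sup>2 = C\<^sup>2 * (1 + real N) powr (2 * (2 + \<alpha>))" for N
    proof -
      have "\<epsilon> powr (1 - 2 * \<beta>) = \<epsilon> * (\<epsilon> powr (- \<beta>))\<^sup>2"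
        using assms by (simp add: powr_diff powr_minus powr_add[symmetric] power2_eq_square field_simps flip: powr_add)
      moreover have "(1 + real N) powr (2 * (2 + \<alpha>)) = ((1 + real N) powr (2 + \<alpha>))\<^sup>2"
        by (simp add: power2_eq_square powr_add[symmetric])
      moreover have "C\<^sup>2 = (18 / \<alpha>)\<^sup>2 * (\<epsilon> powr (1 - 2 * \<beta>) / R)" using R0 by (simp add: C_def power_mult_distrib power_divide)
      ultimately show ?thesis by (simp add: Z_def power_mult_distrib power_divide mult_ac)
    qed
    let ?v = "\<lambda>n. circle_coeff (\<lambda>z. u \<omega> z - ui \<omega> z) R n"
    have mode: "ennreal ((cmod (?v n))\<^sup>2 * (1 + \<bar>of_int n\<bar>) powr (2 * \<sigma>))
      \<le> ennreal (C\<^sup>2) * (ennreal ((cmod (a n))\<^sup>2) * (SUP x\<in>{0<..}. ennreal (\<bar>bessel_J n x\<bar>\<^sup>2)) *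
          ennreal ((1 + \<bar>of_int n\<bar>) powr (2 * (\<sigma> + 2 + \<alpha>))))" if n: "n \<in> UNIV - {0}" for n :: int
    proof -
      define N where "N = nat \<bar>n\<bar>"
      have N: "N \<ge> 1" "real_of_int \<bar>n\<bar> = real N" using n by (auto simp: N_def)
      obtain f f1 g g1 b where op: "outgoing_pair ((real N)\<^sup>2 - 1 / 4) (\<epsilon> * \<kappa>) f f1 g g1" "cmod b = cmod (a n)"
        "?v n = Complex (f (\<kappa> * R)) (g (\<kappa> * R)) / of_real (sqrt (\<kappa> * R))"
        "of_real (\<epsilon> * \<kappa>) * (Complex (f1 (\<epsilon> * \<kappa>)) (g1 (\<epsilon> * \<kappa>)) + b * of_real (JU1 N (\<epsilon> * \<kappa>))) * of_real (JU N \<kappa>)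
        = of_real (\<kappa> * JU1 N \<kappa>) * (Complex (f (\<epsilon> * \<kappa>)) (g (\<epsilon> * \<kappa>)) + b * of_real (JU N (\<epsilon> * \<kappa>)))"
        by (rule scattering_mode[OF assms(1) q(2,1) sq \<omega> inc sc, of n, folded N_def \<kappa>_def]) (use R in blast)
      have "\<kappa> \<notin> resonant ((real N)\<^sup>2 - 1 / 4) (JU N) (JU1 N) \<epsilon> (2 * real N / (Z N - 1)) \<inter> {real N..real N / \<epsilon>}"
        using I(4)[OF N(1)] \<kappa>I unfolding \<kappa>_def by blast
      from mode_bound_pos[OF assms N(1) cov(1)[OF N(1)] \<kappa> op(1,4) this]
      obtain y where y: "y > 0" "\<And>s. s \<ge> \<epsilon> * \<kappa> \<Longrightarrow> (f s)\<^sup>2 + (g s)\<^sup>2 \<le> \<epsilon> * \<kappa> * (Z N * cmod b * Jn N y)\<^sup>2" by blast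
      obtain t :: real where t: "\<bar>t\<bar> = 1" "\<And>x. x > 0 \<Longrightarrow> bessel_J n x = t * Jn N x"
        using bessel_J_Jn[of n] unfolding N_def by blast
      have Jb: "(Jn N y)\<^sup>2 = \<bar>bessel_J n y\<bar>\<^sup>2" using t(1) t(2)[OF y(1)] by (simp add: power_mult_distrib abs_mult)
      have "(cmod (?v n))\<^sup>2 = ((f (\<kappa> * R))\<^sup>2 + (g (\<kappa> * R))\<^sup>2) / (\<kappa> * R)"
        unfolding op(3) by (rule mode_value[OF R0 \<kappa>])
      also have "\<dots> \<le> \<epsilon> * \<kappa> * (Z N * cmod b * Jn N y)\<^sup>2 / (\<kappa> * R)"
        using \<kappa> R R0 by (intro divide_right_mono y(2)) auto
      also have "\<dots> = (\<epsilon> / R * (Z N)\<^sup>2) * (cmod (a n))\<^sup>2 * \<bar>bessel_J n y\<bar>\<^sup>2"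
        using \<kappa> R0 unfolding op(2) Jb[symmetric] by (simp add: power_mult_distrib)
      also have "\<dots> = C\<^sup>2 * (1 + real N) powr (2 * (2 + \<alpha>)) * (cmod (a n))\<^sup>2 * \<bar>bessel_J n y\<bar>\<^sup>2" unfolding C2 ..
      finally have "(cmod (?v n))\<^sup>2 * (1 + real N) powr (2 * \<sigma>)
          \<le> C\<^sup>2 * (1 + real N) powr (2 * (2 + \<alpha>)) * (cmod (a n))\<^sup>2 * \<bar>bessel_J n y\<bar>\<^sup>2 * (1 + real N) powr (2 * \<sigma>)"
        by (intro mult_right_mono) auto
      also have "\<dots> = C\<^sup>2 * ((cmod (a n))\<^sup>2 * \<bar>bessel_J n y\<bar>\<^sup>2 * ((1 + real N) powr (2 * (2 + \<alpha>)) * (1 + real N) powr (2 * \<sigma>)))"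
        by (simp only: mult_ac)
      also have "(1 + real N) powr (2 * (2 + \<alpha>)) * (1 + real N) powr (2 * \<sigma>) = (1 + real N) powr (2 * (\<sigma> + 2 + \<alpha>))"
        unfolding powr_add[symmetric] by (simp add: algebra_simps)
      finally have "ennreal ((cmod (?v n))\<^sup>2 * (1 + real N) powr (2 * \<sigma>))
        \<le> ennreal (C\<^sup>2) * (ennreal ((cmod (a n))\<^sup>2) * ennreal (\<bar>bessel_J n y\<bar>\<^sup>2) * ennreal ((1 + real N) powr (2 * (\<sigma> + 2 + \<alpha>))))"
        by (simp only: ennreal_mult'[symmetric] zero_le_power2 mult_nonneg_nonneg powr_ge_zero) (rule ennreal_leI)
      \<comment> \<open>The witness y may depend on the frequency; the supremum absorbs it and
        leaves a bound independent of \<omega>.\<close>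
      also have "\<dots> \<le> ennreal (C\<^sup>2) * (ennreal ((cmod (a n))\<^sup>2) * (SUP x\<in>{0<..}. ennreal (\<bar>bessel_J n x\<bar>\<^sup>2)) * ennreal ((1 + real N) powr (2 * (\<sigma> + 2 + \<alpha>))))"
        using y(1) by (intro mult_left_mono mult_right_mono SUP_upper) auto
      finally show ?thesis using N(2) by simp
    qed
    have "H_star_norm \<sigma> (\<lambda>z. u \<omega> z - ui \<omega> z) R \<le> ennreal (sqrt (2 * pi)) * (ennreal C *
      ennreal_sqrt (\<Sum>\<^sub>\<infinity>n\<in>UNIV - {0}. ennreal ((cmod (a n))\<^sup>2) * (SUP x\<in>{0<..}. ennreal (\<bar>bessel_J n x\<bar>\<^sup>2)) *
          ennreal ((1 + \<bar>of_int n\<bar>) powr (2 * (\<sigma> + 2 + \<alpha>)))))"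
      unfolding H_star_norm_def
      by (intro mult_left_mono ennreal_sqrt_le[OF C] ennreal_infsum_le_cmult mode) auto
    also have "\<dots> = ennreal C * N_norm (\<sigma> + 2 + \<alpha>) a" unfolding N_norm_def by (simp only: mult.left_commute)
    finally show "H_star_norm \<sigma> (\<lambda>z. u \<omega> z - ui \<omega> z) R \<le> ennreal (18 / \<alpha> * sqrt (\<epsilon> powr (1 - 2 * \<beta>) / R)) * N_norm (\<sigma> + 2 + \<alpha>) a"
      by (simp only: C_def)
  qed (use I lebesgue_of_borel[OF I(1)] in auto)
next
  fix \<beta> :: real assume \<beta>: "\<beta> > 0"
  define y where "y = \<bar>ln \<epsilon>\<bar> + 1"
  define E where "E = y powr \<beta>"
  have y: "y \<ge> 1" by (simp add: y_def)
  have E: "E \<ge> 1" using y \<beta> by (simp add: E_def ge_one_powr_ge_zero)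
  obtain I where I: "I \<in> sets borel" "I \<subseteq> {0<..}" "emeasure lborel I \<le> ennreal (ln \<bar>ln \<epsilon>\<bar> / E)"
    "resonant (- 1 / 4) (JU 0) (JU1 0) \<epsilon> (11 / (20 * y * E)) \<inter> {1 / sqrt (2 * y)..y * sqrt y / (192 * E\<^sup>2)} \<subseteq> I"
    using resonant_cover_zero[OF assms E] unfolding y_def by blast
  show "\<exists>I\<^sub>0 \<in> sets lebesgue. I\<^sub>0 \<subseteq> {0<..} \<and>
        emeasure lebesgue I\<^sub>0 \<le> ennreal (ln \<bar>ln \<epsilon>\<bar> / (\<bar>ln \<epsilon>\<bar> + 1) powr \<beta>) \<and>
        (\<forall>q>0. \<forall>q\<^sub>0>0. \<forall>a ui u.
          sqrt (q / q\<^sub>0) = 1 / \<epsilon> \<and> scattering_family \<epsilon> q q\<^sub>0 a ui u \<longrightarrow>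
          (\<forall>R\<ge>\<epsilon>.
            (SUP \<omega>\<in>{\<omega>. 0 < \<omega> \<and> sqrt q\<^sub>0 * \<omega> \<in> {0<..} - I\<^sub>0}.
                ennreal (cmod (of_real (1 / (2 * pi)) *
                  integral {0..2 * pi} (\<lambda>\<theta>. u \<omega> (rcis R \<theta>) - ui \<omega> (rcis R \<theta>)))))
            \<le> ennreal (12 * (cmod (a 0) / sqrt ((\<bar>ln \<epsilon>\<bar> + 1) powr (3 / 2 - 2 * \<beta>) * R)))))"
    unfolding y_def[symmetric] E_def[symmetric]
  proof (intro bexI[of _ I] conjI allI impI SUP_least)
    fix q q\<^sub>0 :: real and a ui u and R \<omega> :: real
    assume q: "q > 0" "q\<^sub>0 > 0" "sqrt (q / q\<^sub>0) = 1 / \<epsilon> \<and> scattering_family \<epsilon> q q\<^sub>0 a ui u"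
      and R: "R \<ge> \<epsilon>" and "\<omega> \<in> {\<omega>. 0 < \<omega> \<and> sqrt q\<^sub>0 * \<omega> \<in> {0<..} - I}"
    hence \<omega>: "\<omega> > 0" and \<kappa>I: "sqrt q\<^sub>0 * \<omega> \<notin> I" and sq: "sqrt (q / q\<^sub>0) = 1 / \<epsilon>"
      and inc: "incident_field \<omega> q\<^sub>0 a (ui \<omega>)" and sc: "scattering_solution \<epsilon> \<omega> q q\<^sub>0 (ui \<omega>) (u \<omega>)"
      by (auto simp: scattering_family_def)
    define \<kappa> where "\<kappa> = sqrt q\<^sub>0 * \<omega>"
    have \<kappa>: "\<kappa> > 0" using q \<omega> by (simp add: \<kappa>_def)
    have R0: "R > 0" using R assms by simp
    let ?v = "circle_coeff (\<lambda>z. u \<omega> z - ui \<omega> z) R 0"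
    have z: "nat \<bar>0\<bar> = 0" "(real 0)\<^sup>2 - 1 / 4 = - 1 / 4" by simp_all
    obtain f f1 g g1 b where op: "outgoing_pair (- 1 / 4) (\<epsilon> * \<kappa>) f f1 g g1" "cmod b = cmod (a 0)"
      "?v = Complex (f (\<kappa> * R)) (g (\<kappa> * R)) / of_real (sqrt (\<kappa> * R))"
      "of_real (\<epsilon> * \<kappa>) * (Complex (f1 (\<epsilon> * \<kappa>)) (g1 (\<epsilon> * \<kappa>)) + b * of_real (JU1 0 (\<epsilon> * \<kappa>))) * of_real (JU 0 \<kappa>)
      = of_real (\<kappa> * JU1 0 \<kappa>) * (Complex (f (\<epsilon> * \<kappa>)) (g (\<epsilon> * \<kappa>)) + b * of_real (JU 0 (\<epsilon> * \<kappa>)))"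
      by (rule scattering_mode[OF assms(1) q(2,1) sq \<omega> inc sc, of 0, unfolded z, folded \<kappa>_def]) (use R in blast)
    have "\<kappa> \<notin> resonant (- 1 / 4) (JU 0) (JU1 0) \<epsilon> (11 / (20 * y * E)) \<inter> {1 / sqrt (2 * y)..y * sqrt y / (192 * E\<^sup>2)}"
      using I(4) \<kappa>I unfolding \<kappa>_def by blast
    note mb = mode_bound_zero[OF assms E \<kappa> op(1,4), folded y_def, OF this]
    have "(cmod ?v)\<^sup>2 = ((f (\<kappa> * R))\<^sup>2 + (g (\<kappa> * R))\<^sup>2) / (\<kappa> * R)"
      unfolding op(3) by (rule mode_value[OF R0 \<kappa>])
    \<comment> \<open>The factor \<kappa> cancels against the one from v = u / sqrt (\<kappa> R), so
      this bound is independent of the frequency too.\<close>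
    also have "\<dots> \<le> 144 * \<kappa> * (cmod b)\<^sup>2 * E\<^sup>2 / (y * sqrt y) / (\<kappa> * R)"
      using \<kappa> R R0 by (intro divide_right_mono mb) auto
    also have "\<dots> = 144 * (cmod (a 0))\<^sup>2 / (y * sqrt y / E\<^sup>2 * R)"
      using \<kappa> R0 y E unfolding op(2) by (simp add: field_simps)
    also have "y * sqrt y / E\<^sup>2 = y powr (3 / 2 - 2 * \<beta>)"
    proof -
      have "y * sqrt y = y powr (3 / 2)" using y powr_add[of y 1 "1 / 2"] by (simp add: powr_half_sqrt)
      moreover have "E\<^sup>2 = y powr (2 * \<beta>)" by (simp add: E_def power2_eq_square powr_add[symmetric])
      ultimately show ?thesis by (simp add: powr_diff)
    qed
    also have "144 * (cmod (a 0))\<^sup>2 / (y powr (3 / 2 - 2 * \<beta>) * R) = (12 * (cmod (a 0) / sqrt (y powr (3 / 2 - 2 * \<beta>) * R)))\<^sup>2"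
      using R0 by (simp add: power_mult_distrib power_divide)
    finally have "cmod ?v \<le> 12 * (cmod (a 0) / sqrt (y powr (3 / 2 - 2 * \<beta>) * R))"
      by (rule power2_le_imp_le) (use R0 in auto)
    moreover have "of_real (1 / (2 * pi)) * integral {0..2 * pi} (\<lambda>\<theta>. u \<omega> (rcis R \<theta>) - ui \<omega> (rcis R \<theta>)) = ?v"
      by (simp add: circle_coeff_def)
    ultimately show "ennreal (cmod (of_real (1 / (2 * pi)) * integral {0..2 * pi} (\<lambda>\<theta>. u \<omega> (rcis R \<theta>) - ui \<omega> (rcis R \<theta>))))
        \<le> ennreal (12 * (cmod (a 0) / sqrt (y powr (3 / 2 - 2 * \<beta>) * R)))"
      by (simp only: ennreal_leI)
  qed (use I lebesgue_of_borel[OF I(1)] in auto)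
qed

end
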